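(* Let $\mathcal{H}$ be a weak Hopf algebra with a separable base $R$, let $\mathcal{C}={}_{\mathcal{H}}\mathcal{M}$ be the monoidal category of left $\mathcal{H}$-modules, let $A$ be a unital associative algebra in $\mathcal{C}$, and let $\mathcal{F}$ be a left exact symmetric $2$-contratrace on $\mathcal{C}$. Then $\mathcal{F}_A$ is a left exact functor $\mathcal{F}_A:(\mathrm{Bimd}_{\mathcal{C}}A)^{op}\to\mathrm{Vec}$ and $$HH^n(A,\mathcal{F})\simeq R^n\mathcal{F}_A(A),$$ where $R^n\mathcal{F}_A$ denotes the $n$-th right derived functor of $\mathcal{F}_A$.
   Context: Conventions. $k$ is a field of characteristic $0$, $\mathrm{Vec}$ is the category of $k$-vector spaces. All categories are abelian and $k$-linear, all functors are $k$-linear; associativity constraints are suppressed. A contravariant functor $\mathcal{F}$ to $\mathrm{Vec}$ is left exact if it sends exact $X\to Y\to Z\to 0$ to exact $0\to\mathcal{F}(Z)\to\mathcal{F}(Y)\to\mathcal{F}(X)$; its right derived functors are computed by projective resolutions. For a weak Hopf algebra $\mathcal{H}$ over $k$ with separable base algebra $R$, the category ${}_{\mathcal{H}}\mathcal{M}$ of left $\mathcal{H}$-modules (not necessarily finite dimensional) is monoidal with product $\otimes_R$, denoted $\otimes$ below, and unit object $1$ (whose underlying space is $R$); the forgetful functor to $R$-bimodules is monoidal. Symmetric $2$-contratraces. A $2$-contratrace on a monoidal category $\mathcal{D}$ is a functor $\mathcal{F}:\mathcal{D}^{op}\to\mathrm{Vec}$ with bifunctorial isomorphisms $\tau_{c,d}:\mathcal{F}(c\otimes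 d)\to\mathcal{F}(d\otimes c)$ satisfying the usual center coherence: $\tau_{c\otimes c',d}=\tau_{c',d\otimes c}\circ\tau_{c,c'\otimes d}$ and $\tau_{1,d}=Id$. It is symmetric if $\tau_{d,c}\circ\tau_{c,d}=Id$ for all $c,d$. Bimodules. For a unital associative algebra $A$ in $\mathcal{C}$, $\mathrm{Bimd}_{\mathcal{C}}A$ is the category of $A$-bimodules in $\mathcal{C}$, monoidal under $\otimes_A$ with unit $A$. For $S\in\mathrm{Bimd}_{\mathcal{C}}A$ with actions $l:A\otimes S\to S$, $r:S\otimes A\to S$, $\mathcal{F}_A(S)\subset\mathcal{F}(S)$ is the equalizer of $\tau_{A,S}\circ\mathcal{F}(l)$ and $\mathcal{F}(r)$, both maps $\mathcal{F}(S)\to\mathcal{F}(S\otimes A)$; it carries the induced $\tau$. Hochschild cohomology. An admissible pair in $\mathrm{Bimd}_{\mathcal{C}}A$ is a projective object $P$ with a map $d:P\to A$ such that $P\otimes_AP\xrightarrow{d\otimes Id-Id\otimes d}P\xrightarrow{d}A\to 0$ is exact (for $\mathcal{C}={}_{\mathcal{H}}\mathcal{M}$ such a pair always exists). $HH^n(A,\mathcal{F})$ is the Hochschild cohomology of the precocyclic object $C^n=\mathcal{F}_A(P^{\otimes_An+1})$, i.e. the $n$-th cohomology of the complex $(C^\bullet,\sum_{i=0}^{n+1}(-1)^i\delta_i)$ with $\delta_i=\mathcal{F}_A(Id_P^{\otimes_Ai}\otimes_Ad\otimes_AId_P^{\otimes_An+1-i}):C^n\to C^{n+1}$, for any admissible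 pair $(P,d)$ (independent of the choice up to isomorphism). *)

theory Defs
  imports "HOL-Algebra.Module" "HOL-Algebra.AbelCoset"
begin

section \<open>Modules over a field with explicit carriers\<close>

text \<open>
  Vector spaces over a field \<open>K\<close> are records \<open>M\<close> with \<open>module K M\<close>.  The record fields \<open>mult\<close> and \<open>one\<close> of such a record carry no meaning
  unless it is used as an algebra.
\<close>

definition lin_hom ::
  "('k, 'x) ring_scheme \<Rightarrow> ('k, 'm, 'y) module_scheme \<Rightarrow> ('k, 'n, 'z) module_scheme \<Rightarrow> ('m \<Rightarrow> 'n) set"
  where "lin_hom K M N = {f \<in> carrier M \<rightarrow> carrier N.
     (\<forall>x\<in>carrier M. \<forall>y\<in>carrier M. f (x \<oplus>\<^bsub>M\<^esub> y) = f x \<oplus>\<^bsub>N\<^esub> f y) \<and>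
     (\<forall>a\<in>carrier K. \<forall>x\<in>carrier M. f (a \<odot>\<^bsub>M\<^esub> x) = a \<odot>\<^bsub>N\<^esub> f x)}"

definition vs_iso ::
  "('k, 'x) ring_scheme \<Rightarrow> ('k, 'm, 'y) module_scheme \<Rightarrow> ('k, 'n, 'z) module_scheme \<Rightarrow> bool"
  where "vs_iso K M N \<longleftrightarrow> (\<exists>f\<in>lin_hom K M N. bij_betw f (carrier M) (carrier N))"

definition ring_as_module :: "('k, 'x) ring_scheme \<Rightarrow> ('k, 'k) module"
  where "ring_as_module K = \<lparr>carrier = carrier K, mult = mult K, one = \<one>\<^bsub>K\<^esub>,
     zero = \<zero>\<^bsub>K\<^esub>, add = add K, smult = mult K\<rparr>"

definition quot_mod :: "('k, 'm, 'y) module_scheme \<Rightarrow> 'm set \<Rightarrow> ('k, 'm set) module"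
  where "quot_mod M N = \<lparr>carrier = a_rcosets\<^bsub>M\<^esub> N, mult = undefined, one = undefined,
     zero = N, add = set_add M, smult = (\<lambda>a X. \<Union>x\<in>X. N +>\<^bsub>M\<^esub> (a \<odot>\<^bsub>M\<^esub> x))\<rparr>"

definition submod_span :: "('k, 'x) ring_scheme \<Rightarrow> ('k, 'm) module \<Rightarrow> 'm set \<Rightarrow> 'm set"
  where "submod_span K M B = \<Inter>{N. submodule N K M \<and> B \<subseteq> N}"

definition free_mod :: "('k, 'x) ring_scheme \<Rightarrow> 'b set \<Rightarrow> ('k, 'b \<Rightarrow> 'k) module"
  where "free_mod K X = \<lparr>
     carrier = {f. (\<forall>x. f x \<in> carrier K) \<and> finite {x. f x \<noteq> \<zero>\<^bsub>K\<^esub>} \<and> (\<forall>x. x \<notin> X \<longrightarrow> f x = \<zero>\<^bsub>K\<^esub>)},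
     mult = undefined, one = undefined,
     zero = (\<lambda>_. \<zero>\<^bsub>K\<^esub>), add = (\<lambda>f g x. f x \<oplus>\<^bsub>K\<^esub> g x), smult = (\<lambda>a f x. a \<otimes>\<^bsub>K\<^esub> f x)\<rparr>"

definition free_gen :: "('k, 'x) ring_scheme \<Rightarrow> 'b \<Rightarrow> 'b \<Rightarrow> 'k"
  where "free_gen K b = (\<lambda>x. if x = b then \<one>\<^bsub>K\<^esub> else \<zero>\<^bsub>K\<^esub>)"

section \<open>Balanced tensor products\<close>

text \<open>
  \<open>bal\<close> is a set of pairs of endomorphisms of \<open>M\<close> and \<open>N\<close>; a pair \<open>(\<rho>, \<lambda>)\<close> imposes
  \<open>\<rho> m \<otimes> n = m \<otimes> \<lambda> n\<close>.  The empty set gives the tensor product over \<open>K\<close>; the pairs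
  (right multiplication by \<open>r\<close>, left multiplication by \<open>r\<close>) for \<open>r \<in> R\<close> give the one over \<open>R\<close>.
\<close>

definition tensor_rels ::
  "('k, 'x) ring_scheme \<Rightarrow> (('m \<Rightarrow> 'm) \<times> ('n \<Rightarrow> 'n)) set \<Rightarrow> ('k, 'm, 'y) module_scheme
     \<Rightarrow> ('k, 'n, 'z) module_scheme \<Rightarrow> ('m \<times> 'n \<Rightarrow> 'k) set"
  where "tensor_rels K bal M N = (let Fr = free_mod K (carrier M \<times> carrier N); g = (\<lambda>m n. free_gen K (m, n)) in
     {g (m \<oplus>\<^bsub>M\<^esub> m') n \<ominus>\<^bsub>Fr\<^esub> (g m n \<oplus>\<^bsub>Fr\<^esub> g m' n) | m m' n.
        m \<in> carrier M \<and> m' \<in> carrier M \<and> n \<in> carrier N} \<union>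
     {g m (n \<oplus>\<^bsub>N\<^esub> n') \<ominus>\<^bsub>Fr\<^esub> (g m n \<oplus>\<^bsub>Fr\<^esub> g m n') | m n n'.
        m \<in> carrier M \<and> n \<in> carrier N \<and> n' \<in> carrier N} \<union>
     {g (a \<odot>\<^bsub>M\<^esub> m) n \<ominus>\<^bsub>Fr\<^esub> (a \<odot>\<^bsub>Fr\<^esub> g m n) | a m n.
        a \<in> carrier K \<and> m \<in> carrier M \<and> n \<in> carrier N} \<union>
     {g m (a \<odot>\<^bsub>N\<^esub> n) \<ominus>\<^bsub>Fr\<^esub> (a \<odot>\<^bsub>Fr\<^esub> g m n) | a m n.
        a \<in> carrier K \<and> m \<in> carrier M \<and> n \<in> carrier N} \<union>
     {g (\<rho> m) n \<ominus>\<^bsub>Fr\<^esub> g m (l n) | \<rho> l m n.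
        (\<rho>, l) \<in> bal \<and> m \<in> carrier M \<and> n \<in> carrier N})"

definition tensor ::
  "('k, 'x) ring_scheme \<Rightarrow> (('m \<Rightarrow> 'm) \<times> ('n \<Rightarrow> 'n)) set \<Rightarrow> ('k, 'm, 'y) module_scheme
     \<Rightarrow> ('k, 'n, 'z) module_scheme \<Rightarrow> ('k, ('m \<times> 'n \<Rightarrow> 'k) set) module"
  where "tensor K bal M N =
     quot_mod (free_mod K (carrier M \<times> carrier N))
       (submod_span K (free_mod K (carrier M \<times> carrier N)) (tensor_rels K bal M N))"

definition pure_tensor ::
  "('k, 'x) ring_scheme \<Rightarrow> (('m \<Rightarrow> 'm) \<times> ('n \<Rightarrow> 'n)) set \<Rightarrow> ('k, 'm, 'y) module_scheme
     \<Rightarrow> ('k, 'n, 'z) module_scheme \<Rightarrow> 'm \<Rightarrow> 'n \<Rightarrow> ('m \<times> 'n \<Rightarrow> 'k) set"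
  where "pure_tensor K bal M N m n =
     submod_span K (free_mod K (carrier M \<times> carrier N)) (tensor_rels K bal M N)
       +>\<^bsub>free_mod K (carrier M \<times> carrier N)\<^esub> free_gen K (m, n)"

text \<open>
  \<open>tensor_lift K W b t\<close> is the value at \<open>t\<close> of the linear map to \<open>W\<close> induced by a balanced
  bilinear map \<open>b\<close>, computed on an arbitrary representative of \<open>t\<close>.
\<close>

definition tensor_lift ::
  "('k, 'x) ring_scheme \<Rightarrow> ('k, 'w, 'y) module_scheme \<Rightarrow> ('m \<Rightarrow> 'n \<Rightarrow> 'w) \<Rightarrow> ('m \<times> 'n \<Rightarrow> 'k) set \<Rightarrow> 'w"
  where "tensor_lift K W b t = (let f = (SOME f. f \<in> t) in
     finsum W (\<lambda>(m, n). f (m, n) \<odot>\<^bsub>W\<^esub> b m n) {p. f p \<noteq> \<zero>\<^bsub>K\<^esub>})"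

section \<open>Weak Hopf algebras\<close>

record ('k, 'h) weak_hopf = "('k, 'h) module" +
  comul :: "'h \<Rightarrow> ('h \<times> 'h \<Rightarrow> 'k) set"
  counit :: "'h \<Rightarrow> 'k"
  antipode :: "'h \<Rightarrow> 'h"

text \<open>Sweedler notation: \<open>sweedler K H W b h\<close> is \<open>\<Sum> b h\<^sub>(\<^sub>1\<^sub>) h\<^sub>(\<^sub>2\<^sub>)\<close>, computed in \<open>W\<close>.\<close>

definition sweedler ::
  "('k, 'x) ring_scheme \<Rightarrow> ('k, 'h) weak_hopf \<Rightarrow> ('k, 'w, 'y) module_scheme \<Rightarrow> ('h \<Rightarrow> 'h \<Rightarrow> 'w) \<Rightarrow> 'h \<Rightarrow> 'w"
  where "sweedler K H W b h = tensor_lift K W b (comul H h)"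

definition eps_t :: "('k, 'x) ring_scheme \<Rightarrow> ('k, 'h) weak_hopf \<Rightarrow> 'h \<Rightarrow> 'h"
  where "eps_t K H h = sweedler K H H (\<lambda>u v. counit H (u \<otimes>\<^bsub>H\<^esub> h) \<odot>\<^bsub>H\<^esub> v) \<one>\<^bsub>H\<^esub>"

definition eps_s :: "('k, 'x) ring_scheme \<Rightarrow> ('k, 'h) weak_hopf \<Rightarrow> 'h \<Rightarrow> 'h"
  where "eps_s K H h = sweedler K H H (\<lambda>u v. counit H (h \<otimes>\<^bsub>H\<^esub> v) \<odot>\<^bsub>H\<^esub> u) \<one>\<^bsub>H\<^esub>"

text \<open>The axioms of Boehm, Nill and Szlachanyi; no finiteness of the dimension is assumed.\<close>

locale weak_hopf_algebra =
  fixes K :: "'k ring" and H :: "('k, 'h) weak_hopf"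
  assumes field_K: "field K"
    and ring_H: "ring H"
    and module_H: "module K H"
    and smult_mult: "\<And>a x y. a \<in> carrier K \<Longrightarrow> x \<in> carrier H \<Longrightarrow> y \<in> carrier H \<Longrightarrow>
      (a \<odot>\<^bsub>H\<^esub> x) \<otimes>\<^bsub>H\<^esub> y = a \<odot>\<^bsub>H\<^esub> (x \<otimes>\<^bsub>H\<^esub> y) \<and> x \<otimes>\<^bsub>H\<^esub> (a \<odot>\<^bsub>H\<^esub> y) = a \<odot>\<^bsub>H\<^esub> (x \<otimes>\<^bsub>H\<^esub> y)"
    and comul_linear: "comul H \<in> lin_hom K H (tensor K {} H H)"
    and counit_linear: "counit H \<in> lin_hom K H (ring_as_module K)"
    and antipode_linear: "antipode H \<in> lin_hom K H H"
    and coassoc: "\<And>h. h \<in> carrier H \<Longrightarrow>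
      sweedler K H (tensor K {} H (tensor K {} H H))
        (\<lambda>u v. sweedler K H (tensor K {} H (tensor K {} H H))
           (\<lambda>u1 u2. pure_tensor K {} H (tensor K {} H H) u1 (pure_tensor K {} H H u2 v)) u) h =
      sweedler K H (tensor K {} H (tensor K {} H H))
        (\<lambda>u v. pure_tensor K {} H (tensor K {} H H) u (comul H v)) h"
    and counit_left: "\<And>h. h \<in> carrier H \<Longrightarrow> sweedler K H H (\<lambda>u v. counit H u \<odot>\<^bsub>H\<^esub> v) h = h"
    and counit_right: "\<And>h. h \<in> carrier H \<Longrightarrow> sweedler K H H (\<lambda>u v. counit H v \<odot>\<^bsub>H\<^esub> u) h = h"
    and comul_mult: "\<And>x y. x \<in> carrier H \<Longrightarrow> y \<in> carrier H \<Longrightarrow>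
      comul H (x \<otimes>\<^bsub>H\<^esub> y) =
      sweedler K H (tensor K {} H H) (\<lambda>x1 x2. sweedler K H (tensor K {} H H)
        (\<lambda>y1 y2. pure_tensor K {} H H (x1 \<otimes>\<^bsub>H\<^esub> y1) (x2 \<otimes>\<^bsub>H\<^esub> y2)) y) x"
    and comul_one_1: \<comment> \<open>\<open>(id \<otimes> \<Delta>) (\<Delta> 1) = (\<Delta> 1 \<otimes> 1) (1 \<otimes> \<Delta> 1)\<close>\<close>
      "sweedler K H (tensor K {} H (tensor K {} H H))
        (\<lambda>u v. pure_tensor K {} H (tensor K {} H H) u (comul H v)) \<one>\<^bsub>H\<^esub> =
      sweedler K H (tensor K {} H (tensor K {} H H))
        (\<lambda>u v. sweedler K H (tensor K {} H (tensor K {} H H))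
           (\<lambda>u' v'. pure_tensor K {} H (tensor K {} H H) u (pure_tensor K {} H H (v \<otimes>\<^bsub>H\<^esub> u') v')) \<one>\<^bsub>H\<^esub>) \<one>\<^bsub>H\<^esub>"
    and comul_one_2: \<comment> \<open>\<open>(id \<otimes> \<Delta>) (\<Delta> 1) = (1 \<otimes> \<Delta> 1) (\<Delta> 1 \<otimes> 1)\<close>\<close>
      "sweedler K H (tensor K {} H (tensor K {} H H))
        (\<lambda>u v. pure_tensor K {} H (tensor K {} H H) u (comul H v)) \<one>\<^bsub>H\<^esub> =
      sweedler K H (tensor K {} H (tensor K {} H H))
        (\<lambda>u v. sweedler K H (tensor K {} H (tensor K {} H H))
           (\<lambda>u' v'. pure_tensor K {} H (tensor K {} H H) u (pure_tensor K {} H H (u' \<otimes>\<^bsub>H\<^esub> v) v')) \<one>\<^bsub>H\<^esub>) \<one>\<^bsub>H\<^esub>"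
    and counit_mult_1: "\<And>x y z. x \<in> carrier H \<Longrightarrow> y \<in> carrier H \<Longrightarrow> z \<in> carrier H \<Longrightarrow>
      counit H (x \<otimes>\<^bsub>H\<^esub> y \<otimes>\<^bsub>H\<^esub> z) = sweedler K H (ring_as_module K)
        (\<lambda>u v. counit H (x \<otimes>\<^bsub>H\<^esub> u) \<otimes>\<^bsub>K\<^esub> counit H (v \<otimes>\<^bsub>H\<^esub> z)) y"
    and counit_mult_2: "\<And>x y z. x \<in> carrier H \<Longrightarrow> y \<in> carrier H \<Longrightarrow> z \<in> carrier H \<Longrightarrow>
      counit H (x \<otimes>\<^bsub>H\<^esub> y \<otimes>\<^bsub>H\<^esub> z) = sweedler K H (ring_as_module K)
        (\<lambda>u v. counit H (x \<otimes>\<^bsub>H\<^esub> v) \<otimes>\<^bsub>K\<^esub> counit H (u \<otimes>\<^bsub>H\<^esub> z)) y"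
    and antipode_t: "\<And>h. h \<in> carrier H \<Longrightarrow>
      sweedler K H H (\<lambda>u v. u \<otimes>\<^bsub>H\<^esub> antipode H v) h = eps_t K H h"
    and antipode_s: "\<And>h. h \<in> carrier H \<Longrightarrow>
      sweedler K H H (\<lambda>u v. antipode H u \<otimes>\<^bsub>H\<^esub> v) h = eps_s K H h"
    and antipode_3: "\<And>h. h \<in> carrier H \<Longrightarrow>
      sweedler K H H (\<lambda>u v. sweedler K H H
        (\<lambda>v1 v2. antipode H u \<otimes>\<^bsub>H\<^esub> v1 \<otimes>\<^bsub>H\<^esub> antipode H v2) v) h = antipode H h"

text \<open>The base algebra is the target counital subalgebra \<open>\<epsilon>\<^sub>t(H)\<close>.\<close>

definition base_alg :: "('k, 'x) ring_scheme \<Rightarrow> ('k, 'h) weak_hopf \<Rightarrow> ('k, 'h) weak_hopf"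
  where "base_alg K H = H\<lparr>carrier := eps_t K H ` carrier H\<rparr>"

text \<open>Existence of a separability idempotent.\<close>

definition separable_algebra :: "('k, 'x) ring_scheme \<Rightarrow> ('k, 'r, 'y) module_scheme \<Rightarrow> bool"
  where "separable_algebra K R \<longleftrightarrow> (\<exists>e\<in>carrier (tensor K {} R R).
     tensor_lift K R (\<lambda>x y. x \<otimes>\<^bsub>R\<^esub> y) e = \<one>\<^bsub>R\<^esub> \<and>
     (\<forall>r\<in>carrier R.
        tensor_lift K (tensor K {} R R) (\<lambda>x y. pure_tensor K {} R R (r \<otimes>\<^bsub>R\<^esub> x) y) e =
        tensor_lift K (tensor K {} R R) (\<lambda>x y. pure_tensor K {} R R x (y \<otimes>\<^bsub>R\<^esub> r)) e))"

section \<open>Linear categories\<close>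

text \<open>
  Hom-spaces are given as modules, since the categories in question are \<open>k\<close>-linear.  The composite
  \<open>g \<circ> f\<close> is \<open>cmp C g f\<close>; it is meaningful only for composable arrows.
\<close>

record ('k, 'o, 'a) lcat =
  obj :: "'o set"
  homs :: "'o \<Rightarrow> 'o \<Rightarrow> ('k, 'a) module"
  cmp :: "'a \<Rightarrow> 'a \<Rightarrow> 'a"
  idn :: "'o \<Rightarrow> 'a"

abbreviation ar :: "('k, 'o, 'a, 'x) lcat_scheme \<Rightarrow> 'o \<Rightarrow> 'o \<Rightarrow> 'a set"
  where "ar C X Y \<equiv> carrier (homs C X Y)"

definition epi :: "('k, 'o, 'a, 'x) lcat_scheme \<Rightarrow> 'o \<Rightarrow> 'o \<Rightarrow> 'a \<Rightarrow> bool"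
  where "epi C X Y f \<longleftrightarrow> f \<in> ar C X Y \<and>
     (\<forall>Z\<in>obj C. \<forall>g\<in>ar C Y Z. \<forall>h\<in>ar C Y Z. cmp C g f = cmp C h f \<longrightarrow> g = h)"

definition is_kernel :: "('k, 'o, 'a, 'x) lcat_scheme \<Rightarrow> 'o \<Rightarrow> 'o \<Rightarrow> 'a \<Rightarrow> 'o \<Rightarrow> 'a \<Rightarrow> bool"
  where "is_kernel C Y Z g W k \<longleftrightarrow> W \<in> obj C \<and> k \<in> ar C W Y \<and> cmp C g k = \<zero>\<^bsub>homs C W Z\<^esub> \<and>
     (\<forall>V\<in>obj C. \<forall>h\<in>ar C V Y. cmp C g h = \<zero>\<^bsub>homs C V Z\<^esub> \<longrightarrow> (\<exists>!u. u \<in> ar C V W \<and> cmp C k u = h))"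

definition is_coequalizer ::
  "('k, 'o, 'a, 'x) lcat_scheme \<Rightarrow> 'o \<Rightarrow> 'o \<Rightarrow> 'a \<Rightarrow> 'a \<Rightarrow> 'o \<Rightarrow> 'a \<Rightarrow> bool"
  where "is_coequalizer C X Y f g Q q \<longleftrightarrow> Q \<in> obj C \<and> q \<in> ar C Y Q \<and> cmp C q f = cmp C q g \<and>
     (\<forall>Z\<in>obj C. \<forall>h\<in>ar C Y Z. cmp C h f = cmp C h g \<longrightarrow> (\<exists>!u. u \<in> ar C Q Z \<and> cmp C u q = h))"

text \<open>Exactness of \<open>X \<rightarrow> Y \<rightarrow> Z\<close> at \<open>Y\<close>: the first map factors through an epimorphism onto the
  kernel of the second one.\<close>

definition exact_at :: "('k, 'o, 'a, 'x) lcat_scheme \<Rightarrow> 'o \<Rightarrow> 'o \<Rightarrow> 'o \<Rightarrow> 'a \<Rightarrow> 'a \<Rightarrow> bool"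
  where "exact_at C X Y Z f g \<longleftrightarrow> f \<in> ar C X Y \<and> g \<in> ar C Y Z \<and>
     (\<exists>W k e. is_kernel C Y Z g W k \<and> epi C X W e \<and> f = cmp C k e)"

text \<open>Exactness of \<open>X \<rightarrow> Y \<rightarrow> Z \<rightarrow> 0\<close>.\<close>

definition right_exact :: "('k, 'o, 'a, 'x) lcat_scheme \<Rightarrow> 'o \<Rightarrow> 'o \<Rightarrow> 'o \<Rightarrow> 'a \<Rightarrow> 'a \<Rightarrow> bool"
  where "right_exact C X Y Z f g \<longleftrightarrow> exact_at C X Y Z f g \<and> epi C Y Z g"

definition projective :: "('k, 'o, 'a, 'x) lcat_scheme \<Rightarrow> 'o \<Rightarrow> bool"
  where "projective C P \<longleftrightarrow> P \<in> obj C \<and>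
     (\<forall>Y\<in>obj C. \<forall>Z\<in>obj C. \<forall>g f. epi C Y Z g \<longrightarrow> f \<in> ar C P Z \<longrightarrow> (\<exists>h\<in>ar C P Y. cmp C g h = f))"

definition inverse_ar :: "('k, 'o, 'a, 'x) lcat_scheme \<Rightarrow> 'o \<Rightarrow> 'o \<Rightarrow> 'a \<Rightarrow> 'a"
  where "inverse_ar C X Y f = (THE g. g \<in> ar C Y X \<and> cmp C g f = idn C X \<and> cmp C f g = idn C Y)"

section \<open>Contravariant linear functors to vector spaces\<close>

text \<open>Maps of vector spaces are only relevant on the carrier of their source.\<close>

record ('k, 'o, 'a, 'v) vfun =
  fob :: "'o \<Rightarrow> ('k, 'v) module"
  far :: "'a \<Rightarrow> 'v \<Rightarrow> 'v"

definition contra_functor ::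
  "('k, 'y) ring_scheme \<Rightarrow> ('k, 'o, 'a, 'x) lcat_scheme \<Rightarrow> ('k, 'o, 'a, 'v) vfun \<Rightarrow> bool"
  where "contra_functor K C F \<longleftrightarrow>
     (\<forall>X\<in>obj C. module K (fob F X)) \<and>
     (\<forall>X\<in>obj C. \<forall>Y\<in>obj C. \<forall>f\<in>ar C X Y. far F f \<in> lin_hom K (fob F Y) (fob F X)) \<and>
     (\<forall>X\<in>obj C. \<forall>x\<in>carrier (fob F X). far F (idn C X) x = x) \<and>
     (\<forall>X\<in>obj C. \<forall>Y\<in>obj C. \<forall>Z\<in>obj C. \<forall>f\<in>ar C X Y. \<forall>g\<in>ar C Y Z. \<forall>x\<in>carrier (fob F Z).
        far F (cmp C g f) x = far F f (far F g x)) \<and>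
     (\<forall>X\<in>obj C. \<forall>Y\<in>obj C. \<forall>f\<in>ar C X Y. \<forall>g\<in>ar C X Y. \<forall>x\<in>carrier (fob F Y).
        far F (f \<oplus>\<^bsub>homs C X Y\<^esub> g) x = far F f x \<oplus>\<^bsub>fob F X\<^esub> far F g x) \<and>
     (\<forall>X\<in>obj C. \<forall>Y\<in>obj C. \<forall>a\<in>carrier K. \<forall>f\<in>ar C X Y. \<forall>x\<in>carrier (fob F Y).
        far F (a \<odot>\<^bsub>homs C X Y\<^esub> f) x = a \<odot>\<^bsub>fob F X\<^esub> far F f x)"

definition left_exact :: "('k, 'o, 'a, 'x) lcat_scheme \<Rightarrow> ('k, 'o, 'a, 'v) vfun \<Rightarrow> bool"
  where "left_exact C F \<longleftrightarrow>
     (\<forall>X\<in>obj C. \<forall>Y\<in>obj C. \<forall>Z\<in>obj C. \<forall>f g. right_exact C X Y Z f g \<longrightarrow>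
        inj_on (far F g) (carrier (fob F Z)) \<and>
        far F g ` carrier (fob F Z) = {y \<in> carrier (fob F Y). far F f y = \<zero>\<^bsub>fob F X\<^esub>})"

text \<open>Cohomology of a cochain complex \<open>D 0 \<rightarrow> D 1 \<rightarrow> \<dots>\<close>, where \<open>\<delta> n\<close> maps \<open>D n\<close> to \<open>D (n + 1)\<close>.\<close>

definition cohomology ::
  "(nat \<Rightarrow> ('k, 'v) module) \<Rightarrow> (nat \<Rightarrow> 'v \<Rightarrow> 'v) \<Rightarrow> nat \<Rightarrow> ('k, 'v set) module"
  where "cohomology D \<delta> n =
     quot_mod ((D n)\<lparr>carrier := {x \<in> carrier (D n). \<delta> n x = \<zero>\<^bsub>D (Suc n)\<^esub>}\<rparr>)
       (case n of 0 \<Rightarrow> {\<zero>\<^bsub>D 0\<^esub>} | Suc m \<Rightarrow> \<delta> m ` carrier (D m))"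

definition proj_resolution ::
  "('k, 'o, 'a, 'x) lcat_scheme \<Rightarrow> 'o \<Rightarrow> (nat \<Rightarrow> 'o) \<Rightarrow> (nat \<Rightarrow> 'a) \<Rightarrow> 'a \<Rightarrow> bool"
  where "proj_resolution C X Q dQ aug \<longleftrightarrow>
     (\<forall>n. projective C (Q n)) \<and>
     (\<forall>n. exact_at C (Q (Suc (Suc n))) (Q (Suc n)) (Q n) (dQ (Suc n)) (dQ n)) \<and>
     right_exact C (Q 1) (Q 0) X (dQ 0) aug"

text \<open>The value at \<open>X\<close> of the \<open>n\<close>-th right derived functor of \<open>F\<close>.\<close>

definition right_derived ::
  "('k, 'o, 'a, 'x) lcat_scheme \<Rightarrow> ('k, 'o, 'a, 'v) vfun \<Rightarrow> nat \<Rightarrow> 'o \<Rightarrow> ('k, 'v set) module"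
  where "right_derived C F n X =
     (let (Q, dQ, aug) = (SOME (Q, dQ, aug). proj_resolution C X Q dQ aug)
      in cohomology (\<lambda>m. fob F (Q m)) (\<lambda>m. far F (dQ m)) n)"

section \<open>Monoidal categories, algebras, bimodules\<close>

text \<open>\<open>asc C X Y Z\<close> goes from \<open>(X \<otimes> Y) \<otimes> Z\<close> to \<open>X \<otimes> (Y \<otimes> Z)\<close>; \<open>lun C X\<close> and \<open>run C X\<close> go from
  \<open>1 \<otimes> X\<close> and \<open>X \<otimes> 1\<close> to \<open>X\<close>.\<close>

record ('k, 'o, 'a) mcat = "('k, 'o, 'a) lcat" +
  tob :: "'o \<Rightarrow> 'o \<Rightarrow> 'o"
  tar :: "'a \<Rightarrow> 'a \<Rightarrow> 'a"
  unt :: "'o"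
  asc :: "'o \<Rightarrow> 'o \<Rightarrow> 'o \<Rightarrow> 'a"
  lun :: "'o \<Rightarrow> 'a"
  run :: "'o \<Rightarrow> 'a"

record ('o, 'a) alg =
  aob :: "'o"
  amul :: "'a"
  aone :: "'a"

definition is_alg :: "('k, 'o, 'a, 'x) mcat_scheme \<Rightarrow> ('o, 'a) alg \<Rightarrow> bool"
  where "is_alg C A \<longleftrightarrow> (let X = aob A; \<mu> = amul A; \<eta> = aone A; i = idn C X in
     X \<in> obj C \<and> \<mu> \<in> ar C (tob C X X) X \<and> \<eta> \<in> ar C (unt C) X \<and>
     cmp C \<mu> (tar C \<mu> i) = cmp C \<mu> (cmp C (tar C i \<mu>) (asc C X X X)) \<and>
     cmp C \<mu> (tar C \<eta> i) = lun C X \<and>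
     cmp C \<mu> (tar C i \<eta>) = run C X)"

record ('o, 'a) bimod =
  bob :: "'o"
  lac :: "'a"
  rac :: "'a"

definition is_bimod :: "('k, 'o, 'a, 'x) mcat_scheme \<Rightarrow> ('o, 'a) alg \<Rightarrow> ('o, 'a) bimod \<Rightarrow> bool"
  where "is_bimod C A S \<longleftrightarrow>
     (let X = aob A; \<mu> = amul A; \<eta> = aone A; i = idn C X; Y = bob S; l = lac S; r = rac S; j = idn C Y in
     Y \<in> obj C \<and> l \<in> ar C (tob C X Y) Y \<and> r \<in> ar C (tob C Y X) Y \<and>
     cmp C l (tar C \<mu> j) = cmp C l (cmp C (tar C i l) (asc C X X Y)) \<and>
     cmp C l (tar C \<eta> j) = lun C Y \<and>
     cmp C r (tar C r i) = cmp C r (cmp C (tar C j \<mu>) (asc C Y X X)) \<and>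
     cmp C r (tar C j \<eta>) = run C Y \<and>
     cmp C r (tar C l i) = cmp C l (cmp C (tar C i r) (asc C X Y X)))"

definition Bimd :: "('k, 'o, 'a, 'x) mcat_scheme \<Rightarrow> ('o, 'a) alg \<Rightarrow> ('k, ('o, 'a) bimod, 'a) lcat"
  where "Bimd C A = \<lparr>
     obj = {S. is_bimod C A S},
     homs = (\<lambda>S T. (homs C (bob S) (bob T))\<lparr>carrier := {f \<in> ar C (bob S) (bob T).
        cmp C f (lac S) = cmp C (lac T) (tar C (idn C (aob A)) f) \<and>
        cmp C f (rac S) = cmp C (rac T) (tar C f (idn C (aob A)))}\<rparr>),
     cmp = cmp C,
     idn = (\<lambda>S. idn C (bob S))\<rparr>"

definition alg_bimod :: "('o, 'a) alg \<Rightarrow> ('o, 'a) bimod"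
  where "alg_bimod A = \<lparr>bob = aob A, lac = amul A, rac = amul A\<rparr>"

text \<open>\<open>S \<otimes>\<^sub>A T\<close> is a chosen coequalizer of the two maps \<open>(S \<otimes> A) \<otimes> T \<rightarrow> S \<otimes> T\<close>, with the actions
  induced by those of \<open>A\<close> on the left of \<open>S\<close> and on the right of \<open>T\<close>.\<close>

definition bten_coeq ::
  "('k, 'o, 'a, 'x) mcat_scheme \<Rightarrow> ('o, 'a) alg \<Rightarrow> ('o, 'a) bimod \<Rightarrow> ('o, 'a) bimod \<Rightarrow> 'o \<times> 'a"
  where "bten_coeq C A S T = (SOME (Q, q).
     is_coequalizer C (tob C (tob C (bob S) (aob A)) (bob T)) (tob C (bob S) (bob T))
       (tar C (rac S) (idn C (bob T)))
       (cmp C (tar C (idn C (bob S)) (lac T)) (asc C (bob S) (aob A) (bob T))) Q q)"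

abbreviation bten_ob ::
  "('k, 'o, 'a, 'x) mcat_scheme \<Rightarrow> ('o, 'a) alg \<Rightarrow> ('o, 'a) bimod \<Rightarrow> ('o, 'a) bimod \<Rightarrow> 'o"
  where "bten_ob C A S T \<equiv> fst (bten_coeq C A S T)"

abbreviation bten_pr ::
  "('k, 'o, 'a, 'x) mcat_scheme \<Rightarrow> ('o, 'a) alg \<Rightarrow> ('o, 'a) bimod \<Rightarrow> ('o, 'a) bimod \<Rightarrow> 'a"
  where "bten_pr C A S T \<equiv> snd (bten_coeq C A S T)"

definition bten ::
  "('k, 'o, 'a, 'x) mcat_scheme \<Rightarrow> ('o, 'a) alg \<Rightarrow> ('o, 'a) bimod \<Rightarrow> ('o, 'a) bimod \<Rightarrow> ('o, 'a) bimod"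
  where "bten C A S T = (let Q = bten_ob C A S T; q = bten_pr C A S T; X = aob A; i = idn C X in
     \<lparr>bob = Q,
      lac = (THE l. l \<in> ar C (tob C X Q) Q \<and>
        cmp C l (cmp C (tar C i q) (asc C X (bob S) (bob T))) =
        cmp C q (tar C (lac S) (idn C (bob T)))),
      rac = (THE r. r \<in> ar C (tob C Q X) Q \<and>
        cmp C r (tar C q i) =
        cmp C q (cmp C (tar C (idn C (bob S)) (rac T)) (asc C (bob S) (bob T) X)))\<rparr>)"

text \<open>\<open>f \<otimes>\<^sub>A g\<close> for \<open>f : S \<rightarrow> S'\<close> and \<open>g : T \<rightarrow> T'\<close>.\<close>

definition bten_ar ::
  "('k, 'o, 'a, 'x) mcat_scheme \<Rightarrow> ('o, 'a) alg \<Rightarrow> ('o, 'a) bimod \<Rightarrow> ('o, 'a) bimod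
     \<Rightarrow> ('o, 'a) bimod \<Rightarrow> ('o, 'a) bimod \<Rightarrow> 'a \<Rightarrow> 'a \<Rightarrow> 'a"
  where "bten_ar C A S S' T T' f g =
     (THE h. h \<in> ar C (bten_ob C A S T) (bten_ob C A S' T') \<and>
        cmp C h (bten_pr C A S T) = cmp C (bten_pr C A S' T') (tar C f g))"

text \<open>The canonical isomorphisms \<open>A \<otimes>\<^sub>A S \<rightarrow> S\<close> and \<open>S \<otimes>\<^sub>A A \<rightarrow> S\<close>.\<close>

definition bten_lun ::
  "('k, 'o, 'a, 'x) mcat_scheme \<Rightarrow> ('o, 'a) alg \<Rightarrow> ('o, 'a) bimod \<Rightarrow> 'a"
  where "bten_lun C A S = (THE h. h \<in> ar C (bten_ob C A (alg_bimod A) S) (bob S) \<and>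
     cmp C h (bten_pr C A (alg_bimod A) S) = lac S)"

definition bten_run ::
  "('k, 'o, 'a, 'x) mcat_scheme \<Rightarrow> ('o, 'a) alg \<Rightarrow> ('o, 'a) bimod \<Rightarrow> 'a"
  where "bten_run C A S = (THE h. h \<in> ar C (bten_ob C A S (alg_bimod A)) (bob S) \<and>
     cmp C h (bten_pr C A S (alg_bimod A)) = rac S)"

section \<open>Contratraces and Hochschild cohomology\<close>

text \<open>The last two conditions are the coherence of the center with the associativity and unit
  constraints, which are usually suppressed, written out.\<close>

definition contratrace ::
  "('k, 'y) ring_scheme \<Rightarrow> ('k, 'o, 'a, 'x) mcat_scheme \<Rightarrow> ('k, 'o, 'a, 'v) vfun
     \<Rightarrow> ('o \<Rightarrow> 'o \<Rightarrow> 'v \<Rightarrow> 'v) \<Rightarrow> bool"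
  where "contratrace K C F \<tau> \<longleftrightarrow>
     contra_functor K C F \<and>
     (\<forall>c\<in>obj C. \<forall>d\<in>obj C.
        \<tau> c d \<in> lin_hom K (fob F (tob C c d)) (fob F (tob C d c)) \<and>
        bij_betw (\<tau> c d) (carrier (fob F (tob C c d))) (carrier (fob F (tob C d c)))) \<and>
     (\<forall>c\<in>obj C. \<forall>c'\<in>obj C. \<forall>d\<in>obj C. \<forall>d'\<in>obj C. \<forall>f\<in>ar C c c'. \<forall>g\<in>ar C d d'.
        \<forall>x\<in>carrier (fob F (tob C c' d')).
          \<tau> c d (far F (tar C f g) x) = far F (tar C g f) (\<tau> c' d' x)) \<and>
     (\<forall>c\<in>obj C. \<forall>c'\<in>obj C. \<forall>d\<in>obj C. \<forall>x\<in>carrier (fob F (tob C c (tob C c' d))).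
        far F (asc C d c c') (\<tau> (tob C c c') d (far F (asc C c c' d) x)) =
        \<tau> c' (tob C d c)
          (far F (inverse_ar C (tob C (tob C c' d) c) (tob C c' (tob C d c)) (asc C c' d c))
             (\<tau> c (tob C c' d) x))) \<and>
     (\<forall>d\<in>obj C. \<forall>x\<in>carrier (fob F d). \<tau> (unt C) d (far F (lun C d) x) = far F (run C d) x)"

definition symmetric_contratrace ::
  "('k, 'y) ring_scheme \<Rightarrow> ('k, 'o, 'a, 'x) mcat_scheme \<Rightarrow> ('k, 'o, 'a, 'v) vfun
     \<Rightarrow> ('o \<Rightarrow> 'o \<Rightarrow> 'v \<Rightarrow> 'v) \<Rightarrow> bool"
  where "symmetric_contratrace K C F \<tau> \<longleftrightarrow> contratrace K C F \<tau> \<and>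
     (\<forall>c\<in>obj C. \<forall>d\<in>obj C. \<forall>x\<in>carrier (fob F (tob C c d)). \<tau> d c (\<tau> c d x) = x)"

text \<open>The functor \<open>F\<^sub>A\<close> on bimodules.\<close>

definition contratrace_bimod ::
  "('o, 'a) alg \<Rightarrow> ('k, 'o, 'a, 'v) vfun \<Rightarrow> ('o \<Rightarrow> 'o \<Rightarrow> 'v \<Rightarrow> 'v)
     \<Rightarrow> ('k, ('o, 'a) bimod, 'a, 'v) vfun"
  where "contratrace_bimod A F \<tau> = \<lparr>
     fob = (\<lambda>S. (fob F (bob S))\<lparr>carrier := {x \<in> carrier (fob F (bob S)).
        \<tau> (aob A) (bob S) (far F (lac S) x) = far F (rac S) x}\<rparr>),
     far = far F\<rparr>"

text \<open>\<open>bpow C A P n\<close> is the \<open>n + 1\<close>-fold product of \<open>P\<close>, bracketed to the right, and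
  \<open>face C A P d n i\<close> is \<open>id\<^sup>i \<otimes> d \<otimes> id\<^sup>n\<^sup>+\<^sup>1\<^sup>-\<^sup>i\<close> from \<open>bpow C A P (n + 1)\<close> to \<open>bpow C A P n\<close>, for
  \<open>i \<le> n + 1\<close>; the factor \<open>A\<close> in the target is removed by a unit isomorphism.\<close>

primrec bpow ::
  "('k, 'o, 'a, 'x) mcat_scheme \<Rightarrow> ('o, 'a) alg \<Rightarrow> ('o, 'a) bimod \<Rightarrow> nat \<Rightarrow> ('o, 'a) bimod"
  where
    "bpow C A P 0 = P"
  | "bpow C A P (Suc n) = bten C A P (bpow C A P n)"

definition face_first ::
  "('k, 'o, 'a, 'x) mcat_scheme \<Rightarrow> ('o, 'a) alg \<Rightarrow> ('o, 'a) bimod \<Rightarrow> 'a \<Rightarrow> nat \<Rightarrow> 'a"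
  where "face_first C A P d n = (let T = bpow C A P n in
     cmp C (bten_lun C A T) (bten_ar C A P (alg_bimod A) T T d (idn C (bob T))))"

primrec face ::
  "('k, 'o, 'a, 'x) mcat_scheme \<Rightarrow> ('o, 'a) alg \<Rightarrow> ('o, 'a) bimod \<Rightarrow> 'a \<Rightarrow> nat \<Rightarrow> nat \<Rightarrow> 'a"
  where
    "face C A P d 0 = (\<lambda>i. case i of
        0 \<Rightarrow> face_first C A P d 0
      | Suc _ \<Rightarrow> cmp C (bten_run C A P) (bten_ar C A P P P (alg_bimod A) (idn C (bob P)) d))"
  | "face C A P d (Suc n) = (\<lambda>i. case i of
        0 \<Rightarrow> face_first C A P d (Suc n)
      | Suc j \<Rightarrow> bten_ar C A P P (bpow C A P (Suc n)) (bpow C A P n) (idn C (bob P)) (face C A P d n j))"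

definition admissible_pair ::
  "('k, 'o, 'a, 'x) mcat_scheme \<Rightarrow> ('o, 'a) alg \<Rightarrow> ('o, 'a) bimod \<Rightarrow> 'a \<Rightarrow> bool"
  where "admissible_pair C A P d \<longleftrightarrow> projective (Bimd C A) P \<and> d \<in> ar (Bimd C A) P (alg_bimod A) \<and>
     right_exact (Bimd C A) (bten C A P P) P (alg_bimod A)
       (face C A P d 0 0 \<ominus>\<^bsub>homs (Bimd C A) (bten C A P P) P\<^esub> face C A P d 0 1) d"

definition HH ::
  "('k, 'o, 'a, 'x) mcat_scheme \<Rightarrow> ('o, 'a) alg \<Rightarrow> ('k, 'o, 'a, 'v) vfun \<Rightarrow> ('o \<Rightarrow> 'o \<Rightarrow> 'v \<Rightarrow> 'v)
     \<Rightarrow> ('o, 'a) bimod \<Rightarrow> 'a \<Rightarrow> nat \<Rightarrow> ('k, 'v set) module"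
  where "HH C A F \<tau> P d =
     (let FA = contratrace_bimod A F \<tau>; D = (\<lambda>n. fob FA (bpow C A P n)) in
      cohomology D (\<lambda>n x. finsum (D (Suc n))
        (\<lambda>i. if even i then far FA (face C A P d n i) x
             else \<ominus>\<^bsub>D (Suc n)\<^esub> far FA (face C A P d n i) x) {..Suc n}))"

section \<open>The monoidal category of left modules over a weak Hopf algebra\<close>

text \<open>
  Modules have their carrier inside the type \<open>'u\<close>, which plays the role of a universe: all
  constructions below produce objects with carrier in \<open>'u\<close> again, by transporting along a chosen
  injection of the carrier into \<open>'u\<close>.  Such an injection exists as soon as \<open>'u\<close> is infinite and at
  least as large as the field and the weak Hopf algebra.
\<close>

record ('k, 'h, 'u) hmod = "('k, 'u) module" +
  act :: "'h \<Rightarrow> 'u \<Rightarrow> 'u"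

definition is_hmod :: "('k, 'x) ring_scheme \<Rightarrow> ('k, 'h) weak_hopf \<Rightarrow> ('k, 'h, 'u) hmod \<Rightarrow> bool"
  where "is_hmod K H M \<longleftrightarrow> module K M \<and>
     (\<forall>h\<in>carrier H. act M h \<in> lin_hom K M M) \<and>
     (\<forall>m\<in>carrier M. (\<lambda>h. act M h m) \<in> lin_hom K H M) \<and>
     (\<forall>m\<in>carrier M. act M \<one>\<^bsub>H\<^esub> m = m) \<and>
     (\<forall>g\<in>carrier H. \<forall>h\<in>carrier H. \<forall>m\<in>carrier M. act M (g \<otimes>\<^bsub>H\<^esub> h) m = act M g (act M h m))"

definition code_in :: "'b set \<Rightarrow> 'b \<Rightarrow> 'u"
  where "code_in X = (SOME f. inj_on f X)"

definition code_mod :: "('k, 'b, 'x) module_scheme \<Rightarrow> ('h \<Rightarrow> 'b \<Rightarrow> 'b) \<Rightarrow> ('k, 'h, 'u) hmod"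
  where "code_mod M \<alpha> = (let e = code_in (carrier M); e' = inv_into (carrier M) e in
     \<lparr>carrier = e ` carrier M, mult = undefined, one = undefined, zero = e \<zero>\<^bsub>M\<^esub>,
      add = (\<lambda>x y. e (e' x \<oplus>\<^bsub>M\<^esub> e' y)), smult = (\<lambda>a x. e (a \<odot>\<^bsub>M\<^esub> e' x)),
      act = (\<lambda>h x. e (\<alpha> h (e' x)))\<rparr>)"

text \<open>
  An \<open>H\<close>-module is an \<open>R\<close>-bimodule, where \<open>R = \<epsilon>\<^sub>t(H)\<close> acts on the left through the inclusion into
  \<open>H\<close> and on the right through the antihomomorphism \<open>R \<rightarrow> \<epsilon>\<^sub>s(H)\<close>, \<open>z \<mapsto> \<Sum> 1\<^sub>(\<^sub>1\<^sub>) \<epsilon>(1\<^sub>(\<^sub>2\<^sub>) z)\<close>.  The latter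
  is inverse to the restriction of the antipode to \<open>\<epsilon>\<^sub>s(H)\<close>.
\<close>

definition base_right :: "('k, 'x) ring_scheme \<Rightarrow> ('k, 'h) weak_hopf \<Rightarrow> 'h \<Rightarrow> 'h"
  where "base_right K H z = sweedler K H H (\<lambda>u v. counit H (v \<otimes>\<^bsub>H\<^esub> z) \<odot>\<^bsub>H\<^esub> u) \<one>\<^bsub>H\<^esub>"

definition base_bal ::
  "('k, 'x) ring_scheme \<Rightarrow> ('k, 'h) weak_hopf \<Rightarrow> ('k, 'h, 'u) hmod \<Rightarrow> ('k, 'h, 'u) hmod
     \<Rightarrow> (('u \<Rightarrow> 'u) \<times> ('u \<Rightarrow> 'u)) set"
  where "base_bal K H M N = {(act M (base_right K H z), act N z) | z. z \<in> carrier (base_alg K H)}"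

abbreviation htens0 ::
  "('k, 'x) ring_scheme \<Rightarrow> ('k, 'h) weak_hopf \<Rightarrow> ('k, 'h, 'u) hmod \<Rightarrow> ('k, 'h, 'u) hmod
     \<Rightarrow> ('k, ('u \<times> 'u \<Rightarrow> 'k) set) module"
  where "htens0 K H M N \<equiv> tensor K (base_bal K H M N) M N"

definition htens ::
  "('k, 'x) ring_scheme \<Rightarrow> ('k, 'h) weak_hopf \<Rightarrow> ('k, 'h, 'u) hmod \<Rightarrow> ('k, 'h, 'u) hmod
     \<Rightarrow> ('k, 'h, 'u) hmod"
  where "htens K H M N = code_mod (htens0 K H M N)
     (\<lambda>h. tensor_lift K (htens0 K H M N) (\<lambda>m n. sweedler K H (htens0 K H M N)
        (\<lambda>u v. pure_tensor K (base_bal K H M N) M N (act M u m) (act N v n)) h))"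

definition hpure ::
  "('k, 'x) ring_scheme \<Rightarrow> ('k, 'h) weak_hopf \<Rightarrow> ('k, 'h, 'u) hmod \<Rightarrow> ('k, 'h, 'u) hmod
     \<Rightarrow> 'u \<Rightarrow> 'u \<Rightarrow> 'u"
  where "hpure K H M N m n =
     code_in (carrier (htens0 K H M N)) (pure_tensor K (base_bal K H M N) M N m n)"

definition hlift ::
  "('k, 'x) ring_scheme \<Rightarrow> ('k, 'h) weak_hopf \<Rightarrow> ('k, 'h, 'u) hmod \<Rightarrow> ('k, 'h, 'u) hmod
     \<Rightarrow> ('k, 'h, 'u) hmod \<Rightarrow> ('u \<Rightarrow> 'u \<Rightarrow> 'u) \<Rightarrow> 'u \<Rightarrow> 'u"
  where "hlift K H M N W b x = tensor_lift K W b
     (inv_into (carrier (htens0 K H M N)) (code_in (carrier (htens0 K H M N))) x)"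

text \<open>The unit object is \<open>R\<close> with the action \<open>h \<cdot> z = \<epsilon>\<^sub>t(h z)\<close>.\<close>

definition hunit :: "('k, 'x) ring_scheme \<Rightarrow> ('k, 'h) weak_hopf \<Rightarrow> ('k, 'h, 'u) hmod"
  where "hunit K H = code_mod (base_alg K H) (\<lambda>h z. eps_t K H (h \<otimes>\<^bsub>H\<^esub> z))"

definition hunit_decode :: "('k, 'x) ring_scheme \<Rightarrow> ('k, 'h) weak_hopf \<Rightarrow> 'u \<Rightarrow> 'h"
  where "hunit_decode K H = inv_into (carrier (base_alg K H)) (code_in (carrier (base_alg K H)))"

text \<open>An arrow is a triple of source, underlying map and target, the map being \<open>undefined\<close> outside
  the carrier of the source, so that equality of arrows is equality of maps on the source.\<close>

type_synonym ('k, 'h, 'u) harrow = "('k, 'h, 'u) hmod \<times> ('u \<Rightarrow> 'u) \<times> ('k, 'h, 'u) hmod"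

definition mk_ar :: "('k, 'h, 'u) hmod \<Rightarrow> ('u \<Rightarrow> 'u) \<Rightarrow> ('k, 'h, 'u) hmod \<Rightarrow> ('k, 'h, 'u) harrow"
  where "mk_ar M f N = (M, restrict f (carrier M), N)"

definition hhom ::
  "('k, 'x) ring_scheme \<Rightarrow> ('k, 'h) weak_hopf \<Rightarrow> ('k, 'h, 'u) hmod \<Rightarrow> ('k, 'h, 'u) hmod
     \<Rightarrow> ('k, ('k, 'h, 'u) harrow) module"
  where "hhom K H M N = \<lparr>
     carrier = {(M, f, N) | f. f \<in> extensional (carrier M) \<and> f \<in> lin_hom K M N \<and>
        (\<forall>h\<in>carrier H. \<forall>m\<in>carrier M. f (act M h m) = act N h (f m))},
     mult = undefined, one = undefined,
     zero = mk_ar M (\<lambda>_. \<zero>\<^bsub>N\<^esub>) N,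
     add = (\<lambda>(_, f, _) (_, g, _). mk_ar M (\<lambda>m. f m \<oplus>\<^bsub>N\<^esub> g m) N),
     smult = (\<lambda>a (_, f, _). mk_ar M (\<lambda>m. a \<odot>\<^bsub>N\<^esub> f m) N)\<rparr>"

definition HMod :: "('k, 'x) ring_scheme \<Rightarrow> ('k, 'h) weak_hopf
     \<Rightarrow> ('k, ('k, 'h, 'u) hmod, ('k, 'h, 'u) harrow) mcat"
  where "HMod K H = \<lparr>
     obj = {M. is_hmod K H M},
     homs = hhom K H,
     cmp = (\<lambda>(_, g, P) (M, f, _). mk_ar M (\<lambda>m. g (f m)) P),
     idn = (\<lambda>M. mk_ar M (\<lambda>m. m) M),
     tob = htens K H,
     tar = (\<lambda>(M, f, M') (N, g, N'). mk_ar (htens K H M N)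
        (hlift K H M N (htens K H M' N') (\<lambda>m n. hpure K H M' N' (f m) (g n))) (htens K H M' N')),
     unt = hunit K H,
     asc = (\<lambda>M N P. let W = htens K H M (htens K H N P) in
        mk_ar (htens K H (htens K H M N) P)
          (hlift K H (htens K H M N) P W (\<lambda>t p. hlift K H M N W
             (\<lambda>m n. hpure K H M (htens K H N P) m (hpure K H N P n p)) t)) W),
     lun = (\<lambda>M. mk_ar (htens K H (hunit K H) M)
        (hlift K H (hunit K H) M M (\<lambda>z m. act M (hunit_decode K H z) m)) M),
     run = (\<lambda>M. mk_ar (htens K H M (hunit K H))
        (hlift K H M (hunit K H) M (\<lambda>m z. act M (base_right K H (hunit_decode K H z)) m)) M)\<rparr>"

end

theory Submission
  imports Defs
begin

text \<open>Naturality of \<open>\<tau>\<close> in \<open>f \<otimes> id\<close> shows that \<open>F\<^sub>A\<close> is a subfunctor of \<open>F\<close> on bimodules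
 (\<open>FA_square\<close>). Exactness of bimodules is exactness of the underlying modules (\<open>B_exactD\<close>,
 \<open>B_epiD\<close>), so left exactness passes from \<open>F\<close> to \<open>F\<^sub>A\<close> once an element \<open>z\<close> of \<open>F(Z)\<close> whose image
 in \<open>F(Y)\<close> lies in \<open>F\<^sub>A(Y)\<close> is known to lie in \<open>F\<^sub>A(Z)\<close>. That holds because \<open>g \<otimes> A\<close> is
 surjective with \<open>g\<close>, hence \<open>F(g \<otimes> A)\<close> is injective (\<open>FA_left_exact\<close>).

 For an admissible pair \<open>(P, d)\<close> the Hochschild complex is \<open>F\<^sub>A\<close> applied to the bar complex of
 \<open>P\<close>, the alternating sum of the faces. It suffices that the bar complex is a projective resolution
 of \<open>A\<close>; any two such resolutions are homotopy equivalent (\<open>comparison\<close>).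

 Exactness: choose \<open>p\<^sub>0\<close> with \<open>d p\<^sub>0 = 1\<close>. The bar differential \<open>b\<close> satisfies
 \<open>b (p \<otimes> x) = d p x - p \<otimes> b x\<close>, so a cycle \<open>x\<close> is the boundary of \<open>p\<^sub>0 \<otimes> x\<close> (\<open>bar_step\<close>).

 Projectivity of \<open>P \<otimes>\<^sub>A T\<close> for projective \<open>P\<close> and \<open>T\<close> is where the antipode and the separability of
 the base enter. For an \<open>H\<close>-module \<open>Q\<close> and a bimodule \<open>T\<close> consider the bimodule \<open>A \<otimes> Q \<otimes> T\<close>. If
 \<open>Q = H \<otimes> V\<close> is free, then \<open>Q \<otimes> T\<close> is generated under \<open>H\<close> by the elements \<open>(1 \<otimes> v) \<otimes> t\<close>, and a
 bimodule map out of \<open>A \<otimes> Q \<otimes> T\<close> is the same thing as a \<open>K\<close>-linear family of right \<open>A\<close>-linear maps out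
 of \<open>T\<close>, which need not be \<open>H\<close>-linear; the passage back uses the antipode. So \<open>A \<otimes> Q \<otimes> T\<close> is projective as
 soon as such families lift through surjections of bimodules (\<open>rproj\<close>, \<open>proj_ind\<close>). They do lift for
 \<open>T = A\<close>, and also for \<open>T = A \<otimes> Q' \<otimes> A\<close>: there a linear section of the surjection is needed that
 commutes with the right action of the base, and averaging over the separability idempotent provides
 one (\<open>right_section\<close>, \<open>rproj_ind\<close>). Every projective bimodule is a retract of some \<open>A \<otimes> Q \<otimes> A\<close> with
 \<open>Q\<close> free (\<open>cover\<close>), so \<open>P \<otimes>\<^sub>A T\<close> is a retract of the projective bimodule \<open>A \<otimes> Q \<otimes> T\<close> (\<open>proj_bt\<close>).

 The category is handled elementwise. An arrow out of \<open>M \<otimes> N\<close> amounts to a bilinear map that is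
 balanced over the base and equivariant for the comultiplication (\<open>hpairing\<close>), and chosen
 coequalizers are compared with explicit tensor products (\<open>bten_coeq\<close>).\<close>

text \<open>Compact notation, since almost every formula below mentions several structures at once.\<close>

abbreviation elem :: "'a => ('a, 'm) partial_object_scheme => bool" (infix "el" 50)
  where "x el M \<equiv> x \<in> carrier M"

abbreviation add_in ("_ +[_]/ _" [65, 0, 66] 65) where "x +[M] y \<equiv> x \<oplus>\<^bsub>M\<^esub> y"
abbreviation sub_in ("_ -[_]/ _" [65, 0, 66] 65) where "x -[M] y \<equiv> x \<ominus>\<^bsub>M\<^esub> y"
abbreviation neg_in ("-[_] _" [0, 81] 80) where "-[M] x \<equiv> \<ominus>\<^bsub>M\<^esub> x"
abbreviation smult_in ("_ *[_]/ _" [71, 0, 70] 70) where "a *[M] x \<equiv> a \<odot>\<^bsub>M\<^esub> x"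
abbreviation zero_in ("0[_]") where "0[M] \<equiv> \<zero>\<^bsub>M\<^esub>"
abbreviation one_in ("1[_]") where "1[M] \<equiv> \<one>\<^bsub>M\<^esub>"
abbreviation coset_in ("_ +>[_]/ _" [61, 0, 60] 60) where "N +>[M] x \<equiv> N +>\<^bsub>M\<^esub> x"
abbreviation (in weak_hopf_algebra) mult_H (infixl "**" 70) where "x ** y \<equiv> x \<otimes>\<^bsub>H\<^esub> y"

section \<open>Vector spaces with explicit carriers\<close>

locale vec =
 fixes K :: "'k ring"
 assumes field_K: "field K"
begin

abbreviation vs :: "('k, 'm, 'y) module_scheme => bool"
 where "vs M \<equiv> module K M"

abbreviation lin :: "('k, 'm, 'y) module_scheme => ('k, 'n, 'z) module_scheme => ('m => 'n) => bool"
 where "lin M N f \<equiv> f \<in> lin_hom K M N"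

lemma cring_K: "cring K"
 using field_K by (simp add: field_def domain_def)

lemma K_simps [simp]:
 "0[K] el K" "1[K] el K"
 "a el K ==> b el K ==> a +[K] b el K"
 "a el K ==> b el K ==> a \<otimes>\<^bsub>K\<^esub> b el K"
 "a el K ==> -[K] a el K" using cring_K by (simp_all add: cring_def ring.ring_simprules)

lemma vs_group: "vs M ==> abelian_group M"
 by (simp add: module_def)

lemma vs_monoid: "vs M ==> abelian_monoid M"
 using vs_group abelian_group_def by blast

lemma vs_simps [simp]:
 assumes "vs M"
 shows "x el M ==> y el M ==> x +[M] y el M"
  and "0[M] el M"
  and "x el M ==> -[M] x el M"
  and "x el M ==> y el M ==> x -[M] y el M"
  and "a el K ==> x el M ==> a *[M] x el M"
  and "x el M ==> 0[M] +[M] x = x"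
  and "x el M ==> x +[M] 0[M] = x"
  and "x el M ==> -[M] x +[M] x = 0[M]"
  and "x el M ==> x +[M] -[M] x = 0[M]"
  and "x el M ==> x -[M] x = 0[M]"
  and "x el M ==> x -[M] 0[M] = x"
  and "x el M ==> -[M] (\<ominus>\<^bsub>M\<^esub> x) = x"
  and "-[M] 0[M] = 0[M]"
  and "x el M ==> 1[K] *[M] x = x"
  and "x el M ==> 0[K] *[M] x = 0[M]"
  and "a el K ==> a *[M] 0[M] = 0[M]"
proof -
 interpret module K M by fact
 show "x el M ==> y el M ==> x +[M] y el M"
  and "0[M] el M"
  and "x el M ==> -[M] x el M"
  and "x el M ==> y el M ==> x -[M] y el M"
  and "a el K ==> x el M ==> a *[M] x el M"
  and "x el M ==> 0[M] +[M] x = x"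
  and "x el M ==> x +[M] 0[M] = x"
  and "x el M ==> -[M] x +[M] x = 0[M]"
  and "x el M ==> x +[M] -[M] x = 0[M]"
  and "x el M ==> x -[M] x = 0[M]"
  and "x el M ==> x -[M] 0[M] = x"
  and "x el M ==> -[M] (\<ominus>\<^bsub>M\<^esub> x) = x"
  and "-[M] 0[M] = 0[M]"
  and "x el M ==> 1[K] *[M] x = x"
  and "x el M ==> 0[K] *[M] x = 0[M]"
  and "a el K ==> a *[M] 0[M] = 0[M]" by (simp_all add: M.l_neg M.r_neg a_minus_def)
qed

lemma vs_assoc:
 "vs M ==> x el M ==> y el M ==> z el M ==>
  (x +[M] y) +[M] z = x +[M] (y +[M] z)" using abelian_monoid.a_assoc vs_monoid by metis

lemma vs_comm:
 "vs M ==> x el M ==> y el M ==> x +[M] y = y +[M] x" using abelian_monoid.a_comm vs_monoid by metis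

lemma vs_lcomm:
 "vs M ==> x el M ==> y el M ==> z el M ==>
  x +[M] (y +[M] z) = y +[M] (x +[M] z)" using abelian_monoid.a_lcomm vs_monoid by metis

lemmas vs_ac = vs_assoc vs_comm vs_lcomm

lemma vs_smult:
 assumes "vs M" "a el K" "x el M"
 shows "y el M ==> a *[M] (x +[M] y) = a *[M] x +[M] a *[M] y"
  and "b el K ==> (a +[K] b) *[M] x = a *[M] x +[M] b *[M] x"
  and "b el K ==> (a \<otimes>\<^bsub>K\<^esub> b) *[M] x = a *[M] (b *[M] x)"
  and "a *[M] (\<ominus>\<^bsub>M\<^esub> x) = -[M] (a *[M] x)"
 using assms module.smult_r_distr module.smult_l_distr module.smult_assoc1 module.smult_r_minus by metis+

lemma vs_neg_add:
 "vs M ==> x el M ==> y el M ==> -[M] (x +[M] y) = -[M] x +[M] -[M] y" using abelian_group.minus_add vs_group by metis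

lemma vs_neg_smult: "vs M ==> x el M ==> -[M] x = (\<ominus>\<^bsub>K\<^esub> 1[K]) *[M] x"
 by (simp add: module.smult_l_minus)

lemma vs_minus_eq: "vs M ==> x el M ==> y el M ==> (x -[M] y = 0[M]) = (x = y)"
 by (metis abelian_group.r_neg1 abelian_group.minus_eq vs_comm vs_group vs_simps(3,6,7,8,9))

lemma vs_minus_add:
 "vs M ==> x el M ==> y el M ==> (x -[M] y) +[M] y = x"
 "vs M ==> x el M ==> y el M ==> y +[M] (x -[M] y) = x" by (simp_all add: a_minus_def vs_assoc vs_lcomm[of M y x])

lemma linI:
 "(!!x. x el M ==> f x el N) ==>
 (!!x y. x el M ==> y el M ==> f (x +[M] y) = f x +[N] f y) ==>
 (!!a x. a el K ==> x el M ==> f (a *[M] x) = a *[N] f x) ==> lin M N f" by (auto simp: lin_hom_def)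

lemma linD:
 assumes "lin M N f"
 shows "x el M ==> f x el N"
  and "x el M ==> y el M ==> f (x +[M] y) = f x +[N] f y"
  and "a el K ==> x el M ==> f (a *[M] x) = a *[N] f x" using assms by (auto simp: lin_hom_def)

lemma lin_zero: "vs M ==> vs N ==> lin M N f ==> f 0[M] = 0[N]"
 using linD(3)[of f M N "0[K]" "0[M]"] linD(1)[of f M N "0[M]"] by simp

lemma lin_neg: "vs M ==> vs N ==> lin M N f ==> x el M ==> f (\<ominus>\<^bsub>M\<^esub> x) = -[N] f x"
 using linD(3)[of f M N "-[K] 1[K]" x] linD(1)[of f M N x] by (simp add: vs_neg_smult)

lemma lin_minus:
 "vs M ==> vs N ==> lin M N f ==> x el M ==> y el M ==> f (x -[M] y) = f x -[N] f y" by (simp add: a_minus_def linD(2)[of f M N] lin_neg[of M N f])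

lemma lin_comp: "lin M N f ==> lin N P g ==> lin M P (%x. g (f x))"
 by (rule linI) (auto simp: linD)

lemma lin_id: "lin M M (%x. x)"
 by (rule linI) auto

lemma lin_cong: "(!!x. x el M ==> f x = g x) ==> vs M ==> lin M N f = lin M N g"
 by (auto simp: lin_hom_def Pi_iff)

lemma lin_zero_map: "vs N ==> lin M N (%x. 0[N])"
 by (rule linI) auto

lemma lin_add_map: "vs N ==> lin M N f ==> lin M N g ==> lin M N (%x. f x +[N] g x)"
 by (rule linI) (simp_all add: linD vs_ac vs_smult)

lemma lin_smult_map: "vs N ==> a el K ==> lin M N f ==> lin M N (%x. a *[N] f x)"
proof (rule linI, simp_all add: linD vs_smult)
 fix b x assume "vs N" "a el K" "lin M N f" "b el K" "x el M"
 moreover from this have "a \<otimes>\<^bsub>K\<^esub> b = b \<otimes>\<^bsub>K\<^esub> a" using cring_K by (simp add: cring.cring_simprules)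
 ultimately show "a *[N] (b *[N] f x) = b *[N] (a *[N] f x)" by (metis linD(1) vs_smult(3))
qed

lemma lin_neg_map: "vs N ==> lin M N f ==> lin M N (%x. -[N] f x)"
 by (rule linI) (simp_all add: linD vs_neg_add vs_smult)

lemma lin_minus_map: "vs N ==> lin M N f ==> lin M N g ==> lin M N (%x. f x -[N] g x)"
 by (simp add: a_minus_def lin_add_map lin_neg_map)

lemma lin_inv:
 assumes f: "lin M N f" "bij_betw f (carrier M) (carrier N)" and M: "vs M"
 shows "lin N M (inv_into (carrier M) f)" "bij_betw (inv_into (carrier M) f) (carrier N) (carrier M)"
proof -
 let ?g = "inv_into (carrier M) f"
 have inj: "inj_on f (carrier M)" and im: "f ` carrier M = carrier N" using f(2) by (auto simp: bij_betw_def)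
 have g: "?g y el M" "f (?g y) = y" if "y el N" for y using that im by (auto intro: inv_into_into f_inv_into_f)
 show "lin N M ?g"
 proof (rule linI)
  fix x y assume "x el N" "y el N"
  then have "f (?g x +[M] ?g y) = x +[N] y" "?g x +[M] ?g y el M" using g M by (simp_all add: linD[OF f(1)])
  then show "?g (x +[N] y) = ?g x +[M] ?g y" using inj inv_into_f_f by metis
 next
  fix a x assume "a el K" "x el N"
  then have "f (a *[M] ?g x) = a *[N] x" "a *[M] ?g x el M" using g M by (simp_all add: linD[OF f(1)])
  then show "?g (a *[N] x) = a *[M] ?g x" using inj inv_into_f_f by metis
 qed (use g in auto)
 show "bij_betw ?g (carrier N) (carrier M)" using f(2) by (rule bij_betw_inv_into)
qed

definition bilin ::
 "('k, 'm, 'y) module_scheme => ('k, 'n, 'z) module_scheme => ('k, 'w, 'x) module_scheme => ('m => 'n => 'w) => bool"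
 where "bilin M N W b \<longleftrightarrow> (\<forall>m\<in>carrier M. lin N W (%n. b m n)) \<and> (\<forall>n\<in>carrier N. lin M W (%m. b m n))"

lemma bilinI:
 "(!!m. m el M ==> lin N W (%n. b m n)) ==> (!!n. n el N ==> lin M W (%m. b m n)) ==>
 bilin M N W b" by (simp add: bilin_def)

lemma bilinD:
 assumes "bilin M N W b"
 shows "m el M ==> lin N W (%n. b m n)"
  and "m el M ==> lin N W (b m)"
  and "n el N ==> lin M W (%m. b m n)"
  and "m el M ==> n el N ==> b m n el W"
proof -
 show *: "m el M ==> lin N W (%n. b m n)" "m el M ==> lin N W (b m)"
  "n el N ==> lin M W (%m. b m n)" for m n using assms by (auto simp: bilin_def)
 show "m el M ==> n el N ==> b m n el W" by (rule linD(1)[OF *(2)])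
qed

lemma bilin_comp:
 "bilin M N W b ==> lin M' M f ==> lin N' N g ==> bilin M' N' W (%m n. b (f m) (g n))"
proof (rule bilinI)
 fix m assume b: "bilin M N W b" "lin M' M f" "lin N' N g" and m: "m el M'"
 show "lin N' W (%n. b (f m) (g n))" by (rule lin_comp[OF b(3) bilinD(2)[OF b(1) linD(1)[OF b(2) m]]])
next
 fix n assume b: "bilin M N W b" "lin M' M f" "lin N' N g" and n: "n el N'"
 show "lin M' W (%m. b (f m) (g n))" by (rule lin_comp[OF b(2) bilinD(3)[OF b(1) linD(1)[OF b(3) n]]])
qed

lemma lin_bilin: "bilin M N W b ==> lin W W' f ==> bilin M N W' (%m n. f (b m n))"
proof (rule bilinI)
 fix m assume b: "bilin M N W b" "lin W W' f" "m el M"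
 show "lin N W' (%n. f (b m n))" by (rule lin_comp[OF bilinD(2)[OF b(1,3)] b(2)])
next
 fix n assume b: "bilin M N W b" "lin W W' f" "n el N"
 show "lin M W' (%m. f (b m n))" by (rule lin_comp[OF bilinD(3)[OF b(1,3)] b(2)])
qed

lemma bilin_flip: "bilin M N W b ==> bilin N M W (%n m. b m n)"
 by (simp add: bilin_def)

text \<open>Sums over lists avoid the finiteness and closure side conditions of sums over sets, and a representation of a tensor by pure tensors is a
 list anyway.\<close>

primrec lsum :: "('k, 'm, 'y) module_scheme => ('i => 'm) => 'i list => 'm"
 where "lsum M f [] = 0[M]" | "lsum M f (i # is) = f i +[M] lsum M f is"

lemma lsum_closed [simp]: "vs M ==> (!!i. i \<in> set is ==> f i el M) ==> lsum M f is el M"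
 by (induction "is") auto

lemma lsum_cong: "(!!i. i \<in> set is ==> f i = g i) ==> lsum M f is = lsum M g is"
 by (induction "is") auto

lemma lsum_append:
 "vs M ==> (!!i. i \<in> set (is @ js) ==> f i el M) ==>
  lsum M f (is @ js) = lsum M f is +[M] lsum M f js" by (induction "is") (auto simp: vs_assoc)

lemma lsum_zero: "vs M ==> lsum M (%i. 0[M]) is = 0[M]"
 by (induction "is") auto

lemma lsum_lin:
 assumes "vs M" "vs N" and \<phi>: "lin M N \<phi>" and f: "!!i. i \<in> set is ==> f i el M"
 shows "\<phi> (lsum M f is) = lsum N (%i. \<phi> (f i)) is"
 using f by (induction "is") (simp_all add: assms(1,2) lin_zero[OF assms(1-3)] linD[OF \<phi>])

lemma lsum_add:
 "vs M ==> (!!i. i \<in> set is ==> f i el M) ==> (!!i. i \<in> set is ==> g i el M) ==>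
  lsum M (%i. f i +[M] g i) is = lsum M f is +[M] lsum M g is" by (induction "is") (auto simp: vs_ac)

lemma lin_lsum:
 "vs N ==> (!!i. i \<in> set is ==> lin M N (f i)) ==> lin M N (%x. lsum N (%i. f i x) is)" by (induction "is") (auto simp: lin_zero_map lin_add_map)

lemma lsum_swap:
 "vs M ==> (!!i j. i \<in> set is ==> j \<in> set js ==> f i j el M) ==>
  lsum M (%i. lsum M (f i) js) is = lsum M (%j. lsum M (%i. f i j) is) js"
proof (induction "is")
 case Nil
 then show ?case by (simp add: lsum_zero)
next
 case (Cons i "is")
 have "lsum M (%j. f i j +[M] lsum M (%i. f i j) is) js
   = lsum M (f i) js +[M] lsum M (%j. lsum M (%i. f i j) is) js" by (rule lsum_add) (use Cons in auto)
 with Cons show ?case by simp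
qed

lemma submodI:
 assumes "vs M" "N \<subseteq> carrier M" "0[M] \<in> N" "!!a b. a \<in> N ==> b \<in> N ==> a +[M] b \<in> N"
  "!!a x. a el K ==> x \<in> N ==> a *[M] x \<in> N"
 shows "submodule N K M"
proof (rule module.submoduleI)
 show "-[M] a \<in> N" if "a \<in> N" for a using that assms vs_neg_smult[OF assms(1), of a] by auto
qed (use assms in auto)

lemma submodD:
 assumes "vs M" "submodule N K M"
 shows "N \<subseteq> carrier M" "0[M] \<in> N" "a \<in> N ==> b \<in> N ==> a +[M] b \<in> N"
  "c el K ==> a \<in> N ==> c *[M] a \<in> N" "a \<in> N ==> -[M] a \<in> N"
  "a \<in> N ==> b \<in> N ==> a -[M] b \<in> N"
proof -
 note E = module.submoduleE[OF assms]
 show *: "N \<subseteq> carrier M" "a \<in> N ==> b \<in> N ==> a +[M] b \<in> N" for a b using E by auto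
 show n: "c el K ==> a \<in> N ==> c *[M] a \<in> N" "a \<in> N ==> -[M] a \<in> N" for a using E by auto
 obtain u where "u \<in> N" using E(2) by auto
 then have "u +[M] -[M] u \<in> N" "u el M" using * n by auto
 then show "0[M] \<in> N" using assms(1) by simp
 show "a \<in> N ==> b \<in> N ==> a -[M] b \<in> N" using * n by (simp add: a_minus_def)
qed

lemma submod_vs: "vs M ==> submodule N K M ==> vs (M\<lparr>carrier := N\<rparr>)"
 by (rule submodule.submodule_is_module)

lemma submod_ker:
 assumes "vs M" "vs N" "lin M N f"
 shows "submodule {x \<in> carrier M. f x = 0[N]} K M" by (rule submodI) (use assms(1,2) in "auto simp: linD[OF assms(3)] lin_zero[OF assms]")

lemma submod_im:
 assumes M: "vs M" "vs N" "lin M N f"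
 shows "submodule (f ` carrier M) K N"
proof (rule submodI)
 show "0[N] \<in> f ` carrier M" using lin_zero[OF M] M(1) by (metis imageI vs_simps(2))
 fix a b assume "a \<in> f ` carrier M" "b \<in> f ` carrier M"
 then obtain x y where "x el M" "y el M" "a = f x" "b = f y" by auto
 then show "a +[N] b \<in> f ` carrier M" using M linD(2)[OF M(3), of x y] by (metis imageI vs_simps(1))
next
 fix a y assume "a el K" "y \<in> f ` carrier M"
 then obtain x where "x el M" "a el K" "y = f x" by auto
 then show "a *[N] y \<in> f ` carrier M" using M linD(3)[OF M(3), of a x] by (metis imageI vs_simps(5))
qed (use M(1,2) in "auto simp: linD[OF M(3)]")

lemma submod_subgroup: "vs M ==> submodule N K M ==> abelian_subgroup N M"
 by (rule abelian_subgroupI3) (auto simp: additive_subgroup_def submodule_def intro: vs_group)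

lemma coset_eq:
 assumes "vs M" "submodule N K M" "x el M" "y el M"
 shows "N +>[M] x = N +>[M] y \<longleftrightarrow> x -[M] y \<in> N"
proof -
 interpret abelian_subgroup N M by (rule submod_subgroup) fact+
 have "x -[M] y \<in> N \<longleftrightarrow> x \<in> N +>[M] y" using a_rcos_module[OF assms(4,3)] by (simp add: a_minus_def)
 then show ?thesis using assms a_repr_independence'[of x y] a_rcos_self[of x] by auto
qed

lemma coset_zero:
 assumes "vs M" "submodule N K M"
 shows "N +>[M] 0[M] = N" "x el M ==> N +>[M] x = N \<longleftrightarrow> x \<in> N"
proof -
 show *: "N +>[M] 0[M] = N" using assms submodD(1) abelian_group.a_coset_add_zero vs_group by metis
 show "x el M ==> N +>[M] x = N \<longleftrightarrow> x \<in> N" using coset_eq[OF assms, of x "0[M]"] assms * by simp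
qed

lemma coset_mem: "vs M ==> submodule N K M ==> x el M ==>
  y \<in> N +>[M] x \<longleftrightarrow> y el M \<and> N +>[M] y = N +>[M] x"
 using abelian_subgroup.a_elemrcos_carrier[OF submod_subgroup, of M N x y]
  abelian_subgroup.a_rcos_self[OF submod_subgroup, of M N y]
  abelian_subgroup.a_repr_independence'[OF submod_subgroup, of M N y x] by auto

lemma quot_carrier: "carrier (quot_mod M N) = (%x. N +>[M] x) ` carrier M"
 by (auto simp: quot_mod_def A_RCOSETS_def')

lemma quot_add:
 "vs M ==> submodule N K M ==> x el M ==> y el M ==>
  (N +>[M] x) +[quot_mod M N] (N +>[M] y) = N +>[M] (x +[M] y)" by (simp add: quot_mod_def abelian_subgroup.a_rcos_sum[OF submod_subgroup])

lemma quot_smult: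
 assumes M: "vs M" "submodule N K M" and "a el K" "x el M"
 shows "a *[quot_mod M N] (N +>[M] x) = N +>[M] (a *[M] x)"
proof -
 have *: "N +>[M] (a *[M] y) = N +>[M] (a *[M] x)" if "y \<in> N +>[M] x" for y
 proof -
  have y: "y el M" "y -[M] x \<in> N" using that coset_mem[OF M assms(4), of y] coset_eq[OF M _ assms(4), of y] by auto
  then have "a *[M] (y -[M] x) \<in> N" using submodD(4)[OF M assms(3)] by blast
  moreover have "a *[M] (y -[M] x) = a *[M] y -[M] a *[M] x" using y assms(3,4) M(1) by (simp add: a_minus_def vs_smult[OF M(1)])
  ultimately show ?thesis using y assms(3,4) M(1) by (simp add: coset_eq[OF M])
 qed
 have "x \<in> N +>[M] x" using coset_mem[OF M assms(4)] assms(4) by simp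
 then have "(\<Union>y\<in>N +>[M] x. N +>[M] (a *[M] y)) = N +>[M] (a *[M] x)" by (intro SUP_eq_const *) blast+
 then show ?thesis by (simp add: quot_mod_def)
qed

lemma quot_zero: "0[quot_mod M N] = N"
 by (simp add: quot_mod_def)

lemma quot_vs:
 assumes M: "vs M" "submodule N K M"
 shows "vs (quot_mod M N)"
proof (rule moduleI)
 note s = quot_add[OF M] quot_smult[OF M] quot_zero
 have z: "N +>[M] 0[M] = N" using coset_zero[OF M] by simp
 show "cring K" by (rule cring_K)
 show "abelian_group (quot_mod M N)"
 proof (rule abelian_groupI)
  show "0[quot_mod M N] el quot_mod M N" unfolding quot_zero quot_carrier by (rule image_eqI[of _ _ "0[M]"]) (use M z in auto)
  fix x assume x: "x el quot_mod M N"
  then obtain m where m: "m el M" "x = N +>[M] m" by (auto simp: quot_carrier)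
  show "0[quot_mod M N] +[quot_mod M N] x = x" using s(1)[of "0[M]" m] m M by (simp add: z quot_zero)
  show "\<exists>y\<in>carrier (quot_mod M N). y +[quot_mod M N] x = 0[quot_mod M N]"
   by (rule bexI[of _ "N +>[M] (\<ominus>\<^bsub>M\<^esub> m)"]) (use m M(1) z in "simp_all add: s quot_carrier")
  fix y assume y: "y el quot_mod M N"
  then obtain n where n: "n el M" "y = N +>[M] n" by (auto simp: quot_carrier)
  show "x +[quot_mod M N] y el quot_mod M N" using m n M(1) by (simp add: s quot_carrier)
  show "x +[quot_mod M N] y = y +[quot_mod M N] x" using m n M(1) by (simp add: s vs_comm[OF M(1)])
  fix z assume "z el quot_mod M N"
  then obtain p where p: "p el M" "z = N +>[M] p" by (auto simp: quot_carrier)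
  show "x +[quot_mod M N] y +[quot_mod M N] z = x +[quot_mod M N] (y +[quot_mod M N] z)" using m n p M(1) by (simp add: s vs_assoc[OF M(1)])
 qed
qed (use M(1) in "auto simp: quot_carrier quot_add[OF M] quot_smult[OF M] vs_smult[OF M(1)]")

lemma quot_lin: "vs M ==> submodule N K M ==> lin M (quot_mod M N) (%x. N +>[M] x)"
 by (rule linI) (simp_all add: quot_carrier quot_add quot_smult)

end

section \<open>Tensor products and linear sections\<close>

context vec
begin

lemma free_carrier: "f el free_mod K X \<longleftrightarrow>
  (\<forall>x. f x el K) \<and> finite {x. f x \<noteq> 0[K]} \<and> (\<forall>x. x \<notin> X --> f x = 0[K])" by (simp add: free_mod_def)

lemma free_ops:
 "0[free_mod K X] = (%_. 0[K])" "f +[free_mod K X] g = (%x. f x +[K] g x)"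
 "a *[free_mod K X] f = (%x. a \<otimes>\<^bsub>K\<^esub> f x)" by (simp_all add: free_mod_def)

lemma K_ring: "a el K ==> 0[K] +[K] a = a" "a el K ==> a +[K] 0[K] = a"
 "a el K ==> a \<otimes>\<^bsub>K\<^esub> 0[K] = 0[K]" "a el K ==> 0[K] \<otimes>\<^bsub>K\<^esub> a = 0[K]"
 "a el K ==> -[K] a +[K] a = 0[K]" "a el K ==> 1[K] \<otimes>\<^bsub>K\<^esub> a = a"
 "a el K ==> a \<otimes>\<^bsub>K\<^esub> 1[K] = a" using cring_K by (simp_all add: cring.cring_simprules cring_def ring_def monoid.r_one)

lemma free_vs: "vs (free_mod K X)"
proof (rule moduleI)
 have sub: "finite {x. f x +[K] g x \<noteq> 0[K]}" if "finite {x. f x \<noteq> 0[K]}" "finite {x. g x \<noteq> 0[K]}"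
  for f g :: "'a => 'k" by (rule finite_subset[OF _ finite_UnI[OF that]]) (auto simp: K_ring)
 have sub2: "finite {x. a \<otimes>\<^bsub>K\<^esub> f x \<noteq> 0[K]}" if "finite {x. f x \<noteq> 0[K]}" "a el K"
  for f :: "'a => 'k" and a by (rule finite_subset[OF _ that(1)]) (use that in "auto simp: K_ring")
 show "cring K" by (rule cring_K)
 note R = cring.cring_simprules[OF cring_K]
 show "abelian_group (free_mod K X)"
 proof (rule abelian_groupI)
  fix f assume f: "f el free_mod K X"
  have "{x. -[K] f x \<noteq> 0[K]} = {x. f x \<noteq> 0[K]}" using f R by (metis free_carrier)
  then show "\<exists>g\<in>carrier (free_mod K X). g +[free_mod K X] f = 0[free_mod K X]"
   using f by (intro bexI[of _ "%x. -[K] f x"]) (auto simp: free_carrier free_ops K_ring)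
 qed (auto simp: free_carrier free_ops K_ring sub R)
 show "a *[free_mod K X] f el free_mod K X"
  if "a el K" "f el free_mod K X" for a f using that sub2 by (auto simp: free_carrier free_ops K_ring)
qed (auto simp: free_carrier free_ops K_ring cring.cring_simprules[OF cring_K])

lemma free_gen_in: "x \<in> X ==> free_gen K x el free_mod K X"
 by (auto simp: free_gen_def free_carrier)

lemma free_induct:
 assumes f: "f el free_mod K X" and S: "submodule S K (free_mod K X)"
  and g: "!!x. x \<in> X ==> free_gen K x \<in> S"
 shows "f \<in> S"
proof -
 note SD = submodD[OF free_vs S]
 have "finite A ==> f el free_mod K X ==> {x. f x \<noteq> 0[K]} \<subseteq> A ==> f \<in> S" for A f
 proof (induction A arbitrary: f rule: finite_induct)
  case empty
  then have "f = 0[free_mod K X]" by (auto simp: free_ops)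
  then show ?case using SD(2) by simp
 next
  case (insert x A)
  let ?f = "f(x := 0[K])"
  have sub: "{y. ?f y \<noteq> 0[K]} \<subseteq> {y. f y \<noteq> 0[K]}" by auto
  then have "finite {y. ?f y \<noteq> 0[K]}" using insert.prems(1) by (auto simp: free_carrier intro: finite_subset)
  moreover have "?f y el K" "y \<notin> X --> ?f y = 0[K]" for y using insert.prems(1) by (auto simp: free_carrier)
  ultimately have fc: "?f el free_mod K X" unfolding free_carrier by blast
  have fS: "?f \<in> S" by (rule insert.IH[OF fc]) (use insert.prems(2) in auto)
  show ?case
  proof (cases "x \<in> X")
   case True
   have fx: "f x el K" using insert.prems(1) by (simp add: free_carrier)
   have "f = ?f +[free_mod K X] f x *[free_mod K X] free_gen K x"
    using insert.prems(1) by (auto simp: fun_eq_iff free_ops free_gen_def free_carrier K_ring)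
   moreover have "f x *[free_mod K X] free_gen K x \<in> S" using SD(4) fx g True by blast
   ultimately show ?thesis using fS SD(3) by metis
  next
   case False
   then have "?f = f" using insert.prems(1) by (auto simp: free_carrier)
   then show ?thesis using fS by simp
  qed
 qed
 then show ?thesis using f by (metis free_carrier order_refl)
qed

lemma free_smult:
 "vs W ==> e \<in> X \<rightarrow> carrier W ==> f el free_mod K X ==> x \<in> X ==>
  f x *[W] e x el W" by (simp add: free_carrier Pi_iff)

lemma free_supp: "f el free_mod K X ==> finite {p. f p \<noteq> 0[K]}"
  "f el free_mod K X ==> {p. f p \<noteq> 0[K]} \<subseteq> X" by (auto simp: free_carrier)

text \<open>The linear extension to a free module of a map on its basis.\<close>

definition fext :: "('k, 'w, 'y) module_scheme => ('b => 'w) => ('b => 'k) => 'w"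
 where "fext W e f = finsum W (%p. f p *[W] e p) {p. f p \<noteq> 0[K]}"

lemma fext_eq:
 assumes W: "vs W" and e: "e \<in> X \<rightarrow> carrier W" and f: "f el free_mod K X"
  and A: "finite A" "{p. f p \<noteq> 0[K]} \<subseteq> A" "A \<subseteq> X"
 shows "fext W e f = finsum W (%p. f p *[W] e p) A"
proof -
 interpret W: abelian_monoid W by (rule vs_monoid[OF W])
 show ?thesis unfolding fext_def by (rule W.add.finprod_mono_neutral_cong_left[folded finsum_def])
   (use A free_smult[OF W e f] funcset_mem[OF e] W in "auto simp: subset_iff")
qed

lemma fext_lin:
 assumes W: "vs W" and e: "e \<in> X \<rightarrow> carrier W"
 shows "lin (free_mod K X) W (fext W e)"
proof (rule linI)
 interpret W: abelian_monoid W by (rule vs_monoid[OF W])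
 fix f assume f: "f el free_mod K X"
 show "fext W e f el W" unfolding fext_def by (rule W.finsum_closed) (use free_smult[OF W e f] free_supp[OF f] in blast)
 {
  fix g assume g: "g el free_mod K X"
  let ?A = "{p. f p \<noteq> 0[K]} \<union> {p. g p \<noteq> 0[K]}"
  have fg: "f +[free_mod K X] g el free_mod K X" using f g by (simp add: free_vs)
  have A: "finite ?A" "?A \<subseteq> X" using f g by (auto simp: free_carrier)
  have "fext W e (f +[free_mod K X] g) = finsum W (%p. (f +[free_mod K X] g) p *[W] e p) ?A"
   by (rule fext_eq[OF W e fg]) (use A in "auto simp: free_ops K_ring")
  also have "... = finsum W (%p. f p *[W] e p +[W] g p *[W] e p) ?A"
  proof (rule W.finsum_cong')
   show "(%p. f p *[W] e p +[W] g p *[W] e p) \<in> ?A \<rightarrow> carrier W"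
    using free_smult[OF W e f] free_smult[OF W e g] A(2) W by (simp add: Pi_iff subset_iff)
   show "(f +[free_mod K X] g) p *[W] e p = f p *[W] e p +[W] g p *[W] e p" if "p \<in> ?A" for p
   proof -
    have "p \<in> X" using A(2) that by blast
    then show ?thesis using vs_smult(2)[OF W _ funcset_mem[OF e]] f g by (simp add: free_ops free_carrier)
   qed
  qed simp
  also have "... = finsum W (%p. f p *[W] e p) ?A +[W] finsum W (%p. g p *[W] e p) ?A"
   by (rule W.finsum_addf) (use A(2) free_smult[OF W e f] free_smult[OF W e g] in blast)+
  also have "... = fext W e f +[W] fext W e g" using fext_eq[OF W e f A(1)] fext_eq[OF W e g A(1)] A(2) by simp
  finally show "fext W e (f +[free_mod K X] g) = fext W e f +[W] fext W e g" .
 next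
  fix a assume a: "a el K"
  let ?A = "{p. f p \<noteq> 0[K]}"
  have af: "a *[free_mod K X] f el free_mod K X" using f a by (simp add: free_vs)
  have A: "finite ?A" "?A \<subseteq> X" using f by (auto simp: free_carrier)
  have "fext W e (a *[free_mod K X] f) = finsum W (%p. (a *[free_mod K X] f) p *[W] e p) ?A"
   by (rule fext_eq[OF W e af]) (use A a in "auto simp: free_ops K_ring")
  also have "... = finsum W (%p. a *[W] (f p *[W] e p)) ?A"
  proof (rule W.finsum_cong')
   show "(%p. a *[W] (f p *[W] e p)) \<in> ?A \<rightarrow> carrier W" using free_smult[OF W e f] A(2) W a by (simp add: Pi_iff subset_iff)
   show "(a *[free_mod K X] f) p *[W] e p = a *[W] (f p *[W] e p)" if "p \<in> ?A" for p
   proof -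
    have "p \<in> X" using A(2) that by blast
    then show ?thesis using vs_smult(3)[OF W a funcset_mem[OF e]] f by (simp add: free_ops free_carrier)
   qed
  qed simp
  also have "... = a *[W] fext W e f" unfolding fext_def by (rule module.finsum_smult_ldistr[OF W A(1) a, symmetric])
    (use A(2) free_smult[OF W e f] in blast)
  finally show "fext W e (a *[free_mod K X] f) = a *[W] fext W e f" .
 }
qed

lemma fext_gen:
 assumes W: "vs W" and e: "e \<in> X \<rightarrow> carrier W" and x: "x \<in> X"
 shows "fext W e (free_gen K x) = e x"
proof -
 interpret W: abelian_monoid W by (rule vs_monoid[OF W])
 have "fext W e (free_gen K x) = finsum W (%p. free_gen K x p *[W] e p) {x}"
  by (rule fext_eq[OF W e free_gen_in[OF x]]) (use x in "auto simp: free_gen_def")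
 also have "... = e x" using x funcset_mem[OF e x] W by (simp add: free_gen_def W.finsum_insert W.finsum_empty)
 finally show ?thesis .
qed

lemma span_sub:
 assumes "vs M" "B \<subseteq> carrier M"
 shows "submodule (submod_span K M B) K M"
proof (rule submodI[OF assms(1)])
 have c: "submodule (carrier M) K M" by (rule module.carrier_is_submodule) fact
 show "submod_span K M B \<subseteq> carrier M" using c assms(2) by (auto simp: submod_span_def)
 note D = submodD[OF assms(1)]
 show "0[M] \<in> submod_span K M B"
  "a \<in> submod_span K M B ==> b \<in> submod_span K M B ==> a +[M] b \<in> submod_span K M B"
  "c el K ==> a \<in> submod_span K M B ==> c *[M] a \<in> submod_span K M B" for a b c using D(2) D(3) D(4) by (simp_all add: submod_span_def)
qed

lemma span_least: "submodule N K M ==> B \<subseteq> N ==> submod_span K M B \<subseteq> N"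
 by (auto simp: submod_span_def)

lemma span_incl: "B \<subseteq> submod_span K M B"
 by (auto simp: submod_span_def)

end

definition balanced :: "(('m => 'm) \<times> ('n => 'n)) set => ('k, 'm, 'y) module_scheme
  => ('k, 'n, 'z) module_scheme => ('m => 'n => 'w) => bool"
 where "balanced bal M N b \<longleftrightarrow>
  (\<forall>\<rho> l. (\<rho>, l) \<in> bal --> (\<forall>m\<in>carrier M. \<forall>n\<in>carrier N. b (\<rho> m) n = b m (l n)))"

locale tensor_data = vec K for K :: "'k ring" +
 fixes bal :: "(('m => 'm) \<times> ('n => 'n)) set"
  and M :: "('k, 'm, 'y) module_scheme" and N :: "('k, 'n, 'z) module_scheme"
 assumes vsM [simp]: "module K M" and vsN [simp]: "module K N"
  and bal_M: "!!\<rho> l m. (\<rho>, l) \<in> bal ==> m el M ==> \<rho> m el M"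
  and bal_N: "!!\<rho> l n. (\<rho>, l) \<in> bal ==> n el N ==> l n el N"
begin

abbreviation "Fr \<equiv> free_mod K (carrier M \<times> carrier N)"
abbreviation "rel \<equiv> tensor_rels K bal M N"
abbreviation "sp \<equiv> submod_span K Fr rel"
abbreviation "ten \<equiv> tensor K bal M N"
abbreviation "pt \<equiv> pure_tensor K bal M N"

lemma gen_in: "m el M ==> n el N ==> free_gen K (m, n) el Fr"
 by (simp add: free_gen_in)

text \<open>Each kind of relation separately, so that a linear map is seen to kill all relations by five short computations.\<close>

lemma rel_cases:
 assumes f: "f \<in> rel"
  and "!!m m' n. m el M ==> m' el M ==> n el N ==>
   P (free_gen K (m +[M] m', n) -[Fr] (free_gen K (m, n) +[Fr] free_gen K (m', n)))"
  and "!!m n n'. m el M ==> n el N ==> n' el N ==>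
   P (free_gen K (m, n +[N] n') -[Fr] (free_gen K (m, n) +[Fr] free_gen K (m, n')))"
  and "!!a m n. a el K ==> m el M ==> n el N ==>
   P (free_gen K (a *[M] m, n) -[Fr] (a *[Fr] free_gen K (m, n)))"
  and "!!a m n. a el K ==> m el M ==> n el N ==>
   P (free_gen K (m, a *[N] n) -[Fr] (a *[Fr] free_gen K (m, n)))"
  and "!!\<rho> l m n. (\<rho>, l) \<in> bal ==> m el M ==> n el N ==> \<rho> m el M ==> l n el N ==>
   P (free_gen K (\<rho> m, n) -[Fr] free_gen K (m, l n))"
 shows "P f"
proof -
 consider "\<exists>m m' n. f = free_gen K (m +[M] m', n) -[Fr] (free_gen K (m, n) +[Fr] free_gen K (m', n)) \<and>
   m el M \<and> m' el M \<and> n el N"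
  | "\<exists>m n n'. f = free_gen K (m, n +[N] n') -[Fr] (free_gen K (m, n) +[Fr] free_gen K (m, n')) \<and>
   m el M \<and> n el N \<and> n' el N"
  | "\<exists>a m n. f = free_gen K (a *[M] m, n) -[Fr] (a *[Fr] free_gen K (m, n)) \<and>
   a el K \<and> m el M \<and> n el N"
  | "\<exists>a m n. f = free_gen K (m, a *[N] n) -[Fr] (a *[Fr] free_gen K (m, n)) \<and>
   a el K \<and> m el M \<and> n el N"
  | "\<exists>\<rho> l m n. f = free_gen K (\<rho> m, n) -[Fr] free_gen K (m, l n) \<and>
   (\<rho>, l) \<in> bal \<and> m el M \<and> n el N" using f unfolding tensor_rels_def Let_def Un_iff mem_Collect_eq by argo
 then show ?thesis
 proof cases
  case 1
  then show ?thesis using assms(2) by blast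
 next
  case 2
  then show ?thesis using assms(3) by blast
 next
  case 3
  then show ?thesis using assms(4) by blast
 next
  case 4
  then show ?thesis using assms(5) by blast
 next
  case 5
  then show ?thesis using assms(6) bal_M bal_N by blast
 qed
qed

lemma rel_sub: "rel \<subseteq> carrier Fr"
proof
 fix f assume "f \<in> rel"
 then show "f el Fr" by (rule rel_cases) (simp_all add: gen_in free_vs)
qed

lemma sp_sub: "submodule sp K Fr"
 by (rule span_sub[OF free_vs rel_sub])

lemma ten_vs [simp]: "module K ten"
 unfolding tensor_def by (rule quot_vs[OF free_vs sp_sub])

lemma proj_lin: "lin Fr ten (%f. sp +>[Fr] f)"
 unfolding tensor_def by (rule quot_lin[OF free_vs sp_sub])

lemma proj_eq:
 assumes "f el Fr" "g el Fr" "f -[Fr] g \<in> rel"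
 shows "sp +>[Fr] f = sp +>[Fr] g" using coset_eq[OF free_vs sp_sub assms(1,2)] subsetD[OF span_incl assms(3)] by (rule iffD2)

lemma pt_proj: "pt m n = sp +>[Fr] free_gen K (m, n)"
 by (simp add: pure_tensor_def)

lemma pt_bilin: "bilin M N ten pt"
proof (rule bilinI; rule linI)
 note g = gen_in
 note P = linD[OF proj_lin]
 note fv = free_vs[of "carrier M \<times> carrier N"]
 fix m assume m: "m el M"
 show "pt m n el ten" if "n el N" for n using that m g P(1) unfolding pt_proj by blast
 show "pt m (n +[N] n') = pt m n +[ten] pt m n'" if n: "n el N" "n' el N" for n n'
 proof -
  have "pt m (n +[N] n') = sp +>[Fr] (free_gen K (m, n) +[Fr] free_gen K (m, n'))" unfolding pt_proj
   by (rule proj_eq) (use m n g fv in simp_all, unfold tensor_rels_def Let_def, use m n in blast)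
  then show ?thesis using P(2) g m n by (simp add: pt_proj)
 qed
 show "pt m (a *[N] n) = a *[ten] pt m n" if n: "a el K" "n el N" for a n
 proof -
  have "pt m (a *[N] n) = sp +>[Fr] (a *[Fr] free_gen K (m, n))" unfolding pt_proj
   by (rule proj_eq) (use m n g fv in simp_all, unfold tensor_rels_def Let_def, use m n in blast)
  then show ?thesis using P(3) g m n by (simp add: pt_proj)
 qed
next
 note g = gen_in
 note P = linD[OF proj_lin]
 note fv = free_vs[of "carrier M \<times> carrier N"]
 fix n assume n: "n el N"
 show "pt m n el ten" if "m el M" for m using that n g P(1) unfolding pt_proj by blast
 show "pt (m +[M] m') n = pt m n +[ten] pt m' n" if m: "m el M" "m' el M" for m m'
 proof -
  have "pt (m +[M] m') n = sp +>[Fr] (free_gen K (m, n) +[Fr] free_gen K (m', n))" unfolding pt_proj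
   by (rule proj_eq) (use m n g fv in simp_all, unfold tensor_rels_def Let_def, use m n in blast)
  then show ?thesis using P(2) g m n by (simp add: pt_proj)
 qed
 show "pt (a *[M] m) n = a *[ten] pt m n" if m: "a el K" "m el M" for a m
 proof -
  have "pt (a *[M] m) n = sp +>[Fr] (a *[Fr] free_gen K (m, n))" unfolding pt_proj
   by (rule proj_eq) (use m n g fv in simp_all, unfold tensor_rels_def Let_def, use m n in blast)
  then show ?thesis using P(3) g m n by (simp add: pt_proj)
 qed
qed

lemma pt_balanced: "balanced bal M N pt"
 unfolding balanced_def
proof (intro allI impI ballI)
 fix \<rho> l m n assume a: "(\<rho>, l) \<in> bal" "m el M" "n el N"
 show "pt (\<rho> m) n = pt m (l n)" unfolding pt_proj
 proof (rule proj_eq)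
  show "free_gen K (\<rho> m, n) -[Fr] free_gen K (m, l n) \<in> rel" unfolding tensor_rels_def Let_def using a by blast
 qed (use a gen_in[OF bal_M[OF a(1,2)] a(3)] gen_in[OF a(2) bal_N[OF a(1,3)]] in simp_all)
qed

text \<open>The set of all \<open>f\<close> in the free module such that the image of every multiple of \<open>f\<close> satisfies \<open>P\<close> is
 a submodule containing the generators.\<close>

lemma ten_induct:
 assumes t: "t el ten" and z: "P 0[ten]"
  and add: "!!x y. x el ten ==> y el ten ==> P x ==> P y ==> P (x +[ten] y)"
  and p: "!!m n. m el M ==> n el N ==> P (pt m n)"
 shows "P t"
proof -
 let ?\<pi> = "%f. sp +>[Fr] f"
 let ?S = "{f \<in> carrier Fr. \<forall>a\<in>carrier K. P (?\<pi> (a *[Fr] f))}"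
 note P = linD[OF proj_lin] lin_zero[OF free_vs ten_vs proj_lin]
 note fv = free_vs[of "carrier M \<times> carrier N"]
 obtain f where f: "f el Fr" "t = ?\<pi> f" using t by (auto simp: tensor_def quot_carrier)
 have "submodule ?S K Fr"
 proof (rule submodI[OF free_vs])
  show "0[Fr] \<in> ?S" using fv P(4) z by simp
  fix f g assume fg: "f \<in> ?S" "g \<in> ?S"
  then have c: "f el Fr" "g el Fr" by auto
  have "P (?\<pi> (a *[Fr] (f +[Fr] g)))" if a: "a el K" for a
  proof -
   have "?\<pi> (a *[Fr] (f +[Fr] g)) = ?\<pi> (a *[Fr] f) +[ten] ?\<pi> (a *[Fr] g)" using a c fv P(2) by (simp add: vs_smult)
   then show ?thesis using add P(1) a c fg fv by simp
  qed
  then show "f +[Fr] g \<in> ?S" using c fv by simp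
 next
  fix b f assume b: "b el K" and f: "f \<in> ?S"
  have "P (?\<pi> (a *[Fr] (b *[Fr] f)))" if "a el K" for a
  proof -
   have "a *[Fr] (b *[Fr] f) = (a \<otimes>\<^bsub>K\<^esub> b) *[Fr] f" using that b f vs_smult(3)[OF fv that _ b, of f] by simp
   then show ?thesis using f that b by simp
  qed
  then show "b *[Fr] f \<in> ?S" using b f fv by simp
 qed auto
 moreover have "free_gen K x \<in> ?S" if xX: "x \<in> carrier M \<times> carrier N" for x
 proof -
  obtain m n where x: "x = (m, n)" "m el M" "n el N" using xX by auto
  have "P (?\<pi> (a *[Fr] free_gen K x))" if a: "a el K" for a
  proof -
   have "?\<pi> (a *[Fr] free_gen K x) = pt (a *[M] m) n" using linD(3)[OF bilinD(3)[OF pt_bilin x(3)] a x(2)] P(3)[OF a gen_in[OF x(2,3)]]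
    by (simp add: pt_proj x)
   then show ?thesis using p[of "a *[M] m" n] x a vsM by simp
  qed
  then show ?thesis using x gen_in by simp
 qed
 ultimately have "f \<in> ?S" using f(1) free_induct by blast
 then have "P (?\<pi> (\<one>\<^bsub>K\<^esub> *[Fr] f))" by simp
 then show ?thesis using f fv by simp
qed

lemma tensor_lift:
 assumes W: "vs W" and b: "bilin M N W b" "balanced bal M N b"
 shows "lin ten W (tensor_lift K W b)"
  and "m el M ==> n el N ==> tensor_lift K W b (pt m n) = b m n"
proof -
 let ?e = "case_prod b" let ?\<phi> = "fext W ?e"
 note fv = free_vs[of "carrier M \<times> carrier N"]
 have e: "?e \<in> carrier M \<times> carrier N \<rightarrow> carrier W" using bilinD(4)[OF b(1)] by auto
 have \<phi>: "lin Fr W ?\<phi>" by (rule fext_lin[OF W e])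
 note \<phi>D = linD[OF \<phi>] lin_minus[OF fv W \<phi>]
 have \<phi>g: "?\<phi> (free_gen K (m, n)) = b m n" if "m el M" "n el N" for m n using fext_gen[OF W e, of "(m, n)"] that by simp
 have k: "submodule {f \<in> carrier Fr. ?\<phi> f = 0[W]} K Fr" by (rule submod_ker[OF fv W \<phi>])
 note bD = linD[OF bilinD(1)[OF b(1)]] linD[OF bilinD(3)[OF b(1)]]
 note B = bilinD(4)[OF b(1)]
 have bb: "(\<rho>, l) \<in> bal ==> m el M ==> n el N ==> b (\<rho> m) n = b m (l n)" for \<rho> l m n using b(2) by (auto simp: balanced_def)
 have r: "?\<phi> f = 0[W]" if "f \<in> rel" for f using that by (rule rel_cases) (simp_all add: \<phi>D \<phi>g gen_in fv W B bD bb)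
 have sp0: "?\<phi> f = 0[W]" if "f \<in> sp" for f using span_least[OF k, of rel] r rel_sub that by blast
 have lift: "tensor_lift K W b (sp +>[Fr] f) = ?\<phi> f" if f: "f el Fr" for f
 proof -
  define g where "g = (SOME g. g \<in> sp +>[Fr] f)"
  have "f \<in> sp +>[Fr] f" using coset_mem[OF fv sp_sub f] f by simp
  then have "g \<in> sp +>[Fr] f" unfolding g_def by (rule someI[of "%g. g \<in> sp +>[Fr] f"])
  then have g: "g el Fr" "g -[Fr] f \<in> sp" using coset_mem[OF fv sp_sub f] coset_eq[OF fv sp_sub _ f] by auto
  have "?\<phi> g -[W] ?\<phi> f = 0[W]" using sp0[OF g(2)] \<phi>D(4) g f by simp
  then have "?\<phi> g = ?\<phi> f" using vs_minus_eq W \<phi>D(1) g f by metis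
  moreover have "tensor_lift K W b (sp +>[Fr] f) = ?\<phi> g" unfolding tensor_lift_def Let_def g_def[symmetric] fext_def
   by (rule arg_cong[where f = "%h. finsum W h _"]) auto
  ultimately show ?thesis by simp
 qed
 have "ten_carrier": "\<exists>f\<in>carrier Fr. t = sp +>[Fr] f" if "t el ten" for t using that by (auto simp: tensor_def quot_carrier)
 note P = linD[OF proj_lin]
 show "lin ten W (tensor_lift K W b)"
 proof (rule linI)
  fix x assume "x el ten"
  then obtain f where f: "f el Fr" "x = sp +>[Fr] f" using ten_carrier by blast
  show "tensor_lift K W b x el W" using f lift \<phi>D(1) by simp
  show "tensor_lift K W b (x +[ten] y) = tensor_lift K W b x +[W] tensor_lift K W b y"
   if y: "y el ten" for y
  proof -
   obtain g where g: "g el Fr" "y = sp +>[Fr] g" using ten_carrier y by blast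
   have "x +[ten] y = sp +>[Fr] (f +[Fr] g)" using P(2) f g by simp
   then show ?thesis using lift f g fv \<phi>D(2) by simp
  qed
  show "tensor_lift K W b (a *[ten] x) = a *[W] tensor_lift K W b x" if "a el K" for a
  proof -
   have "a *[ten] x = sp +>[Fr] (a *[Fr] f)" using P(3) f that by simp
   then show ?thesis using lift f fv \<phi>D(3) that by simp
  qed
 qed
 show "tensor_lift K W b (pt m n) = b m n" if "m el M" "n el N" using lift[OF gen_in[OF that]] \<phi>g[OF that] by (simp add: pt_proj)
qed

lemma ten_list:
 assumes "t el ten"
 shows "\<exists>xs. set xs \<subseteq> carrier M \<times> carrier N \<and> t = lsum ten (%(m, n). pt m n) xs" using assms
proof (rule ten_induct)
 fix x y assume "x el ten" "y el ten"
  and "\<exists>xs. set xs \<subseteq> carrier M \<times> carrier N \<and> x = lsum ten (%(m, n). pt m n) xs"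
  and "\<exists>xs. set xs \<subseteq> carrier M \<times> carrier N \<and> y = lsum ten (%(m, n). pt m n) xs"
 then obtain xs ys where x: "set xs \<subseteq> carrier M \<times> carrier N" "x = lsum ten (%(m, n). pt m n) xs"
  and y: "set ys \<subseteq> carrier M \<times> carrier N" "y = lsum ten (%(m, n). pt m n) ys" by blast
 have "lsum ten (%(m, n). pt m n) (xs @ ys) = x +[ten] y" unfolding x(2) y(2) by (rule lsum_append) (use x y bilinD(4)[OF pt_bilin] in auto)
 then show "\<exists>zs. set zs \<subseteq> carrier M \<times> carrier N \<and> x +[ten] y = lsum ten (%(m, n). pt m n) zs"
  using x y by (intro exI[of _ "xs @ ys"]) auto
next
 show "\<exists>xs. set xs \<subseteq> carrier M \<times> carrier N \<and> 0[ten] = lsum ten (%(m, n). pt m n) xs" by (rule exI[of _ "[]"]) simp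
next
 fix m n assume "m el M" "n el N"
 then show "\<exists>xs. set xs \<subseteq> carrier M \<times> carrier N \<and> pt m n = lsum ten (%(m, n). pt m n) xs"
  using bilinD(4)[OF pt_bilin] by (intro exI[of _ "[(m, n)]"]) simp
qed

end

text \<open>\<open>Q\<close> is a tensor product up to isomorphism. The chosen codes in the universe and the chosen coequalizers are both of this
 kind, so their universal properties are proved once.\<close>

locale tensor_by = tensor_data K bal M N
 for K :: "'k ring" and bal :: "(('m => 'm) \<times> ('n => 'n)) set"
  and M :: "('k, 'm, 'y) module_scheme" and N :: "('k, 'n, 'z) module_scheme" +
 fixes Q :: "('k, 'q, 'x) module_scheme" and p :: "'m => 'n => 'q"
 assumes vsQ [simp]: "module K Q"
  and iso: "\<exists>\<phi>\<in>lin_hom K ten Q. bij_betw \<phi> (carrier ten) (carrier Q) \<and>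
   (\<forall>m\<in>carrier M. \<forall>n\<in>carrier N. \<phi> (pt m n) = p m n)"
begin

definition "iso_ten = (SOME \<phi>. \<phi> \<in> lin_hom K ten Q \<and> bij_betw \<phi> (carrier ten) (carrier Q) \<and>
   (\<forall>m\<in>carrier M. \<forall>n\<in>carrier N. \<phi> (pt m n) = p m n))"

lemma iso_ten: "lin ten Q iso_ten" "bij_betw iso_ten (carrier ten) (carrier Q)"
 "m el M ==> n el N ==> iso_ten (pt m n) = p m n" using someI_ex[OF iso[unfolded Bex_def]] unfolding iso_ten_def by blast+

lemma p_bilin: "bilin M N Q p"
proof -
 have *: "bilin M N Q (%m n. iso_ten (pt m n))" by (rule lin_bilin[OF pt_bilin iso_ten(1)])
 show ?thesis
 proof (rule bilinI)
  fix m assume m: "m el M"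
  show "lin N Q (%n. p m n)" using bilinD(1)[OF * m] lin_cong[of N "%n. iso_ten (pt m n)" "p m" Q] iso_ten(3) m by simp
 next
  fix n assume n: "n el N"
  show "lin M Q (%m. p m n)" using bilinD(3)[OF * n] lin_cong[of M "%m. iso_ten (pt m n)" "%m. p m n" Q] iso_ten(3) n by simp
 qed
qed


lemma p_bal: "(\<rho>, l) \<in> bal ==> m el M ==> n el N ==> p (\<rho> m) n = p m (l n)"
 using pt_balanced iso_ten(3) bal_M bal_N unfolding balanced_def by metis

lemma induct:
 assumes t: "t el Q" and z: "P 0[Q]"
  and add: "!!x y. x el Q ==> y el Q ==> P x ==> P y ==> P (x +[Q] y)"
  and p: "!!m n. m el M ==> n el N ==> P (p m n)"
 shows "P t"
proof -
 obtain s where s: "s el ten" "t = iso_ten s" using t iso_ten(2) by (metis bij_betw_imp_surj_on imageE)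
 note I = linD[OF iso_ten(1)] lin_zero[OF ten_vs vsQ iso_ten(1)]
 have "P (iso_ten s)" by (rule ten_induct[OF s(1), of "%s. P (iso_ten s)"]) (simp_all add: I iso_ten(3) z add p)
 then show ?thesis using s by simp
qed

lemma ext:
 assumes W: "vs W" and f: "lin Q W f" "lin Q W g"
  and p: "!!m n. m el M ==> n el N ==> f (p m n) = g (p m n)"
  and t: "t el Q"
 shows "f t = g t" using t by (rule induct)
  (simp_all add: linD[OF f(1)] linD[OF f(2)] lin_zero[OF vsQ W f(1)] lin_zero[OF vsQ W f(2)] p)

lemma lift:
 assumes W: "vs W" and b: "bilin M N W b" "balanced bal M N b"
 obtains f where "lin Q W f" "!!m n. m el M ==> n el N ==> f (p m n) = b m n"
proof
 let ?g = "inv_into (carrier ten) iso_ten"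
 have "lin Q ten ?g" by (rule lin_inv[OF iso_ten(1,2)]) simp
 then show "lin Q W (%x. tensor_lift K W b (?g x))" by (rule lin_comp[OF _ tensor_lift(1)[OF W b]])
 fix m n assume "m el M" "n el N"
 then show "tensor_lift K W b (?g (p m n)) = b m n" using tensor_lift(2)[OF W b] iso_ten bilinD(4)[OF pt_bilin] by (metis bij_betw_inv_into_left)
qed

end

context tensor_data
begin

lemma tensor_byI:
 assumes "vs Q" "lin ten Q \<phi>" "bij_betw \<phi> (carrier ten) (carrier Q)"
  "!!m n. m el M ==> n el N ==> \<phi> (pt m n) = p m n"
 shows "tensor_by K bal M N Q p" using assms by (intro tensor_by.intro tensor_data_axioms tensor_by_axioms.intro bexI[of _ \<phi>]) auto

lemma tensor_by_ten: "tensor_by K bal M N ten pt"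
 by (rule tensor_byI[OF ten_vs lin_id]) (auto simp: bij_betw_def)

text \<open>A tensor is determined by a list of pairs, and an infinite universe contains a code for every list of its own elements.\<close>

lemma ten_inj:
 assumes inf: "infinite (UNIV :: 'u set)"
  and M: "\<exists>f :: 'm => 'u. inj_on f (carrier M)" and N: "\<exists>f :: 'n => 'u. inj_on f (carrier N)"
 shows "\<exists>f :: ('m \<times> 'n => 'k) set => 'u. inj_on f (carrier ten)"
proof -
 obtain fm :: "'m => 'u" and fn :: "'n => 'u"
  where f: "inj_on fm (carrier M)" "inj_on fn (carrier N)" using M N by blast
 obtain pr :: "'u \<times> 'u => 'u" where pr: "inj pr"
  using iffD2[OF card_of_ordLeq ordIso_imp_ordLeq[OF card_of_Times_same_infinite[OF inf]]] by auto
 obtain nt :: "nat => 'u" where nt: "inj nt" using inf infinite_countable_subset by blast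
 define enc where "enc xs = foldr (%x y. pr (x, y)) xs undefined" for xs
 have enc: "xs = ys" if "length xs = length ys" "enc xs = enc ys" for xs ys
  using that by (induction rule: list_induct2) (auto simp: enc_def dest: injD[OF pr])
 define le where "le xs = pr (nt (length xs), enc xs)" for xs
 have le: "xs = ys" if l: "le xs = le ys" for xs ys
 proof -
  have "(nt (length xs), enc xs) = (nt (length ys), enc ys)" using l unfolding le_def by (rule injD[OF pr])
  then show ?thesis using enc injD[OF nt] by blast
 qed
 define rep where "rep t = (SOME xs. set xs \<subseteq> carrier M \<times> carrier N \<and> t = lsum ten (%(m, n). pt m n) xs)" for t
 have rep: "set (rep t) \<subseteq> carrier M \<times> carrier N" "t = lsum ten (%(m, n). pt m n) (rep t)"
  if "t el ten" for t using someI_ex[OF ten_list[OF that]] unfolding rep_def by blast+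
 let ?g = "%(m, n). pr (fm m, fn n)"
 have g: "inj_on ?g (carrier M \<times> carrier N)"
 proof (rule inj_onI)
  fix x y assume x: "x \<in> carrier M \<times> carrier N" "y \<in> carrier M \<times> carrier N" "?g x = ?g y"
  then have "pr (fm (fst x), fn (snd x)) = pr (fm (fst y), fn (snd y))" by (simp add: case_prod_beta)
  then have "(fm (fst x), fn (snd x)) = (fm (fst y), fn (snd y))" by (rule injD[OF pr])
  then show "x = y" using inj_onD[OF f(1)] inj_onD[OF f(2)] x(1,2) by (auto simp: prod_eq_iff)
 qed
 have "inj_on (%t. le (map ?g (rep t))) (carrier ten)"
 proof (rule inj_onI)
  fix s t assume st: "s el ten" "t el ten" "le (map ?g (rep s)) = le (map ?g (rep t))"
  then have "map ?g (rep s) = map ?g (rep t)" using le by blast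
  then have "rep s = rep t" by (rule map_inj_on) (use rep(1)[OF st(1)] rep(1)[OF st(2)] inj_on_subset[OF g] in blast)
  then show "s = t" using rep(2)[OF st(1)] rep(2)[OF st(2)] by simp
 qed
 then show ?thesis by blast
qed

end

context vec
begin

text \<open>A submodule that is maximal among those meeting the kernel trivially (Zorn) is mapped bijectively onto the target; the section is the
 inverse.\<close>

lemma lin_section:
 assumes Y: "vs Y" and Z: "vs Z" and g: "lin Y Z g" and surj: "g ` carrier Y = carrier Z"
 obtains s where "lin Z Y s" "!!z. z el Z ==> g (s z) = z"
proof -
 let ?A = "{C. submodule C K Y \<and> (\<forall>y\<in>C. g y = 0[Z] --> y = 0[Y])}"
 note gD = linD[OF g] lin_zero[OF Y Z g] lin_minus[OF Y Z g]
 have ne: "{0[Y]} \<in> ?A" using Y by (auto intro!: submodI)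
 have "\<exists>C\<in>?A. \<forall>X\<in>?A. C \<subseteq> X --> X = C"
 proof (rule subset_Zorn_nonempty)
  fix \<C> assume C: "\<C> \<noteq> {}" "subset.chain ?A \<C>"
  then have sub: "!!C. C \<in> \<C> ==> submodule C K Y" "!!C y. C \<in> \<C> ==> y \<in> C ==> g y = 0[Z] ==> y = 0[Y]"
   by (auto simp: subset.chain_def)
  have "submodule (\<Union>\<C>) K Y"
  proof (rule submodI[OF Y])
   show "\<Union>\<C> \<subseteq> carrier Y" using sub(1) submodD(1)[OF Y] by blast
   show "0[Y] \<in> \<Union>\<C>" using sub(1) submodD(2)[OF Y] C(1) by blast
   show "c *[Y] a \<in> \<Union>\<C>" if "c el K" "a \<in> \<Union>\<C>" for c a using that sub(1) submodD(4)[OF Y] by blast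
   fix a b assume "a \<in> \<Union>\<C>" "b \<in> \<Union>\<C>"
   then obtain C1 C2 where C12: "C1 \<in> \<C>" "a \<in> C1" "C2 \<in> \<C>" "b \<in> C2" by blast
   then have "C1 \<subseteq> C2 \<or> C2 \<subseteq> C1" using C(2) unfolding subset.chain_def by blast
   then show "a +[Y] b \<in> \<Union>\<C>" using C12 submodD(3)[OF Y sub(1)[OF C12(1)]] submodD(3)[OF Y sub(1)[OF C12(3)]] by blast
  qed
  moreover have "\<forall>y\<in>\<Union>\<C>. g y = 0[Z] --> y = 0[Y]" using sub(2) by (meson UnionE)
  ultimately show "\<Union>\<C> \<in> ?A" by (intro CollectI conjI)
 qed (use ne in blast)
 then obtain C where CA: "C \<in> ?A" "\<forall>X\<in>?A. C \<subseteq> X --> X = C" by (rule bexE)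
 then have C: "submodule C K Y" "!!y. y \<in> C ==> g y = 0[Z] ==> y = 0[Y]" by simp_all
 have max: "X = C" if "submodule X K Y" "\<forall>y\<in>X. g y = 0[Z] --> y = 0[Y]" "C \<subseteq> X" for X using bspec[OF CA(2), of X] that by simp
 note CD = submodD[OF Y C(1)]
 have Csub: "x \<in> C ==> x el Y" for x using CD(1) by blast
 have im: "g ` C = carrier Z"
 proof (rule ccontr)
  assume ne: "g ` C \<noteq> carrier Z"
  have "g ` C \<subseteq> carrier Z" using image_mono[OF CD(1), of g] surj by simp
  then obtain z where z: "z el Z" "z \<notin> g ` C" using ne by (meson subsetI subset_antisym)
  then have "z \<in> g ` carrier Y" using surj by simp
  then obtain y where "z = g y" "y el Y" by (rule imageE)
  then have y: "y el Y" "g y \<notin> g ` C" using z by simp_all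
  let ?X = "{c +[Y] a *[Y] y | c a. c \<in> C \<and> a el K}"
  have X1: "submodule ?X K Y"
  proof (rule submodI[OF Y])
   show "?X \<subseteq> carrier Y" using Y y CD(1) by auto
   show "0[Y] \<in> ?X" using Y y CD(2) by (intro CollectI exI[of _ "0[Y]"] exI[of _ "0[K]"]) simp
   fix u v assume "u \<in> ?X" "v \<in> ?X"
   then obtain c a d b where uv: "u = c +[Y] a *[Y] y" "c \<in> C" "a el K"
    "v = d +[Y] b *[Y] y" "d \<in> C" "b el K" by blast
   have "u +[Y] v = (c +[Y] d) +[Y] (a +[K] b) *[Y] y" unfolding uv(1,4) using Y uv(2,3,5,6) y(1) Csub by (simp add: vs_smult vs_ac)
   moreover have "c +[Y] d \<in> C" "a +[K] b el K" using uv CD(3) by simp_all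
   ultimately show "u +[Y] v \<in> ?X" by blast
  next
   fix b u assume b: "b el K" and "u \<in> ?X"
   then obtain c a where u: "u = c +[Y] a *[Y] y" "c \<in> C" "a el K" by blast
   have "b *[Y] u = b *[Y] c +[Y] (b \<otimes>\<^bsub>K\<^esub> a) *[Y] y" unfolding u(1) using Y u(2,3) b y(1) Csub by (simp add: vs_smult)
   moreover have "b *[Y] c \<in> C" "b \<otimes>\<^bsub>K\<^esub> a el K" using u CD(4) b by simp_all
   ultimately show "b *[Y] u \<in> ?X" by blast
  qed
  have X2: "u = 0[Y]" if u: "u \<in> ?X" "g u = 0[Z]" for u
  proof -
   obtain c a where ca: "u = c +[Y] a *[Y] y" "c \<in> C" "a el K" using u by blast
   have "a = 0[K]"
   proof (rule ccontr)
    assume "a \<noteq> 0[K]"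
    then have "a \<in> Units K" using ca(3) field.field_Units[OF field_K] by simp
    then obtain b where b: "b el K" "b \<otimes>\<^bsub>K\<^esub> a = 1[K]" unfolding Units_def by blast
    have "b *[Y] u = b *[Y] c +[Y] (b \<otimes>\<^bsub>K\<^esub> a) *[Y] y" unfolding ca(1) using Y ca(2,3) b(1) y(1) Csub by (simp add: vs_smult)
    then have "b *[Y] u = b *[Y] c +[Y] y" using b(2) y(1) Y by simp
    moreover have "u el Y" using ca Csub y Y by simp
    ultimately have "b *[Z] g u = g (b *[Y] c) +[Z] g y" using gD(3)[OF b(1), of u] gD(2)[of "b *[Y] c" y] b ca(2) y(1) Csub Y by simp
    then have s0: "g y +[Z] g (b *[Y] c) = 0[Z]" using u(2) b(1) Z gD(1) y(1) ca(2) Csub Y vs_comm[OF Z, of "g y" "g (b *[Y] c)"] by simp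
    have "g y = -[Z] g (b *[Y] c)" using abelian_group.minus_equality[OF vs_group[OF Z] s0] gD(1) b ca(2) y(1) Csub Y by simp
    also have "... = g (\<ominus>\<^bsub>Y\<^esub> (b *[Y] c))" using lin_neg[OF Y Z g] b ca Csub Y by simp
    finally show False using y(2) CD(4,5) b(1) ca(2) by blast
   qed
   then have "u = c" using ca Csub Y y by simp
   then show ?thesis using C(2) ca(2) u(2) by simp
  qed
  have "C \<subseteq> ?X"
  proof
   fix c assume "c \<in> C"
   then show "c \<in> ?X" using Y y Csub by (intro CollectI exI[of _ c] exI[of _ "0[K]"]) simp
  qed
  then have "?X = C" using max[OF X1] X2 by blast
  moreover have "y \<in> ?X" using Y y CD(2) by (intro CollectI exI[of _ "0[Y]"] exI[of _ "1[K]"]) simp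
  ultimately show False using y(2) by blast
 qed
 have inj: "inj_on g C"
 proof (rule inj_onI)
  fix x y assume xy: "x \<in> C" "y \<in> C" "g x = g y"
  then have "g (x -[Y] y) = 0[Z]" using gD(1,5) Csub Z by simp
  then show "x = y" using C(2) CD(6) xy vs_minus_eq[OF Y] Csub by metis
 qed
 let ?C = "Y\<lparr>carrier := C\<rparr>"
 have gC: "lin ?C Z g" by (rule linI) (use gD Csub in auto)
 have bij: "bij_betw g (carrier ?C) (carrier Z)" using inj im by (simp add: bij_betw_def)
 have s: "lin Z ?C (inv_into (carrier ?C) g)" by (rule lin_inv(1)[OF gC bij submod_vs[OF Y C(1)]])
 show ?thesis
 proof
  show "lin Z Y (inv_into C g)" by (rule linI) (use linD[OF s] Csub in auto)
  show "g (inv_into C g z) = z" if "z el Z" for z using that im by (simp add: f_inv_into_f)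
 qed
qed

lemma vs_transport:
 assumes M: "vs M" and e: "bij_betw e (carrier M) (carrier N)"
  and add: "!!x y. x el M ==> y el M ==> e x +[N] e y = e (x +[M] y)"
  and zero: "0[N] = e 0[M]"
  and smult: "!!a x. a el K ==> x el M ==> a *[N] e x = e (a *[M] x)"
 shows "vs N"
proof -
 have im: "carrier N = e ` carrier M" using e by (simp add: bij_betw_def)
 show ?thesis
 proof (rule moduleI[OF cring_K])
  show "abelian_group N"
  proof (rule abelian_groupI)
   fix x assume "x el N"
   then obtain m where m: "m el M" "x = e m" using im by blast
   then show "\<exists>y\<in>carrier N. y +[N] x = 0[N]" using M by (intro bexI[of _ "e (\<ominus>\<^bsub>M\<^esub> m)"]) (simp_all add: add zero im)
   show "0[N] +[N] x = x" using m M add[of "0[M]" m] by (simp add: zero)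
   fix y assume "y el N"
   then obtain n where n: "n el M" "y = e n" using im by blast
   show "x +[N] y el N" using m n M by (simp add: add im)
   show "x +[N] y = y +[N] x" using m n M by (simp add: add vs_comm[OF M])
   fix z assume "z el N"
   then obtain l where l: "l el M" "z = e l" using im by blast
   show "x +[N] y +[N] z = x +[N] (y +[N] z)" using m n l M by (simp add: add vs_assoc[OF M])
  qed (use M im zero in auto)
 qed (use M in "auto simp: im add smult vs_smult[OF M]")
qed

text \<open>Transport of structure along the chosen code, which is injective as soon as some injection into the universe exists.\<close>

lemma code_mod:
 fixes M :: "('k, 'b, 'x) module_scheme" and \<alpha> :: "'h => 'b => 'b"
 assumes M: "vs M" and ex: "\<exists>f :: 'b => 'u. inj_on f (carrier M)"
 defines "e \<equiv> code_in (carrier M) :: 'b => 'u" and "C \<equiv> code_mod M \<alpha> :: ('k, 'h, 'u) hmod"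
 shows code_mod_vs: "vs C" and code_mod_lin: "lin M C e"
  and code_mod_bij: "bij_betw e (carrier M) (carrier C)"
  and code_mod_act: "x el M ==> act C h (e x) = e (\<alpha> h x)"
proof -
 have inj: "inj_on e (carrier M)" unfolding e_def code_in_def by (rule someI_ex[OF ex])
 have i: "x el M ==> inv_into (carrier M) e (e x) = x" for x using inj by simp
 have C: "carrier C = e ` carrier M" "0[C] = e 0[M]"
  "x el M ==> y el M ==> e x +[C] e y = e (x +[M] y)"
  "x el M ==> a *[C] e x = e (a *[M] x)"
  "x el M ==> act C h (e x) = e (\<alpha> h x)" for x y a h by (simp_all add: C_def code_mod_def Let_def i flip: e_def)
 show bij: "bij_betw e (carrier M) (carrier C)" using inj C(1) by (simp add: bij_betw_def)
 show "vs C" by (rule vs_transport[OF M bij]) (simp_all add: C)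
 show "lin M C e" by (rule linI) (simp_all add: C)
 show "x el M ==> act C h (e x) = e (\<alpha> h x)" by (rule C(5))
qed

text \<open>A coset is coded by one of its elements.\<close>

lemma quot_inj:
 assumes "\<exists>f :: 'm => 'u. inj_on f (carrier M)" "vs M" "submodule N K M"
 shows "\<exists>f :: 'm set => 'u. inj_on f (carrier (quot_mod M N))"
proof -
 obtain f :: "'m => 'u" where f: "inj_on f (carrier M)" using assms by blast
 define r where "r q = (SOME x. x el M \<and> q = N +>[M] x)" for q
 have r: "r q el M" "q = N +>[M] r q" if "q el quot_mod M N" for q
 proof -
  have "\<exists>x. x el M \<and> q = N +>[M] x" using that by (auto simp: quot_carrier)
  then have "r q el M \<and> q = N +>[M] r q" unfolding r_def by (rule someI_ex)
  then show "r q el M" "q = N +>[M] r q" by auto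
 qed
 have "inj_on (%q. f (r q)) (carrier (quot_mod M N))"
 proof (rule inj_onI)
  fix p q assume pq: "p el quot_mod M N" "q el quot_mod M N" "f (r p) = f (r q)"
  have rr: "r p = r q" by (rule inj_onD[OF f pq(3) r(1)[OF pq(1)] r(1)[OF pq(2)]])
  have "p = N +>[M] r p" by (rule r(2)[OF pq(1)])
  also have "... = N +>[M] r q" by (simp only: rr)
  also have "... = q" by (rule r(2)[OF pq(2), symmetric])
  finally show "p = q" .
 qed
 then show ?thesis by blast
qed

end

section \<open>Sweedler calculus in a weak Hopf algebra\<close>

context tensor_by
begin

text \<open>A family of balanced maps that is linear in a parameter lifts to a family with the same dependence, by uniqueness of each lift.\<close>

lemma param_lift:
 assumes W: "vs W" and b: "!!u. u el U ==> bilin M N W (t u)"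
  "!!u. u el U ==> balanced bal M N (t u)"
  and U: "vs U" and l: "!!m n. m el M ==> n el N ==> lin U W (%u. t u m n)"
 obtains g where "bilin U Q W g"
  "!!u m n. u el U ==> m el M ==> n el N ==> g u (p m n) = t u m n"
proof -
 define P where "P u f \<longleftrightarrow> lin Q W f \<and> (\<forall>m\<in>carrier M. \<forall>n\<in>carrier N. f (p m n) = t u m n)" for u f
 have ex: "\<exists>f. P u f" if u: "u el U" for u using lift[OF W b(1)[OF u] b(2)[OF u]] unfolding P_def by metis
 define g where "g u = (SOME f. P u f)" for u
 have "P u (g u)" if u: "u el U" for u using someI_ex[OF ex[OF u]] unfolding g_def .
 then have g: "!!u. u el U ==> lin Q W (g u)"
  "!!u m n. u el U ==> m el M ==> n el N ==> g u (p m n) = t u m n" by (simp_all add: P_def)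
 have "lin U W (%u. g u x)" if x: "x el Q" for x using x
 proof (rule induct)
  have "lin U W (%u. g u 0[Q]) = lin U W (%u. 0[W])" by (rule lin_cong[OF _ U]) (simp add: lin_zero[OF vsQ W g(1)])
  then show "lin U W (%u. g u 0[Q])" using lin_zero_map[OF W] by blast
 next
  fix x y assume xy: "x el Q" "y el Q" "lin U W (%u. g u x)" "lin U W (%u. g u y)"
  have "lin U W (%u. g u (x +[Q] y)) = lin U W (%u. g u x +[W] g u y)" by (rule lin_cong[OF _ U]) (simp add: linD(2)[OF g(1)] xy)
  then show "lin U W (%u. g u (x +[Q] y))" using lin_add_map[OF W xy(3,4)] by blast
 next
  fix m n assume mn: "m el M" "n el N"
  have "lin U W (%u. g u (p m n)) = lin U W (%u. t u m n)" by (rule lin_cong[OF _ U]) (simp add: g(2) mn)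
  then show "lin U W (%u. g u (p m n))" using l[OF mn] by blast
 qed
 then have "bilin U Q W g" using g(1) by (simp add: bilin_def)
 then show ?thesis using g(2) that by blast
qed

end

context vec
begin

lemma tensor_dataI:
 "vs M ==> vs N ==> (!!\<rho> l m. (\<rho>, l) \<in> bal ==> m el M ==> \<rho> m el M) ==>
 (!!\<rho> l n. (\<rho>, l) \<in> bal ==> n el N ==> l n el N) ==> tensor_data K bal M N"
 by (intro tensor_data.intro vec_axioms tensor_data_axioms.intro) auto

end

sublocale weak_hopf_algebra \<subseteq> vec K
 by (rule vec.intro) (rule field_K)

context weak_hopf_algebra
begin

lemma vsH [simp]: "module K H" by (rule module_H)

lemma H_simps [simp]:
 "1[H] el H" "x el H ==> y el H ==> x ** y el H"
 "x el H ==> 1[H] ** x = x" "x el H ==> x ** 1[H] = x"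
 using ring_H by (auto simp: ring.ring_simprules intro: monoid.intro monoid.m_closed monoid.one_closed
   monoid.l_one monoid.r_one dest: ring.axioms)

lemma H_assoc:
 "x el H ==> y el H ==> z el H ==> x ** y ** z = x ** (y ** z)" using ring_H ring.ring_simprules(11) by metis

abbreviation "KK \<equiv> ring_as_module K"

lemma KK: "carrier KK = carrier K" "add KK = add K" "smult KK = mult K" "zero KK = zero K"
 by (simp_all add: ring_as_module_def)

lemma vsKK [simp]: "module K KK"
proof (rule moduleI[OF cring_K])
 note R = cring.cring_simprules[OF cring_K]
 show "abelian_group KK"
 proof (rule abelian_groupI)
  fix x assume "x el KK"
  then show "\<exists>y\<in>carrier KK. y +[KK] x = 0[KK]" by (intro bexI[of _ "-[K] x"]) (auto simp: KK R)
 qed (auto simp: KK R)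
qed (auto simp: KK cring.cring_simprules[OF cring_K] K_ring)

abbreviation \<epsilon> where "\<epsilon> \<equiv> counit H"
abbreviation anti where "anti \<equiv> antipode H"
abbreviation \<epsilon>t where "\<epsilon>t \<equiv> eps_t K H"
abbreviation \<epsilon>s where "\<epsilon>s \<equiv> eps_s K H"
abbreviation br where "br \<equiv> base_right K H"
abbreviation "H2 \<equiv> tensor K ({} :: (('h => 'h) \<times> ('h => 'h)) set) H H"
abbreviation "ptH \<equiv> pure_tensor K ({} :: (('h => 'h) \<times> ('h => 'h)) set) H H"

lemma tdH: "tensor_data K ({} :: (('h => 'h) \<times> ('h => 'h)) set) H H"
 by (rule tensor_dataI) auto

lemmas vsH2 [simp] = tensor_data.ten_vs[OF tdH]
lemmas ptH_bilin = tensor_data.pt_bilin[OF tdH]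

lemma bal_empty: "balanced {} M N b"
 by (simp add: balanced_def)

text \<open>A fixed way of writing \<open>\<Delta>(h)\<close> as a sum of pure tensors.\<close>

definition cop :: "'h => ('h \<times> 'h) list"
 where "cop h = (SOME xs. set xs \<subseteq> carrier H \<times> carrier H \<and> comul H h = lsum H2 (%(m, n). ptH m n) xs)"

lemma cop:
 assumes "h el H"
 shows "set (cop h) \<subseteq> carrier H \<times> carrier H" "comul H h = lsum H2 (%(m, n). ptH m n) (cop h)"
 using someI_ex[OF tensor_data.ten_list[OF tdH linD(1)[OF comul_linear assms]]] unfolding cop_def by blast+

text \<open>The sum over Sweedler components; unlike the tensor lift it makes sense before bilinearity of \<open>b\<close> is known, and it agrees
 with it for bilinear \<open>b\<close> (\<open>sweedler_SW\<close>).\<close>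

definition SW :: "('k, 'w, 'x) module_scheme => ('h => 'h => 'w) => 'h => 'w"
 where "SW W b h = lsum W (%(u, v). b u v) (cop h)"

lemma copD: "h el H ==> p \<in> set (cop h) ==> fst p el H \<and> snd p el H"
 using cop(1)[of h] by auto

lemma SW_closed [simp]:
 "vs W ==> h el H ==> (!!u v. u el H ==> v el H ==> b u v el W) ==>
  SW W b h el W" unfolding SW_def by (rule lsum_closed) (auto dest: copD)

lemma SW_cong:
 "h el H ==> (!!u v. u el H ==> v el H ==> b u v = b' u v) ==> SW W b h = SW W b' h" unfolding SW_def by (rule lsum_cong) (auto dest: copD)

lemma SW_lin:
 assumes "vs W" "vs W'" "lin W W' \<phi>" "h el H"
  "!!u v. u el H ==> v el H ==> b u v el W"
 shows "\<phi> (SW W b h) = SW W' (%u v. \<phi> (b u v)) h"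
proof -
 have "\<phi> (SW W b h) = lsum W' (%p. \<phi> (case p of (u, v) => b u v)) (cop h)"
  unfolding SW_def by (rule lsum_lin[OF assms(1-3)]) (use assms(4,5) in "auto dest: copD")
 also have "... = SW W' (%u v. \<phi> (b u v)) h" unfolding SW_def by (rule lsum_cong) auto
 finally show ?thesis .
qed

lemma SW_swap:
 assumes "vs W" "h el H" "k el H"
  "!!u v x y. u el H ==> v el H ==> x el H ==> y el H ==> t u v x y el W"
 shows "SW W (%u v. SW W (%x y. t u v x y) k) h = SW W (%x y. SW W (%u v. t u v x y) h) k"
proof -
 have "lsum W (%p. lsum W (%q. t (fst p) (snd p) (fst q) (snd q)) (cop k)) (cop h) =
   lsum W (%q. lsum W (%p. t (fst p) (snd p) (fst q) (snd q)) (cop h)) (cop k)" by (rule lsum_swap[OF assms(1)]) (use assms copD in blast)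
 then show ?thesis by (simp add: SW_def case_prod_unfold)
qed

lemma lin_SW:
 assumes "vs W" "h el H" "!!u v. u el H ==> v el H ==> lin M W (%m. b m u v)"
 shows "lin M W (%m. SW W (b m) h)" unfolding SW_def case_prod_unfold by (rule lin_lsum[OF assms(1)]) (use assms copD in blast)

lemma sweedler_SW:
 assumes W: "vs W" and b: "bilin H H W b" and h: "h el H"
 shows "sweedler K H W b h = SW W b h"
proof -
 note L = tensor_data.tensor_lift[OF tdH W b bal_empty]
 have "sweedler K H W b h = lsum W (%p. tensor_lift K W b (case p of (u, v) => ptH u v)) (cop h)" unfolding sweedler_def cop(2)[OF h]
  by (rule lsum_lin[OF vsH2 W L(1)]) (use bilinD(4)[OF ptH_bilin] copD[OF h] in auto)
 also have "... = SW W b h" unfolding SW_def by (rule lsum_cong) (use L(2) copD[OF h] in auto)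
 finally show ?thesis .
qed

lemma SW_hlin:
 assumes W: "vs W" and b: "bilin H H W b"
 shows "lin H W (SW W b)"
proof -
 have "lin H W (%h. tensor_lift K W b (comul H h))" by (rule lin_comp[OF comul_linear tensor_data.tensor_lift(1)[OF tdH W b bal_empty]])
 moreover have "tensor_lift K W b (comul H h) = SW W b h" if "h el H" for h using sweedler_SW[OF W b that] by (simp add: sweedler_def)
 ultimately show ?thesis using lin_cong[OF _ vsH, of "%h. tensor_lift K W b (comul H h)" "SW W b" W] by simp
qed

lemma comul_SW: "h el H ==> comul H h = SW H2 ptH h"
 unfolding SW_def by (rule cop(2))

named_theorems lins

lemma lin_ident [lins]: "lin M M (%x. x)" by (rule lin_id)

lemma lin_mult [lins]:
 assumes f: "lin X H f" and c: "c el H"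
 shows "lin X H (%x. f x ** c)" "lin X H (%x. c ** f x)"
proof -
 have m: "lin H H (%x. x ** c)" "lin H H (%x. c ** x)" using c smult_mult ring_H by (auto intro!: linI simp: ring.ring_simprules)
 show "lin X H (%x. f x ** c)" "lin X H (%x. c ** f x)" by (rule lin_comp[OF f m(1)], rule lin_comp[OF f m(2)])
qed

lemma lin_scal [lins]: "vs W ==> a el K ==> lin X W f ==> lin X W (%x. a *[W] f x)"
 by (rule lin_smult_map)

lemma lin_scal2 [lins]:
 assumes "lin X KK f" "vs W" "w el W"
 shows "lin X W (%x. f x *[W] w)" by (rule linI) (use linD[OF assms(1)] assms(2,3) in "simp_all add: KK vs_smult")

lemma lin_eps [lins]: "lin X H f ==> lin X KK (%x. \<epsilon> (f x))"
 by (rule lin_comp[OF _ counit_linear])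

lemma lin_antipode [lins]: "lin X H f ==> lin X H (%x. anti (f x))"
 by (rule lin_comp[OF _ antipode_linear])

lemma lin_SW1 [lins]:
 "vs W ==> h el H ==> (!!u v. u el H ==> v el H ==> lin M W (%m. b m u v)) ==>
  lin M W (%m. SW W (%u v. b m u v) h)" by (rule lin_SW)

lemma lin_SW2 [lins]: "vs W ==> bilin H H W b ==> lin X H f ==> lin X W (%x. SW W b (f x))"
 by (rule lin_comp[OF _ SW_hlin])

lemma lin_b1:
 assumes "bilin M N W b" "lin X M f" "n el N"
 shows "lin X W (%x. b (f x) n)" by (rule lin_comp[OF assms(2) bilinD(3)[OF assms(1,3)]])

lemma lin_b2:
 assumes "bilin M N W b" "lin X N f" "m el M"
 shows "lin X W (%x. b m (f x))" by (rule lin_comp[OF assms(2) bilinD(2)[OF assms(1,3)]])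

lemma eps_closed [simp]: "h el H ==> \<epsilon> h el K"
 using linD(1)[OF counit_linear] by (simp add: KK)

lemma S_closed [simp]: "h el H ==> anti h el H"
 using linD(1)[OF antipode_linear] .

definition trilin :: "('k, 'w, 'x) module_scheme => ('h => 'h => 'h => 'w) => bool"
 where "trilin W t \<longleftrightarrow> (\<forall>x\<in>carrier H. \<forall>y\<in>carrier H.
  lin H W (%u. t u x y) \<and> lin H W (%u. t x u y) \<and> lin H W (%u. t x y u))"

lemma trilinI:
 "(!!x y. x el H ==> y el H ==> lin H W (%u. t u x y)) ==>
 (!!x y. x el H ==> y el H ==> lin H W (%u. t x u y)) ==>
 (!!x y. x el H ==> y el H ==> lin H W (%u. t x y u)) ==> trilin W t" by (simp add: trilin_def)

lemma trilinD:
 assumes t: "trilin W t"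
 shows "x el H ==> y el H ==> lin H W (%u. t u x y)"
  "x el H ==> y el H ==> lin H W (%u. t x u y)"
  "x el H ==> y el H ==> lin H W (%u. t x y u)"
  "x el H ==> bilin H H W (t x)"
  "x el H ==> y el H ==> z el H ==> t x y z el W"
proof -
 show *: "x el H ==> y el H ==> lin H W (%u. t u x y)"
  "x el H ==> y el H ==> lin H W (%u. t x u y)"
  "x el H ==> y el H ==> lin H W (%u. t x y u)" for x y using t by (simp_all add: trilin_def)
 then show "x el H ==> bilin H H W (t x)" by (auto intro!: bilinI)
 show "x el H ==> y el H ==> z el H ==> t x y z el W" using linD(1)[OF *(1)] .
qed

abbreviation "H3 \<equiv> tensor K ({} :: (('h => 'h) \<times> (('h \<times> 'h => 'k) set => ('h \<times> 'h => 'k) set)) set) H H2"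
abbreviation "pt3 u x \<equiv> pure_tensor K ({} :: (('h => 'h) \<times> (('h \<times> 'h => 'k) set => ('h \<times> 'h => 'k) set)) set) H H2 u x"

lemma td3: "tensor_data K ({} :: (('h => 'h) \<times> (('h \<times> 'h => 'k) set => ('h \<times> 'h => 'k) set)) set) H H2"
 by (rule tensor_dataI) auto

lemmas vsH3 [simp] = tensor_data.ten_vs[OF td3]
lemmas pt3_bilin = tensor_data.pt_bilin[OF td3]

lemma pt3_trilin: "trilin H3 (%u v w. pt3 u (ptH v w))"
 by (rule trilinI)
  (simp_all add: bilinD[OF ptH_bilin] lin_b1[OF pt3_bilin lin_id] lin_b2[OF pt3_bilin])

lemma lift3:
 assumes W: "vs W" and t: "trilin W t"
 obtains \<phi> where "lin H3 W \<phi>"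
  "!!u v w. u el H ==> v el H ==> w el H ==> \<phi> (pt3 u (ptH v w)) = t u v w"
proof -
 obtain g where g: "bilin H H2 W g"
  "!!u m n. u el H ==> m el H ==> n el H ==> g u (ptH m n) = t u m n"
  by (rule tensor_by.param_lift[OF tensor_data.tensor_by_ten[OF tdH] W trilinD(4)[OF t] bal_empty vsH trilinD(1)[OF t]]) auto
 note L = tensor_data.tensor_lift[OF td3 W g(1) bal_empty]
 show ?thesis by (rule that[OF L(1)]) (simp add: L(2) g(2) bilinD(4)[OF ptH_bilin])
qed

lemma SW3_right:
 assumes W: "vs W" and \<phi>: "lin H3 W \<phi>" and h: "h el H"
  and \<phi>t: "!!u v w. u el H ==> v el H ==> w el H ==> \<phi> (pt3 u (ptH v w)) = t u v w"
 shows "\<phi> (sweedler K H H3 (%u v. pt3 u (comul H v)) h) = SW W (%u v. SW W (%v1 v2. t u v1 v2) v) h"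
proof -
 note T = trilinD[OF pt3_trilin]
 have c: "pt3 u (comul H v) = SW H3 (%v1 v2. pt3 u (ptH v1 v2)) v" if "u el H" "v el H" for u v unfolding comul_SW[OF that(2)]
  by (rule SW_lin[OF vsH2 vsH3 bilinD(2)[OF pt3_bilin that(1)] that(2)]) (rule bilinD(4)[OF ptH_bilin])
 have "bilin H H H3 (%u v. pt3 u (comul H v))" by (rule bilin_comp[OF pt3_bilin lin_id comul_linear])
 then have "sweedler K H H3 (%u v. pt3 u (comul H v)) h = SW H3 (%u v. pt3 u (comul H v)) h" by (rule sweedler_SW[OF vsH3 _ h])
 also have "... = SW H3 (%u v. SW H3 (%v1 v2. pt3 u (ptH v1 v2)) v) h" by (rule SW_cong[OF h]) (rule c)
 finally have "\<phi> (sweedler K H H3 (%u v. pt3 u (comul H v)) h) =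
   \<phi> (SW H3 (%u v. SW H3 (%v1 v2. pt3 u (ptH v1 v2)) v) h)" by simp
 also have "... = SW W (%u v. \<phi> (SW H3 (%v1 v2. pt3 u (ptH v1 v2)) v)) h" by (rule SW_lin[OF vsH3 W \<phi> h]) (simp add: T(5))
 also have "... = SW W (%u v. SW W (%v1 v2. t u v1 v2) v) h"
 proof (rule SW_cong[OF h])
  fix u v assume uv: "u el H" "v el H"
  have "\<phi> (SW H3 (%v1 v2. pt3 u (ptH v1 v2)) v) = SW W (%v1 v2. \<phi> (pt3 u (ptH v1 v2))) v"
   by (rule SW_lin[OF vsH3 W \<phi> uv(2)]) (simp add: T(5) uv)
  also have "... = SW W (%v1 v2. t u v1 v2) v" by (rule SW_cong[OF uv(2)]) (rule \<phi>t[OF uv(1)])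
  finally show "\<phi> (SW H3 (%v1 v2. pt3 u (ptH v1 v2)) v) = SW W (%v1 v2. t u v1 v2) v" .
 qed
 finally show ?thesis .
qed

text \<open>A linear map on the threefold tensor power is moved inside a twofold Sweedler sum; with \<open>lift3\<close> this turns the
 coassociativity axioms into statements about arbitrary trilinear maps.\<close>

lemma SW3_eval:
 assumes W: "vs W" and \<phi>: "lin H3 W \<phi>" and h: "h el H"
  and k: "!!u v. u el H ==> v el H ==> k u v el H"
  and c: "!!u v x y. u el H ==> v el H ==> x el H ==> y el H ==> c u v x y el H3"
  and b: "!!u v. u el H ==> v el H ==> bilin H H H3 (c u v)"
  and B: "bilin H H H3 (%u v. SW H3 (c u v) (k u v))"
 shows "\<phi> (sweedler K H H3 (%u v. sweedler K H H3 (c u v) (k u v)) h) =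
  SW W (%u v. SW W (%x y. \<phi> (c u v x y)) (k u v)) h"
proof -
 have *: "sweedler K H H3 (c u v) (k u v) = SW H3 (c u v) (k u v)" if "u el H" "v el H" for u v
  by (rule sweedler_SW[OF vsH3 b k]) (use that in simp_all)
 have B': "bilin H H H3 (%u v. sweedler K H H3 (c u v) (k u v))"
 proof (rule bilinI)
  fix m assume m: "m el H"
  show "lin H H3 (%n. sweedler K H H3 (c m n) (k m n))" using bilinD(1)[OF B m] lin_cong[OF _ vsH, of "%n. sweedler K H H3 (c m n) (k m n)"
    "%n. SW H3 (c m n) (k m n)" H3] *[OF m] by simp
 next
  fix n assume n: "n el H"
  show "lin H H3 (%m. sweedler K H H3 (c m n) (k m n))" using bilinD(3)[OF B n] lin_cong[OF _ vsH, of "%m. sweedler K H H3 (c m n) (k m n)"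
    "%m. SW H3 (c m n) (k m n)" H3] *[OF _ n] by simp
 qed
 have "\<phi> (sweedler K H H3 (%u v. sweedler K H H3 (c u v) (k u v)) h) =
   \<phi> (SW H3 (%u v. sweedler K H H3 (c u v) (k u v)) h)" by (simp only: sweedler_SW[OF vsH3 B' h])
 also have "... = \<phi> (SW H3 (%u v. SW H3 (c u v) (k u v)) h)" by (rule arg_cong[where f = \<phi>], rule SW_cong[OF h]) (rule *)
 also have "... = SW W (%u v. \<phi> (SW H3 (c u v) (k u v))) h" by (rule SW_lin[OF vsH3 W \<phi> h]) (rule bilinD(4)[OF B])
 also have "... = SW W (%u v. SW W (%x y. \<phi> (c u v x y)) (k u v)) h"
 proof (rule SW_cong[OF h])
  fix u v assume uv: "u el H" "v el H"
  show "\<phi> (SW H3 (c u v) (k u v)) = SW W (%x y. \<phi> (c u v x y)) (k u v)" by (rule SW_lin[OF vsH3 W \<phi> k[OF uv]]) (rule c[OF uv])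
 qed
 finally show ?thesis .
qed

text \<open>Coassociativity in the form in which it is used: for every trilinear map, by applying the linear map it induces on the threefold tensor
 power.\<close>

lemma coassoc3:
 assumes W: "vs W" and t: "trilin W t" and h: "h el H"
 shows "SW W (%u v. SW W (%u1 u2. t u1 u2 v) u) h = SW W (%u v. SW W (%v1 v2. t u v1 v2) v) h"
proof -
 obtain \<phi> where \<phi>: "lin H3 W \<phi>"
  "!!u v w. u el H ==> v el H ==> w el H ==> \<phi> (pt3 u (ptH v w)) = t u v w" by (rule lift3[OF W t], rule that, assumption+)
 note T = trilinD[OF pt3_trilin]
 have "\<phi> (sweedler K H H3 (%u v. sweedler K H H3 (%u1 u2. pt3 u1 (ptH u2 v)) u) h) =
   SW W (%u v. SW W (%u1 u2. \<phi> (pt3 u1 (ptH u2 v))) u) h"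
 proof (rule SW3_eval[OF W \<phi>(1) h])
  show B: "bilin H H H3 (%u1 u2. pt3 u1 (ptH u2 v))" if "v el H" for v by (rule bilinI) (use T(1,2) that in simp_all)
  show "bilin H H H3 (%u v. SW H3 (%u1 u2. pt3 u1 (ptH u2 v)) u)" by (rule bilinI) (simp_all add: lin_SW T(3) SW_hlin B)
 qed (simp_all add: T(5))
 also have "... = SW W (%u v. SW W (%u1 u2. t u1 u2 v) u) h" by (intro SW_cong[OF h] SW_cong) (simp_all add: \<phi>(2))
 finally show ?thesis unfolding coassoc[OF h] using SW3_right[OF W \<phi>(1) h \<phi>(2)] by simp
qed

lemma comul_one3:
 assumes W: "vs W" and t: "trilin W t"
 shows "SW W (%u v. SW W (%v1 v2. t u v1 v2) v) 1[H] =
   SW W (%u v. SW W (%u' v'. t u (v ** u') v') 1[H]) 1[H]"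
  and "SW W (%u v. SW W (%v1 v2. t u v1 v2) v) 1[H] =
   SW W (%u v. SW W (%u' v'. t u (u' ** v) v') 1[H]) 1[H]"
proof -
 obtain \<phi> where \<phi>: "lin H3 W \<phi>"
  "!!u v w. u el H ==> v el H ==> w el H ==> \<phi> (pt3 u (ptH v w)) = t u v w" by (rule lift3[OF W t], rule that, assumption+)
 note T = trilinD[OF pt3_trilin]
 have T2: "lin X H3 (%x. pt3 u (ptH (f x) v))" if "lin X H f" "u el H" "v el H" for X f u v using lin_comp[OF that(1) T(2)[OF that(2,3)]] .
 have "\<phi> (sweedler K H H3 (%u v. sweedler K H H3 (%u' v'. pt3 u (ptH (v ** u') v')) 1[H]) 1[H]) =
   SW W (%u v. SW W (%u' v'. \<phi> (pt3 u (ptH (v ** u') v'))) 1[H]) 1[H]"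
  by (rule SW3_eval[OF W \<phi>(1)]) (auto intro!: bilinI lins T2 T(1,3) T(5))
 also have "... = SW W (%u v. SW W (%u' v'. t u (v ** u') v') 1[H]) 1[H]" by (intro SW_cong) (simp_all add: \<phi>(2))
 finally show "SW W (%u v. SW W (%v1 v2. t u v1 v2) v) 1[H] =
   SW W (%u v. SW W (%u' v'. t u (v ** u') v') 1[H]) 1[H]"
  unfolding comul_one_1[symmetric] using SW3_right[OF W \<phi>(1) _ \<phi>(2), of "1[H]"] by simp
 have "\<phi> (sweedler K H H3 (%u v. sweedler K H H3 (%u' v'. pt3 u (ptH (u' ** v) v')) 1[H]) 1[H]) =
   SW W (%u v. SW W (%u' v'. \<phi> (pt3 u (ptH (u' ** v) v'))) 1[H]) 1[H]"
  by (rule SW3_eval[OF W \<phi>(1)]) (auto intro!: bilinI lins T2 T(1,3) T(5))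
 also have "... = SW W (%u v. SW W (%u' v'. t u (u' ** v) v') 1[H]) 1[H]" by (intro SW_cong) (simp_all add: \<phi>(2))
 finally show "SW W (%u v. SW W (%v1 v2. t u v1 v2) v) 1[H] =
   SW W (%u v. SW W (%u' v'. t u (u' ** v) v') 1[H]) 1[H]"
  unfolding comul_one_2[symmetric] using SW3_right[OF W \<phi>(1) _ \<phi>(2), of "1[H]"] by simp
qed

lemma SW_mult:
 assumes W: "vs W" and b: "bilin H H W b" and x: "x el H" and y: "y el H"
 shows "SW W b (x ** y) = SW W (%x1 x2. SW W (%y1 y2. b (x1 ** y1) (x2 ** y2)) y) x"
proof -
 note L = tensor_data.tensor_lift[OF tdH W b bal_empty]
 note P = lin_b1[OF ptH_bilin] lin_b2[OF ptH_bilin]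
 have B1: "bilin H H H2 (%y1 y2. ptH (x1 ** y1) (x2 ** y2))" if "x1 el H" "x2 el H" for x1 x2 using that by (intro bilinI P lins) simp_all
 have B2: "bilin H H H2 (%x1 x2. SW H2 (%y1 y2. ptH (x1 ** y1) (x2 ** y2)) y)" using y by (intro bilinI P lins) simp_all
 have e: "sweedler K H H2 (%y1 y2. ptH (x1 ** y1) (x2 ** y2)) y =
   SW H2 (%y1 y2. ptH (x1 ** y1) (x2 ** y2)) y" if "x1 el H" "x2 el H" for x1 x2 by (rule sweedler_SW[OF vsH2 B1[OF that] y])
 have "bilin H H H2 (%x1 x2. sweedler K H H2 (%y1 y2. ptH (x1 ** y1) (x2 ** y2)) y)" using B2 unfolding bilin_def lin_hom_def by (simp add: e Pi_iff)
 then have "comul H (x ** y) = SW H2 (%x1 x2. sweedler K H H2 (%y1 y2. ptH (x1 ** y1) (x2 ** y2)) y) x"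
  unfolding comul_mult[OF x y] by (rule sweedler_SW[OF vsH2 _ x])
 also have "... = SW H2 (%x1 x2. SW H2 (%y1 y2. ptH (x1 ** y1) (x2 ** y2)) y) x" by (rule SW_cong[OF x]) (rule e)
 finally have c: "comul H (x ** y) = SW H2 (%x1 x2. SW H2 (%y1 y2. ptH (x1 ** y1) (x2 ** y2)) y) x" .
 have "SW W b (x ** y) = tensor_lift K W b (comul H (x ** y))" using sweedler_SW[OF W b, of "x ** y"] x y by (simp add: sweedler_def)
 also have "... = SW W (%x1 x2. tensor_lift K W b (SW H2 (%y1 y2. ptH (x1 ** y1) (x2 ** y2)) y)) x"
  unfolding c by (rule SW_lin[OF vsH2 W L(1) x]) (rule bilinD(4)[OF B2])
 also have "... = SW W (%x1 x2. SW W (%y1 y2. b (x1 ** y1) (x2 ** y2)) y) x"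
 proof (rule SW_cong[OF x])
  fix x1 x2 assume xx: "x1 el H" "x2 el H"
  have "tensor_lift K W b (SW H2 (%y1 y2. ptH (x1 ** y1) (x2 ** y2)) y) =
    SW W (%y1 y2. tensor_lift K W b (ptH (x1 ** y1) (x2 ** y2))) y" by (rule SW_lin[OF vsH2 W L(1) y]) (rule bilinD(4)[OF B1[OF xx]])
  also have "... = SW W (%y1 y2. b (x1 ** y1) (x2 ** y2)) y" by (rule SW_cong[OF y]) (use L(2) xx in simp)
  finally show "tensor_lift K W b (SW H2 (%y1 y2. ptH (x1 ** y1) (x2 ** y2)) y) =
    SW W (%y1 y2. b (x1 ** y1) (x2 ** y2)) y" .
 qed
 finally show ?thesis .
qed

lemma counit_SW:
 assumes W: "vs W" and f: "lin H W f" and h: "h el H"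
 shows "SW W (%u v. \<epsilon> u *[W] f v) h = f h" "SW W (%u v. \<epsilon> v *[W] f u) h = f h"
proof -
 have B: "bilin H H H (%u v. \<epsilon> u *[H] v)" "bilin H H H (%u v. \<epsilon> v *[H] u)" by (intro bilinI lins; simp)+
 have "f h = f (SW H (%u v. \<epsilon> u *[H] v) h)" using counit_left[OF h] sweedler_SW[OF vsH B(1) h] by simp
 also have "... = SW W (%u v. f (\<epsilon> u *[H] v)) h" by (rule SW_lin[OF vsH W f h]) simp
 also have "... = SW W (%u v. \<epsilon> u *[W] f v) h" by (rule SW_cong[OF h]) (simp add: linD(3)[OF f])
 finally show "SW W (%u v. \<epsilon> u *[W] f v) h = f h" by simp
 have "f h = f (SW H (%u v. \<epsilon> v *[H] u) h)" using counit_right[OF h] sweedler_SW[OF vsH B(2) h] by simp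
 also have "... = SW W (%u v. f (\<epsilon> v *[H] u)) h" by (rule SW_lin[OF vsH W f h]) simp
 also have "... = SW W (%u v. \<epsilon> v *[W] f u) h" by (rule SW_cong[OF h]) (simp add: linD(3)[OF f])
 finally show "SW W (%u v. \<epsilon> v *[W] f u) h = f h" by simp
qed


lemma eps_mult:
 assumes "vs W" "w el W" "x el H" "y el H" "z el H"
 shows "\<epsilon> (x ** y ** z) *[W] w = SW W (%u v. (\<epsilon> (x ** u) \<otimes>\<^bsub>K\<^esub> \<epsilon> (v ** z)) *[W] w) y"
  and "\<epsilon> (x ** y ** z) *[W] w = SW W (%u v. (\<epsilon> (x ** v) \<otimes>\<^bsub>K\<^esub> \<epsilon> (u ** z)) *[W] w) y"
proof -
 have L: "lin KK W (%a. a *[W] w)" using lin_scal2[OF lin_id assms(1,2)] .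
 have s: "lin X KK (%x. a \<otimes>\<^bsub>K\<^esub> f x)" "lin X KK (%x. f x \<otimes>\<^bsub>K\<^esub> a)" if "a el K" "lin X KK f" for X a f
  using lin_scal[OF vsKK that] lin_scal2[OF that(2) vsKK, of a] that(1) by (simp_all add: KK)
 have B: "bilin H H KK (%u v. \<epsilon> (x ** u) \<otimes>\<^bsub>K\<^esub> \<epsilon> (v ** z))"
  "bilin H H KK (%u v. \<epsilon> (x ** v) \<otimes>\<^bsub>K\<^esub> \<epsilon> (u ** z))" using assms by (intro bilinI s lins; simp)+
 show "\<epsilon> (x ** y ** z) *[W] w = SW W (%u v. (\<epsilon> (x ** u) \<otimes>\<^bsub>K\<^esub> \<epsilon> (v ** z)) *[W] w) y"
  unfolding counit_mult_1[OF assms(3-5)] sweedler_SW[OF vsKK B(1) assms(4)]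
  by (rule SW_lin[OF vsKK assms(1) L assms(4)]) (use assms in "simp add: KK")
 show "\<epsilon> (x ** y ** z) *[W] w = SW W (%u v. (\<epsilon> (x ** v) \<otimes>\<^bsub>K\<^esub> \<epsilon> (u ** z)) *[W] w) y"
  unfolding counit_mult_2[OF assms(3-5)] sweedler_SW[OF vsKK B(2) assms(4)]
  by (rule SW_lin[OF vsKK assms(1) L assms(4)]) (use assms in "simp add: KK")
qed

lemma eps_t_SW: "h el H ==> \<epsilon>t h = SW H (%u v. \<epsilon> (u ** h) *[H] v) 1[H]"
 unfolding eps_t_def by (rule sweedler_SW[OF vsH]; (intro bilinI lins)?; simp)

lemma eps_s_SW: "h el H ==> \<epsilon>s h = SW H (%u v. \<epsilon> (h ** v) *[H] u) 1[H]"
 unfolding eps_s_def by (rule sweedler_SW[OF vsH]; (intro bilinI lins)?; simp)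

lemma br_SW: "h el H ==> br h = SW H (%u v. \<epsilon> (v ** h) *[H] u) 1[H]"
 unfolding base_right_def by (rule sweedler_SW[OF vsH]; (intro bilinI lins)?; simp)

lemma counital_closed [simp]:
 "h el H ==> \<epsilon>t h el H" "h el H ==> \<epsilon>s h el H" "h el H ==> br h el H" by (simp_all add: eps_t_SW eps_s_SW br_SW)

lemma lin_counital: "lin H H \<epsilon>t" "lin H H \<epsilon>s" "lin H H br"
proof -
 have "lin H H (%h. SW H (%u v. \<epsilon> (u ** h) *[H] v) 1[H])"
  "lin H H (%h. SW H (%u v. \<epsilon> (h ** v) *[H] u) 1[H])"
  "lin H H (%h. SW H (%u v. \<epsilon> (v ** h) *[H] u) 1[H])" by (intro lins; simp)+
 then show "lin H H \<epsilon>t" "lin H H \<epsilon>s" "lin H H br"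
  using lin_cong[OF _ vsH, of \<epsilon>t "%h. SW H (%u v. \<epsilon> (u ** h) *[H] v) 1[H]" H]
   lin_cong[OF _ vsH, of \<epsilon>s "%h. SW H (%u v. \<epsilon> (h ** v) *[H] u) 1[H]" H]
   lin_cong[OF _ vsH, of br "%h. SW H (%u v. \<epsilon> (v ** h) *[H] u) 1[H]" H] by (simp_all add: eps_t_SW eps_s_SW br_SW)
qed

lemma lin_counital' [lins]:
 "lin X H f ==> lin X H (%x. \<epsilon>t (f x))" "lin X H f ==> lin X H (%x. \<epsilon>s (f x))"
 "lin X H f ==> lin X H (%x. br (f x))" by (rule lin_comp[OF _ lin_counital(1)] lin_comp[OF _ lin_counital(2)] lin_comp[OF _ lin_counital(3)],
   assumption)+

lemma lin_counital_SW:
 assumes W: "vs W" and f: "lin H W f" and h: "h el H"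
 shows "f (\<epsilon>t h) = SW W (%u v. \<epsilon> (u ** h) *[W] f v) 1[H]"
  and "f (\<epsilon>s h) = SW W (%u v. \<epsilon> (h ** v) *[W] f u) 1[H]"
  and "f (br h) = SW W (%u v. \<epsilon> (v ** h) *[W] f u) 1[H]"
proof -
 have "f (SW H (%u v. c u v *[H] g u v) 1[H]) = SW W (%u v. c u v *[W] f (g u v)) 1[H]"
  if "!!u v. u el H ==> v el H ==> c u v el K"
   "!!u v. u el H ==> v el H ==> g u v el H" for c g
 proof -
  have "f (SW H (%u v. c u v *[H] g u v) 1[H]) = SW W (%u v. f (c u v *[H] g u v)) 1[H]" by (rule SW_lin[OF vsH W f]) (simp_all add: that)
  also have "... = SW W (%u v. c u v *[W] f (g u v)) 1[H]" by (rule SW_cong) (simp_all add: linD(3)[OF f] that)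
  finally show ?thesis .
 qed
 then show "f (\<epsilon>t h) = SW W (%u v. \<epsilon> (u ** h) *[W] f v) 1[H]"
  "f (\<epsilon>s h) = SW W (%u v. \<epsilon> (h ** v) *[W] f u) 1[H]"
  "f (br h) = SW W (%u v. \<epsilon> (v ** h) *[W] f u) 1[H]" using h by (simp_all add: eps_t_SW eps_s_SW br_SW)
qed

lemma eps_eps_t: "x el H ==> k el H ==> \<epsilon> (x ** \<epsilon>t k) = \<epsilon> (x ** k)"
proof -
 assume x: "x el H" and k: "k el H"
 have L: "lin H KK (%v. \<epsilon> (x ** v))" using x by (intro lins)
 have c: "a \<otimes>\<^bsub>K\<^esub> b \<otimes>\<^bsub>K\<^esub> 1[K] = b \<otimes>\<^bsub>K\<^esub> a" if "a el K" "b el K" for a b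
  using that cring_K by (simp add: K_ring cring.cring_simprules)
 have "\<epsilon> (x ** \<epsilon>t k) = SW KK (%u v. \<epsilon> (u ** k) \<otimes>\<^bsub>K\<^esub> \<epsilon> (x ** v)) 1[H]"
  using lin_counital_SW(1)[OF vsKK L k] by (simp add: KK)
 also have "... = SW KK (%u v. \<epsilon> (x ** v) \<otimes>\<^bsub>K\<^esub> \<epsilon> (u ** k) \<otimes>\<^bsub>K\<^esub> 1[K]) 1[H]"
  by (rule SW_cong) (use x k c in simp_all)
 also have "... = \<epsilon> (x ** 1[H] ** k) *[KK] 1[K]" using eps_mult(2)[OF vsKK, of "1[K]" x "1[H]" k] x k by (simp add: KK)
 finally show ?thesis using x k by (simp add: KK K_ring)
qed

lemma eps_br: "x el H ==> k el H ==> \<epsilon> (x ** br k) = \<epsilon> (x ** k)"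
proof -
 assume x: "x el H" and k: "k el H"
 have L: "lin H KK (%v. \<epsilon> (x ** v))" using x by (intro lins)
 have c: "a \<otimes>\<^bsub>K\<^esub> b \<otimes>\<^bsub>K\<^esub> 1[K] = b \<otimes>\<^bsub>K\<^esub> a" if "a el K" "b el K" for a b
  using that cring_K by (simp add: K_ring cring.cring_simprules)
 have "\<epsilon> (x ** br k) = SW KK (%u v. \<epsilon> (v ** k) \<otimes>\<^bsub>K\<^esub> \<epsilon> (x ** u)) 1[H]"
  using lin_counital_SW(3)[OF vsKK L k] by (simp add: KK)
 also have "... = SW KK (%u v. \<epsilon> (x ** u) \<otimes>\<^bsub>K\<^esub> \<epsilon> (v ** k) \<otimes>\<^bsub>K\<^esub> 1[K]) 1[H]"
  by (rule SW_cong) (use x k c in simp_all)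
 also have "... = \<epsilon> (x ** 1[H] ** k) *[KK] 1[K]" using eps_mult(1)[OF vsKK, of "1[K]" x "1[H]" k] x k by (simp add: KK)
 finally show ?thesis using x k by (simp add: KK K_ring)
qed

lemma br_eps_t: "k el H ==> br (\<epsilon>t k) = br k"
 by (simp add: br_SW) (rule SW_cong; simp add: eps_eps_t)

lemma eps_t_idem:
 assumes k: "k el H"
 shows "\<epsilon>t (\<epsilon>t k) = \<epsilon>t k"
proof -
 have "\<epsilon>t (\<epsilon>t k) = SW H (%u v. \<epsilon> (u ** \<epsilon>t k) *[H] v) 1[H]" by (rule eps_t_SW) (simp add: k)
 also have "... = SW H (%u v. \<epsilon> (u ** k) *[H] v) 1[H]" by (rule SW_cong) (simp_all add: eps_eps_t k)
 also have "... = \<epsilon>t k" by (rule eps_t_SW[OF k, symmetric])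
 finally show ?thesis .
qed

lemma eps_t_one: "\<epsilon>t 1[H] = 1[H]"
proof -
 have "\<epsilon>t 1[H] = SW H (%u v. \<epsilon> u *[H] v) 1[H]" unfolding eps_t_SW[OF H_simps(1)] by (rule SW_cong) simp_all
 then show ?thesis using counit_SW(1)[OF vsH lin_id, of "1[H]"] by simp
qed

text \<open>The second leg of \<open>\<Delta>(1)\<close> lies in the target subalgebra.\<close>

lemma SW_one_right:
 assumes W: "vs W" and b: "bilin H H W b"
 shows "SW W b 1[H] = SW W (%u v. b u (\<epsilon>t v)) 1[H]"
proof -
 note B = lin_b1[OF b] lin_b2[OF b]
 have t: "trilin W (%u m v. \<epsilon> m *[W] b u v)" using W by (intro trilinI lins B; simp add: bilinD(4)[OF b])
 have "SW W b 1[H] = SW W (%u v. SW W (%v1 v2. \<epsilon> v1 *[W] b u v2) v) 1[H]"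
  by (rule SW_cong) (simp_all add: counit_SW(1)[OF W bilinD(2)[OF b]])
 also have "... = SW W (%u v. SW W (%u' v'. \<epsilon> (u' ** v) *[W] b u v') 1[H]) 1[H]" by (rule comul_one3(2)[OF W t])
 also have "... = SW W (%u v. b u (\<epsilon>t v)) 1[H]" by (rule SW_cong) (simp_all add: lin_counital_SW(1)[OF W bilinD(2)[OF b]])
 finally show ?thesis .
qed

text \<open>Elements of the target subalgebra comultiply as \<open>\<Delta>(z) = z 1\<^sub>1 \<otimes> 1\<^sub>2 = 1\<^sub>1 z \<otimes>
 1\<^sub>2\<close>.\<close>

lemma SW_target:
 assumes W: "vs W" and b: "bilin H H W b" and k: "k el H"
 shows "SW W b (\<epsilon>t k) = SW W (%u v. b (\<epsilon>t k ** u) v) 1[H]"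
  and "SW W b (\<epsilon>t k) = SW W (%u v. b (u ** \<epsilon>t k) v) 1[H]"
proof -
 note B = lin_b1[OF b] lin_b2[OF b]
 note Bc = bilinD(4)[OF b]
 have t: "trilin W (%u m v. \<epsilon> (u ** k) *[W] b m v)" using W k by (intro trilinI lins B; simp add: Bc)
 have *: "SW W b (\<epsilon>t k) = SW W (%u v. SW W (%v1 v2. \<epsilon> (u ** k) *[W] b v1 v2) v) 1[H]"
  unfolding lin_counital_SW(1)[OF W SW_hlin[OF W b] k]
 proof (rule SW_cong)
  fix u v assume uv: "u el H" "v el H"
  have L: "lin W W (%x. \<epsilon> (u ** k) *[W] x)" using W uv k by (intro lins) simp_all
  show "\<epsilon> (u ** k) *[W] SW W b v = SW W (%v1 v2. \<epsilon> (u ** k) *[W] b v1 v2) v" by (rule SW_lin[OF W W L uv(2) Bc])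
 qed simp
 have "SW W b (\<epsilon>t k) = SW W (%u v. SW W (%u' v'. \<epsilon> (u ** k) *[W] b (v ** u') v') 1[H]) 1[H]"
  unfolding * by (rule comul_one3(1)[OF W t])
 also have "... = SW W (%u' v'. SW W (%u v. \<epsilon> (u ** k) *[W] b (v ** u') v') 1[H]) 1[H]"
  by (rule SW_swap[OF W]) (use k W in "simp_all add: Bc")
 also have "... = SW W (%u' v'. b (\<epsilon>t k ** u') v') 1[H]"
 proof (rule SW_cong)
  fix u v assume uv: "u el H" "v el H"
  have L: "lin H W (%x. b (x ** u) v)" using uv by (intro lins B)
  show "SW W (%u' v'. \<epsilon> (u' ** k) *[W] b (v' ** u) v) 1[H] = b (\<epsilon>t k ** u) v" using lin_counital_SW(1)[OF W L k] by simp
 qed simp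
 finally show "SW W b (\<epsilon>t k) = SW W (%u v. b (\<epsilon>t k ** u) v) 1[H]" .
 have "SW W b (\<epsilon>t k) = SW W (%u v. SW W (%u' v'. \<epsilon> (u ** k) *[W] b (u' ** v) v') 1[H]) 1[H]"
  unfolding * by (rule comul_one3(2)[OF W t])
 also have "... = SW W (%u' v'. SW W (%u v. \<epsilon> (u ** k) *[W] b (u' ** v) v') 1[H]) 1[H]"
  by (rule SW_swap[OF W]) (use k W in "simp_all add: Bc")
 also have "... = SW W (%u' v'. b (u' ** \<epsilon>t k) v') 1[H]"
 proof (rule SW_cong)
  fix u v assume uv: "u el H" "v el H"
  have L: "lin H W (%x. b (u ** x) v)" using uv by (intro lins B)
  show "SW W (%u' v'. \<epsilon> (u' ** k) *[W] b (u ** v') v) 1[H] = b (u ** \<epsilon>t k) v" using lin_counital_SW(1)[OF W L k] by simp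
 qed simp
 finally show "SW W b (\<epsilon>t k) = SW W (%u v. b (u ** \<epsilon>t k) v) 1[H]" .
qed

text \<open>The general element \<open>\<Sum> \<phi>(1\<^sub>2) 1\<^sub>1\<close> of the source subalgebra; both \<open>br k\<close> and
 \<open>\<epsilon>s k\<close> have this form.\<close>

definition src :: "('h => 'k) => 'h"
 where "src \<phi> = SW H (%u v. \<phi> v *[H] u) 1[H]"

text \<open>The mirror image of the formula for target elements: \<open>\<Delta>(s) = 1\<^sub>1 \<otimes> 1\<^sub>2 s = 1\<^sub>1 \<otimes> s
 1\<^sub>2\<close> for \<open>s\<close> in the source subalgebra.\<close>

lemma SW_source:
 assumes W: "vs W" and b: "bilin H H W b" and \<phi>: "lin H KK \<phi>"
 shows "SW W b (src \<phi>) = SW W (%u v. b u (v ** src \<phi>)) 1[H]"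
  and "SW W b (src \<phi>) = SW W (%u v. b u (src \<phi> ** v)) 1[H]"
proof -
 note B = lin_b1[OF b] lin_b2[OF b]
 note Bc = bilinD(4)[OF b]
 have \<phi>c: "\<phi> h el K" if "h el H" for h using linD(1)[OF \<phi> that] by (simp add: KK)
 have \<phi>l: "lin X KK (%x. \<phi> (f x))" if "lin X H f" for X f by (rule lin_comp[OF that \<phi>])
 have t: "trilin W (%u m v. \<phi> v *[W] b u m)" using W by (intro trilinI lins B \<phi>l; simp add: Bc \<phi>c)
 have src: "f (src \<phi>) = SW W (%u v. \<phi> v *[W] f u) 1[H]" if f: "lin H W f" for f
 proof -
  have "f (src \<phi>) = SW W (%u v. f (\<phi> v *[H] u)) 1[H]" unfolding src_def by (rule SW_lin[OF vsH W f]) (simp_all add: \<phi>c)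
  also have "... = SW W (%u v. \<phi> v *[W] f u) 1[H]" by (rule SW_cong) (simp_all add: linD(3)[OF f] \<phi>c)
  finally show ?thesis .
 qed
 have "SW W b (src \<phi>) = SW W (%u v. SW W (%u1 u2. \<phi> v *[W] b u1 u2) u) 1[H]" unfolding src[OF SW_hlin[OF W b]]
 proof (rule SW_cong)
  fix u v assume uv: "u el H" "v el H"
  have L: "lin W W (%x. \<phi> v *[W] x)" using W uv \<phi>c by (intro lins) simp
  show "\<phi> v *[W] SW W b u = SW W (%v1 v2. \<phi> v *[W] b v1 v2) u" by (rule SW_lin[OF W W L uv(1) Bc])
 qed simp
 also have "... = SW W (%u v. SW W (%v1 v2. \<phi> v2 *[W] b u v1) v) 1[H]" by (rule coassoc3[OF W t]) simp
 finally have *: "SW W b (src \<phi>) = SW W (%u v. SW W (%v1 v2. \<phi> v2 *[W] b u v1) v) 1[H]" .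
 have "SW W b (src \<phi>) = SW W (%u v. SW W (%u' v'. \<phi> v' *[W] b u (v ** u')) 1[H]) 1[H]" unfolding * by (rule comul_one3(1)[OF W t])
 also have "... = SW W (%u v. b u (v ** src \<phi>)) 1[H]"
 proof (rule SW_cong)
  fix u v assume uv: "u el H" "v el H"
  have L: "lin H W (%x. b u (v ** x))" using uv by (intro lins B)
  show "SW W (%u' v'. \<phi> v' *[W] b u (v ** u')) 1[H] = b u (v ** src \<phi>)" using src[OF L] by simp
 qed simp
 finally show "SW W b (src \<phi>) = SW W (%u v. b u (v ** src \<phi>)) 1[H]" .
 have "SW W b (src \<phi>) = SW W (%u v. SW W (%u' v'. \<phi> v' *[W] b u (u' ** v)) 1[H]) 1[H]" unfolding * by (rule comul_one3(2)[OF W t])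
 also have "... = SW W (%u v. b u (src \<phi> ** v)) 1[H]"
 proof (rule SW_cong)
  fix u v assume uv: "u el H" "v el H"
  have L: "lin H W (%x. b u (x ** v))" using uv by (intro lins B)
  show "SW W (%u' v'. \<phi> v' *[W] b u (u' ** v)) 1[H] = b u (src \<phi> ** v)" using src[OF L] by simp
 qed simp
 finally show "SW W b (src \<phi>) = SW W (%u v. b u (src \<phi> ** v)) 1[H]" .
qed

lemma src_br: "k el H ==> br k = src (%v. \<epsilon> (v ** k))" "k el H ==> lin H KK (%v. \<epsilon> (v ** k))"
 by (simp add: src_def br_SW) (intro lins)

lemma src_eps_s: "k el H ==> \<epsilon>s k = src (%v. \<epsilon> (k ** v))" "k el H ==> lin H KK (%v. \<epsilon> (k ** v))"
 by (simp add: src_def eps_s_SW) (intro lins)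

lemma SW_br:
 assumes W: "vs W" and b: "bilin H H W b" and k: "k el H"
 shows "SW W b (br k) = SW W (%u v. b u (v ** br k)) 1[H]"
  and "SW W b (br k) = SW W (%u v. b u (br k ** v)) 1[H]" using SW_source[OF W b src_br(2)[OF k]] by (simp_all add: src_br(1)[OF k])

lemma eps_s_br: "k el H ==> br (\<epsilon>t (\<epsilon>s k)) = \<epsilon>s k"
proof -
 assume k: "k el H"
 have B: "bilin H H H (%u v. \<epsilon> v *[H] u)" by (intro bilinI lins; simp)
 have "\<epsilon>s k = SW H (%u v. \<epsilon> v *[H] u) (\<epsilon>s k)" using counit_SW(2)[OF vsH lin_id, of "\<epsilon>s k"] k by simp
 also have "... = SW H (%u v. \<epsilon> (v ** \<epsilon>s k) *[H] u) 1[H]"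
  using SW_source(1)[OF vsH B src_eps_s(2)[OF k]] by (simp add: src_eps_s(1)[OF k])
 also have "... = br (\<epsilon>s k)" by (rule br_SW[symmetric]) (simp add: k)
 also have "... = br (\<epsilon>t (\<epsilon>s k))" by (rule br_eps_t[symmetric]) (simp add: k)
 finally show ?thesis by simp
qed

lemma SW_mult_one:
 assumes W: "vs W" and b: "bilin H H W b" and h: "h el H"
 shows "SW W (%x1 x2. SW W (%u v. b (x1 ** u) (x2 ** v)) 1[H]) h = SW W b h"
  "SW W (%u v. SW W (%x1 x2. b (u ** x1) (v ** x2)) h) 1[H] = SW W b h"
 using SW_mult[OF W b h, of "1[H]"] SW_mult[OF W b _ h, of "1[H]"] h by simp_all

lemma SW_mult_br:
 assumes W: "vs W" and b: "bilin H H W b" and x: "x el H" and k: "k el H"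
 shows "SW W b (x ** br k) = SW W (%u v. b u (v ** br k)) x"
  and "SW W b (br k ** x) = SW W (%u v. b u (br k ** v)) x"
proof -
 note B = lin_b1[OF b] lin_b2[OF b]
 note Bc = bilinD(4)[OF b]
 have "SW W b (x ** br k) = SW W (%x1 x2. SW W (%y1 y2. b (x1 ** y1) (x2 ** y2)) (br k)) x" by (rule SW_mult[OF W b x]) (simp add: k)
 also have "... = SW W (%x1 x2. SW W (%u v. b (x1 ** u) (x2 ** v ** br k)) 1[H]) x"
 proof (rule SW_cong[OF x])
  fix x1 x2 assume xx: "x1 el H" "x2 el H"
  have b': "bilin H H W (%y1 y2. b (x1 ** y1) (x2 ** y2))" using xx by (intro bilinI lins B; simp)
  show "SW W (%y1 y2. b (x1 ** y1) (x2 ** y2)) (br k) = SW W (%u v. b (x1 ** u) (x2 ** v ** br k)) 1[H]"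
   unfolding SW_br(1)[OF W b' k] by (rule SW_cong) (simp_all add: H_assoc xx k)
 qed
 also have "... = SW W (%u v. b u (v ** br k)) x" by (rule SW_mult_one(1)[OF W _ x]) (use k in "intro bilinI lins B; simp")
 finally show "SW W b (x ** br k) = SW W (%u v. b u (v ** br k)) x" .
 have b2: "bilin H H W (%y1 y2. SW W (%x1 x2. b (y1 ** x1) (y2 ** x2)) x)" using x W by (intro bilinI lins B; simp)
 have "SW W b (br k ** x) = SW W (%y1 y2. SW W (%x1 x2. b (y1 ** x1) (y2 ** x2)) x) (br k)" by (rule SW_mult[OF W b _ x]) (simp add: k)
 also have "... = SW W (%u v. SW W (%x1 x2. b (u ** x1) (br k ** (v ** x2))) x) 1[H]" unfolding SW_br(2)[OF W b2 k]
  by (intro SW_cong) (simp_all add: H_assoc x k)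
 also have "... = SW W (%u v. b u (br k ** v)) x" by (rule SW_mult_one(2)[OF W _ x]) (use k in "intro bilinI lins B; simp")
 finally show "SW W b (br k ** x) = SW W (%u v. b u (br k ** v)) x" .
qed

lemma SW_mult_target:
 assumes W: "vs W" and b: "bilin H H W b" and x: "x el H" and k: "k el H"
 shows "SW W b (x ** \<epsilon>t k) = SW W (%u v. b (u ** \<epsilon>t k) v) x"
proof -
 note B = lin_b1[OF b] lin_b2[OF b]
 have "SW W b (x ** \<epsilon>t k) = SW W (%x1 x2. SW W (%y1 y2. b (x1 ** y1) (x2 ** y2)) (\<epsilon>t k)) x"
  by (rule SW_mult[OF W b x]) (simp add: k)
 also have "... = SW W (%x1 x2. SW W (%u v. b (x1 ** u ** \<epsilon>t k) (x2 ** v)) 1[H]) x"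
 proof (rule SW_cong[OF x])
  fix x1 x2 assume xx: "x1 el H" "x2 el H"
  have b': "bilin H H W (%y1 y2. b (x1 ** y1) (x2 ** y2))" using xx by (intro bilinI lins B; simp)
  show "SW W (%y1 y2. b (x1 ** y1) (x2 ** y2)) (\<epsilon>t k) = SW W (%u v. b (x1 ** u ** \<epsilon>t k) (x2 ** v)) 1[H]"
   unfolding SW_target(2)[OF W b' k] by (rule SW_cong) (simp_all add: H_assoc xx k)
 qed
 also have "... = SW W (%u v. b (u ** \<epsilon>t k) v) x" by (rule SW_mult_one(1)[OF W _ x]) (use k in "intro bilinI lins B; simp")
 finally show ?thesis .
qed

text \<open>The relation \<open>1\<^sub>1 br(k) \<otimes> 1\<^sub>2 = 1\<^sub>1 \<otimes> 1\<^sub>2 \<epsilon>t(k)\<close>, on which the passage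
 between the right action of the base on one factor and its left action on the next depends.\<close>

lemma SW_balance_one:
 assumes W: "vs W" and b: "bilin H H W b" and k: "k el H"
 shows "SW W (%u v. b (u ** br k) v) 1[H] = SW W (%u v. b u (v ** \<epsilon>t k)) 1[H]"
proof -
 note B = lin_b1[OF b] lin_b2[OF b]
 note Bc = bilinD(4)[OF b]
 have 1: "b (u ** br k) v = SW W (%u1 u2. \<epsilon> (u2 ** k) *[W] b u1 v) u" if uv: "u el H" "v el H" for u v
 proof -
  have L: "lin H W (%x. b x v)" using uv by (intro lins B)
  have b': "bilin H H W (%x1 x2. \<epsilon> x2 *[W] b x1 v)" using W uv by (intro bilinI lins B; simp add: Bc)
  have "b (u ** br k) v = SW W (%x1 x2. \<epsilon> x2 *[W] b x1 v) (u ** br k)" using counit_SW(2)[OF W L, of "u ** br k"] uv k by simp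
  also have "... = SW W (%x1 x2. \<epsilon> (x2 ** br k) *[W] b x1 v) u" by (rule SW_mult_br(1)[OF W b' uv(1) k])
  also have "... = SW W (%u1 u2. \<epsilon> (u2 ** k) *[W] b u1 v) u" by (rule SW_cong[OF uv(1)]) (simp add: eps_br k)
  finally show ?thesis .
 qed
 have 2: "b u (v ** \<epsilon>t k) = SW W (%v1 v2. \<epsilon> (v1 ** k) *[W] b u v2) v" if uv: "u el H" "v el H" for u v
 proof -
  have L: "lin H W (%x. b u x)" using uv by (intro lins B)
  have b': "bilin H H W (%x1 x2. \<epsilon> x1 *[W] b u x2)" using W uv by (intro bilinI lins B; simp add: Bc)
  have "b u (v ** \<epsilon>t k) = SW W (%x1 x2. \<epsilon> x1 *[W] b u x2) (v ** \<epsilon>t k)"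
   using counit_SW(1)[OF W L, of "v ** \<epsilon>t k"] uv k by simp
  also have "... = SW W (%x1 x2. \<epsilon> (x1 ** \<epsilon>t k) *[W] b u x2) v" by (rule SW_mult_target[OF W b' uv(2) k])
  also have "... = SW W (%v1 v2. \<epsilon> (v1 ** k) *[W] b u v2) v" by (rule SW_cong[OF uv(2)]) (simp add: eps_eps_t k)
  finally show ?thesis .
 qed
 have t: "trilin W (%u m v. \<epsilon> (m ** k) *[W] b u v)" using W k by (intro trilinI lins B; simp add: Bc)
 have "SW W (%u v. b (u ** br k) v) 1[H] = SW W (%u v. SW W (%u1 u2. \<epsilon> (u2 ** k) *[W] b u1 v) u) 1[H]" by (rule SW_cong) (simp_all add: 1)
 also have "... = SW W (%u v. SW W (%v1 v2. \<epsilon> (v1 ** k) *[W] b u v2) v) 1[H]" by (rule coassoc3[OF W t]) simp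
 also have "... = SW W (%u v. b u (v ** \<epsilon>t k)) 1[H]" by (rule SW_cong) (simp_all add: 2)
 finally show ?thesis .
qed

lemma SW_balance:
 assumes W: "vs W" and b: "bilin H H W b" and k: "k el H" and h: "h el H"
 shows "SW W (%u v. b (u ** br k) v) h = SW W (%u v. b u (v ** \<epsilon>t k)) h"
proof -
 note B = lin_b1[OF b] lin_b2[OF b]
 have "SW W (%u v. b (u ** br k) v) h =
   SW W (%x1 x2. SW W (%u v. b (x1 ** u ** br k) (x2 ** v)) 1[H]) h"
  by (rule SW_mult_one(1)[OF W _ h, symmetric]) (use k in "intro bilinI lins B; simp")
 also have "... = SW W (%x1 x2. SW W (%u v. b (x1 ** u) (x2 ** v ** \<epsilon>t k)) 1[H]) h"
 proof (rule SW_cong[OF h])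
  fix x1 x2 assume xx: "x1 el H" "x2 el H"
  have b': "bilin H H W (%y1 y2. b (x1 ** y1) (x2 ** y2))" using xx by (intro bilinI lins B; simp)
  have "SW W (%u v. b (x1 ** u ** br k) (x2 ** v)) 1[H] =
    SW W (%u v. b (x1 ** (u ** br k)) (x2 ** v)) 1[H]" by (rule SW_cong) (simp_all add: H_assoc xx k)
  also have "... = SW W (%u v. b (x1 ** u) (x2 ** (v ** \<epsilon>t k))) 1[H]" by (rule SW_balance_one[OF W b' k])
  also have "... = SW W (%u v. b (x1 ** u) (x2 ** v ** \<epsilon>t k)) 1[H]" by (rule SW_cong) (simp_all add: H_assoc xx k)
  finally show "SW W (%u v. b (x1 ** u ** br k) (x2 ** v)) 1[H] =
   SW W (%u v. b (x1 ** u) (x2 ** v ** \<epsilon>t k)) 1[H]" .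
 qed
 also have "... = SW W (%u v. b u (v ** \<epsilon>t k)) h" by (rule SW_mult_one(1)[OF W _ h]) (use k in "intro bilinI lins B; simp")
 finally show ?thesis .
qed

text \<open>\<open>\<Sum> br(h\<^sub>2) h\<^sub>1 = h\<close>: expanding \<open>br\<close>, the left side is the counit applied to the second leg of
 \<open>\<Delta>(1) \<Delta>(h) = \<Delta>(h)\<close>.\<close>

lemma SW_br_left:
 assumes W: "vs W" and f: "lin H W f" and h: "h el H"
 shows "SW W (%u v. f (br v ** u)) h = f h"
proof -
 have F: "lin X W (%x. f (g x))" if "lin X H g" for X g by (rule lin_comp[OF that f])
 have B: "bilin H H W (%p q. \<epsilon> q *[W] f p)" using W by (intro bilinI lins F; simp add: linD(1)[OF f])
 have "SW W (%u v. f (br v ** u)) h = SW W (%u v. SW W (%x y. \<epsilon> (y ** v) *[W] f (x ** u)) 1[H]) h"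
 proof (rule SW_cong[OF h])
  fix u v assume uv: "u el H" "v el H"
  show "f (br v ** u) = SW W (%x y. \<epsilon> (y ** v) *[W] f (x ** u)) 1[H]"
   by (rule lin_counital_SW(3)[OF W _ uv(2), of "%x. f (x ** u)"]) (use uv in "intro F lins")
 qed
 also have "... = SW W (%x y. SW W (%u v. \<epsilon> (y ** v) *[W] f (x ** u)) h) 1[H]" by (rule SW_swap[OF W h]) (simp_all add: W linD(1)[OF f])
 also have "... = SW W (%p q. \<epsilon> q *[W] f p) h" by (rule SW_mult_one(2)[OF W B h])
 also have "... = f h" by (rule counit_SW(2)[OF W f h])
 finally show ?thesis .
qed

lemma SW_eps_s:
 assumes W: "vs W" and f: "lin H W f" and h: "h el H"
 shows "SW W (%u v. f (u ** \<epsilon>s v)) h = f h"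
proof -
 have F: "lin X W (%x. f (g x))" if "lin X H g" for X g by (rule lin_comp[OF that f])
 have B: "bilin H H W (%p q. \<epsilon> q *[W] f p)" using W by (intro bilinI lins F; simp add: linD(1)[OF f])
 have "SW W (%u v. f (u ** \<epsilon>s v)) h = SW W (%u v. SW W (%x y. \<epsilon> (v ** y) *[W] f (u ** x)) 1[H]) h"
 proof (rule SW_cong[OF h])
  fix u v assume uv: "u el H" "v el H"
  show "f (u ** \<epsilon>s v) = SW W (%x y. \<epsilon> (v ** y) *[W] f (u ** x)) 1[H]"
   by (rule lin_counital_SW(2)[OF W _ uv(2), of "%x. f (u ** x)"]) (use uv in "intro F lins")
 qed
 also have "... = SW W (%p q. \<epsilon> q *[W] f p) h" by (rule SW_mult_one(1)[OF W B h])
 also have "... = f h" by (rule counit_SW(2)[OF W f h])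
 finally show ?thesis .
qed

lemma antipode_SW:
 assumes h: "h el H"
 shows "SW H (%u v. u ** anti v) h = \<epsilon>t h" "SW H (%u v. anti u ** v) h = \<epsilon>s h"
  "SW H (%u v. anti u ** \<epsilon>t v) h = anti h"
proof -
 have B: "bilin H H H (%u v. u ** anti v)" "bilin H H H (%u v. anti u ** v)" "bilin H H H (%u v. anti u ** \<epsilon>t v)"
  by (intro bilinI lins; simp)+
 have 1: "SW H (%u v. u ** anti v) h = \<epsilon>t h" "SW H (%u v. anti u ** v) h = \<epsilon>s h" if h: "h el H" for h
  using antipode_t[OF h] antipode_s[OF h] sweedler_SW[OF vsH B(1) h] sweedler_SW[OF vsH B(2) h] by simp_all
 have *: "sweedler K H H (%v1 v2. anti u ** v1 ** anti v2) v = anti u ** \<epsilon>t v"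
  if uv: "u el H" "v el H" for u v
 proof -
  have b: "bilin H H H (%v1 v2. anti u ** v1 ** anti v2)" using uv by (intro bilinI lins; simp)
  have L: "lin H H (%x. anti u ** x)" using uv by (intro lins) simp
  have "sweedler K H H (%v1 v2. anti u ** v1 ** anti v2) v = SW H (%v1 v2. anti u ** (v1 ** anti v2)) v"
   unfolding sweedler_SW[OF vsH b uv(2)] by (rule SW_cong[OF uv(2)]) (simp add: H_assoc uv)
  also have "... = anti u ** SW H (%v1 v2. v1 ** anti v2) v" by (rule SW_lin[OF vsH vsH L uv(2), symmetric]) simp
  finally show ?thesis using 1 uv by simp
 qed
 have B': "bilin H H H (%u v. sweedler K H H (%v1 v2. anti u ** v1 ** anti v2) v)" using B(3) unfolding bilin_def lin_hom_def by (simp add: * Pi_iff)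
 have "anti h = SW H (%u v. sweedler K H H (%v1 v2. anti u ** v1 ** anti v2) v) h" using antipode_3[OF h] sweedler_SW[OF vsH B' h] by simp
 also have "... = SW H (%u v. anti u ** \<epsilon>t v) h" by (rule SW_cong[OF h]) (rule *)
 finally show "SW H (%u v. anti u ** \<epsilon>t v) h = anti h" by simp
 show "SW H (%u v. u ** anti v) h = \<epsilon>t h" "SW H (%u v. anti u ** v) h = \<epsilon>s h" by (rule 1[OF h])+
qed

lemma eps_t_br:
 assumes x: "x el H" and k: "k el H"
 shows "\<epsilon>t (br k ** x) = \<epsilon>t x ** \<epsilon>t k"
proof -
  have b: "bilin H H H (%p q. \<epsilon> (p ** x) *[H] q)" using x by (intro bilinI lins; simp)
  have L: "lin H H (%y. y ** \<epsilon>t k)" using k by (intro lins) simp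
  have "\<epsilon>t (br k ** x) = SW H (%u v. \<epsilon> (u ** br k ** x) *[H] v) 1[H]"
   using x k by (simp add: eps_t_SW) (rule SW_cong; simp add: H_assoc)
  also have "... = SW H (%u v. \<epsilon> (u ** x) *[H] (v ** \<epsilon>t k)) 1[H]" by (rule SW_balance_one[OF vsH b k])
  also have "... = \<epsilon>t x ** \<epsilon>t k" using lin_counital_SW(1)[OF vsH L x] by simp
  finally show ?thesis .
qed

text \<open>The antipode axioms give \<open>anti(x) = \<Sum> anti(x\<^sub>1) \<epsilon>t(x\<^sub>2)\<close>, and a source element multiplied from the
 left moves into the second leg, where \<open>\<epsilon>t\<close> turns it into a target element on the right.\<close>

lemma antipode_br:
 assumes x: "x el H" and k: "k el H"
 shows "anti (br k ** x) = anti x ** \<epsilon>t k"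
proof -
 have b: "bilin H H H (%u v. anti u ** \<epsilon>t v)" by (intro bilinI lins; simp)
 have L: "lin H H (%y. y ** \<epsilon>t k)" using k by (intro lins) simp
 have "anti (br k ** x) = SW H (%u v. anti u ** \<epsilon>t v) (br k ** x)" using antipode_SW(3)[of "br k ** x"] x k by simp
 also have "... = SW H (%u v. anti u ** \<epsilon>t (br k ** v)) x" by (rule SW_mult_br(2)[OF vsH b x k])
 also have "... = SW H (%u v. anti u ** \<epsilon>t v ** \<epsilon>t k) x" by (rule SW_cong[OF x]) (simp add: eps_t_br H_assoc k)
 also have "... = SW H (%u v. anti u ** \<epsilon>t v) x ** \<epsilon>t k" by (rule SW_lin[OF vsH vsH L x, symmetric]) simp
 finally show ?thesis by (simp add: antipode_SW(3)[OF x])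
qed

lemma eps_t_mult:
 assumes x: "x el H" and k: "k el H"
 shows "\<epsilon>t (\<epsilon>t x ** \<epsilon>t k) = \<epsilon>t x ** \<epsilon>t k"
proof -
 let ?w = "\<epsilon>t x ** \<epsilon>t k"
 have w: "?w el H" using x k by simp
 have b: "bilin H H H (%u v. \<epsilon> u *[H] v)" by (intro bilinI lins; simp)
 have b': "bilin H H H (%u v. \<epsilon> (u ** \<epsilon>t k) *[H] v)" using k by (intro bilinI lins; simp)
 have "?w = SW H (%u v. \<epsilon> u *[H] v) ?w" using counit_SW(1)[OF vsH lin_id w] by simp
 also have "... = SW H (%u v. \<epsilon> (u ** \<epsilon>t k) *[H] v) (\<epsilon>t x)" by (rule SW_mult_target[OF vsH b _ k]) (simp add: x)
 also have "... = SW H (%u v. \<epsilon> (u ** \<epsilon>t x ** \<epsilon>t k) *[H] v) 1[H]" by (rule SW_target(2)[OF vsH b' x])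
 also have "... = \<epsilon>t ?w" unfolding eps_t_SW[OF w] by (rule SW_cong) (simp_all add: H_assoc x k)
 finally show ?thesis by simp
qed

end

section \<open>Modules over a weak Hopf algebra and their tensor product\<close>

text \<open>The type \<open>'u\<close> is the universe of carriers. Being infinite and no smaller than \<open>H\<close>, it has room for the tensor
 products, quotients and free modules formed below.\<close>

locale hmods = weak_hopf_algebra K H for K :: "'k ring" and H :: "('k, 'h) weak_hopf" +
 fixes U :: "'u itself"
 assumes inf_u: "infinite (UNIV :: 'u set)"
  and size_H: "\<exists>j :: 'h => 'u. inj_on j (carrier H)"
begin

abbreviation hm :: "('k, 'h, 'v) hmod => bool" where "hm M \<equiv> is_hmod K H M"

lemma hmD:
 assumes "hm M"
 shows hm_vs: "vs M" and "h el H ==> lin M M (act M h)"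
  and "m el M ==> lin H M (%h. act M h m)"
  and "m el M ==> act M 1[H] m = m"
  and "g el H ==> h el H ==> m el M ==> act M (g ** h) m = act M g (act M h m)" using assms by (simp_all add: is_hmod_def)

lemma act_closed [simp]: "hm M ==> h el H ==> m el M ==> act M h m el M"
 using linD(1)[OF hmD(2)] .

lemma lin_act [lins]:
 "hm M ==> m el M ==> lin X H f ==> lin X M (%x. act M (f x) m)"
 "hm M ==> h el H ==> lin X M g ==> lin X M (%x. act M h (g x))"
 by (erule lin_comp[OF _ hmD(3)], assumption+) (erule lin_comp[OF _ hmD(2)], assumption+)

text \<open>The bilinear form of an arrow out of \<open>M \<otimes> N\<close>: balanced over the base algebra, and equivariant in the sense \<open>h
 b(m, n) = \<Sum> b(h\<^sub>1 m, h\<^sub>2 n)\<close>.\<close>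

definition hpairing :: "('k, 'h, 'm) hmod => ('k, 'h, 'n) hmod => ('k, 'h, 'w) hmod => ('m => 'n => 'w) => bool"
 where "hpairing M N W b \<longleftrightarrow> bilin M N W b \<and>
  (\<forall>k\<in>carrier H. \<forall>m\<in>carrier M. \<forall>n\<in>carrier N. b (act M (br k) m) n = b m (act N (\<epsilon>t k) n)) \<and>
  (\<forall>h\<in>carrier H. \<forall>m\<in>carrier M. \<forall>n\<in>carrier N. act W h (b m n) = SW W (%u v. b (act M u m) (act N v n)) h)"

lemma hpairingI:
 "bilin M N W b ==>
 (!!k m n. k el H ==> m el M ==> n el N ==> b (act M (br k) m) n = b m (act N (\<epsilon>t k) n)) ==>
 (!!h m n. h el H ==> m el M ==> n el N ==>
  act W h (b m n) = SW W (%u v. b (act M u m) (act N v n)) h) ==> hpairing M N W b" by (simp add: hpairing_def)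

lemma hpD:
 assumes "hpairing M N W b"
 shows "bilin M N W b"
  and "k el H ==> m el M ==> n el N ==> b (act M (br k) m) n = b m (act N (\<epsilon>t k) n)"
  and "h el H ==> m el M ==> n el N ==>
   act W h (b m n) = SW W (%u v. b (act M u m) (act N v n)) h"
  and "m el M ==> n el N ==> b m n el W" using assms bilinD(4)[of M N W b] by (simp_all add: hpairing_def)

text \<open>The base acts on a tensor product from the left through the first factor, since a target element comultiplies with all of itself in the
 first leg.\<close>

lemma hp_target:
 assumes hm: "hm M" "hm N" "hm W" and b: "hpairing M N W b"
  and k: "k el H" and m: "m el M" and n: "n el N"
 shows "act W (\<epsilon>t k) (b m n) = b (act M (\<epsilon>t k) m) n"
proof -
 note v = hm_vs[OF hm(1)] hm_vs[OF hm(2)] hm_vs[OF hm(3)]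
 note B = lin_b1[OF hpD(1)[OF b]] lin_b2[OF hpD(1)[OF b]]
 have b': "bilin H H W (%u v. b (act M u m) (act N v n))" using hm m n by (intro bilinI lins B; simp)
 have "act W (\<epsilon>t k) (b m n) = SW W (%u v. b (act M u m) (act N v n)) (\<epsilon>t k)" by (rule hpD(3)[OF b]) (use k m n in simp_all)
 also have "... = SW W (%u v. b (act M (u ** \<epsilon>t k) m) (act N v n)) 1[H]" by (rule SW_target(2)[OF v(3) b' k])
 also have "... = SW W (%u v. b (act M u (act M (\<epsilon>t k) m)) (act N v n)) 1[H]" by (rule SW_cong) (use k m hmD(5)[OF hm(1)] in simp_all)
 also have "... = act W 1[H] (b (act M (\<epsilon>t k) m) n)" by (rule hpD(3)[OF b, symmetric]) (use k m n hm in simp_all)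
 finally show ?thesis using hmD(4)[OF hm(3)] hpD(4)[OF b] k m n hm by simp
qed

text \<open>Likewise the right action of the base is that on the second factor.\<close>

lemma hp_source:
 assumes hm: "hm M" "hm N" "hm W" and b: "hpairing M N W b"
  and k: "k el H" and m: "m el M" and n: "n el N"
 shows "act W (br k) (b m n) = b m (act N (br k) n)"
proof -
 note v = hm_vs[OF hm(1)] hm_vs[OF hm(2)] hm_vs[OF hm(3)]
 note B = lin_b1[OF hpD(1)[OF b]] lin_b2[OF hpD(1)[OF b]]
 have b': "bilin H H W (%u v. b (act M u m) (act N v n))" using hm m n by (intro bilinI lins B; simp)
 have "act W (br k) (b m n) = SW W (%u v. b (act M u m) (act N v n)) (br k)" by (rule hpD(3)[OF b]) (use k m n in simp_all)
 also have "... = SW W (%u v. b (act M u m) (act N (v ** br k) n)) 1[H]" by (rule SW_br(1)[OF v(3) b' k])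
 also have "... = SW W (%u v. b (act M u m) (act N v (act N (br k) n))) 1[H]" by (rule SW_cong) (use k n hmD(5)[OF hm(2)] in simp_all)
 also have "... = act W 1[H] (b m (act N (br k) n))" by (rule hpD(3)[OF b, symmetric]) (use k m n hm in simp_all)
 finally show ?thesis using hmD(4)[OF hm(3)] hpD(4)[OF b] k m n hm by simp
qed

text \<open>The untwisting identity \<open>\<Sum> h\<^sub>1 (m \<otimes> anti(h\<^sub>2) n) = h m \<otimes> n\<close>: coassociativity produces
 \<open>h\<^sub>2 anti(h\<^sub>3) = \<epsilon>t(h\<^sub>2)\<close>, which is balanced over to the first factor as \<open>br(h\<^sub>2)
 h\<^sub>1\<close>.\<close>

lemma hp_antipode:
 assumes hm: "hm M" "hm N" "hm W" and b: "hpairing M N W b"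
  and h: "h el H" and m: "m el M" and n: "n el N"
 shows "SW W (%u v. act W u (b m (act N (anti v) n))) h = b (act M h m) n"
proof -
 note v = hm_vs[OF hm(1)] hm_vs[OF hm(2)] hm_vs[OF hm(3)]
 note B = lin_b1[OF hpD(1)[OF b]] lin_b2[OF hpD(1)[OF b]]
 note Bc = hpD(4)[OF b]
 have t: "trilin W (%u1 u2 v. b (act M u1 m) (act N u2 (act N (anti v) n)))" using hm m n by (intro trilinI lins B; simp)
 have f: "lin H W (%x. b (act M x m) n)" using hm m n by (intro lins B)
 have "SW W (%u v. act W u (b m (act N (anti v) n))) h =
   SW W (%u v. SW W (%u1 u2. b (act M u1 m) (act N u2 (act N (anti v) n))) u) h" by (rule SW_cong[OF h]) (simp add: hpD(3)[OF b] hm m n)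
 also have "... = SW W (%u v. SW W (%v1 v2. b (act M u m) (act N v1 (act N (anti v2) n))) v) h" by (rule coassoc3[OF v(3) t h])
 also have "... = SW W (%u v. b (act M (br v ** u) m) n) h"
 proof (rule SW_cong[OF h])
  fix u v' assume uv: "u el H" "v' el H"
  have L: "lin H W (%x. b (act M u m) (act N x n))" using hm m n uv by (intro lins B) simp_all
  have "SW W (%v1 v2. b (act M u m) (act N v1 (act N (anti v2) n))) v' =
    SW W (%v1 v2. b (act M u m) (act N (v1 ** anti v2) n)) v'" by (rule SW_cong[OF uv(2)]) (simp add: hmD(5)[OF hm(2)] n)
  also have "... = b (act M u m) (act N (SW H (%v1 v2. v1 ** anti v2) v') n)" by (rule SW_lin[OF vsH v(3) L uv(2), symmetric]) simp
  also have "... = b (act M (br v') (act M u m)) n" using hpD(2)[OF b] uv hm m n by (simp add: antipode_SW(1))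
  also have "... = b (act M (br v' ** u) m) n" using uv m by (simp add: hmD(5)[OF hm(1)])
  finally show "SW W (%v1 v2. b (act M u m) (act N v1 (act N (anti v2) n))) v' = b (act M (br v' ** u) m) n" .
 qed
 also have "... = b (act M h m) n" by (rule SW_br_left[OF v(3) f h])
 finally show ?thesis .
qed

definition hlin :: "('k, 'h, 'm) hmod => ('k, 'h, 'n) hmod => ('m => 'n) => bool"
 where "hlin M N f \<longleftrightarrow> lin M N f \<and> (\<forall>h\<in>carrier H. \<forall>m\<in>carrier M. f (act M h m) = act N h (f m))"

lemma hlinI: "lin M N f ==> (!!h m. h el H ==> m el M ==> f (act M h m) = act N h (f m)) ==> hlin M N f"
 by (simp add: hlin_def)

lemma hlinD:
 assumes "hlin M N f"
 shows "lin M N f" "h el H ==> m el M ==> f (act M h m) = act N h (f m)"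
  "m el M ==> f m el N" using assms linD(1)[of f M N] by (simp_all add: hlin_def)

lemma hpairing_comp:
 assumes hm: "hm M" "hm N" "hm M'" "hm N'" "hm W" "hm W'" and b: "hpairing M N W b"
  and f: "hlin M' M f" and g: "hlin N' N g" and e: "hlin W W' e"
 shows "hpairing M' N' W' (%m n. e (b (f m) (g n)))"
proof (rule hpairingI)
 show "bilin M' N' W' (%m n. e (b (f m) (g n)))" by (rule lin_bilin[OF bilin_comp[OF hpD(1)[OF b] hlinD(1)[OF f] hlinD(1)[OF g]] hlinD(1)[OF e]])
 fix k m n assume k: "k el H" and m: "m el M'" and n: "n el N'"
 show "e (b (f (act M' (br k) m)) (g n)) = e (b (f m) (g (act N' (\<epsilon>t k) n)))" using k m n by (simp add: hlinD[OF f] hlinD[OF g] hpD(2)[OF b])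
 have "act W' k (e (b (f m) (g n))) = e (SW W (%u v. b (act M u (f m)) (act N v (g n))) k)"
  using k m n by (simp add: hlinD[OF f] hlinD[OF g] hpD[OF b] hlinD(2)[OF e, symmetric])
 also have "... = SW W' (%u v. e (b (act M u (f m)) (act N v (g n)))) k" by (rule SW_lin[OF hm_vs[OF hm(5)] hm_vs[OF hm(6)] hlinD(1)[OF e] k])
   (use m n in "simp add: hpD(4)[OF b] hm hlinD(3)[OF f] hlinD(3)[OF g]")
 also have "... = SW W' (%u v. e (b (f (act M' u m)) (g (act N' v n)))) k" by (rule SW_cong[OF k]) (simp add: hlinD(2)[OF f] hlinD(2)[OF g] m n)
 finally show "act W' k (e (b (f m) (g n))) = SW W' (%u v. e (b (f (act M' u m)) (g (act N' v n)))) k" .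
qed

lemma hlin_id: "hlin M M (%x. x)" by (simp add: hlin_def lin_id)

text \<open>Equivariance of the induced linear map may be tested on pure tensors.\<close>

lemma tensor_hlin:
 assumes T: "tensor_by K bal M N Q p" and hm: "hm M" "hm N" "hm Q" "hm W"
  and p: "hpairing M N Q p" and b: "hpairing M N W b"
  and f: "lin Q W f" "!!m n. m el M ==> n el N ==> f (p m n) = b m n"
 shows "hlin Q W f"
proof (rule hlinI[OF f(1)])
 note v = hm_vs[OF hm(3)] hm_vs[OF hm(4)]
 fix h x assume h: "h el H" and x: "x el Q"
 have L: "lin Q W (%x. f (act Q h x))" "lin Q W (%x. act W h (f x))"
  by (rule lin_comp[OF hmD(2)[OF hm(3) h] f(1)], rule lin_comp[OF f(1) hmD(2)[OF hm(4) h]])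
 show "f (act Q h x) = act W h (f x)"
 proof (rule tensor_by.ext[OF T v(2) L _ x])
  fix m n assume m: "m el M" and n: "n el N"
  have "f (act Q h (p m n)) = SW W (%u v. f (p (act M u m) (act N v n))) h" unfolding hpD(3)[OF p h m n]
   by (rule SW_lin[OF v f(1) h]) (simp add: hpD(4)[OF p] hm m n)
  also have "... = SW W (%u v. b (act M u m) (act N v n)) h" by (rule SW_cong[OF h]) (simp add: f(2) hm m n)
  also have "... = act W h (f (p m n))" by (simp add: f(2) m n hpD(3)[OF b h])
  finally show "f (act Q h (p m n)) = act W h (f (p m n))" .
 qed
qed

text \<open>An action on the left factor induces one on the tensor product, equivariantly, provided it respects the balancing relations. Linearity in
 the acting element is what the parametrised lift is for.\<close>

lemma left_ext:
 assumes T: "tensor_by K bal M N Q p" and hm: "hm M" "hm N" "hm Q" "hm X"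
  and p: "hpairing M N Q p" and l: "hpairing X M M l"
  and c: "!!\<rho> l' a m n. (\<rho>, l') \<in> bal ==> a el X ==> m el M ==> n el N ==>
   p (l a (\<rho> m)) n = p (l a m) (l' n)"
 obtains l' where "hpairing X Q Q l'"
  "!!a m n. a el X ==> m el M ==> n el N ==> l' a (p m n) = p (l a m) n"
proof -
 note v = hm_vs[OF hm(1)] hm_vs[OF hm(2)] hm_vs[OF hm(3)] hm_vs[OF hm(4)]
 note P = hpD[OF p] and L = hpD[OF l]
 note PB = lin_b1[OF P(1)] lin_b2[OF P(1)]
 note LB = lin_b1[OF L(1)] lin_b2[OF L(1)]
 have 1: "bilin M N Q (%m n. p (l a m) n)" if "a el X" for a using that by (intro bilinI PB LB lins; simp add: L)
 have 2: "balanced bal M N (%m n. p (l a m) n)" if "a el X" for a using c that by (simp add: balanced_def)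
 have 3: "lin X Q (%a. p (l a m) n)" if "m el M" "n el N" for m n using that by (intro PB LB lins)
 obtain l' where l': "bilin X Q Q l'"
  "!!a m n. a el X ==> m el M ==> n el N ==> l' a (p m n) = p (l a m) n"
  by (rule tensor_by.param_lift[OF T v(3) 1 2 v(4) 3], assumption+, rule that, assumption+) 
 note LB' = lin_b1[OF l'(1)] lin_b2[OF l'(1)]
 have "hpairing X Q Q l'"
 proof (rule hpairingI[OF l'(1)])
  fix k a x assume k: "k el H" and a: "a el X" and x: "x el Q"
  show "l' (act X (br k) a) x = l' a (act Q (\<epsilon>t k) x)"
  proof (rule tensor_by.ext[OF T v(3) _ _ _ x])
   fix m n assume m: "m el M" and n: "n el N"
   show "l' (act X (br k) a) (p m n) = l' a (act Q (\<epsilon>t k) (p m n))" using k a m n hm by (simp add: l'(2) L(2) hp_target[OF hm(1-3) p])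
  qed (use k a hm in "(intro LB' lins; simp)+")
 next
  fix h a x assume h: "h el H" and a: "a el X" and x: "x el Q"
  show "act Q h (l' a x) = SW Q (%u v. l' (act X u a) (act Q v x)) h"
  proof (rule tensor_by.ext[OF T v(3) _ _ _ x])
   fix m n assume m: "m el M" and n: "n el N"
   have t: "trilin Q (%u1 u2 v. p (l (act X u1 a) (act M u2 m)) (act N v n))" using hm a m n by (intro trilinI PB LB lins; simp add: L)
   have "act Q h (l' a (p m n)) = SW Q (%u v. p (act M u (l a m)) (act N v n)) h" using h a m n by (simp add: l'(2) P(3) L(4))
   also have "... = SW Q (%u v. SW Q (%u1 u2. p (l (act X u1 a) (act M u2 m)) (act N v n)) u) h"
   proof (rule SW_cong[OF h])
    fix u w assume uw: "u el H" "w el H"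
    have Lp: "lin M Q (%x. p x (act N w n))" using uw n hm by (intro PB lins) simp
    show "p (act M u (l a m)) (act N w n) = SW Q (%u1 u2. p (l (act X u1 a) (act M u2 m)) (act N w n)) u" unfolding L(3)[OF uw(1) a m]
     by (rule SW_lin[OF v(1,3) Lp uw(1)]) (simp add: L hm a m)
   qed
   also have "... = SW Q (%u v. SW Q (%v1 v2. p (l (act X u a) (act M v1 m)) (act N v2 n)) v) h" by (rule coassoc3[OF v(3) t h])
   also have "... = SW Q (%u v. l' (act X u a) (act Q v (p m n))) h"
   proof (rule SW_cong[OF h])
    fix u w assume uw: "u el H" "w el H"
    have Lp: "lin Q Q (%x. l' (act X u a) x)" using uw a hm by (intro LB' lins) simp
    have "l' (act X u a) (act Q w (p m n)) = SW Q (%v1 v2. l' (act X u a) (p (act M v1 m) (act N v2 n))) w" unfolding P(3)[OF uw(2) m n]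
     by (rule SW_lin[OF v(3,3) Lp uw(2)]) (simp add: P hm m n)
    also have "... = SW Q (%v1 v2. p (l (act X u a) (act M v1 m)) (act N v2 n)) w" by (rule SW_cong[OF uw(2)]) (simp add: l'(2) hm m n a uw)
    finally show "SW Q (%v1 v2. p (l (act X u a) (act M v1 m)) (act N v2 n)) w = l' (act X u a) (act Q w (p m n))" by simp
   qed
   finally show "act Q h (l' a (p m n)) = SW Q (%u v. l' (act X u a) (act Q v (p m n))) h" .
  qed (use h a hm v in "(intro LB' lins; simp)+")
 qed
 then show ?thesis using l'(2) by (rule that)
qed

lemma right_ext:
 assumes T: "tensor_by K bal M N Q p" and hm: "hm M" "hm N" "hm Q" "hm X"
  and p: "hpairing M N Q p" and r: "hpairing N X N r"
  and c: "!!\<rho> l' a m n. (\<rho>, l') \<in> bal ==> a el X ==> m el M ==> n el N ==>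
   p (\<rho> m) (r n a) = p m (r (l' n) a)"
 obtains r' where "hpairing Q X Q r'"
  "!!a m n. a el X ==> m el M ==> n el N ==> r' (p m n) a = p m (r n a)"
proof -
 note v = hm_vs[OF hm(1)] hm_vs[OF hm(2)] hm_vs[OF hm(3)] hm_vs[OF hm(4)]
 note P = hpD[OF p] and R = hpD[OF r]
 note PB = lin_b1[OF P(1)] lin_b2[OF P(1)]
 note RB = lin_b1[OF R(1)] lin_b2[OF R(1)]
 have 1: "bilin M N Q (%m n. p m (r n a))" if "a el X" for a using that by (intro bilinI PB RB lins; simp add: R)
 have 2: "balanced bal M N (%m n. p m (r n a))" if "a el X" for a using c that by (simp add: balanced_def)
 have 3: "lin X Q (%a. p m (r n a))" if "m el M" "n el N" for m n using that by (intro PB RB lins)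
 obtain r'' where r'': "bilin X Q Q r''"
  "!!a m n. a el X ==> m el M ==> n el N ==> r'' a (p m n) = p m (r n a)"
  by (rule tensor_by.param_lift[OF T v(3) 1 2 v(4) 3], assumption+, rule that, assumption+) 
 define r' where "r' x a = r'' a x" for x a
 have r': "bilin Q X Q r'"
  "!!a m n. a el X ==> m el M ==> n el N ==> r' (p m n) a = p m (r n a)" using bilin_flip[OF r''(1)] r''(2) by (simp_all add: r'_def[abs_def])
 note RB' = lin_b1[OF r'(1)] lin_b2[OF r'(1)]
 have "hpairing Q X Q r'"
 proof (rule hpairingI[OF r'(1)])
  fix k a x assume k: "k el H" and a: "a el X" and x: "x el Q"
  show "r' (act Q (br k) x) a = r' x (act X (\<epsilon>t k) a)"
  proof (rule tensor_by.ext[OF T v(3) _ _ _ x])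
   fix m n assume m: "m el M" and n: "n el N"
   show "r' (act Q (br k) (p m n)) a = r' (p m n) (act X (\<epsilon>t k) a)" using k a m n hm by (simp add: r'(2) R(2) hp_source[OF hm(1-3) p])
  qed (use k a hm in "(intro RB' lins; simp)+")
 next
  fix h a x assume h: "h el H" and x: "x el Q" and a: "a el X"
  show "act Q h (r' x a) = SW Q (%u v. r' (act Q u x) (act X v a)) h"
  proof (rule tensor_by.ext[OF T v(3) _ _ _ x])
   fix m n assume m: "m el M" and n: "n el N"
   have t: "trilin Q (%u v1 v2. p (act M u m) (r (act N v1 n) (act X v2 a)))" using hm a m n by (intro trilinI PB RB lins; simp add: R)
   have "SW Q (%u v. r' (act Q u (p m n)) (act X v a)) h =
     SW Q (%u v. SW Q (%u1 u2. p (act M u1 m) (r (act N u2 n) (act X v a))) u) h"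
   proof (rule SW_cong[OF h])
    fix u w assume uw: "u el H" "w el H"
    have Lp: "lin Q Q (%x. r' x (act X w a))" using uw a hm by (intro RB' lins) simp
    have "r' (act Q u (p m n)) (act X w a) = SW Q (%u1 u2. r' (p (act M u1 m) (act N u2 n)) (act X w a)) u" unfolding P(3)[OF uw(1) m n]
     by (rule SW_lin[OF v(3,3) Lp uw(1)]) (simp add: P hm m n)
    also have "... = SW Q (%u1 u2. p (act M u1 m) (r (act N u2 n) (act X w a))) u" by (rule SW_cong[OF uw(1)]) (simp add: r'(2) hm m n a uw)
    finally show "r' (act Q u (p m n)) (act X w a) = SW Q (%u1 u2. p (act M u1 m) (r (act N u2 n) (act X w a))) u" .
   qed
   also have "... = SW Q (%u v. SW Q (%v1 v2. p (act M u m) (r (act N v1 n) (act X v2 a))) v) h" by (rule coassoc3[OF v(3) t h])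
   also have "... = SW Q (%u v. p (act M u m) (act N v (r n a))) h"
   proof (rule SW_cong[OF h])
    fix u w assume uw: "u el H" "w el H"
    have Lp: "lin N Q (%x. p (act M u m) x)" using uw m hm by (intro PB lins) simp
    show "SW Q (%v1 v2. p (act M u m) (r (act N v1 n) (act X v2 a))) w = p (act M u m) (act N w (r n a))" unfolding R(3)[OF uw(2) n a]
     by (rule SW_lin[OF v(2,3) Lp uw(2), symmetric]) (simp add: R hm a n)
   qed
   also have "... = act Q h (r' (p m n) a)" using h a m n by (simp add: r'(2) P(3) R(4))
   finally show "act Q h (r' (p m n) a) = SW Q (%u v. r' (act Q u (p m n)) (act X v a)) h" by simp
  qed (use h a hm v in "(intro RB' lins; simp)+")
 qed
 then show ?thesis using r'(2) by (rule that)
qed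

text \<open>The diagonal action is well defined on a balanced tensor product when the relations include those over the base, without which
 \<open>1\<close> would act as the projection \<open>\<Delta>(1)\<close>, and are compatible with the action of \<open>H\<close>.\<close>

definition dten :: "(('m => 'm) \<times> ('n => 'n)) set => ('k, 'h, 'm) hmod => ('k, 'h, 'n) hmod => ('k, 'h, 'u) hmod"
 where "dten bal M N = code_mod (tensor K bal M N) (%h. tensor_lift K (tensor K bal M N)
  (%m n. sweedler K H (tensor K bal M N) (%u v. pure_tensor K bal M N (act M u m) (act N v n)) h))"

definition dpure :: "(('m => 'm) \<times> ('n => 'n)) set => ('k, 'h, 'm) hmod => ('k, 'h, 'n) hmod => 'm => 'n => 'u"
 where "dpure bal M N m n = code_in (carrier (tensor K bal M N)) (pure_tensor K bal M N m n)"

lemma dten: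
 fixes M :: "('k, 'h, 'm) hmod" and N :: "('k, 'h, 'n) hmod"
 assumes T: "tensor_data K bal M N" and hm: "hm M" "hm N"
  and inj: "\<exists>f :: 'm => 'u. inj_on f (carrier M)" "\<exists>f :: 'n => 'u. inj_on f (carrier N)"
  and G1: "!!k m n. k el H ==> m el M ==> n el N ==>
   pure_tensor K bal M N (act M (br k) m) n = pure_tensor K bal M N m (act N (\<epsilon>t k) n)"
  and G2: "!!\<rho> l h m n. (\<rho>, l) \<in> bal ==> h el H ==> m el M ==> n el N ==>
   SW (tensor K bal M N) (%u v. pure_tensor K bal M N (act M u (\<rho> m)) (act N v n)) h =
   SW (tensor K bal M N) (%u v. pure_tensor K bal M N (act M u m) (act N v (l n))) h"
 shows dten_hm: "hm (dten bal M N)" and dten_tensor: "tensor_by K bal M N (dten bal M N) (dpure bal M N)"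
  and dten_hp: "hpairing M N (dten bal M N) (dpure bal M N)"
proof -
 let ?T = "tensor K bal M N" and ?p = "pure_tensor K bal M N"
 note vT = tensor_data.ten_vs[OF T] and pb = tensor_data.pt_bilin[OF T]
 note PB = lin_b1[OF pb] lin_b2[OF pb] and Pc = bilinD(4)[OF pb]
 note TT = tensor_data.tensor_by_ten[OF T]
 define B where "B h m n = SW ?T (%u v. ?p (act M u m) (act N v n)) h" for h m n
 define B' where "B' h m n = sweedler K H ?T (%u v. ?p (act M u m) (act N v n)) h" for h m n
 define \<alpha> where "\<alpha> h = tensor_lift K ?T (B' h)" for h
 have BB: "B' h m n = B h m n" if "h el H" "m el M" "n el N" for h m n unfolding B_def B'_def
  by (rule sweedler_SW[OF vT _ that(1)]) (use hm that in "intro bilinI PB lins; simp")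
 have Bc: "B h m n el ?T" if "h el H" "m el M" "n el N" for h m n unfolding B_def using that vT hm Pc by simp
 have Bb: "bilin M N ?T (B h)" if "h el H" for h unfolding B_def[abs_def] using hm vT that by (intro bilinI PB lins; simp)
 have Bb': "bilin M N ?T (B' h)" if h: "h el H" for h using Bb[OF h] hm_vs[OF hm(1)] hm_vs[OF hm(2)] unfolding bilin_def lin_hom_def
  by (simp add: BB[OF h] Pi_iff)
 have Bbal: "balanced bal M N (B h)" if "h el H" for h using G2 that by (simp add: balanced_def B_def)
 have Bbal': "balanced bal M N (B' h)" if "h el H" for h using Bbal[OF that] BB[OF that] tensor_data.bal_M[OF T] tensor_data.bal_N[OF T]
  by (simp add: balanced_def)
 have Bl: "lin H ?T (%h. B h m n)" if "m el M" "n el N" for m n unfolding B_def using that vT hm by (intro bilinI PB lins; simp)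
 have \<alpha>l: "lin ?T ?T (\<alpha> h)" and \<alpha>p: "!!m n. m el M ==> n el N ==> \<alpha> h (?p m n) = B h m n"
  if "h el H" for h unfolding \<alpha>_def using tensor_data.tensor_lift[OF T vT Bb'[OF that] Bbal'[OF that]] BB[OF that] by simp_all
 have \<alpha>c: "\<alpha> h t el ?T" if "h el H" "t el ?T" for h t using linD(1)[OF \<alpha>l] that by blast
 obtain g where g: "bilin H ?T ?T g"
  "!!h m n. h el H ==> m el M ==> n el N ==> g h (?p m n) = B h m n"
  by (rule tensor_by.param_lift[OF TT vT Bb Bbal vsH Bl], assumption+, rule that, assumption+)
 have \<alpha>g: "\<alpha> h t = g h t" if "h el H" "t el ?T" for h t
  by (rule tensor_by.ext[OF TT vT \<alpha>l bilinD(2)[OF g(1)] _ that(2)]) (use that in "simp_all add: \<alpha>p g(2)")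
 have \<alpha>h: "lin H ?T (%h. \<alpha> h t)" if t: "t el ?T" for t
  using bilinD(3)[OF g(1) t] lin_cong[OF _ vsH, of "%h. \<alpha> h t" "%h. g h t" ?T] \<alpha>g[OF _ t] by simp
 have \<alpha>1: "\<alpha> 1[H] t = t" if t: "t el ?T" for t
 proof (rule tensor_by.ext[OF TT vT \<alpha>l lin_id _ t])
  fix m n assume m: "m el M" and n: "n el N"
  have b: "bilin H H ?T (%u v. ?p (act M u m) (act N v n))" using m n hm by (intro bilinI PB lins; simp)
  have f: "lin H ?T (%x. ?p (act M x m) n)" using m n hm by (intro PB lins)
  have "\<alpha> 1[H] (?p m n) = SW ?T (%u v. ?p (act M u m) (act N (\<epsilon>t v) n)) 1[H]"
   using SW_one_right[OF vT b] by (simp add: \<alpha>p m n B_def)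
  also have "... = SW ?T (%u v. ?p (act M (br v ** u) m) n) 1[H]" by (rule SW_cong) (simp_all add: G1[symmetric] hm m n hmD(5)[OF hm(1)])
  also have "... = ?p m n" using SW_br_left[OF vT f, of "1[H]"] m hmD(4)[OF hm(1)] by simp
  finally show "\<alpha> 1[H] (?p m n) = ?p m n" .
 qed simp
 have \<alpha>m: "\<alpha> (g ** h) t = \<alpha> g (\<alpha> h t)" if gh: "g el H" "h el H" and t: "t el ?T" for g h t
 proof (rule tensor_by.ext[OF TT vT \<alpha>l lin_comp[OF \<alpha>l \<alpha>l] _ t])
  fix m n assume m: "m el M" and n: "n el N"
  have b: "bilin H H ?T (%u v. ?p (act M u m) (act N v n))" using m n hm by (intro bilinI PB lins; simp)
  have "\<alpha> (g ** h) (?p m n) =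
    SW ?T (%x y. SW ?T (%u v. ?p (act M (x ** u) m) (act N (y ** v) n)) h) g" using SW_mult[OF vT b gh] gh by (simp add: \<alpha>p m n B_def)
  also have "... = SW ?T (%u v. SW ?T (%x y. ?p (act M (x ** u) m) (act N (y ** v) n)) g) h" by (rule SW_swap[OF vT gh]) (simp add: Pc hm m n)
  also have "... = SW ?T (%u v. \<alpha> g (?p (act M u m) (act N v n))) h"
   by (rule SW_cong[OF gh(2)], simp add: \<alpha>p gh hm m n B_def, rule SW_cong[OF gh(1)])
    (simp add: hmD(5)[OF hm(1)] hmD(5)[OF hm(2)] m n)
  also have "... = \<alpha> g (\<alpha> h (?p m n))" unfolding \<alpha>p[OF gh(2) m n] B_def
   by (rule SW_lin[OF vT vT \<alpha>l[OF gh(1)] gh(2), symmetric]) (simp add: Pc hm m n)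
  finally show "\<alpha> (g ** h) (?p m n) = \<alpha> g (\<alpha> h (?p m n))" .
 qed (use gh in simp_all)
 let ?e = "code_in (carrier ?T) :: _ => 'u" and ?C = "dten bal M N"
 have C: "?C = code_mod ?T \<alpha>" unfolding dten_def \<alpha>_def[abs_def] B'_def[abs_def] ..
 note code = code_mod[OF vT tensor_data.ten_inj[OF T inf_u inj], where \<alpha> = \<alpha>, folded C]
 have im: "carrier ?C = ?e ` carrier ?T" using code(3) by (simp add: bij_betw_def)
 have el: "?e t el ?C" if "t el ?T" for t using linD(1)[OF code(2) that] .
 show hmC: "hm ?C" unfolding is_hmod_def
 proof (intro conjI ballI)
  show "vs ?C" by (rule code(1))
  fix h assume h: "h el H"
  show "lin ?C ?C (act ?C h)"
  proof (rule linI)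
   fix x assume "x el ?C"
   then obtain t where t: "t el ?T" "x = ?e t" using im by blast
   show "act ?C h x el ?C" using t el \<alpha>c h by (simp add: code(4))
   show "act ?C h (x +[?C] y) = act ?C h x +[?C] act ?C h y" if y: "y el ?C" for y
   proof -
    obtain s where s: "s el ?T" "y = ?e s" using im y by blast
    show ?thesis unfolding t s using t s vT \<alpha>c h by (simp add: linD(2)[OF code(2), symmetric] code(4) linD(2)[OF \<alpha>l])
   qed
   show "act ?C h (a *[?C] x) = a *[?C] act ?C h x" if a: "a el K" for a
    unfolding t using t vT \<alpha>c h a by (simp add: linD(3)[OF code(2), symmetric] code(4) linD(3)[OF \<alpha>l])
  qed
 next
  fix x assume "x el ?C"
  then obtain t where t: "t el ?T" "x = ?e t" using im by blast
  have "lin H ?C (%h. ?e (\<alpha> h t))" by (rule lin_comp[OF \<alpha>h[OF t(1)] code(2)])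
  then show "lin H ?C (%h. act ?C h x)" unfolding t by (simp add: code(4) t(1))
  show "act ?C 1[H] x = x" using t by (simp add: code(4) \<alpha>1)
  fix g h assume "g el H" "h el H"
  then show "act ?C (g ** h) x = act ?C g (act ?C h x)" using t by (simp add: code(4) \<alpha>m \<alpha>c)
 qed
 show tb: "tensor_by K bal M N ?C (dpure bal M N)" by (rule tensor_data.tensor_byI[OF T code(1-3)]) (simp add: dpure_def)
 show "hpairing M N ?C (dpure bal M N)"
 proof (rule hpairingI[OF tensor_by.p_bilin[OF tb]])
  fix k m n assume k: "k el H" and m: "m el M" and n: "n el N"
  show "dpure bal M N (act M (br k) m) n = dpure bal M N m (act N (\<epsilon>t k) n)" by (simp add: dpure_def G1 k m n)
  have "act ?C k (dpure bal M N m n) = ?e (SW ?T (%u v. ?p (act M u m) (act N v n)) k)" by (simp add: dpure_def code(4) Pc m n \<alpha>p k B_def)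
  also have "... = SW ?C (%u v. dpure bal M N (act M u m) (act N v n)) k"
   unfolding dpure_def by (rule SW_lin[OF vT code(1,2) k]) (simp add: Pc hm m n)
  finally show "act ?C k (dpure bal M N m n) = SW ?C (%u v. dpure bal M N (act M u m) (act N v n)) k" .
 qed
qed

lemma base_balD: "(\<rho>, l) \<in> base_bal K H M N ==> \<exists>k\<in>carrier H. \<rho> = act M (br k) \<and> l = act N (\<epsilon>t k)"
 by (auto simp: base_bal_def base_alg_def br_eps_t)

lemma base_balI: "k el H ==> (act M (br k), act N (\<epsilon>t k)) \<in> base_bal K H M N"
 unfolding base_bal_def base_alg_def mem_Collect_eq by (intro exI[of _ "\<epsilon>t k"]) (simp add: br_eps_t)

lemma hp_balanced: "hpairing M N W b ==> balanced (base_bal K H M N) M N b"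
 using hpD(2)[of M N W b] base_balD[of _ _ M N] unfolding balanced_def by blast

lemma base_td:
 assumes "hm M" "hm N"
 shows "tensor_data K (base_bal K H M N) M N"
proof (rule tensor_dataI)
 show "\<rho> m el M" if "(\<rho>, l) \<in> base_bal K H M N" "m el M" for \<rho> l m using base_balD[OF that(1)] that(2) assms by auto
 show "l n el N" if "(\<rho>, l) \<in> base_bal K H M N" "n el N" for \<rho> l n using base_balD[OF that(1)] that(2) assms by auto
qed (use assms hm_vs in auto)

lemma htens:
 fixes M N :: "('k, 'h, 'u) hmod"
 assumes hm: "hm M" "hm N"
 shows htens_hm [simp]: "hm (htens K H M N)"
  and htens_tensor: "tensor_by K (base_bal K H M N) M N (htens K H M N) (hpure K H M N)"
  and htens_hp: "hpairing M N (htens K H M N) (hpure K H M N)"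
proof -
 let ?b = "base_bal K H M N"
 note T = base_td[OF hm]
 have e: "htens K H M N = dten ?b M N" "hpure K H M N = dpure ?b M N" by (simp_all add: htens_def dten_def hpure_def dpure_def fun_eq_iff)
 note vT = tensor_data.ten_vs[OF T] and pb = tensor_data.pt_bilin[OF T]
 note PB = lin_b1[OF pb] lin_b2[OF pb]
 have inj: "\<exists>f :: 'u => 'u. inj_on f X" for X by (rule exI[of _ "%x. x"]) simp
 have G1: "pure_tensor K ?b M N (act M (br k) m) n = pure_tensor K ?b M N m (act N (\<epsilon>t k) n)"
  if "k el H" "m el M" "n el N" for k m n using tensor_data.pt_balanced[OF T] base_balI[OF that(1)] that unfolding balanced_def by blast
 have G2: "SW (tensor K ?b M N) (%u v. pure_tensor K ?b M N (act M u (\<rho> m)) (act N v n)) h =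
   SW (tensor K ?b M N) (%u v. pure_tensor K ?b M N (act M u m) (act N v (l n))) h"
  if bal: "(\<rho>, l) \<in> ?b" and h: "h el H" and m: "m el M" and n: "n el N" for \<rho> l h m n
 proof -
  obtain k where k: "k el H" "\<rho> = act M (br k)" "l = act N (\<epsilon>t k)" using base_balD[OF bal] by blast
  have b: "bilin H H (tensor K ?b M N) (%u v. pure_tensor K ?b M N (act M u m) (act N v n))" using hm m n by (intro bilinI PB lins; simp)
  have "SW (tensor K ?b M N) (%u v. pure_tensor K ?b M N (act M u (\<rho> m)) (act N v n)) h =
    SW (tensor K ?b M N) (%u v. pure_tensor K ?b M N (act M (u ** br k) m) (act N v n)) h"
   by (rule SW_cong[OF h]) (simp add: k(2) hmD(5)[OF hm(1)] m k(1))
  also have "... = SW (tensor K ?b M N) (%u v. pure_tensor K ?b M N (act M u m) (act N (v ** \<epsilon>t k) n)) h"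
   by (rule SW_balance[OF vT b k(1) h])
  also have "... = SW (tensor K ?b M N) (%u v. pure_tensor K ?b M N (act M u m) (act N v (l n))) h"
   by (rule SW_cong[OF h]) (simp add: k(3) hmD(5)[OF hm(2)] n k(1))
  finally show ?thesis .
 qed
 show "hm (htens K H M N)" unfolding e by (rule dten_hm[OF T hm inj inj]; (rule G1 G2; assumption))
 show "tensor_by K (base_bal K H M N) M N (htens K H M N) (hpure K H M N)"
  unfolding e by (rule dten_tensor[OF T hm inj inj]; (rule G1 G2; assumption))
 show "hpairing M N (htens K H M N) (hpure K H M N)" unfolding e by (rule dten_hp[OF T hm inj inj]; (rule G1 G2; assumption))
qed

lemma hlift:
 fixes M N :: "('k, 'h, 'u) hmod"
 assumes hm: "hm M" "hm N" and W: "vs W" and b: "bilin M N W b" "balanced (base_bal K H M N) M N b"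
 shows "lin (htens K H M N) W (hlift K H M N W b)"
  "m el M ==> n el N ==> hlift K H M N W b (hpure K H M N m n) = b m n"
proof -
 note T = base_td[OF hm]
 note vT = tensor_data.ten_vs[OF T]
 have inj: "\<exists>f :: 'u => 'u. inj_on f X" for X by (rule exI[of _ "%x. x"]) simp
 note code = code_mod[OF vT tensor_data.ten_inj[OF T inf_u inj inj], folded htens_def]
 note L = tensor_data.tensor_lift[OF T W b]
 let ?e = "code_in (carrier (htens0 K H M N)) :: _ => 'u"
 have i: "lin (htens K H M N) (htens0 K H M N) (inv_into (carrier (htens0 K H M N)) ?e)" unfolding htens_def by (rule lin_inv(1)[OF code(2,3) vT])
 show "lin (htens K H M N) W (hlift K H M N W b)" unfolding hlift_def[abs_def] by (rule lin_comp[OF i L(1)])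
 show "hlift K H M N W b (hpure K H M N m n) = b m n" if "m el M" "n el N"
 proof -
  have "inj_on ?e (carrier (htens0 K H M N))" unfolding code_in_def by (rule someI_ex[OF tensor_data.ten_inj[OF T inf_u inj inj]])
  then show ?thesis using L(2)[OF that] bilinD(4)[OF tensor_data.pt_bilin[OF T] that] by (simp add: hlift_def hpure_def)
 qed
qed

lemma hlift_hlin:
 fixes M N :: "('k, 'h, 'u) hmod" and W :: "('k, 'h, 'u) hmod"
 assumes hm: "hm M" "hm N" "hm W" and b: "hpairing M N W b"
 shows "hlin (htens K H M N) W (hlift K H M N W b)"
 by (rule tensor_hlin[OF htens_tensor[OF hm(1,2)] hm(1,2) htens_hm[OF hm(1,2)] hm(3) htens_hp[OF hm(1,2)] b])
  (use hlift[OF hm(1,2) hm_vs[OF hm(3)] hpD(1)[OF b] hp_balanced[OF b]] in blast)+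


definition mp :: "('k, 'h, 'u) harrow => 'u => 'u" where "mp t = fst (snd t)"

abbreviation CC :: "('k, ('k, 'h, 'u) hmod, ('k, 'h, 'u) harrow) mcat" where "CC \<equiv> HMod K H"

lemma CC_simps: "obj CC = {M. hm M}" "homs CC = hhom K H" "tob CC = htens K H" "unt CC = hunit K H"
 "idn CC M = mk_ar M (%m. m) M" by (simp_all add: HMod_def)

lemma ar_iff: "t \<in> ar CC M N \<longleftrightarrow> t = mk_ar M (mp t) N \<and> hlin M N (mp t)"
proof
 assume "t \<in> ar CC M N"
 then obtain f where "t = (M, f, N)" "f \<in> extensional (carrier M)" "hlin M N f" by (auto simp: CC_simps hhom_def hlin_def)
 then show "t = mk_ar M (mp t) N \<and> hlin M N (mp t)" by (simp add: mp_def mk_ar_def extensional_restrict)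
next
 assume a: "t = mk_ar M (mp t) N \<and> hlin M N (mp t)"
 then have e: "t = (M, restrict (mp t) (carrier M), N)" by (simp add: mk_ar_def)
 have r: "mp t = restrict (mp t) (carrier M)" using arg_cong[OF e, of "%x. fst (snd x)"] by (simp add: mp_def)
 have "mp t \<in> extensional (carrier M)" by (subst r) (rule restrict_extensional)
 moreover have "t = (M, mp t, N)" using e r by (simp only: r[symmetric])
 ultimately show "t \<in> ar CC M N" using a by (force simp: CC_simps hhom_def hlin_def)
qed

lemma arD: "t \<in> ar CC M N ==> hlin M N (mp t)" "t \<in> ar CC M N ==> t = mk_ar M (mp t) N"
 by (auto simp: ar_iff)

lemma ar_closed: "t \<in> ar CC M N ==> m el M ==> mp t m el N"
 using hlinD(3)[OF arD(1)] .

lemma mp_mk [simp]: "m el M ==> mp (mk_ar M f N) m = f m"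
 by (simp add: mp_def mk_ar_def)

lemma mk_ar_eq: "(!!m. m el M ==> f m = g m) ==> mk_ar M f N = mk_ar M g N"
 by (auto simp: mk_ar_def restrict_def)

lemma hlin_cong:
 assumes "hm M" "hlin M N f" "!!m. m el M ==> f m = g m"
 shows "hlin M N g"
proof -
 have "lin M N g" using hlinD(1)[OF assms(2)] lin_cong[of M f g N] assms(3) hm_vs[OF assms(1)] by simp
 then show ?thesis
 proof (rule hlinI)
  fix h m assume a: "h el H" "m el M"
  have "g (act M h m) = f (act M h m)" using assms(1,3) a by simp
  also have "... = act N h (f m)" by (rule hlinD(2)[OF assms(2) a])
  also have "... = act N h (g m)" using assms(3)[OF a(2)] by simp
  finally show "g (act M h m) = act N h (g m)" .
 qed
qed

lemma mk_ar_in: "hm M ==> hlin M N f ==> mk_ar M f N \<in> ar CC M N"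
 unfolding ar_iff by (rule conjI, rule mk_ar_eq, simp, rule hlin_cong[of M N f]) simp_all

lemma ar_eqI:
 assumes "t \<in> ar CC M N" "t' \<in> ar CC M N" "!!m. m el M ==> mp t m = mp t' m"
 shows "t = t'" using arD(2)[OF assms(1)] arD(2)[OF assms(2)] mk_ar_eq[of M "mp t" "mp t'" N] assms(3) by simp

lemma cmp_eq:
 assumes g: "g \<in> ar CC N P" and f: "f \<in> ar CC M N"
 shows "cmp CC g f = mk_ar M (%m. mp g (mp f m)) P"
proof -
 have e: "t = (M, mp t, N)" if t: "t \<in> ar CC M N" for t :: "('k, 'h, 'u) harrow" and M N
 proof -
  obtain x where "t = (M, x, N)" using arD(2)[OF t] unfolding mk_ar_def by blast
  then show ?thesis by (simp add: mp_def)
 qed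
 have "cmp CC g f = cmp CC (N, mp g, P) (M, mp f, N)" by (subst e[OF g], subst e[OF f]) (rule refl)
 then show ?thesis by (simp add: HMod_def)
qed

lemma hlin_comp:
 assumes f: "hlin M N f" and g: "hlin N P g"
 shows "hlin M P (%m. g (f m))" by (rule hlinI[OF lin_comp[OF hlinD(1)[OF f] hlinD(1)[OF g]]])
  (simp add: hlinD(2,3)[OF f] hlinD(2)[OF g])

lemma cmp_in: "hm M ==> g \<in> ar CC N P ==> f \<in> ar CC M N ==> cmp CC g f \<in> ar CC M P"
 by (simp only: cmp_eq) (rule mk_ar_in[OF _ hlin_comp[OF arD(1) arD(1)]])

lemma mp_cmp: "g \<in> ar CC N P ==> f \<in> ar CC M N ==> m el M ==> mp (cmp CC g f) m = mp g (mp f m)"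
 by (simp add: cmp_eq)

lemma idn_in: "hm M ==> idn CC M \<in> ar CC M M"
 unfolding CC_simps(5) by (rule mk_ar_in[OF _ hlin_id])

lemma mp_idn: "m el M ==> mp (idn CC M) m = m"
 by (simp add: CC_simps(5))

lemma tar_eq: "f \<in> ar CC M M' ==> g \<in> ar CC N N' ==> tar CC f g = mk_ar (htens K H M N)
  (hlift K H M N (htens K H M' N') (%m n. hpure K H M' N' (mp f m) (mp g n))) (htens K H M' N')"
 using arD(2)[of f M M'] arD(2)[of g N N'] by (cases f; cases g) (auto simp: HMod_def mk_ar_def mp_def)

lemma tar:
 assumes hm: "hm M" "hm N" "hm M'" "hm N'" and f: "f \<in> ar CC M M'" and g: "g \<in> ar CC N N'"
 shows tar_in: "tar CC f g \<in> ar CC (htens K H M N) (htens K H M' N')"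
  and mp_tar: "m el M ==> n el N ==>
   mp (tar CC f g) (hpure K H M N m n) = hpure K H M' N' (mp f m) (mp g n)"
proof -
 have b: "hpairing M N (htens K H M' N') (%m n. hpure K H M' N' (mp f m) (mp g n))"
  by (rule hpairing_comp[OF hm(3,4,1,2) htens_hm[OF hm(3,4)] htens_hm[OF hm(3,4)] htens_hp[OF hm(3,4)]
     arD(1)[OF f] arD(1)[OF g] hlin_id])
 show "tar CC f g \<in> ar CC (htens K H M N) (htens K H M' N')"
  unfolding tar_eq[OF f g] by (rule mk_ar_in[OF htens_hm[OF hm(1,2)] hlift_hlin[OF hm(1,2) htens_hm[OF hm(3,4)] b]])
 show "mp (tar CC f g) (hpure K H M N m n) = hpure K H M' N' (mp f m) (mp g n)"
  if "m el M" "n el N" unfolding tar_eq[OF f g] using that hm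
  by (simp add: hpD(4)[OF htens_hp] hlift(2)[OF hm(1,2) hm_vs[OF htens_hm[OF hm(3,4)]] hpD(1)[OF b] hp_balanced[OF b]])
qed

definition par :: "('k, 'h, 'u) hmod => ('k, 'h, 'u) hmod => ('k, 'h, 'u) hmod => ('u => 'u => 'u) => ('k, 'h, 'u) harrow"
 where "par M N W b = mk_ar (htens K H M N) (hlift K H M N W b) W"

text \<open>The pairing that belongs to an arrow out of a tensor product; \<open>par\<close> goes the other way.\<close>

definition pmap :: "('k, 'h, 'u) hmod => ('k, 'h, 'u) hmod => ('k, 'h, 'u) harrow => 'u => 'u => 'u"
 where "pmap M N t m n = mp t (hpure K H M N m n)"

lemma par:
 assumes hm: "hm M" "hm N" "hm W" and b: "hpairing M N W b"
 shows par_in: "par M N W b \<in> ar CC (htens K H M N) W"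
  and pmap_par: "m el M ==> n el N ==> pmap M N (par M N W b) m n = b m n"
proof -
 show "par M N W b \<in> ar CC (htens K H M N) W" unfolding par_def by (rule mk_ar_in[OF htens_hm[OF hm(1,2)] hlift_hlin[OF hm b]])
 show "pmap M N (par M N W b) m n = b m n" if "m el M" "n el N" using that hm unfolding pmap_def par_def
  by (simp add: hpD(4)[OF htens_hp] hlift(2)[OF hm(1,2) hm_vs[OF hm(3)] hpD(1)[OF b] hp_balanced[OF b]])
qed

lemma pmap_hp:
 assumes hm: "hm M" "hm N" "hm W" and t: "t \<in> ar CC (htens K H M N) W"
 shows "hpairing M N W (pmap M N t)" unfolding pmap_def[abs_def]
 by (rule hpairing_comp[OF hm(1,2,1,2) htens_hm[OF hm(1,2)] hm(3) htens_hp[OF hm(1,2)] hlin_id hlin_id arD(1)[OF t]])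

lemma tens_ar_eqI:
 assumes hm: "hm M" "hm N" "hm W" and t: "t \<in> ar CC (htens K H M N) W" "t' \<in> ar CC (htens K H M N) W"
  and e: "!!m n. m el M ==> n el N ==> mp t (hpure K H M N m n) = mp t' (hpure K H M N m n)"
 shows "t = t'" by (rule ar_eqI[OF t])
  (rule tensor_by.ext[OF htens_tensor[OF hm(1,2)] hm_vs[OF hm(3)] hlinD(1)[OF arD(1)[OF t(1)]] hlinD(1)[OF arD(1)[OF t(2)]] e])

lemma tens3_ar_eqI:
 assumes hm: "hm M" "hm N" "hm P" "hm W"
  and t: "t \<in> ar CC (htens K H (htens K H M N) P) W" "t' \<in> ar CC (htens K H (htens K H M N) P) W"
  and e: "!!m n p. m el M ==> n el N ==> p el P ==>
   mp t (hpure K H (htens K H M N) P (hpure K H M N m n) p) = mp t' (hpure K H (htens K H M N) P (hpure K H M N m n) p)"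
 shows "t = t'"
proof (rule tens_ar_eqI[OF htens_hm[OF hm(1,2)] hm(3,4) t])
 fix x p assume x: "x el htens K H M N" and p: "p el P"
 let ?q = "%x. hpure K H (htens K H M N) P x p"
 have q: "lin (htens K H M N) (htens K H (htens K H M N) P) ?q" using bilinD(3)[OF hpD(1)[OF htens_hp[OF htens_hm[OF hm(1,2)] hm(3)]] p] .
 show "mp t (?q x) = mp t' (?q x)" by (rule tensor_by.ext[OF htens_tensor[OF hm(1,2)] hm_vs[OF hm(4)] lin_comp[OF q hlinD(1)[OF arD(1)[OF t(1)]]]
   lin_comp[OF q hlinD(1)[OF arD(1)[OF t(2)]]] e[OF _ _ p] x])
qed

lemma asc:
 assumes hm: "hm M" "hm N" "hm P"
 defines "W \<equiv> htens K H M (htens K H N P)"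
 shows asc_in: "asc CC M N P \<in> ar CC (htens K H (htens K H M N) P) W"
  and mp_asc: "m el M ==> n el N ==> p el P ==>
   mp (asc CC M N P) (hpure K H (htens K H M N) P (hpure K H M N m n) p) =
   hpure K H M (htens K H N P) m (hpure K H N P n p)"
proof -
 let ?MN = "htens K H M N" and ?NP = "htens K H N P"
 note hMN = htens_hm[OF hm(1,2)] and hNP = htens_hm[OF hm(2,3)]
 have hW: "hm W" unfolding W_def by (rule htens_hm[OF hm(1) hNP])
 note vW = hm_vs[OF hW]
 note hp1 = htens_hp[OF hm(1) hNP, folded W_def] and hp2 = htens_hp[OF hm(2,3)] and hp3 = htens_hp[OF hm(1,2)]
 note B1 = lin_b1[OF hpD(1)[OF hp1]] lin_b2[OF hpD(1)[OF hp1]]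
 note B2 = lin_b1[OF hpD(1)[OF hp2]] lin_b2[OF hpD(1)[OF hp2]]
 note c = hpD(4)[OF hp1] hpD(4)[OF hp2] hpD(4)[OF hp3]
 define t where "t p m n = hpure K H M ?NP m (hpure K H N P n p)" for p m n
 have tb: "bilin M N W (t p)" if "p el P" for p unfolding t_def[abs_def] using that by (intro bilinI B1 B2 lins; simp add: c)
 have tl: "lin P W (%p. t p m n)" if "m el M" "n el N" for m n unfolding t_def using that by (intro B1 B2 lins)
 have tbal: "balanced (base_bal K H M N) M N (t p)" if p: "p el P" for p unfolding balanced_def
 proof (intro allI impI ballI)
  fix \<rho> l m n assume bal: "(\<rho>, l) \<in> base_bal K H M N" and m: "m el M" and n: "n el N"
  obtain k where k: "k el H" "\<rho> = act M (br k)" "l = act N (\<epsilon>t k)" using base_balD[OF bal] by blast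
  show "t p (\<rho> m) n = t p m (l n)" using p m n k(1) by (simp add: t_def k(2,3) hpD(2)[OF hp1] c hp_target[OF hm(2,3) hNP hp2])
 qed
 define \<beta> where "\<beta> x p = hlift K H M N W (%m n. t p m n) x" for x p
 have \<beta>l: "lin ?MN W (%x. \<beta> x p)" and \<beta>p: "!!m n. m el M ==> n el N ==> \<beta> (hpure K H M N m n) p = t p m n"
  if "p el P" for p unfolding \<beta>_def using hlift[OF hm(1,2) vW tb[OF that] tbal[OF that]] by simp_all
 obtain g where g: "bilin P ?MN W g"
  "!!p m n. p el P ==> m el M ==> n el N ==> g p (hpure K H M N m n) = t p m n"
  by (rule tensor_by.param_lift[OF htens_tensor[OF hm(1,2)] vW tb tbal hm_vs[OF hm(3)] tl], assumption+, rule that, assumption+)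
 have \<beta>g: "\<beta> x p = g p x" if "x el ?MN" "p el P" for x p
  by (rule tensor_by.ext[OF htens_tensor[OF hm(1,2)] vW \<beta>l bilinD(2)[OF g(1)] _ that(1)])
   (use that in "simp_all add: \<beta>p g(2)")
 have \<beta>b: "bilin ?MN P W \<beta>"
 proof (rule bilinI)
  fix x assume x: "x el ?MN"
  show "lin P W (%p. \<beta> x p)" using bilinD(3)[OF g(1) x] lin_cong[OF _ hm_vs[OF hm(3)], of "\<beta> x" "%p. g p x" W] \<beta>g[OF x] by simp
 qed (rule \<beta>l)
 note BB = lin_b1[OF \<beta>b] lin_b2[OF \<beta>b] and \<beta>c = bilinD(4)[OF \<beta>b]
 have hp: "hpairing ?MN P W \<beta>"
 proof (rule hpairingI[OF \<beta>b])
  fix k x p assume k: "k el H" and x: "x el ?MN" and p: "p el P"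
  show "\<beta> (act ?MN (br k) x) p = \<beta> x (act P (\<epsilon>t k) p)"
  proof (rule tensor_by.ext[OF htens_tensor[OF hm(1,2)] vW _ _ _ x])
   fix m n assume m: "m el M" and n: "n el N"
   show "\<beta> (act ?MN (br k) (hpure K H M N m n)) p = \<beta> (hpure K H M N m n) (act P (\<epsilon>t k) p)"
    using k m n p hm by (simp add: hp_source[OF hm(1,2) hMN hp3] \<beta>p t_def hpD(2)[OF hp2])
  qed (use k p hm hMN in "(intro BB lins; simp)+")
 next
  fix h x p assume h: "h el H" and x: "x el ?MN" and p: "p el P"
  show "act W h (\<beta> x p) = SW W (%u v. \<beta> (act ?MN u x) (act P v p)) h"
  proof (rule tensor_by.ext[OF htens_tensor[OF hm(1,2)] vW _ _ _ x])
   fix m n assume m: "m el M" and n: "n el N"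
   have tr: "trilin W (%u v w. t (act P w p) (act M u m) (act N v n))" unfolding t_def using hm m n p by (intro trilinI B1 B2 lins; simp add: c)
   have "SW W (%u v. \<beta> (act ?MN u (hpure K H M N m n)) (act P v p)) h =
     SW W (%u v. SW W (%u1 u2. t (act P v p) (act M u1 m) (act N u2 n)) u) h"
   proof (rule SW_cong[OF h])
    fix u w assume uw: "u el H" "w el H"
    have L: "lin ?MN W (%x. \<beta> x (act P w p))" using uw p hm by (intro BB lins) simp
    have "\<beta> (act ?MN u (hpure K H M N m n)) (act P w p) =
      SW W (%u1 u2. \<beta> (hpure K H M N (act M u1 m) (act N u2 n)) (act P w p)) u" unfolding hpD(3)[OF hp3 uw(1) m n]
     by (rule SW_lin[OF hm_vs[OF hMN] vW L uw(1)]) (simp add: c hm m n)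
    also have "... = SW W (%u1 u2. t (act P w p) (act M u1 m) (act N u2 n)) u" by (rule SW_cong[OF uw(1)]) (simp add: \<beta>p hm m n p uw)
    finally show "\<beta> (act ?MN u (hpure K H M N m n)) (act P w p) =
      SW W (%u1 u2. t (act P w p) (act M u1 m) (act N u2 n)) u" .
   qed
   also have "... = SW W (%u v. SW W (%v1 v2. t (act P v2 p) (act M u m) (act N v1 n)) v) h" by (rule coassoc3[OF vW tr h])
   also have "... = SW W (%u v. hpure K H M ?NP (act M u m) (act ?NP v (hpure K H N P n p))) h"
   proof (rule SW_cong[OF h])
    fix u w assume uw: "u el H" "w el H"
    have L: "lin ?NP W (%x. hpure K H M ?NP (act M u m) x)" using uw m hm by (intro B1 lins) simp
    show "SW W (%v1 v2. t (act P v2 p) (act M u m) (act N v1 n)) w =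
      hpure K H M ?NP (act M u m) (act ?NP w (hpure K H N P n p))" unfolding hpD(3)[OF hp2 uw(2) n p] t_def
     by (rule SW_lin[OF hm_vs[OF hNP] vW L uw(2), symmetric]) (simp add: c hm n p)
   qed
   also have "... = act W h (\<beta> (hpure K H M N m n) p)" by (simp add: \<beta>p t_def m n p hpD(3)[OF hp1 h] c)
   finally show "act W h (\<beta> (hpure K H M N m n) p) = SW W (%u v. \<beta> (act ?MN u (hpure K H M N m n)) (act P v p)) h" by simp
  qed (use h p hm hMN hW vW in "(intro BB lins; simp)+")
 qed
 have e: "asc CC M N P = par ?MN P W \<beta>" unfolding par_def \<beta>_def[abs_def] t_def by (simp add: HMod_def Let_def W_def)
 show "asc CC M N P \<in> ar CC (htens K H ?MN P) W" unfolding e by (rule par_in[OF hMN hm(3) hW hp])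
 show "mp (asc CC M N P) (hpure K H ?MN P (hpure K H M N m n) p) = hpure K H M ?NP m (hpure K H N P n p)"
  if "m el M" "n el N" "p el P" using pmap_par[OF hMN hm(3) hW hp c(3)[OF that(1,2)] that(3)] that by (simp add: e pmap_def \<beta>p t_def)
qed

end

section \<open>Unit object, quotients, algebras and bimodules\<close>

context hmods
begin

abbreviation "R0 \<equiv> base_alg K H"
abbreviation "I0 \<equiv> hunit K H :: ('k, 'h, 'u) hmod"
definition ec :: "'h => 'u" where "ec = code_in (carrier R0)"

lemma R0_carrier: "carrier R0 = \<epsilon>t ` carrier H" by (simp add: base_alg_def)

lemma R0_iff: "z el R0 \<longleftrightarrow> z el H \<and> \<epsilon>t z = z"
proof
 assume "z el R0"
 then obtain k where k: "k el H" "z = \<epsilon>t k" unfolding R0_carrier by (elim imageE)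
 show "z el H \<and> \<epsilon>t z = z" unfolding k(2) using k(1) by (simp add: eps_t_idem)
next
 assume z: "z el H \<and> \<epsilon>t z = z"
 show "z el R0" unfolding R0_carrier by (rule image_eqI[of _ _ z]) (use z in simp_all)
qed

lemma R0_sub: "submodule (\<epsilon>t ` carrier H) K H"
 by (rule submod_im[OF vsH vsH lin_counital(1)])

lemma vsR0 [simp]: "vs R0"
 unfolding base_alg_def by (rule submod_vs[OF vsH R0_sub])

lemma br_mult: "k el H ==> z el H ==> br (\<epsilon>t k ** z) = br z ** br k"
proof -
 assume k: "k el H" and z: "z el H"
 have b: "bilin H H H (%u v. \<epsilon> (v ** z) *[H] u)" using z by (intro bilinI lins; simp)
 have L: "lin H H (%x. x ** br k)" using k by (intro lins) simp
 have "br (\<epsilon>t k ** z) = SW H (%u v. \<epsilon> (v ** \<epsilon>t k ** z) *[H] u) 1[H]"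
  using k z by (simp add: br_SW) (rule SW_cong; simp add: H_assoc)
 also have "... = SW H (%u v. \<epsilon> (v ** z) *[H] (u ** br k)) 1[H]" by (rule SW_balance_one[OF vsH b k, symmetric])
 also have "... = br z ** br k" using lin_counital_SW(3)[OF vsH L z] by simp
 finally show ?thesis .
qed

text \<open>This makes the action \<open>h z = \<epsilon>t(h z)\<close> on the unit object associative.\<close>

lemma eps_t_left: "x el H ==> k el H ==> \<epsilon>t (x ** \<epsilon>t k) = \<epsilon>t (x ** k)"
proof -
 assume x: "x el H" and k: "k el H"
 have "\<epsilon>t (x ** \<epsilon>t k) = SW H (%u v. \<epsilon> (u ** (x ** \<epsilon>t k)) *[H] v) 1[H]" by (rule eps_t_SW) (simp add: x k)
 also have "... = SW H (%u v. \<epsilon> (u ** (x ** k)) *[H] v) 1[H]" by (rule SW_cong) (simp_all add: x k eps_eps_t flip: H_assoc)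
 also have "... = \<epsilon>t (x ** k)" by (rule eps_t_SW[symmetric]) (simp add: x k)
 finally show ?thesis .
qed

lemma R0_inj: "\<exists>f :: 'h => 'u. inj_on f (carrier R0)"
proof -
 obtain f :: "'h => 'u" where "inj_on f (carrier H)" using size_H by (elim exE)
 then have "inj_on f (carrier R0)" by (rule inj_on_subset) (simp add: R0_iff subset_iff)
 then show ?thesis by (rule exI[of _ f])
qed

lemmas hunit_code = code_mod[OF vsR0 R0_inj, where \<alpha> = "%h z. \<epsilon>t (h ** z)", folded hunit_def ec_def]

lemma hunit_surj: "x el I0 ==> \<exists>z\<in>carrier R0. x = ec z"
 using hunit_code(3) by (auto simp: bij_betw_def)

lemma hunit_decode: "z el R0 ==> hunit_decode K H (ec z) = z"
 using hunit_code(3) by (simp add: hunit_decode_def bij_betw_def flip: ec_def)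

lemma ec_closed: "z el R0 ==> ec z el I0"
 by (rule linD(1)[OF hunit_code(2)])

lemma hunit_hm: "hm I0"
proof -
 have c: "\<epsilon>t (h ** z) el R0" if "h el H" "z el R0" for h z using that by (simp add: R0_iff eps_t_idem)
 have l1: "lin R0 R0 (%z. \<epsilon>t (h ** z))" if h: "h el H" for h
 proof -
  have L: "lin H H (%z. \<epsilon>t (h ** z))" using h by (intro lins)
  show ?thesis
  proof (rule linI)
   show "\<epsilon>t (h ** (x +[R0] y)) = \<epsilon>t (h ** x) +[R0] \<epsilon>t (h ** y)"
    if "x el R0" "y el R0" for x y using that linD(2)[OF L, of x y] by (simp add: base_alg_def R0_iff[unfolded base_alg_def, simplified])
   show "\<epsilon>t (h ** (a *[R0] x)) = a *[R0] \<epsilon>t (h ** x)"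
    if "a el K" "x el R0" for a x using that linD(3)[OF L, of a x] by (simp add: base_alg_def R0_iff[unfolded base_alg_def, simplified])
  qed (rule c[OF h])
 qed
 have l2: "lin H R0 (%h. \<epsilon>t (h ** z))" if z: "z el R0" for z
 proof -
  have zH: "z el H" using z R0_iff by blast
  have L: "lin H H (%h. \<epsilon>t (h ** z))" using zH by (intro lins)
  show ?thesis by (rule linI) (use linD[OF L] c[OF _ z] in "simp_all add: base_alg_def")
 qed
 have im: "carrier I0 = ec ` carrier R0" using hunit_code(3) by (simp add: bij_betw_def)
 note code = hunit_code
 show ?thesis unfolding is_hmod_def
 proof (intro conjI ballI)
  show "vs I0" by (rule code(1))
  fix h assume h: "h el H"
  show "lin I0 I0 (act I0 h)"
  proof (rule linI)
   fix x assume "x el I0"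
   then obtain t where t: "t el R0" "x = ec t" using im by blast
   show "act I0 h x el I0" using t ec_closed c h by (simp add: code(4))
   show "act I0 h (x +[I0] y) = act I0 h x +[I0] act I0 h y" if y: "y el I0" for y
   proof -
    obtain s where s: "s el R0" "y = ec s" using im y by blast
    show ?thesis unfolding t s using t s c h by (simp add: linD(2)[OF code(2), symmetric] code(4) linD(2)[OF l1])
   qed
   show "act I0 h (a *[I0] x) = a *[I0] act I0 h x" if a: "a el K" for a
    unfolding t using t c h a by (simp add: linD(3)[OF code(2), symmetric] code(4) linD(3)[OF l1])
  qed
 next
  fix x assume "x el I0"
  then obtain t where t: "t el R0" "x = ec t" using im by blast
  have "lin H I0 (%h. ec (\<epsilon>t (h ** t)))" by (rule lin_comp[OF l2[OF t(1)] code(2)])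
  then show "lin H I0 (%h. act I0 h x)" unfolding t by (simp add: code(4) t(1))
  show "act I0 1[H] x = x" using t by (simp add: code(4) R0_iff)
  fix g h assume "g el H" "h el H"
  then show "act I0 (g ** h) x = act I0 g (act I0 h x)" using t R0_iff[of t] by (simp add: code(4) c eps_t_left H_assoc)
 qed
qed

lemma lun:
 assumes hm: "hm M"
 obtains f where "lun CC M = mk_ar (htens K H I0 M) f M" "lin (htens K H I0 M) M f"
  "!!z m. z el R0 ==> m el M ==> f (hpure K H I0 M (ec z) m) = act M z m"
proof -
 let ?b = "%z m. act M (hunit_decode K H z) m"
 note vI = hm_vs[OF hunit_hm]
 have bij: "bij_betw ec (carrier R0) (carrier I0)" by (rule hunit_code(3))
 have dl: "lin I0 R0 (hunit_decode K H)" unfolding hunit_decode_def[abs_def] ec_def[symmetric] by (rule lin_inv(1)[OF hunit_code(2) bij vsR0])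
 have R0H: "lin R0 H (%z. z)" by (rule linI) (auto simp: R0_iff base_alg_def)
 have d: "lin I0 H (hunit_decode K H)" using lin_comp[OF dl R0H] .
 have b: "bilin I0 M M ?b" by (rule bilinI) (use hm d linD(1)[OF d] in "(intro lins; simp)+")
 have bal: "balanced (base_bal K H I0 M) I0 M ?b" unfolding balanced_def
 proof (intro allI impI ballI)
  fix \<rho> l x m assume bal: "(\<rho>, l) \<in> base_bal K H I0 M" and x: "x el I0" and m: "m el M"
  obtain k where k: "k el H" "\<rho> = act I0 (br k)" "l = act M (\<epsilon>t k)" using base_balD[OF bal] by blast
  obtain z where z: "z el R0" "x = ec z" using hunit_surj[OF x] by blast
  have zH: "z el H" "\<epsilon>t z = z" using z(1) R0_iff by auto
  have e: "\<epsilon>t (br k ** z) = z ** \<epsilon>t k" using eps_t_br[OF zH(1) k(1)] zH by simp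
  have "z ** \<epsilon>t k el R0" using eps_t_mult[OF zH(1) k(1)] zH k(1) by (simp add: R0_iff)
  then show "act M (hunit_decode K H (\<rho> x)) m = act M (hunit_decode K H x) (l m)"
   using k(1) z(1) zH m hm by (simp add: k(2,3) z(2) hunit_code(4) e hunit_decode hmD(5)[OF hm])
 qed
 show ?thesis
 proof (rule that)
  show "lun CC M = mk_ar (htens K H I0 M) (hlift K H I0 M M ?b) M" by (simp add: HMod_def)
  show "lin (htens K H I0 M) M (hlift K H I0 M M ?b)" by (rule hlift(1)[OF hunit_hm hm hm_vs[OF hm] b bal])
  show "hlift K H I0 M M ?b (hpure K H I0 M (ec z) m) = act M z m" if "z el R0" "m el M" for z m
   using hlift(2)[OF hunit_hm hm hm_vs[OF hm] b bal ec_closed[OF that(1)] that(2)] hunit_decode[OF that(1)] by simp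
 qed
qed

lemma run:
 assumes hm: "hm M"
 obtains f where "run CC M = mk_ar (htens K H M I0) f M" "lin (htens K H M I0) M f"
  "!!z m. z el R0 ==> m el M ==> f (hpure K H M I0 m (ec z)) = act M (br z) m"
proof -
 let ?b = "%m z. act M (br (hunit_decode K H z)) m"
 note vI = hm_vs[OF hunit_hm]
 have bij: "bij_betw ec (carrier R0) (carrier I0)" by (rule hunit_code(3))
 have dl: "lin I0 R0 (hunit_decode K H)" unfolding hunit_decode_def[abs_def] ec_def[symmetric] by (rule lin_inv(1)[OF hunit_code(2) bij vsR0])
 have R0H: "lin R0 H (%z. z)" by (rule linI) (auto simp: R0_iff base_alg_def)
 have d: "lin I0 H (hunit_decode K H)" using lin_comp[OF dl R0H] .
 have b: "bilin M I0 M ?b" by (rule bilinI) (use hm d linD(1)[OF d] in "(intro lins; simp)+")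
 have bal: "balanced (base_bal K H M I0) M I0 ?b" unfolding balanced_def
 proof (intro allI impI ballI)
  fix \<rho> l m x assume bal: "(\<rho>, l) \<in> base_bal K H M I0" and m: "m el M" and x: "x el I0"
  obtain k where k: "k el H" "\<rho> = act M (br k)" "l = act I0 (\<epsilon>t k)" using base_balD[OF bal] by blast
  obtain z where z: "z el R0" "x = ec z" using hunit_surj[OF x] by blast
  have zH: "z el H" "\<epsilon>t z = z" using z(1) R0_iff by auto
  have e: "\<epsilon>t (\<epsilon>t k ** z) = \<epsilon>t k ** z" using eps_t_mult[OF k(1) zH(1)] zH by simp
  have r: "\<epsilon>t k ** z el R0" using e zH k(1) by (simp add: R0_iff)
  have "act M (br (hunit_decode K H (l x))) m = act M (br (\<epsilon>t k ** z)) m"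
   using k(1) z(1) by (simp add: k(3) z(2) hunit_code(4) e hunit_decode[OF r])
  also have "... = act M (br z) (act M (br k) m)" using br_mult[OF k(1) zH(1)] hmD(5)[OF hm] k(1) zH(1) m by simp
  finally show "act M (br (hunit_decode K H x)) (\<rho> m) = act M (br (hunit_decode K H (l x))) m" using z(1) by (simp add: k(2) z(2) hunit_decode)
 qed
 show ?thesis
 proof (rule that)
  show "run CC M = mk_ar (htens K H M I0) (hlift K H M I0 M ?b) M" by (simp add: HMod_def)
  show "lin (htens K H M I0) M (hlift K H M I0 M ?b)" by (rule hlift(1)[OF hm hunit_hm hm_vs[OF hm] b bal])
  show "hlift K H M I0 M ?b (hpure K H M I0 m (ec z)) = act M (br z) m" if "z el R0" "m el M" for z m
   using hlift(2)[OF hm hunit_hm hm_vs[OF hm] b bal that(2) ec_closed[OF that(1)]] hunit_decode[OF that(1)] by simp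
 qed
qed

lemma one_R0: "1[H] el R0" by (simp add: R0_iff eps_t_one)

definition sub :: "('k, 'h, 'm) hmod => 'm set => ('k, 'h, 'm) hmod"
 where "sub M N = M\<lparr>carrier := N\<rparr>"

lemma sub_simps: "carrier (sub M N) = N" "act (sub M N) = act M" "add (sub M N) = add M"
 "smult (sub M N) = smult M" "zero (sub M N) = zero M" by (simp_all add: sub_def)

lemma SW_sub: "SW (sub M N) b h = SW M b h"
proof -
 have "lsum (sub M N) f xs = lsum M f xs" for f :: "'h \<times> 'h => 'a" and xs by (induction xs) (simp_all add: sub_simps)
 then show ?thesis by (simp add: SW_def)
qed

lemma sub_hm:
 assumes hm: "hm M" and N: "submodule N K M" "!!h x. h el H ==> x \<in> N ==> act M h x \<in> N"
 shows "hm (sub M N)" and sub_incl: "hlin (sub M N) M (%x. x)"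
proof -
 have s: "x \<in> N ==> x el M" for x using submodD(1)[OF hm_vs[OF hm] N(1)] by blast
 note v = submod_vs[OF hm_vs[OF hm] N(1), folded sub_def]
 show "hm (sub M N)" unfolding is_hmod_def
 proof (intro conjI ballI)
  show "vs (sub M N)" by (rule v)
  show "lin (sub M N) (sub M N) (act (sub M N) h)" if h: "h el H" for h
   by (rule linI) (use h N(2) s linD[OF hmD(2)[OF hm h]] in "simp_all add: sub_simps")
  show "lin H (sub M N) (%h. act (sub M N) h m)" if m: "m el sub M N" for m
   by (rule linI) (use m N(2) s linD[OF hmD(3)[OF hm]] in "simp_all add: sub_simps")
 qed (use s hmD(4,5)[OF hm] in "simp_all add: sub_simps")
 show "hlin (sub M N) M (%x. x)" by (rule hlinI[OF linI]) (simp_all add: sub_simps s)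
qed

text \<open>The action on cosets is read off from a representative; stability of the submodule makes the choice irrelevant.\<close>

definition quo :: "('k, 'h, 'u) hmod => 'u set => ('k, 'h, 'u) hmod"
 where "quo M N = code_mod (quot_mod M N) (%h q. N +>[M] act M h (SOME x. x \<in> q))"

definition qpr :: "('k, 'h, 'u) hmod => 'u set => 'u => 'u"
 where "qpr M N x = code_in (carrier (quot_mod M N)) (N +>[M] x)"

lemma quo:
 assumes hm: "hm M" and N: "submodule N K M" "!!h x. h el H ==> x \<in> N ==> act M h x \<in> N"
 shows quo_hm: "hm (quo M N)" and qpr_hlin: "hlin M (quo M N) (qpr M N)"
  and qpr_surj: "qpr M N ` carrier M = carrier (quo M N)"
  and qpr_ker: "x el M ==> qpr M N x = 0[quo M N] \<longleftrightarrow> x \<in> N"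
proof -
 let ?Q = "quot_mod M N" and ?C = "quo M N" and ?e = "code_in (carrier (quot_mod M N)) :: _ => 'u"
 note v = hm_vs[OF hm]
 note vQ = quot_vs[OF v N(1)] and ql = quot_lin[OF v N(1)]
 have inj: "\<exists>f :: 'u set => 'u. inj_on f (carrier ?Q)" by (rule quot_inj[OF _ v N(1)], rule exI[of _ "%x. x"]) simp
 note code = code_mod[OF vQ inj, where \<alpha> = "%h q. N +>[M] act M h (SOME x. x \<in> q)", folded quo_def]
 have qin: "N +>[M] x el ?Q" if "x el M" for x using that by (simp add: quot_carrier)
 have ac: "act ?C h (qpr M N x) = qpr M N (act M h x)" if h: "h el H" and x: "x el M" for h x
 proof -
  let ?y = "SOME y. y \<in> N +>[M] x"
  have "x \<in> N +>[M] x" using coset_mem[OF v N(1) x] x by simp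
  then have "?y \<in> N +>[M] x" by (rule someI[of "%y. y \<in> N +>[M] x"])
  then have y: "?y el M" "?y -[M] x \<in> N" using coset_mem[OF v N(1) x] coset_eq[OF v N(1) _ x] by auto
  then have "act M h (?y -[M] x) \<in> N" using N(2)[OF h] by blast
  then have "act M h ?y -[M] act M h x \<in> N" using lin_minus[OF v v hmD(2)[OF hm h] y(1) x] by simp
  then have "N +>[M] act M h ?y = N +>[M] act M h x" using coset_eq[OF v N(1) act_closed[OF hm h y(1)] act_closed[OF hm h x]] by simp
  then show ?thesis by (simp add: qpr_def code(4) qin x)
 qed
 have ql': "lin M ?C (qpr M N)" unfolding qpr_def[abs_def] by (rule lin_comp[OF ql code(2)])
 show surj: "qpr M N ` carrier M = carrier ?C" using code(3) by (auto simp: bij_betw_def qpr_def quot_carrier image_image)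
 have ex: "\<exists>m\<in>carrier M. x = qpr M N m" if "x el ?C" for x using that surj by blast
 note qD = linD[OF ql']
 show hmC: "hm ?C" unfolding is_hmod_def
 proof (intro conjI ballI)
  show "vs ?C" by (rule code(1))
  fix h assume h: "h el H"
  show "lin ?C ?C (act ?C h)"
  proof (rule linI)
   fix x assume "x el ?C"
   then obtain m where m: "m el M" "x = qpr M N m" using ex by blast
   show "act ?C h x el ?C" using m h hm by (simp add: ac qD(1))
   show "act ?C h (x +[?C] y) = act ?C h x +[?C] act ?C h y" if y: "y el ?C" for y
   proof -
    obtain n where n: "n el M" "y = qpr M N n" using ex y by blast
    show ?thesis unfolding m n using m n h v hm by (simp add: ac qD(2)[symmetric] linD(2)[OF hmD(2)[OF hm h]])
   qed
   show "act ?C h (a *[?C] x) = a *[?C] act ?C h x" if a: "a el K" for a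
    unfolding m using m a h v hm by (simp add: ac qD(3)[symmetric] linD(3)[OF hmD(2)[OF hm h]])
  qed
 next
  fix x assume "x el ?C"
  then obtain m where m: "m el M" "x = qpr M N m" using ex by blast
  have L: "lin H ?C (%h. qpr M N (act M h m))" by (rule lin_comp[OF hmD(3)[OF hm m(1)] ql'])
  show "lin H ?C (%h. act ?C h x)" using L lin_cong[OF _ vsH, of "%h. act ?C h x" "%h. qpr M N (act M h m)" ?C] by (simp add: m ac)
  show "act ?C 1[H] x = x" using m by (simp add: ac hmD(4)[OF hm])
  fix g h assume "g el H" "h el H"
  then show "act ?C (g ** h) x = act ?C g (act ?C h x)" using m hm by (simp add: ac hmD(5)[OF hm])
 qed
 show "hlin M ?C (qpr M N)" by (rule hlinI[OF ql']) (simp add: ac)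
 show "qpr M N x = 0[?C] \<longleftrightarrow> x \<in> N" if x: "x el M"
 proof -
  have z: "0[?C] = ?e (N +>[M] 0[M])" using lin_zero[OF vQ code(1,2)] coset_zero(1)[OF v N(1)] by (simp add: quot_zero)
  have "inj_on ?e (carrier ?Q)" using code(3) by (simp add: bij_betw_def)
  then have "qpr M N x = 0[?C] \<longleftrightarrow> N +>[M] x = N +>[M] 0[M]"
   unfolding z qpr_def using qin[OF x] qin[of "0[M]"] v by (simp add: inj_on_eq_iff)
  also have "... \<longleftrightarrow> x \<in> N" using coset_zero[OF v N(1)] x by simp
  finally show ?thesis .
 qed
qed

end

locale halg = hmods K H U for K :: "'k ring" and H :: "('k, 'h) weak_hopf" and U :: "'u itself" +
 fixes A :: "(('k, 'h, 'u) hmod, ('k, 'h, 'u) harrow) alg"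
 assumes is_alg: "is_alg (HMod K H) A"
begin

abbreviation "X \<equiv> aob A"
definition mul :: "'u => 'u => 'u" where "mul = pmap X X (amul A)"
definition one :: 'u where "one = mp (aone A) (ec 1[H])"

lemma alg0:
 shows hmX [simp]: "hm X" and amul_in: "amul A \<in> ar CC (htens K H X X) X" and aone_in: "aone A \<in> ar CC I0 X"
  and alg_assoc: "cmp CC (amul A) (tar CC (amul A) (idn CC X)) = cmp CC (amul A) (cmp CC (tar CC (idn CC X) (amul A)) (asc CC X X X))"
  and alg_lun: "cmp CC (amul A) (tar CC (aone A) (idn CC X)) = lun CC X"
  and alg_run: "cmp CC (amul A) (tar CC (idn CC X) (aone A)) = run CC X"
 using is_alg unfolding is_alg_def Let_def CC_simps(3,4) by (simp_all add: CC_simps(1))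

lemma vsX [simp]: "vs X" by (rule hm_vs[OF hmX])

lemma mul_hp: "hpairing X X X mul"
 unfolding mul_def by (rule pmap_hp[OF hmX hmX hmX amul_in])

lemma one_in [simp]: "one el X"
 unfolding one_def by (rule ar_closed[OF aone_in ec_closed[OF one_R0]])

lemma aone_ec: "z el R0 ==> mp (aone A) (ec z) = act X z one"
proof -
 assume z: "z el R0"
 have zH: "z el H" "\<epsilon>t z = z" using z by (simp_all add: R0_iff)
 have "act I0 z (ec 1[H]) = ec z" using zH by (simp add: hunit_code(4)[OF one_R0])
 then show ?thesis using hlinD(2)[OF arD(1)[OF aone_in], of z "ec 1[H]"] z ec_closed[OF one_R0] by (simp add: one_def R0_iff)
qed

text \<open>Equations between arrows out of a triple tensor product are equations on elements. Associativity of an algebra, the laws of a bimodule and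
 the coequalizer condition are all of this shape.\<close>

lemma assoc_iff:
 assumes hm: "hm M" "hm N" "hm P" "hm MN" "hm NP" "hm W"
  and f: "f \<in> ar CC (htens K H M N) MN" and g: "g \<in> ar CC (htens K H MN P) W"
  and h: "h \<in> ar CC (htens K H N P) NP" and k: "k \<in> ar CC (htens K H M NP) W"
 shows "cmp CC g (tar CC f (idn CC P)) = cmp CC k (cmp CC (tar CC (idn CC M) h) (asc CC M N P)) \<longleftrightarrow>
  (\<forall>m\<in>carrier M. \<forall>n\<in>carrier N. \<forall>p\<in>carrier P.
   pmap MN P g (pmap M N f m n) p = pmap M NP k m (pmap N P h n p))"
proof -
 let ?MN = "htens K H M N" and ?NP = "htens K H N P"
 note h1 = htens_hm[OF hm(1,2)] and h2 = htens_hm[OF hm(2,3)]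
 note t1 = tar[OF h1 hm(3,4,3) f idn_in[OF hm(3)]] and t2 = tar[OF hm(1) h2 hm(1,5) idn_in[OF hm(1)] h]
 note a = asc[OF hm(1-3)]
 note l = cmp_in[OF htens_hm[OF h1 hm(3)] g t1(1)]
 note r1 = cmp_in[OF htens_hm[OF h1 hm(3)] t2(1) a(1)]
 note r = cmp_in[OF htens_hm[OF h1 hm(3)] k r1]
 note c = hpD(4)[OF htens_hp[OF hm(1,2)]] hpD(4)[OF htens_hp[OF hm(2,3)]] hpD(4)[OF htens_hp[OF h1 hm(3)]]
  hpD(4)[OF htens_hp[OF hm(1) h2]]
 have v1: "mp (cmp CC g (tar CC f (idn CC P))) (hpure K H ?MN P (hpure K H M N m n) p) =
   pmap MN P g (pmap M N f m n) p"
  if "m el M" "n el N" "p el P" for m n p using that by (simp add: mp_cmp[OF g t1(1)] c t1(2) mp_idn pmap_def)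
 have v2: "mp (cmp CC k (cmp CC (tar CC (idn CC M) h) (asc CC M N P))) (hpure K H ?MN P (hpure K H M N m n) p) =
   pmap M NP k m (pmap N P h n p)"
  if "m el M" "n el N" "p el P" for m n p using that by (simp add: mp_cmp[OF k r1] mp_cmp[OF t2(1) a(1)] a(2) c t2(2) mp_idn pmap_def)
 show ?thesis
 proof
  assume "cmp CC g (tar CC f (idn CC P)) = cmp CC k (cmp CC (tar CC (idn CC M) h) (asc CC M N P))"
  then show "\<forall>m\<in>carrier M. \<forall>n\<in>carrier N. \<forall>p\<in>carrier P.
   pmap MN P g (pmap M N f m n) p = pmap M NP k m (pmap N P h n p)" using v1 v2 by simp
 next
  assume "\<forall>m\<in>carrier M. \<forall>n\<in>carrier N. \<forall>p\<in>carrier P.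
   pmap MN P g (pmap M N f m n) p = pmap M NP k m (pmap N P h n p)"
  then show "cmp CC g (tar CC f (idn CC P)) = cmp CC k (cmp CC (tar CC (idn CC M) h) (asc CC M N P))"
   by (intro tens3_ar_eqI[OF hm(1-3) hm(6) l r]) (simp add: v1 v2)
 qed
qed

lemma lunit_iff:
 assumes Y: "hm Y" and l: "l \<in> ar CC (htens K H X Y) Y"
 shows "cmp CC l (tar CC (aone A) (idn CC Y)) = lun CC Y \<longleftrightarrow> (\<forall>m\<in>carrier Y. pmap X Y l one m = m)"
proof -
 note t = tar[OF hunit_hm Y hmX Y aone_in idn_in[OF Y]]
 note c = hpD(4)[OF htens_hp[OF hunit_hm Y]]
 note hpl = pmap_hp[OF hmX Y Y l]
 obtain f where f: "lun CC Y = mk_ar (htens K H I0 Y) f Y" "lin (htens K H I0 Y) Y f"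
  "!!z m. z el R0 ==> m el Y ==> f (hpure K H I0 Y (ec z) m) = act Y z m" by (rule lun[OF Y], rule that, assumption+)
 note li = cmp_in[OF htens_hm[OF hunit_hm Y] l t(1)]
 have v: "mp (cmp CC l (tar CC (aone A) (idn CC Y))) (hpure K H I0 Y (ec z) m) = act Y z (pmap X Y l one m)"
  if z: "z el R0" and m: "m el Y" for z m
 proof -
  have zH: "z el H" "\<epsilon>t z = z" using z R0_iff by auto
  have "mp (cmp CC l (tar CC (aone A) (idn CC Y))) (hpure K H I0 Y (ec z) m) = pmap X Y l (act X z one) m"
   using z m by (simp add: mp_cmp[OF l t(1)] c ec_closed t(2) mp_idn pmap_def aone_ec)
  also have "... = act Y z (pmap X Y l one m)" using hp_target[OF hmX Y Y hpl zH(1) one_in m] zH(2) by simp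
  finally show ?thesis .
 qed
 show ?thesis
 proof
  assume a: "cmp CC l (tar CC (aone A) (idn CC Y)) = lun CC Y"
  show "\<forall>m\<in>carrier Y. pmap X Y l one m = m"
  proof
   fix m assume m: "m el Y"
   have "act Y 1[H] (pmap X Y l one m) = act Y 1[H] m" using v[OF one_R0 m] f(3)[OF one_R0 m] m by (simp add: a f(1) c ec_closed one_R0)
   then show "pmap X Y l one m = m" using hmD(4)[OF Y] m hpD(4)[OF hpl one_in m] by simp
  qed
 next
  assume a: "\<forall>m\<in>carrier Y. pmap X Y l one m = m"
  have "mp (cmp CC l (tar CC (aone A) (idn CC Y))) x = f x" if x: "x el htens K H I0 Y" for x
  proof (rule tensor_by.ext[OF htens_tensor[OF hunit_hm Y] hm_vs[OF Y] hlinD(1)[OF arD(1)[OF li]] f(2) _ x])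
   fix y m assume "y el I0" and m: "m el Y"
   then obtain z where z: "z el R0" "y = ec z" using hunit_surj by blast
   show "mp (cmp CC l (tar CC (aone A) (idn CC Y))) (hpure K H I0 Y y m) = f (hpure K H I0 Y y m)" using a m by (simp add: z v f(3))
  qed
  then show "cmp CC l (tar CC (aone A) (idn CC Y)) = lun CC Y" unfolding f(1) by (subst arD(2)[OF li]) (rule mk_ar_eq)
 qed
qed

lemma runit_iff:
 assumes Y: "hm Y" and r: "r \<in> ar CC (htens K H Y X) Y"
 shows "cmp CC r (tar CC (idn CC Y) (aone A)) = run CC Y \<longleftrightarrow> (\<forall>m\<in>carrier Y. pmap Y X r m one = m)"
proof -
 note t = tar[OF Y hunit_hm Y hmX idn_in[OF Y] aone_in]
 note c = hpD(4)[OF htens_hp[OF Y hunit_hm]]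
 note hpr = pmap_hp[OF Y hmX Y r]
 obtain f where f: "run CC Y = mk_ar (htens K H Y I0) f Y" "lin (htens K H Y I0) Y f"
  "!!z m. z el R0 ==> m el Y ==> f (hpure K H Y I0 m (ec z)) = act Y (br z) m" by (rule run[OF Y], rule that, assumption+)
 note li = cmp_in[OF htens_hm[OF Y hunit_hm] r t(1)]
 have v: "mp (cmp CC r (tar CC (idn CC Y) (aone A))) (hpure K H Y I0 m (ec z)) = pmap Y X r (act Y (br z) m) one"
  if z: "z el R0" and m: "m el Y" for z m
 proof -
  have zH: "z el H" "\<epsilon>t z = z" using z R0_iff by auto
  have "mp (cmp CC r (tar CC (idn CC Y) (aone A))) (hpure K H Y I0 m (ec z)) = pmap Y X r m (act X z one)"
   using z m by (simp add: mp_cmp[OF r t(1)] c ec_closed t(2) mp_idn pmap_def aone_ec)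
  also have "... = pmap Y X r (act Y (br z) m) one" using hpD(2)[OF hpr zH(1) m one_in] zH(2) by simp
  finally show ?thesis .
 qed
 have b1: "br 1[H] = 1[H]"
 proof -
  have "br 1[H] = SW H (%u v. \<epsilon> v *[H] u) 1[H]" unfolding br_SW[OF H_simps(1)] by (rule SW_cong) simp_all
  then show ?thesis using counit_SW(2)[OF vsH lin_id, of "1[H]"] by simp
 qed
 show ?thesis
 proof
  assume a: "cmp CC r (tar CC (idn CC Y) (aone A)) = run CC Y"
  show "\<forall>m\<in>carrier Y. pmap Y X r m one = m"
  proof
   fix m assume m: "m el Y"
   show "pmap Y X r m one = m" using v[OF one_R0 m] f(3)[OF one_R0 m] m hmD(4)[OF Y m] by (simp add: a f(1) c ec_closed one_R0 b1)
  qed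
 next
  assume a: "\<forall>m\<in>carrier Y. pmap Y X r m one = m"
  have "mp (cmp CC r (tar CC (idn CC Y) (aone A))) x = f x" if x: "x el htens K H Y I0" for x
  proof (rule tensor_by.ext[OF htens_tensor[OF Y hunit_hm] hm_vs[OF Y] hlinD(1)[OF arD(1)[OF li]] f(2) _ x])
   fix m y assume "y el I0" and m: "m el Y"
   then obtain z where z: "z el R0" "y = ec z" using hunit_surj by blast
   then show "mp (cmp CC r (tar CC (idn CC Y) (aone A))) (hpure K H Y I0 m y) = f (hpure K H Y I0 m y)" using a m Y by (simp add: z v f(3) R0_iff)
  qed
  then show "cmp CC r (tar CC (idn CC Y) (aone A)) = run CC Y" unfolding f(1) by (subst arD(2)[OF li]) (rule mk_ar_eq)
 qed
qed

definition cbim :: "('k, 'h, 'y) hmod => ('u => 'y => 'y) => ('y => 'u => 'y) => bool"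
 where "cbim Y l r \<longleftrightarrow> hm Y \<and> hpairing X Y Y l \<and> hpairing Y X Y r \<and>
  (\<forall>a\<in>carrier X. \<forall>b\<in>carrier X. \<forall>m\<in>carrier Y. l (mul a b) m = l a (l b m)) \<and>
  (\<forall>m\<in>carrier Y. l one m = m) \<and>
  (\<forall>a\<in>carrier X. \<forall>b\<in>carrier X. \<forall>m\<in>carrier Y. r (r m a) b = r m (mul a b)) \<and>
  (\<forall>m\<in>carrier Y. r m one = m) \<and>
  (\<forall>a\<in>carrier X. \<forall>b\<in>carrier X. \<forall>m\<in>carrier Y. r (l a m) b = l a (r m b))"

lemma cbimD:
 assumes "cbim Y l r"
 shows "hm Y" "hpairing X Y Y l" "hpairing Y X Y r"
  "a el X ==> b el X ==> m el Y ==> l (mul a b) m = l a (l b m)"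
  "m el Y ==> l one m = m"
  "a el X ==> b el X ==> m el Y ==> r (r m a) b = r m (mul a b)"
  "m el Y ==> r m one = m"
  "a el X ==> b el X ==> m el Y ==> r (l a m) b = l a (r m b)" using assms by (simp_all add: cbim_def)

abbreviation "lm S \<equiv> pmap X (bob S) (lac S)"
abbreviation "rm S \<equiv> pmap (bob S) X (rac S)"

abbreviation bim where "bim S \<equiv> is_bimod CC A S"

lemma bim_iff: "bim S \<longleftrightarrow> lac S \<in> ar CC (htens K H X (bob S)) (bob S) \<and> rac S \<in> ar CC (htens K H (bob S) X) (bob S) \<and>
  cbim (bob S) (lm S) (rm S)"
proof (cases "hm (bob S) \<and> lac S \<in> ar CC (htens K H X (bob S)) (bob S) \<and> rac S \<in> ar CC (htens K H (bob S) X) (bob S)")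
 case False
 then show ?thesis by (auto simp: is_bimod_def Let_def CC_simps(1,3) cbim_def)
next
 case True
 then have Y: "hm (bob S)" and l: "lac S \<in> ar CC (htens K H X (bob S)) (bob S)"
  and r: "rac S \<in> ar CC (htens K H (bob S) X) (bob S)" by auto
 show ?thesis unfolding is_bimod_def Let_def CC_simps(3)
   assoc_iff[OF hmX hmX Y hmX Y Y amul_in l l l] lunit_iff[OF Y l]
   assoc_iff[OF Y hmX hmX Y hmX Y r r amul_in r] runit_iff[OF Y r]
   assoc_iff[OF hmX Y hmX Y Y Y l r r l] using Y l r pmap_hp[OF hmX Y Y l] pmap_hp[OF Y hmX Y r] by (auto simp: cbim_def mul_def CC_simps(1))
qed

lemma bimD:
 assumes "bim S"
 shows "lac S \<in> ar CC (htens K H X (bob S)) (bob S)" "rac S \<in> ar CC (htens K H (bob S) X) (bob S)"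
  "cbim (bob S) (lm S) (rm S)" "hm (bob S)" "vs (bob S)" using assms cbimD(1)[of "bob S"] hm_vs by (auto simp: bim_iff)

lemmas bim_laws = cbimD[OF bimD(3)]

definition mkb :: "('k, 'h, 'u) hmod => ('u => 'u => 'u) => ('u => 'u => 'u) => (('k, 'h, 'u) hmod, ('k, 'h, 'u) harrow) bimod"
 where "mkb Y l r = \<lparr>bob = Y, lac = par X Y Y l, rac = par Y X Y r\<rparr>"

lemma cbim_cong:
 assumes c: "cbim Y l r" and l: "!!a m. a el X ==> m el Y ==> l' a m = l a m"
  and r: "!!a m. a el X ==> m el Y ==> r' m a = r m a"
  and hp: "hpairing X Y Y l'" "hpairing Y X Y r'"
 shows "cbim Y l' r'" using hpD(4)[OF mul_hp] hpD(4)[OF cbimD(2)[OF c]] hpD(4)[OF cbimD(3)[OF c]] unfolding cbim_def by (simp add: hp cbimD[OF c] l r)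

lemma mkb:
 assumes c: "cbim Y l r"
 shows mkb_bim: "bim (mkb Y l r)" and mkb_bob: "bob (mkb Y l r) = Y"
  and mkb_lm: "a el X ==> m el Y ==> lm (mkb Y l r) a m = l a m"
  and mkb_rm: "a el X ==> m el Y ==> rm (mkb Y l r) m a = r m a"
proof -
 note D = cbimD[OF c]
 note P = par[OF hmX D(1,1,2)] par[OF D(1) hmX D(1,3)]
 show b: "bob (mkb Y l r) = Y" by (simp add: mkb_def)
 show l: "lm (mkb Y l r) a m = l a m" if "a el X" "m el Y" for a m using that P by (simp add: mkb_def)
 show r: "rm (mkb Y l r) m a = r m a" if "a el X" "m el Y" for a m using that P by (simp add: mkb_def)
 have "cbim Y (lm (mkb Y l r)) (rm (mkb Y l r))"
  by (rule cbim_cong[OF c l r]) (use P pmap_hp[OF hmX D(1,1)] pmap_hp[OF D(1) hmX D(1)] in "simp_all add: mkb_def")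
 then show "bim (mkb Y l r)" unfolding bim_iff b using P by (simp add: mkb_def)
qed

lemma mul_laws:
 "a el X ==> b el X ==> c el X ==> mul (mul a b) c = mul a (mul b c)"
 "a el X ==> mul one a = a" "a el X ==> mul a one = a"
 using assoc_iff[OF hmX hmX hmX hmX hmX hmX amul_in amul_in amul_in amul_in] lunit_iff[OF hmX amul_in]
  runit_iff[OF hmX amul_in] alg_assoc alg_lun alg_run by (simp_all add: mul_def)

lemma mul_closed [simp]: "a el X ==> b el X ==> mul a b el X"
 by (rule hpD(4)[OF mul_hp])

lemma cbim_A: "cbim X mul mul"
 by (simp add: cbim_def mul_hp mul_laws)

abbreviation "AA \<equiv> alg_bimod A"

lemma A_bim: "bim AA" "bob AA = X" "lm AA = mul" "rm AA = mul"
 using cbim_A amul_in by (simp_all add: bim_iff alg_bimod_def mul_def)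

definition bhom :: "('k, 'h, 'y) hmod => ('u => 'y => 'y) => ('y => 'u => 'y) =>
  ('k, 'h, 'z) hmod => ('u => 'z => 'z) => ('z => 'u => 'z) => ('y => 'z) => bool"
 where "bhom Y l r Z l' r' f \<longleftrightarrow> hlin Y Z f \<and>
  (\<forall>a\<in>carrier X. \<forall>m\<in>carrier Y. f (l a m) = l' a (f m) \<and> f (r m a) = r' (f m) a)"

abbreviation "bh S T f \<equiv> bhom (bob S) (lm S) (rm S) (bob T) (lm T) (rm T) f"

abbreviation "BB \<equiv> Bimd CC A"

lemma BB_simps: "obj BB = {S. bim S}" "cmp BB = cmp CC" "idn BB S = idn CC (bob S)"
 "add (homs BB S T) = add (homs CC (bob S) (bob T))" "zero (homs BB S T) = zero (homs CC (bob S) (bob T))"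
 "smult (homs BB S T) = smult (homs CC (bob S) (bob T))" by (simp_all add: Bimd_def)

lemma B_ar_iff:
 assumes S: "bim S" and T: "bim T"
 shows "f \<in> ar BB S T \<longleftrightarrow> f \<in> ar CC (bob S) (bob T) \<and> bh S T (mp f)"
proof (cases "f \<in> ar CC (bob S) (bob T)")
 case False
 then show ?thesis by (simp add: Bimd_def)
next
 case f: True
 note Y = bimD(4)[OF S] and Z = bimD(4)[OF T]
 note i = idn_in[OF hmX]
 note t1 = tar[OF hmX Y hmX Z i f] and t2 = tar[OF Y hmX Z hmX f i]
 note s1 = bimD(1)[OF S] and s2 = bimD(2)[OF S] and z1 = bimD(1)[OF T] and z2 = bimD(2)[OF T]
 have 1: "cmp CC f (lac S) = cmp CC (lac T) (tar CC (idn CC X) f) \<longleftrightarrow>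
   (\<forall>a\<in>carrier X. \<forall>m\<in>carrier (bob S). mp f (lm S a m) = lm T a (mp f m))" (is "?x = ?y \<longleftrightarrow> _")
 proof
  assume e: "?x = ?y"
  show "\<forall>a\<in>carrier X. \<forall>m\<in>carrier (bob S). mp f (lm S a m) = lm T a (mp f m)"
  proof (intro ballI)
   fix a m assume am: "a el X" "m el bob S"
   show "mp f (lm S a m) = lm T a (mp f m)" using arg_cong[OF e, of "%t. mp t (hpure K H X (bob S) a m)"] am
    by (simp add: mp_cmp[OF f s1] mp_cmp[OF z1 t1(1)] hpD(4)[OF htens_hp[OF hmX Y]] t1(2) mp_idn pmap_def)
  qed
 next
  assume a: "\<forall>a\<in>carrier X. \<forall>m\<in>carrier (bob S). mp f (lm S a m) = lm T a (mp f m)"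
  show "?x = ?y" by (rule tens_ar_eqI[OF hmX Y Z cmp_in[OF htens_hm[OF hmX Y] f s1] cmp_in[OF htens_hm[OF hmX Y] z1 t1(1)]])
    (use a in "simp add: mp_cmp[OF f s1] mp_cmp[OF z1 t1(1)] hpD(4)[OF htens_hp[OF hmX Y]] t1(2) mp_idn pmap_def")
 qed
 have 2: "cmp CC f (rac S) = cmp CC (rac T) (tar CC f (idn CC X)) \<longleftrightarrow>
   (\<forall>a\<in>carrier X. \<forall>m\<in>carrier (bob S). mp f (rm S m a) = rm T (mp f m) a)" (is "?x = ?y \<longleftrightarrow> _")
 proof
  assume e: "?x = ?y"
  show "\<forall>a\<in>carrier X. \<forall>m\<in>carrier (bob S). mp f (rm S m a) = rm T (mp f m) a"
  proof (intro ballI)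
   fix a m assume am: "a el X" "m el bob S"
   show "mp f (rm S m a) = rm T (mp f m) a" using arg_cong[OF e, of "%t. mp t (hpure K H (bob S) X m a)"] am
    by (simp add: mp_cmp[OF f s2] mp_cmp[OF z2 t2(1)] hpD(4)[OF htens_hp[OF Y hmX]] t2(2) mp_idn pmap_def)
  qed
 next
  assume a: "\<forall>a\<in>carrier X. \<forall>m\<in>carrier (bob S). mp f (rm S m a) = rm T (mp f m) a"
  show "?x = ?y" by (rule tens_ar_eqI[OF Y hmX Z cmp_in[OF htens_hm[OF Y hmX] f s2] cmp_in[OF htens_hm[OF Y hmX] z2 t2(1)]])
    (use a in "simp add: mp_cmp[OF f s2] mp_cmp[OF z2 t2(1)] hpD(4)[OF htens_hp[OF Y hmX]] t2(2) mp_idn pmap_def")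
 qed
 show ?thesis using f arD(1)[OF f] unfolding bhom_def 1[symmetric] by (auto simp: Bimd_def 1 2)
qed

lemma bhD:
 assumes "bhom Y l r Z l' r' f"
 shows "hlin Y Z f" "lin Y Z f" "a el X ==> m el Y ==> f (l a m) = l' a (f m)"
  "a el X ==> m el Y ==> f (r m a) = r' (f m) a" "m el Y ==> f m el Z" using assms hlinD(1,3)[of Y Z f] by (simp_all add: bhom_def)

end

section \<open>Exactness for modules and bimodules\<close>

type_synonym ('k, 'h, 'u) bm = "(('k, 'h, 'u) hmod, ('k, 'h, 'u) harrow) bimod"

context halg
begin

lemma bhom_cong:
 assumes b: "bhom Y l r Z l' r' f" and e: "!!m. m el Y ==> f m = g m" and hm: "hm Y"
  and c: "!!a m. a el X ==> m el Y ==> l a m el Y"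
   "!!a m. a el X ==> m el Y ==> r m a el Y"
 shows "bhom Y l r Z l' r' g" unfolding bhom_def
proof (intro conjI ballI)
 show "hlin Y Z g" by (rule hlin_cong[OF hm bhD(1)[OF b] e])
 show "g (l a m) = l' a (g m)" "g (r m a) = r' (g m) a" if "a el X" "m el Y" for a m
  using bhD(3,4)[OF b that] e[OF that(2)] e[OF c(1)[OF that]] e[OF c(2)[OF that]] by simp_all
qed

lemma lm_closed [simp]: "bim S ==> a el X ==> m el bob S ==> lm S a m el bob S"
 by (rule hpD(4)[OF bim_laws(2)])

lemma rm_closed [simp]: "bim S ==> a el X ==> m el bob S ==> rm S m a el bob S"
 by (rule hpD(4)[OF bim_laws(3)])

lemma B_arI:
 assumes S: "bim S" and T: "bim T" and f: "bh S T f"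
 shows "mk_ar (bob S) f (bob T) \<in> ar BB S T"
proof -
 have "mk_ar (bob S) f (bob T) \<in> ar CC (bob S) (bob T)" by (rule mk_ar_in[OF bimD(4)[OF S] bhD(1)[OF f]])
 moreover have "bh S T (mp (mk_ar (bob S) f (bob T)))" by (rule bhom_cong[OF f _ bimD(4)[OF S]]) (simp_all add: S)
 ultimately show ?thesis unfolding B_ar_iff[OF S T] by simp
qed

lemma B_arD: "f \<in> ar BB S T ==> f \<in> ar CC (bob S) (bob T)"
 "bim S ==> bim T ==> f \<in> ar BB S T ==> bh S T (mp f)" by (simp add: Bimd_def) (simp add: B_ar_iff)

lemma bhom_comp:
 assumes f: "bhom Y l r Z l' r' f" and g: "bhom Z l' r' V l'' r'' g"
 shows "bhom Y l r V l'' r'' (%m. g (f m))" unfolding bhom_def by (intro conjI ballI hlin_comp[OF bhD(1)[OF f] bhD(1)[OF g]])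
  (simp_all add: bhD(3-5)[OF f] bhD(3,4)[OF g])

lemma B_cmp_in:
 assumes S: "bim S" "bim T" "bim V" and g: "g \<in> ar BB T V" and f: "f \<in> ar BB S T"
 shows "cmp CC g f \<in> ar BB S V" unfolding cmp_eq[OF B_arD(1)[OF g] B_arD(1)[OF f]]
 by (rule B_arI[OF S(1,3) bhom_comp[OF B_arD(2)[OF S(1,2) f] B_arD(2)[OF S(2,3) g]]])

lemma B_idn_in: "bim S ==> idn CC (bob S) \<in> ar BB S S"
 unfolding CC_simps(5) by (rule B_arI) (simp_all add: bhom_def hlin_id)

lemma zero_ar: "0[homs CC M N] = mk_ar M (%_. 0[N]) N"
 by (simp add: CC_simps hhom_def)

lemma cmp_zero_iff:
 assumes g: "g \<in> ar CC N P" and f: "f \<in> ar CC M N"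
 shows "cmp CC g f = 0[homs CC M P] \<longleftrightarrow> (\<forall>m\<in>carrier M. mp g (mp f m) = 0[P])"
proof
 assume e: "cmp CC g f = 0[homs CC M P]"
 show "\<forall>m\<in>carrier M. mp g (mp f m) = 0[P]"
 proof
  fix m assume m: "m el M"
  show "mp g (mp f m) = 0[P]" using arg_cong[OF e, of "%t. mp t m"] m by (simp add: mp_cmp[OF g f] zero_ar)
 qed
next
 assume "\<forall>m\<in>carrier M. mp g (mp f m) = 0[P]"
 then show "cmp CC g f = 0[homs CC M P]" unfolding cmp_eq[OF g f] zero_ar by (intro mk_ar_eq) simp
qed

abbreviation "ker M N g \<equiv> {x \<in> carrier M. g x = 0[N]}"

lemma ker_stable:
 assumes hm: "hm M" "hm N" and g: "hlin M N g"
 shows "submodule (ker M N g) K M" "h el H ==> x \<in> ker M N g ==> act M h x \<in> ker M N g"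
proof -
 show "submodule (ker M N g) K M" by (rule submod_ker[OF hm_vs[OF hm(1)] hm_vs[OF hm(2)] hlinD(1)[OF g]])
 show "act M h x \<in> ker M N g" if "h el H" "x \<in> ker M N g" using that hm lin_zero[OF hm_vs[OF hm(2)] hm_vs[OF hm(2)] hmD(2)[OF hm(2)]]
  by (simp add: hlinD(2)[OF g])
qed

lemma hlin_into_sub:
 assumes f: "hlin M N f" and "!!m. m el M ==> f m \<in> V"
 shows "hlin M (sub N V) f" using f assms(2) by (simp add: hlin_def lin_hom_def sub_simps)

text \<open>The categorical notion of exactness, by a kernel and an epimorphism onto it, follows from the elementwise one; the kernel is the obvious
 submodule.\<close>

lemma C_right_exact:
 assumes hm: "hm M" "hm N" "hm P" and f: "f \<in> ar CC M N" and g: "g \<in> ar CC N P"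
  and ex: "mp f ` carrier M = ker N P (mp g)" and surj: "mp g ` carrier N = carrier P"
 shows "right_exact CC M N P f g"
proof -
 let ?V = "ker N P (mp g)" let ?W = "sub N ?V"
 note st = ker_stable[OF hm(2,3) arD(1)[OF g]]
 note W = sub_hm[OF hm(2) st]
 have k: "mk_ar ?W (%x. x) N \<in> ar CC ?W N" by (rule mk_ar_in[OF W])
 have e: "mk_ar M (mp f) ?W \<in> ar CC M ?W" by (rule mk_ar_in[OF hm(1) hlin_into_sub[OF arD(1)[OF f]]]) (use ex in blast)
 have epiI: "epi CC Y Z t" if t: "t \<in> ar CC Y Z" "mp t ` carrier Y = carrier Z" for t Y Z unfolding epi_def
 proof (intro conjI ballI impI)
  fix V u v assume u: "u \<in> ar CC Z V" "v \<in> ar CC Z V" "cmp CC u t = cmp CC v t"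
  show "u = v"
  proof (rule ar_eqI[OF u(1,2)])
   fix z assume "z el Z"
   then obtain y where y: "y el Y" "z = mp t y" using t(2) by blast
   show "mp u z = mp v z" using arg_cong[OF u(3), of "%t. mp t y"] y by (simp add: mp_cmp[OF u(1) t(1)] mp_cmp[OF u(2) t(1)])
  qed
 qed (rule t(1))
 have "is_kernel CC N P g ?W (mk_ar ?W (%x. x) N)" unfolding is_kernel_def
 proof (intro conjI ballI impI)
  show "?W \<in> obj CC" using W(1) by (simp add: CC_simps(1))
  show "cmp CC g (mk_ar ?W (%x. x) N) = 0[homs CC ?W P]" unfolding cmp_zero_iff[OF g k] by (simp add: sub_simps)
  fix V h assume V: "V \<in> obj CC" and h: "h \<in> ar CC V N" and z: "cmp CC g h = 0[homs CC V P]"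
  have V': "hm V" using V by (simp add: CC_simps(1))
  have zz: "\<forall>m\<in>carrier V. mp g (mp h m) = 0[P]" using z cmp_zero_iff[OF g h] by simp
  have u: "mk_ar V (mp h) ?W \<in> ar CC V ?W" by (rule mk_ar_in[OF V' hlin_into_sub[OF arD(1)[OF h]]]) (use zz ar_closed[OF h] in simp)
  show "\<exists>!u. u \<in> ar CC V ?W \<and> cmp CC (mk_ar ?W (%x. x) N) u = h"
  proof (rule ex1I[of _ "mk_ar V (mp h) ?W"], intro conjI)
   show "cmp CC (mk_ar ?W (%x. x) N) (mk_ar V (mp h) ?W) = h"
    by (rule ar_eqI[OF cmp_in[OF V' k u] h]) (use zz ar_closed[OF h] in "simp add: mp_cmp[OF k u] sub_simps")
  next
   fix v assume v: "v \<in> ar CC V ?W \<and> cmp CC (mk_ar ?W (%x. x) N) v = h"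
   then have v1: "v \<in> ar CC V ?W" by simp
   show "v = mk_ar V (mp h) ?W"
   proof (rule ar_eqI[OF v1 u])
    fix m assume m: "m el V"
    have "mp h m = mp (cmp CC (mk_ar ?W (%x. x) N) v) m" using v by simp
    also have "... = mp v m" using m ar_closed[OF v1 m] by (simp add: mp_cmp[OF k v1])
    finally show "mp v m = mp (mk_ar V (mp h) ?W) m" using m by simp
   qed
  qed (rule u)
 qed (rule k)
 moreover have "epi CC M ?W (mk_ar M (mp f) ?W)" by (rule epiI[OF e]) (use ex in "simp add: sub_simps image_def")
 moreover have "f = cmp CC (mk_ar ?W (%x. x) N) (mk_ar M (mp f) ?W)"
 proof (rule ar_eqI[OF f cmp_in[OF hm(1) k e]])
  fix m assume m: "m el M"
  have "mp f m \<in> ?V" using ex m by blast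
  then show "mp f m = mp (cmp CC (mk_ar ?W (%x. x) N) (mk_ar M (mp f) ?W)) m" using m by (simp add: mp_cmp[OF k e] sub_simps)
 qed
 ultimately show ?thesis unfolding right_exact_def exact_at_def using f g epiI[OF g surj] by blast
qed

text \<open>Left exact functors are applied to single surjections; the kernel completes them to an exact sequence.\<close>

lemma C_surj_right_exact:
 assumes hm: "hm N" "hm P" and g: "g \<in> ar CC N P" and surj: "mp g ` carrier N = carrier P"
 shows "\<exists>W k. hm W \<and> right_exact CC W N P k g"
proof -
 let ?V = "ker N P (mp g)" let ?W = "sub N ?V"
 note W = sub_hm[OF hm(1) ker_stable[OF hm arD(1)[OF g]]]
 have k: "mk_ar ?W (%x. x) N \<in> ar CC ?W N" by (rule mk_ar_in[OF W])
 have "mp (mk_ar ?W (%x. x) N) ` carrier ?W = (%x. x) ` carrier ?W" by (rule image_cong[OF refl mp_mk])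
 then have "mp (mk_ar ?W (%x. x) N) ` carrier ?W = ?V" by (simp only: sub_simps image_ident)
 then show ?thesis using C_right_exact[OF W(1) hm k g _ surj] W(1) by blast
qed

lemma hpairing_sub:
 assumes b: "hpairing M N W b" and M: "M' = M \<or> (\<exists>V. M' = sub M V \<and> V \<subseteq> carrier M)"
  and N: "N' = N \<or> (\<exists>V. N' = sub N V \<and> V \<subseteq> carrier N)"
  and W: "!!m n. m el M' ==> n el N' ==> b m n \<in> V"
 shows "hpairing M' N' (sub W V) b"
proof -
 have m: "carrier M' \<subseteq> carrier M" "act M' = act M" "add M' = add M" "smult M' = smult M" using M by (auto simp: sub_simps)
 have n: "carrier N' \<subseteq> carrier N" "act N' = act N" "add N' = add N" "smult N' = smult N" using N by (auto simp: sub_simps)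
 note B = linD[OF bilinD(1)[OF hpD(1)[OF b]]] linD[OF bilinD(3)[OF hpD(1)[OF b]]]
 have mm: "x el M' ==> x el M" and nn: "y el N' ==> y el N" for x y using m n by auto
 show ?thesis
 proof (rule hpairingI[OF bilinI])
  show "lin N' (sub W V) (%n. b x n)" if "x el M'" for x by (rule linI) (use that W B(1-3)[OF mm[OF that]] nn in "simp_all add: sub_simps m n")
  show "lin M' (sub W V) (%m. b m y)" if "y el N'" for y by (rule linI) (use that W B(4-6)[OF nn[OF that]] mm in "simp_all add: sub_simps m n")
 qed (use hpD(2,3)[OF b] mm nn in "simp_all add: m n sub_simps SW_sub")
qed

definition subbim :: "('k, 'h, 'u) bm => 'u set => bool"
 where "subbim S N \<longleftrightarrow> submodule N K (bob S) \<and> (\<forall>h\<in>carrier H. \<forall>x\<in>N. act (bob S) h x \<in> N) \<and>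
  (\<forall>a\<in>carrier X. \<forall>x\<in>N. lm S a x \<in> N \<and> rm S x a \<in> N)"

lemma subbimD:
 assumes "subbim S N"
 shows "submodule N K (bob S)" "h el H ==> x \<in> N ==> act (bob S) h x \<in> N"
  "a el X ==> x \<in> N ==> lm S a x \<in> N" "a el X ==> x \<in> N ==> rm S x a \<in> N" using assms by (simp_all add: subbim_def)

lemma sub_bim:
 assumes S: "bim S" and st: "subbim S N"
 shows "\<exists>T. bim T \<and> bob T = sub (bob S) N \<and> bh T S (%x. x) \<and>
  (\<forall>(V :: ('k, 'h, 'u) bm) f. bh V S f --> (\<forall>m\<in>carrier (bob V). f m \<in> N) --> bh V T f)"
proof -
 note N = subbimD[OF st]
 note hs = bimD(4)[OF S] and L = bim_laws[OF S]
 have s: "N \<subseteq> carrier (bob S)" by (rule submodD(1)[OF bimD(5)[OF S] N(1)])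
 then have sx: "x \<in> N ==> x el bob S" for x by blast
 note W = sub_hm[OF hs N(1,2)]
 have c: "cbim (sub (bob S) N) (lm S) (rm S)" unfolding cbim_def
 proof (intro conjI)
  show "hpairing X (sub (bob S) N) (sub (bob S) N) (lm S)" by (rule hpairing_sub[OF L(2)]) (use s N(3) in "auto simp: sub_simps")
  show "hpairing (sub (bob S) N) X (sub (bob S) N) (rm S)" by (rule hpairing_sub[OF L(3)]) (use s N(4) in "auto simp: sub_simps")
 qed (use L(4-) sx W(1) in "simp_all add: sub_simps")
 let ?T = "mkb (sub (bob S) N) (lm S) (rm S)"
 note T = mkb[OF c]
 show ?thesis
 proof (intro exI[of _ ?T] conjI)
  have "bh V ?T f" if f: "bh V S f" and fN: "!!m. m el bob V ==> f m \<in> N" for V :: "('k, 'h, 'u) bm" and f unfolding bhom_def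
  proof (intro conjI ballI)
   show "hlin (bob V) (bob ?T) f" unfolding T(2) by (rule hlin_into_sub[OF bhD(1)[OF f] fN])
   show "f (lm V a m) = lm ?T a (f m)" "f (rm V m a) = rm ?T (f m) a"
    if "a el X" "m el bob V" for a m using bhD(3,4)[OF f that] T(3,4)[of a "f m"] that fN by (simp_all add: sub_simps)
  qed
  then show "\<forall>(V :: ('k, 'h, 'u) bm) f. bh V S f --> (\<forall>m\<in>carrier (bob V). f m \<in> N) --> bh V ?T f" by (intro allI impI) simp
  show "bh ?T S (%x. x)" unfolding bhom_def
  proof (intro conjI ballI)
   show "hlin (bob ?T) (bob S) (%x. x)" unfolding T(2) by (rule W(2))
   show "lm ?T a m = lm S a m" "rm ?T m a = rm S m a" if "a el X" "m el bob ?T" for a m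
    by (rule T(3)[OF that(1) that(2)[unfolded T(2)]], rule T(4)[OF that(1) that(2)[unfolded T(2)]])
  qed
  show "bim ?T" by (rule T(1))
  show "bob ?T = sub (bob S) N" by (rule T(2))
 qed
qed

lemma quo_bim:
 assumes S: "bim S" and st: "subbim S N"
 obtains T \<pi> where "bim T" "bh S T \<pi>" "\<pi> ` carrier (bob S) = carrier (bob T)"
  "!!x. x el bob S ==> \<pi> x = 0[bob T] \<longleftrightarrow> x \<in> N"
proof -
 note N = subbimD[OF st]
 let ?Y = "bob S" let ?Q = "quo ?Y N" let ?\<pi> = "qpr ?Y N"
 note hs = bimD(4)[OF S] and L = bim_laws[OF S] and v = bimD(5)[OF S]
 have Q: "hm ?Q" "hlin ?Y ?Q ?\<pi>" "?\<pi> ` carrier ?Y = carrier ?Q"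
  by (rule quo_hm[OF hs N(1,2)], assumption+, rule qpr_hlin[OF hs N(1,2)], assumption+,
   rule qpr_surj[OF hs N(1,2)], assumption+)
 have Q4: "?\<pi> x = 0[?Q] \<longleftrightarrow> x \<in> N" if "x el ?Y" for x by (rule qpr_ker[OF hs N(1,2)], assumption+, rule that)
 note vQ = hm_vs[OF Q(1)]
 note \<pi>D = linD[OF hlinD(1)[OF Q(2)]]
 have ex: "\<exists>m\<in>carrier ?Y. q = ?\<pi> m" if q: "q el ?Q" for q
 proof -
  have "q \<in> ?\<pi> ` carrier ?Y" unfolding Q(3) by (rule q)
  then show ?thesis by (rule imageE) (rule bexI)
 qed
 define s where "s = inv_into (carrier ?Y) ?\<pi>"
 have s: "s q el ?Y" "?\<pi> (s q) = q" if q: "q el ?Q" for q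
 proof -
  have "q \<in> ?\<pi> ` carrier ?Y" unfolding Q(3) by (rule q)
  then show "s q el ?Y" "?\<pi> (s q) = q" unfolding s_def by (rule inv_into_into, rule f_inv_into_f)
 qed
 have fac: "?\<pi> (f x) = ?\<pi> (f y)" if f: "lin ?Y ?Y f" "!!x. x \<in> N ==> f x \<in> N"
  and xy: "x el ?Y" "y el ?Y" "?\<pi> x = ?\<pi> y" for f x y
 proof -
  have "?\<pi> (x -[?Y] y) = 0[?Q]" using lin_minus[OF v vQ hlinD(1)[OF Q(2)] xy(1,2)] xy \<pi>D(1) vQ by simp
  then have "x -[?Y] y \<in> N" using Q4[of "x -[?Y] y"] xy v by simp
  then have "f x -[?Y] f y \<in> N" using f(2)[of "x -[?Y] y"] lin_minus[OF v v f(1) xy(1,2)] by simp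
  then have "?\<pi> (f x -[?Y] f y) = 0[?Q]" using Q4[of "f x -[?Y] f y"] linD(1)[OF f(1)] xy v by simp
  then show ?thesis using lin_minus[OF v vQ hlinD(1)[OF Q(2)] linD(1)[OF f(1) xy(1)] linD(1)[OF f(1) xy(2)]]
    vs_minus_eq[OF vQ \<pi>D(1)[OF linD(1)[OF f(1) xy(1)]] \<pi>D(1)[OF linD(1)[OF f(1) xy(2)]]] by simp
 qed
 define l where "l a q = ?\<pi> (lm S a (s q))" for a q
 define r where "r q a = ?\<pi> (rm S (s q) a)" for q a
 note LB = lin_b1[OF hpD(1)[OF L(2)]] lin_b2[OF hpD(1)[OF L(2)]]
 note RB = lin_b1[OF hpD(1)[OF L(3)]] lin_b2[OF hpD(1)[OF L(3)]]
 have l: "l a (?\<pi> m) = ?\<pi> (lm S a m)" if "a el X" "m el ?Y" for a m unfolding l_def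
 proof (rule fac[of "lm S a"])
  show "lin ?Y ?Y (lm S a)" by (intro LB lins that)
 qed (use that s \<pi>D(1) N(3) in simp_all)
 have r: "r (?\<pi> m) a = ?\<pi> (rm S m a)" if "a el X" "m el ?Y" for a m unfolding r_def
 proof (rule fac[of "%m. rm S m a"])
  show "lin ?Y ?Y (%m. rm S m a)" by (intro RB lins that)
 qed (use that s \<pi>D(1) N(4) in simp_all)
 have ac: "act ?Q h (?\<pi> m) = ?\<pi> (act ?Y h m)" if "h el H" "m el ?Y" for h m using hlinD(2)[OF Q(2) that] by simp
 note Lc = hpD(4)[OF L(2)] hpD(4)[OF L(3)]
 have lh: "hpairing X ?Q ?Q l"
 proof (rule hpairingI[OF bilinI])
  fix a assume a: "a el X"
  note La = linD[OF bilinD(1)[OF hpD(1)[OF L(2)] a]]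
  show "lin ?Q ?Q (%q. l a q)"
  proof (rule linI)
   fix x assume "x el ?Q" then obtain m where m: "m el ?Y" "x = ?\<pi> m" by (rule ex[THEN bexE])
   show "l a x el ?Q" using m a by (simp add: l \<pi>D(1) Lc)
   show "l a (x +[?Q] y) = l a x +[?Q] l a y" if y: "y el ?Q" for y
   proof -
    obtain n where n: "n el ?Y" "y = ?\<pi> n" by (rule ex[OF y, THEN bexE])
    show ?thesis unfolding m n using m n a v by (simp add: l \<pi>D(2)[symmetric] La Lc)
   qed
   show "l a (c *[?Q] x) = c *[?Q] l a x" if "c el K" for c unfolding m using m a v that by (simp add: l \<pi>D(3)[symmetric] La Lc)
  qed
 next
  fix q assume "q el ?Q" then obtain m where m: "m el ?Y" "q = ?\<pi> m" by (rule ex[THEN bexE])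
  have "lin X ?Q (%a. ?\<pi> (lm S a m))" by (rule lin_comp[OF bilinD(3)[OF hpD(1)[OF L(2)] m(1)] hlinD(1)[OF Q(2)]])
  then show "lin X ?Q (%a. l a q)" using lin_cong[OF _ vsX, of "%a. l a q" "%a. ?\<pi> (lm S a m)" ?Q] m l by simp
 next
  fix k a q assume k: "k el H" and a: "a el X" and q: "q el ?Q"
  obtain m where m: "m el ?Y" "q = ?\<pi> m" by (rule ex[OF q, THEN bexE])
  show "l (act X (br k) a) q = l a (act ?Q (\<epsilon>t k) q)" using k a m hs by (simp add: l ac hpD(2)[OF L(2)])
  have "act ?Q k (l a q) = ?\<pi> (SW ?Y (%u v. lm S (act X u a) (act ?Y v m)) k)" using k a m hs by (simp add: l ac Lc hpD(3)[OF L(2)])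
  also have "... = SW ?Q (%u v. ?\<pi> (lm S (act X u a) (act ?Y v m))) k" by (rule SW_lin[OF v vQ hlinD(1)[OF Q(2)] k]) (simp add: Lc hs a m)
  also have "... = SW ?Q (%u v. l (act X u a) (act ?Q v q)) k" by (rule SW_cong[OF k]) (use a m hs in "simp add: l ac")
  finally show "act ?Q k (l a q) = SW ?Q (%u v. l (act X u a) (act ?Q v q)) k" .
 qed
 have rh: "hpairing ?Q X ?Q r"
 proof (rule hpairingI[OF bilinI])
  fix a assume a: "a el X"
  note La = linD[OF bilinD(3)[OF hpD(1)[OF L(3)] a]]
  show "lin ?Q ?Q (%q. r q a)"
  proof (rule linI)
   fix x assume "x el ?Q" then obtain m where m: "m el ?Y" "x = ?\<pi> m" by (rule ex[THEN bexE])
   show "r x a el ?Q" using m a by (simp add: r \<pi>D(1) Lc)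
   show "r (x +[?Q] y) a = r x a +[?Q] r y a" if y: "y el ?Q" for y
   proof -
    obtain n where n: "n el ?Y" "y = ?\<pi> n" by (rule ex[OF y, THEN bexE])
    show ?thesis unfolding m n using m n a v by (simp add: r \<pi>D(2)[symmetric] La Lc)
   qed
   show "r (c *[?Q] x) a = c *[?Q] r x a" if "c el K" for c unfolding m using m a v that by (simp add: r \<pi>D(3)[symmetric] La Lc)
  qed
 next
  fix q assume "q el ?Q" then obtain m where m: "m el ?Y" "q = ?\<pi> m" by (rule ex[THEN bexE])
  have "lin X ?Q (%a. ?\<pi> (rm S m a))" by (rule lin_comp[OF bilinD(1)[OF hpD(1)[OF L(3)] m(1)] hlinD(1)[OF Q(2)]])
  then show "lin X ?Q (%a. r q a)" using lin_cong[OF _ vsX, of "%a. r q a" "%a. ?\<pi> (rm S m a)" ?Q] m r by simp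
 next
  fix k q a assume k: "k el H" and q: "q el ?Q" and a: "a el X"
  obtain m where m: "m el ?Y" "q = ?\<pi> m" by (rule ex[OF q, THEN bexE])
  show "r (act ?Q (br k) q) a = r q (act X (\<epsilon>t k) a)" using k a m hs by (simp add: r ac hpD(2)[OF L(3)])
  have "act ?Q k (r q a) = ?\<pi> (SW ?Y (%u v. rm S (act ?Y u m) (act X v a)) k)" using k a m hs by (simp add: r ac Lc hpD(3)[OF L(3)])
  also have "... = SW ?Q (%u v. ?\<pi> (rm S (act ?Y u m) (act X v a))) k" by (rule SW_lin[OF v vQ hlinD(1)[OF Q(2)] k]) (simp add: Lc hs a m)
  also have "... = SW ?Q (%u v. r (act ?Q u q) (act X v a)) k" by (rule SW_cong[OF k]) (use a m hs in "simp add: r ac")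
  finally show "act ?Q k (r q a) = SW ?Q (%u v. r (act ?Q u q) (act X v a)) k" .
 qed
 have c: "cbim ?Q l r" unfolding cbim_def
 proof (intro conjI ballI)
  fix q assume "q el ?Q"
  then obtain m where m: "m el ?Y" "q = ?\<pi> m" by (rule ex[THEN bexE])
  show "l one q = q" "r q one = q" using m by (simp_all add: l r L(5,7))
  fix a b assume ab: "a el X" "b el X"
  show "l (mul a b) q = l a (l b q)" "r (r q a) b = r q (mul a b)" "r (l a q) b = l a (r q b)" using ab m by (simp_all add: l r L(4,6,8) Lc)
 qed (rule Q(1) lh rh)+
 note T = mkb[OF c]
 show ?thesis
 proof (rule that[of "mkb ?Q l r" ?\<pi>])
  show "bh S (mkb ?Q l r) ?\<pi>" unfolding bhom_def T(2) using Q(2) T(3,4)[unfolded T(2)] by (simp add: l r \<pi>D(1))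
 qed (use T(1,2) Q(3) Q4 in simp_all)
qed

lemma bh_ker:
 assumes S: "bim S" "bim T" and g: "bh S T g"
 defines "N \<equiv> ker (bob S) (bob T) g"
 shows "subbim S N"
proof -
 note st = ker_stable[OF bimD(4)[OF S(1)] bimD(4)[OF S(2)] bhD(1)[OF g], folded N_def]
 have z: "lm T a 0[bob T] = 0[bob T]" "rm T 0[bob T] a = 0[bob T]" if "a el X" for a
  using lin_zero[OF bimD(5)[OF S(2)] bimD(5)[OF S(2)] bilinD(2)[OF hpD(1)[OF bim_laws(2)[OF S(2)]] that]]
   lin_zero[OF bimD(5)[OF S(2)] bimD(5)[OF S(2)] bilinD(3)[OF hpD(1)[OF bim_laws(3)[OF S(2)]] that]] by simp_all
 have "lm S a x \<in> N" "rm S x a \<in> N" if "a el X" "x \<in> N" for a x using that S z by (simp_all add: N_def bhD(3,4)[OF g])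
 then show ?thesis using st unfolding subbim_def by blast
qed

lemma B_epiI:
 assumes S: "bim S" "bim T" and g: "g \<in> ar BB S T" and surj: "mp g ` carrier (bob S) = carrier (bob T)"
 shows "epi BB S T g" unfolding epi_def BB_simps(2)
proof (intro conjI ballI impI)
 fix V u v assume V: "V \<in> obj BB" and u: "u \<in> ar BB T V" and v: "v \<in> ar BB T V" and e: "cmp CC u g = cmp CC v g"
 note c = B_arD(1)[OF u] B_arD(1)[OF v] B_arD(1)[OF g]
 show "u = v"
 proof (rule ar_eqI[OF c(1,2)])
  fix z assume "z el bob T"
  then obtain y where y: "y el bob S" "z = mp g y" using surj by blast
  show "mp u z = mp v z" using arg_cong[OF e, of "%t. mp t y"] y by (simp add: mp_cmp[OF c(1,3)] mp_cmp[OF c(2,3)])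
 qed
qed (rule g)

text \<open>The projection to the quotient by the image and the zero map agree after composition with the epimorphism, so the quotient
 vanishes.\<close>

lemma B_epiD:
 assumes S: "bim S" "bim T" and e: "epi BB S T g"
 shows "g \<in> ar BB S T" "mp g ` carrier (bob S) = carrier (bob T)"
proof -
 show g: "g \<in> ar BB S T" using e by (simp add: epi_def)
 let ?N = "mp g ` carrier (bob S)"
 note b = B_arD(2)[OF S g]
 note c = bhD(5)[OF b]
 have N: "submodule ?N K (bob T)" by (rule submod_im[OF bimD(5)[OF S(1)] bimD(5)[OF S(2)] bhD(2)[OF b]])
 have N2: "act (bob T) h x \<in> ?N" if h: "h el H" and x: "x \<in> ?N" for h x
 proof -
  obtain m where m: "x = mp g m" "m el bob S" using x by (rule imageE)
  show ?thesis by (rule image_eqI[of _ _ "act (bob S) h m"])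
    (use h m bimD(4)[OF S(1)] hlinD(2)[OF bhD(1)[OF b] h m(2)] in simp_all)
 qed
 have N3: "lm T a x \<in> ?N" "rm T x a \<in> ?N" if a: "a el X" and x: "x \<in> ?N" for a x
 proof -
  obtain m where m: "x = mp g m" "m el bob S" using x by (rule imageE)
  have "lm T a x = mp g (lm S a m)" "rm T x a = mp g (rm S m a)" using bhD(3,4)[OF b a m(2)] m(1) by simp_all
  then show "lm T a x \<in> ?N" "rm T x a \<in> ?N" using lm_closed[OF S(1) a m(2)] rm_closed[OF S(1) a m(2)] by auto
 qed
 obtain V \<pi> where V: "bim V" "bh T V \<pi>" "\<pi> ` carrier (bob T) = carrier (bob V)"
  "!!x. x el bob T ==> \<pi> x = 0[bob V] \<longleftrightarrow> x \<in> ?N"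
  by (rule quo_bim[OF S(2), of ?N]) (use N N2 N3 in \<open>simp add: subbim_def\<close>, rule that, assumption+)
 have z: "bh T V (%_. 0[bob V])"
 proof -
  note vv = bimD(5)[OF V(1)] and hv = bimD(4)[OF V(1)]
  have "lm V a 0[bob V] = 0[bob V]" "rm V 0[bob V] a = 0[bob V]" if "a el X" for a
   using lin_zero[OF vv vv bilinD(2)[OF hpD(1)[OF bim_laws(2)[OF V(1)]] that]]
    lin_zero[OF vv vv bilinD(3)[OF hpD(1)[OF bim_laws(3)[OF V(1)]] that]] by simp_all
  moreover have "act (bob V) h 0[bob V] = 0[bob V]" if "h el H" for h using lin_zero[OF vv vv hmD(2)[OF hv that]] .
  ultimately show ?thesis using lin_zero_map[OF vv] by (simp add: bhom_def hlin_def)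
 qed
 let ?p = "mk_ar (bob T) \<pi> (bob V)" and ?z = "mk_ar (bob T) (%_. 0[bob V]) (bob V)"
 have p: "?p \<in> ar BB T V" by (rule B_arI[OF S(2) V(1,2)])
 have zz: "?z \<in> ar BB T V" by (rule B_arI[OF S(2) V(1) z])
 note cc = B_arD(1)[OF p] B_arD(1)[OF zz] B_arD(1)[OF g]
 have "cmp CC ?p g = cmp CC ?z g" unfolding cmp_eq[OF cc(1,3)] cmp_eq[OF cc(2,3)] by (rule mk_ar_eq) (simp add: c V(4))
 then have pz: "?p = ?z" using e p zz V(1) unfolding epi_def BB_simps(2) by (auto simp: BB_simps(1))
 show "mp g ` carrier (bob S) = carrier (bob T)"
 proof
  show "carrier (bob T) \<subseteq> ?N"
  proof
   fix x assume x: "x el bob T"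
   show "x \<in> ?N" using arg_cong[OF pz, of "%t. mp t x"] x V(4)[OF x] by simp
  qed
 qed (use c in blast)
qed

lemma B_kernel:
 assumes S: "bim S" "bim T" and g: "g \<in> ar BB S T"
 obtains W where "is_kernel BB S T g W (mk_ar (bob W) (%x. x) (bob S))" "bim W"
  "bob W = sub (bob S) (ker (bob S) (bob T) (mp g))"
  "\<forall>(V :: ('k, 'h, 'u) bm) f. bh V S f --> (\<forall>m\<in>carrier (bob V). f m \<in> ker (bob S) (bob T) (mp g)) --> bh V W f"
proof -
 let ?N = "ker (bob S) (bob T) (mp g)"
 note b = B_arD(2)[OF S g]
 obtain W where W: "bim W" "bob W = sub (bob S) ?N"
  "\<forall>(V :: ('k, 'h, 'u) bm) f. bh V S f --> (\<forall>m\<in>carrier (bob V). f m \<in> ?N) --> bh V W f" "bh W S (%x. x)"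
  using sub_bim[OF S(1) bh_ker[OF S b]] by (elim exE conjE) (rule that, assumption+)
 have cw: "carrier (bob W) = ?N" by (simp add: W(2) sub_simps)
 let ?k = "mk_ar (bob W) (%x. x) (bob S)"
 have k: "?k \<in> ar BB W S" by (rule B_arI[OF W(1) S(1) W(4)])
 note kc = B_arD(1)[OF k] and gc = B_arD(1)[OF g]
 have "is_kernel BB S T g W ?k" unfolding is_kernel_def BB_simps(1,2,5) mem_Collect_eq
 proof (intro conjI ballI impI)
  show "cmp CC g ?k = 0[homs CC (bob W) (bob T)]" unfolding cmp_zero_iff[OF gc kc] by (simp add: cw)
  fix V h assume "V \<in> Collect bim" and h: "h \<in> ar BB V S" and z: "cmp CC g h = 0[homs CC (bob V) (bob T)]"
  then have V: "bim V" by simp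
  note hc = B_arD(1)[OF h]
  have zz: "\<forall>m\<in>carrier (bob V). mp g (mp h m) = 0[bob T]" using z cmp_zero_iff[OF gc hc] by simp
  have u: "mk_ar (bob V) (mp h) (bob W) \<in> ar BB V W"
   by (rule B_arI[OF V W(1) W(3)[rule_format, OF B_arD(2)[OF V S(1) h]]]) (use zz ar_closed[OF hc] in simp)
  note uc = B_arD(1)[OF u]
  show "\<exists>!u. u \<in> ar BB V W \<and> cmp CC ?k u = h"
  proof (rule ex1I[of _ "mk_ar (bob V) (mp h) (bob W)"], intro conjI)
   show "cmp CC ?k (mk_ar (bob V) (mp h) (bob W)) = h" by (rule ar_eqI[OF cmp_in[OF bimD(4)[OF V] kc uc] hc])
     (use zz ar_closed[OF hc] in "simp add: mp_cmp[OF kc uc] cw")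
  next
   fix v assume v: "v \<in> ar BB V W \<and> cmp CC ?k v = h"
   then have v1: "v \<in> ar CC (bob V) (bob W)" using B_arD(1) by blast
   show "v = mk_ar (bob V) (mp h) (bob W)"
   proof (rule ar_eqI[OF v1 uc])
    fix m assume m: "m el bob V"
    have "mp h m = mp (cmp CC ?k v) m" using v by simp
    also have "... = mp v m" using m ar_closed[OF v1 m] by (simp add: mp_cmp[OF kc v1])
    finally show "mp v m = mp (mk_ar (bob V) (mp h) (bob W)) m" using m by simp
   qed
  qed (rule u)
 qed (rule W(1), rule k)
 then show ?thesis using W(1-3) that by blast
qed

lemma B_exactI:
 assumes S: "bim S" "bim T" "bim V" and f: "f \<in> ar BB S T" and g: "g \<in> ar BB T V"
  and ex: "mp f ` carrier (bob S) = ker (bob T) (bob V) (mp g)"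
 shows "exact_at BB S T V f g"
proof -
 let ?N = "ker (bob T) (bob V) (mp g)"
 obtain W where W: "is_kernel BB T V g W (mk_ar (bob W) (%x. x) (bob T))" "bim W" "bob W = sub (bob T) ?N"
  "\<forall>(V :: ('k, 'h, 'u) bm) f. bh V T f --> (\<forall>m\<in>carrier (bob V). f m \<in> ?N) --> bh V W f"
  by (rule B_kernel[OF S(2,3) g], rule that, assumption+)
 have cw: "carrier (bob W) = ?N" by (simp add: W(3) sub_simps)
 let ?k = "mk_ar (bob W) (%x. x) (bob T)" and ?e = "mk_ar (bob S) (mp f) (bob W)"
 have k: "?k \<in> ar BB W T" using W(1) by (simp add: is_kernel_def)
 have e: "?e \<in> ar BB S W" by (rule B_arI[OF S(1) W(2) W(4)[rule_format, OF B_arD(2)[OF S(1,2) f]]]) (use ex in blast)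
 have "epi BB S W ?e" by (rule B_epiI[OF S(1) W(2) e]) (use ex cw in "simp cong: image_cong")
 moreover have "f = cmp BB ?k ?e" unfolding BB_simps(2)
 proof (rule ar_eqI[OF B_arD(1)[OF f] B_arD(1)[OF B_cmp_in[OF S(1) W(2) S(2) k e]]])
  fix m assume m: "m el bob S"
  have "mp f m \<in> ?N" using ex m by blast
  then show "mp f m = mp (cmp CC ?k ?e) m" using m by (simp add: mp_cmp[OF B_arD(1)[OF k] B_arD(1)[OF e]] cw)
 qed
 ultimately show ?thesis unfolding exact_at_def using f g W(1) by blast
qed

text \<open>Kernels are unique up to isomorphism, so the given one has the elements of the explicit one.\<close>

lemma B_exactD:
 assumes S: "bim S" "bim T" "bim V" and ex: "exact_at BB S T V f g"
 shows "f \<in> ar BB S T" "g \<in> ar BB T V" "mp f ` carrier (bob S) = ker (bob T) (bob V) (mp g)"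
proof -
 show f: "f \<in> ar BB S T" and g: "g \<in> ar BB T V" using ex by (simp_all add: exact_at_def)
 obtain W k e where W: "is_kernel BB T V g W k" "epi BB S W e" "f = cmp CC k e" using ex unfolding exact_at_def BB_simps(2) by blast
 have bW: "bim W" and k: "k \<in> ar BB W T" and kz: "cmp CC g k = 0[homs CC (bob W) (bob V)]" using W(1) by (simp_all add: is_kernel_def BB_simps)
 note e = B_epiD[OF S(1) bW W(2)]
 note gc = B_arD(1)[OF g] and kc = B_arD(1)[OF k] and ec = B_arD(1)[OF e(1)]
 have im: "mp f ` carrier (bob S) = mp k ` carrier (bob W)"
  unfolding W(3) e(2)[symmetric] image_image by (rule image_cong[OF refl]) (rule mp_cmp[OF kc ec])
 let ?N = "ker (bob T) (bob V) (mp g)"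
 have "mp k ` carrier (bob W) \<subseteq> ?N" using kz[unfolded cmp_zero_iff[OF gc kc]] ar_closed[OF kc] by auto
 moreover have "?N \<subseteq> mp k ` carrier (bob W)"
 proof
  fix x assume x: "x \<in> ?N"
  obtain W0 where W0: "is_kernel BB T V g W0 (mk_ar (bob W0) (%x. x) (bob T))" "bim W0" "bob W0 = sub (bob T) ?N"
   by (rule B_kernel[OF S(2,3) g], rule that, assumption+)
  let ?k0 = "mk_ar (bob W0) (%x. x) (bob T)"
  have k0: "?k0 \<in> ar BB W0 T" "cmp BB g ?k0 = 0[homs BB W0 V]" using W0(1) by (simp_all add: is_kernel_def)
  then obtain u where u: "u \<in> ar BB W0 W" "cmp CC k u = ?k0" using W(1) W0(2) unfolding is_kernel_def BB_simps(1,2) by (metis mem_Collect_eq)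
  have x0: "x el bob W0" using x by (simp add: W0(3) sub_simps)
  have "x = mp k (mp u x)" using arg_cong[OF u(2), of "%t. mp t x"] x0 by (simp add: mp_cmp[OF kc B_arD(1)[OF u(1)]])
  then show "x \<in> mp k ` carrier (bob W)" using ar_closed[OF B_arD(1)[OF u(1)] x0] by (rule image_eqI)
 qed
 ultimately show "mp f ` carrier (bob S) = ?N" unfolding im by (rule subset_antisym)
qed

end

section \<open>Tensor products over the algebra\<close>

context halg
begin

definition balA :: "('k, 'h, 'u) bm => ('k, 'h, 'u) bm => (('u => 'u) \<times> ('u => 'u)) set"
 where "balA S T = {(%s. rm S s a, %t. lm T a t) | a. a el X}"

lemma balAD: "(\<rho>, l) \<in> balA S T ==> \<exists>a\<in>carrier X. \<rho> = (%s. rm S s a) \<and> l = (%t. lm T a t)"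
 by (auto simp: balA_def)

lemma balanced_A: "balanced (balA S T) (bob S) (bob T) b \<longleftrightarrow>
  (\<forall>a\<in>carrier X. \<forall>s\<in>carrier (bob S). \<forall>t\<in>carrier (bob T). b (rm S s a) t = b s (lm T a t))"
 unfolding balanced_def balA_def by blast

text \<open>On a bimodule the right action of the base comes from the algebra through its unit; \<open>tgt_act\<close> is the same for the left
 action. So relations over the algebra imply those over the base.\<close>

lemma src_act: "bim S ==> k el H ==> s el bob S ==> act (bob S) (br k) s = rm S s (act X (\<epsilon>t k) one)"
proof -
 assume S: "bim S" and k: "k el H" and s: "s el bob S"
 have "act (bob S) (br k) s = rm S (act (bob S) (br k) s) one" using bim_laws(7)[OF S] k s bimD(4)[OF S] by simp
 also have "... = rm S s (act X (\<epsilon>t k) one)" using hpD(2)[OF bim_laws(3)[OF S] k s one_in] .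
 finally show ?thesis .
qed

lemma tgt_act: "bim T ==> k el H ==> t el bob T ==> act (bob T) (\<epsilon>t k) t = lm T (act X (\<epsilon>t k) one) t"
proof -
 assume T: "bim T" and k: "k el H" and t: "t el bob T"
 have "act (bob T) (\<epsilon>t k) t = act (bob T) (\<epsilon>t k) (lm T one t)" using bim_laws(5)[OF T t] by simp
 also have "... = lm T (act X (\<epsilon>t k) one) t" using hp_target[OF hmX bimD(4)[OF T] bimD(4)[OF T] bim_laws(2)[OF T] k one_in t] .
 finally show ?thesis .
qed

lemma bal_td:
 assumes S: "bim S" and T: "bim T"
 shows "tensor_data K (balA S T) (bob S) (bob T)"
proof (rule tensor_dataI[OF bimD(5)[OF S] bimD(5)[OF T]])
 show "\<rho> m el bob S" if "(\<rho>, l) \<in> balA S T" "m el bob S" for \<rho> l m using balAD[OF that(1)] that(2) S by auto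
 show "l n el bob T" if "(\<rho>, l) \<in> balA S T" "n el bob T" for \<rho> l n using balAD[OF that(1)] that(2) T by auto
qed

abbreviation "dA S T \<equiv> dten (balA S T) (bob S) (bob T)"
abbreviation "pA S T \<equiv> dpure (balA S T) (bob S) (bob T)"

text \<open>The explicit tensor product over the algebra. Its relations contain those over the base, because the base acts through the unit of the
 algebra.\<close>

lemma dA:
 assumes S: "bim S" and T: "bim T"
 shows dA_hm: "hm (dA S T)" and dA_tensor: "tensor_by K (balA S T) (bob S) (bob T) (dA S T) (pA S T)"
  and dA_hp: "hpairing (bob S) (bob T) (dA S T) (pA S T)"
proof -
 let ?T = "tensor K (balA S T) (bob S) (bob T)" and ?p = "pure_tensor K (balA S T) (bob S) (bob T)"
 note td = bal_td[OF S T]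
 note hS = bimD(4)[OF S] and hT = bimD(4)[OF T]
 note vT = tensor_data.ten_vs[OF td] and pb = tensor_data.pt_bilin[OF td]
 note PB = lin_b1[OF pb] lin_b2[OF pb]
 note R = bim_laws(3)[OF S] and L = bim_laws(2)[OF T]
 note RB = lin_b1[OF hpD(1)[OF R]] lin_b2[OF hpD(1)[OF R]]
 note LB = lin_b1[OF hpD(1)[OF L]] lin_b2[OF hpD(1)[OF L]]
 have bal: "?p (rm S s a) t = ?p s (lm T a t)" if "a el X" "s el bob S" "t el bob T" for s a t
  using tensor_data.pt_balanced[OF td, unfolded balanced_A] that by simp
 have G1: "?p (act (bob S) (br k) s) t = ?p s (act (bob T) (\<epsilon>t k) t)"
  if "k el H" "s el bob S" "t el bob T" for k s t using that by (simp add: src_act[OF S] tgt_act[OF T] bal)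
 have G2: "SW ?T (%u v. ?p (act (bob S) u (\<rho> s)) (act (bob T) v t)) h =
   SW ?T (%u v. ?p (act (bob S) u s) (act (bob T) v (l t))) h"
  if b: "(\<rho>, l) \<in> balA S T" and h: "h el H" and s: "s el bob S" and t: "t el bob T"
  for \<rho> l h s t
 proof -
  obtain a where a: "a el X" "\<rho> = (%s. rm S s a) \<and> l = (%t. lm T a t)" by (rule balAD[OF b, THEN bexE])
  have tr: "trilin ?T (%u v w. ?p (rm S (act (bob S) u s) (act X v a)) (act (bob T) w t))" using hS hT a(1) s t S by (intro trilinI PB RB lins; simp)
  have "SW ?T (%u v. ?p (act (bob S) u (rm S s a)) (act (bob T) v t)) h =
    SW ?T (%u v. SW ?T (%u1 u2. ?p (rm S (act (bob S) u1 s) (act X u2 a)) (act (bob T) v t)) u) h"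
  proof (rule SW_cong[OF h])
   fix u w assume uw: "u el H" "w el H"
   have Lp: "lin (bob S) ?T (%x. ?p x (act (bob T) w t))" using uw hT t by (intro PB lins) simp
   show "?p (act (bob S) u (rm S s a)) (act (bob T) w t) =
     SW ?T (%u1 u2. ?p (rm S (act (bob S) u1 s) (act X u2 a)) (act (bob T) w t)) u" unfolding hpD(3)[OF R uw(1) s a(1)]
    by (rule SW_lin[OF bimD(5)[OF S] vT Lp uw(1)]) (simp add: S hS a(1) s)
  qed
  also have "... = SW ?T (%u v. SW ?T (%v1 v2. ?p (rm S (act (bob S) u s) (act X v1 a)) (act (bob T) v2 t)) v) h" by (rule coassoc3[OF vT tr h])
  also have "... = SW ?T (%u v. ?p (act (bob S) u s) (act (bob T) v (lm T a t))) h"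
  proof (rule SW_cong[OF h])
   fix u w assume uw: "u el H" "w el H"
   have Lp: "lin (bob T) ?T (%x. ?p (act (bob S) u s) x)" using uw hS s by (intro PB lins) simp
   have "?p (act (bob S) u s) (act (bob T) w (lm T a t)) =
     SW ?T (%v1 v2. ?p (act (bob S) u s) (lm T (act X v1 a) (act (bob T) v2 t))) w" unfolding hpD(3)[OF L uw(2) a(1) t]
    by (rule SW_lin[OF bimD(5)[OF T] vT Lp uw(2)]) (simp add: T hT a(1) t)
   also have "... = SW ?T (%v1 v2. ?p (rm S (act (bob S) u s) (act X v1 a)) (act (bob T) v2 t)) w"
    by (rule SW_cong[OF uw(2)]) (simp add: bal hS hT s t a(1) uw)
   finally show "SW ?T (%v1 v2. ?p (rm S (act (bob S) u s) (act X v1 a)) (act (bob T) v2 t)) w =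
    ?p (act (bob S) u s) (act (bob T) w (lm T a t))" by simp
  qed
  finally show ?thesis using a(2) by simp
 qed
 have inj: "\<exists>f :: 'u => 'u. inj_on f Y" for Y by (rule exI[of _ "%x. x"]) simp
 show "hm (dA S T)" by (rule dten_hm[OF td hS hT inj inj]; (rule G1 G2; assumption))
 show "tensor_by K (balA S T) (bob S) (bob T) (dA S T) (pA S T)" by (rule dten_tensor[OF td hS hT inj inj]; (rule G1 G2; assumption))
 show "hpairing (bob S) (bob T) (dA S T) (pA S T)" by (rule dten_hp[OF td hS hT inj inj]; (rule G1 G2; assumption))
qed

abbreviation "tl_ar S T \<equiv> tar CC (rac S) (idn CC (bob T))"
abbreviation "tr_ar S T \<equiv> cmp CC (tar CC (idn CC (bob S)) (lac T)) (asc CC (bob S) X (bob T))"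

lemma coeq_iff:
 assumes S: "bim S" and T: "bim T" and W: "hm W" and g: "g \<in> ar CC (htens K H (bob S) (bob T)) W"
 shows "cmp CC g (tl_ar S T) = cmp CC g (tr_ar S T) \<longleftrightarrow>
  (\<forall>s\<in>carrier (bob S). \<forall>a\<in>carrier X. \<forall>t\<in>carrier (bob T).
   pmap (bob S) (bob T) g (rm S s a) t = pmap (bob S) (bob T) g s (lm T a t))"
 by (rule assoc_iff[OF bimD(4)[OF S] hmX bimD(4)[OF T] bimD(4)[OF S] bimD(4)[OF T] W
  bimD(2)[OF S] g bimD(1)[OF T] g])

text \<open>The universal property of the coequalizer, for any model \<open>Q\<close> of the tensor product over the algebra.\<close>

lemma fact_A:
 assumes S: "bim S" and T: "bim T" and W: "hm W" and Q: "hm Q"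
  and TB: "tensor_by K (balA S T) (bob S) (bob T) Q p" and p: "hpairing (bob S) (bob T) Q p"
  and q: "q \<in> ar CC (htens K H (bob S) (bob T)) Q"
   "!!s t. s el bob S ==> t el bob T ==> pmap (bob S) (bob T) q s t = p s t"
  and e: "e \<in> ar CC (htens K H (bob S) (bob T)) W"
  and b: "!!s a t. s el bob S ==> a el X ==> t el bob T ==>
   pmap (bob S) (bob T) e (rm S s a) t = pmap (bob S) (bob T) e s (lm T a t)"
 shows "\<exists>!u. u \<in> ar CC Q W \<and> cmp CC u q = e"
  and "u \<in> ar CC Q W ==> cmp CC u q = e ==> s el bob S ==> t el bob T ==>
   mp u (p s t) = pmap (bob S) (bob T) e s t"
proof -
 note hS = bimD(4)[OF S] and hT = bimD(4)[OF T]
 note hpe = pmap_hp[OF hS hT W e]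
 have val: "mp u (p s t) = pmap (bob S) (bob T) e s t"
  if u: "u \<in> ar CC Q W" "cmp CC u q = e" and st: "s el bob S" "t el bob T" for u s t
  unfolding u(2)[symmetric] using st q(2)[OF st] hpD(4)[OF htens_hp[OF hS hT] st] by (simp add: pmap_def mp_cmp[OF u(1) q(1)])
 show "u \<in> ar CC Q W ==> cmp CC u q = e ==> s el bob S ==> t el bob T ==>
   mp u (p s t) = pmap (bob S) (bob T) e s t" by (rule val)
 have bal: "balanced (balA S T) (bob S) (bob T) (pmap (bob S) (bob T) e)" unfolding balanced_A using b by simp
 obtain f where f: "lin Q W f"
  "!!s t. s el bob S ==> t el bob T ==> f (p s t) = pmap (bob S) (bob T) e s t"
  by (rule tensor_by.lift[OF TB hm_vs[OF W] hpD(1)[OF hpe] bal], rule that, assumption+)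
 have fh: "hlin Q W f" by (rule tensor_hlin[OF TB hS hT Q W p hpe f])
 let ?u = "mk_ar Q f W"
 have u: "?u \<in> ar CC Q W" by (rule mk_ar_in[OF Q fh])
 show "\<exists>!u. u \<in> ar CC Q W \<and> cmp CC u q = e"
 proof (rule ex1I[of _ ?u], intro conjI)
  show "cmp CC ?u q = e"
  proof (rule tens_ar_eqI[OF hS hT W cmp_in[OF htens_hm[OF hS hT] u q(1)] e])
   fix s t assume st: "s el bob S" "t el bob T"
   show "mp (cmp CC ?u q) (hpure K H (bob S) (bob T) s t) = mp e (hpure K H (bob S) (bob T) s t)"
    using st q(2)[OF st] hpD(4)[OF p st] hpD(4)[OF htens_hp[OF hS hT] st] f(2)[OF st] by (simp add: mp_cmp[OF u q(1)] pmap_def)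
  qed
 next
  fix v assume v: "v \<in> ar CC Q W \<and> cmp CC v q = e"
  show "v = ?u"
  proof (rule ar_eqI[OF conjunct1[OF v] u])
   fix x assume x: "x el Q"
   have "mp v x = f x" by (rule tensor_by.ext[OF TB hm_vs[OF W] hlinD(1)[OF arD(1)[OF conjunct1[OF v]]] f(1) _ x])
     (use val v f(2) in simp)
   then show "mp v x = mp ?u x" using x by simp
  qed
 qed (rule u)
qed

text \<open>The image of \<open>s \<otimes> t\<close> in the chosen tensor product over the algebra.\<close>

definition tp :: "('k, 'h, 'u) bm => ('k, 'h, 'u) bm => 'u => 'u => 'u"
 where "tp S T = pmap (bob S) (bob T) (bten_pr CC A S T)"

abbreviation "bo S T \<equiv> bten_ob CC A S T"

text \<open>The chosen coequalizer is isomorphic to the explicit tensor product, hence generated by the images of pure tensors with the same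
 relations.\<close>

lemma bten_coeq:
 assumes S: "bim S" and T: "bim T"
 shows bo_hm: "hm (bo S T)" and pr_in: "bten_pr CC A S T \<in> ar CC (htens K H (bob S) (bob T)) (bo S T)"
  and tp_tensor: "tensor_by K (balA S T) (bob S) (bob T) (bo S T) (tp S T)"
  and tp_hp: "hpairing (bob S) (bob T) (bo S T) (tp S T)"
  and tp_bal: "s el bob S ==> a el X ==> t el bob T ==> tp S T (rm S s a) t = tp S T s (lm T a t)"
proof -
 let ?ST = "htens K H (bob S) (bob T)"
 note hS = bimD(4)[OF S] and hT = bimD(4)[OF T]
 note D = dA[OF S T]
 let ?D = "dA S T"
 let ?P = "%Q q. is_coequalizer CC (tob CC (tob CC (bob S) X) (bob T)) (tob CC (bob S) (bob T)) (tl_ar S T) (tr_ar S T) Q q"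
 define q0 where "q0 = par (bob S) (bob T) ?D (pA S T)"
 have q0: "q0 \<in> ar CC ?ST ?D" "!!s t. s el bob S ==> t el bob T ==> pmap (bob S) (bob T) q0 s t = pA S T s t"
  unfolding q0_def using par[OF hS hT D(1,3)] by simp_all
 have q0b: "pmap (bob S) (bob T) q0 (rm S s a) t = pmap (bob S) (bob T) q0 s (lm T a t)"
  if "s el bob S" "a el X" "t el bob T" for s a t
 proof -
  have "(%s. rm S s a, %t. lm T a t) \<in> balA S T" using that(2) unfolding balA_def by blast
  then show ?thesis using tensor_by.p_bal[OF D(2), of "%s. rm S s a" "%t. lm T a t" s t] that S T by (simp add: q0(2))
 qed
 have "?P ?D q0" unfolding is_coequalizer_def
 proof (intro conjI ballI impI)
  show "?D \<in> obj CC" using D(1) by (simp add: CC_simps(1))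
  show "q0 \<in> ar CC (tob CC (bob S) (bob T)) ?D" using q0(1) by (simp add: CC_simps(3))
  show "cmp CC q0 (tl_ar S T) = cmp CC q0 (tr_ar S T)" unfolding coeq_iff[OF S T D(1) q0(1)] using q0b by simp
  fix Z h assume "Z \<in> obj CC" "h \<in> ar CC (tob CC (bob S) (bob T)) Z" and e: "cmp CC h (tl_ar S T) = cmp CC h (tr_ar S T)"
  then have Z: "hm Z" and h: "h \<in> ar CC ?ST Z" by (simp_all add: CC_simps(1,3))
  show "\<exists>!u. u \<in> ar CC ?D Z \<and> cmp CC u q0 = h"
   by (rule fact_A(1)[OF S T Z D(1,2,3) q0 h]) (use e[unfolded coeq_iff[OF S T Z h]] in simp_all)
 qed
 then have "\<exists>x. case x of (Q, q) => ?P Q q" by (intro exI[of _ "(?D, q0)"]) simp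
 then have "case bten_coeq CC A S T of (Q, q) => ?P Q q" unfolding bten_coeq_def by (rule someI_ex)
 then have P: "?P (bo S T) (bten_pr CC A S T)" by (simp add: case_prod_beta)
 let ?Q = "bo S T" and ?q = "bten_pr CC A S T"
 show Q: "hm ?Q" and q: "?q \<in> ar CC ?ST ?Q" using P by (simp_all add: is_coequalizer_def CC_simps(1,3))
 have qe: "cmp CC ?q (tl_ar S T) = cmp CC ?q (tr_ar S T)" using P by (simp add: is_coequalizer_def)
 have qu: "\<exists>!u. u \<in> ar CC ?Q Z \<and> cmp CC u ?q = h"
  if "hm Z" "h \<in> ar CC ?ST Z" "cmp CC h (tl_ar S T) = cmp CC h (tr_ar S T)" for Z h
  using P that unfolding is_coequalizer_def CC_simps(1,3) by blast
 have qb: "pmap (bob S) (bob T) ?q (rm S s a) t = pmap (bob S) (bob T) ?q s (lm T a t)"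
  if "s el bob S" "a el X" "t el bob T" for s a t using qe[unfolded coeq_iff[OF S T Q q]] that by simp
 show "tp S T (rm S s a) t = tp S T s (lm T a t)" if "s el bob S" "a el X" "t el bob T" unfolding tp_def by (rule qb[OF that])
 have "\<exists>!u. u \<in> ar CC ?D ?Q \<and> cmp CC u q0 = ?q" by (rule fact_A(1)[OF S T Q D(1,2,3) q0 q qb])
 then obtain u where u: "u \<in> ar CC ?D ?Q" "cmp CC u q0 = ?q" by blast
 have "cmp CC q0 (tl_ar S T) = cmp CC q0 (tr_ar S T)" unfolding coeq_iff[OF S T D(1) q0(1)] using q0b by simp
 then obtain v where v: "v \<in> ar CC ?Q ?D" "cmp CC v ?q = q0" using qu[OF D(1) q0(1)] by blast
 have uv: "mp u (mp v x) = x" if x: "x el ?Q" for x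
 proof -
  have c: "cmp CC u v \<in> ar CC ?Q ?Q" by (rule cmp_in[OF Q u(1) v(1)])
  have i: "idn CC ?Q \<in> ar CC ?Q ?Q" by (rule idn_in[OF Q])
  have "cmp CC (cmp CC u v) ?q = ?q"
  proof (rule ar_eqI[OF cmp_in[OF htens_hm[OF hS hT] c q] q])
   fix y assume y: "y el ?ST"
   have "mp (cmp CC (cmp CC u v) ?q) y = mp u (mp (cmp CC v ?q) y)"
    using y ar_closed[OF q y] by (simp add: mp_cmp[OF c q] mp_cmp[OF u(1) v(1)] mp_cmp[OF v(1) q])
   also have "... = mp (cmp CC u q0) y" using y by (simp add: v(2) mp_cmp[OF u(1) q0(1)])
   finally show "mp (cmp CC (cmp CC u v) ?q) y = mp ?q y" by (simp add: u(2))
  qed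
  moreover have "cmp CC (idn CC ?Q) ?q = ?q"
   by (rule ar_eqI[OF cmp_in[OF htens_hm[OF hS hT] i q] q]) (simp add: mp_cmp[OF i q] mp_idn ar_closed[OF q])
  ultimately have "cmp CC u v = idn CC ?Q" using qu[OF Q q qe] c i by blast
  then show ?thesis using mp_cmp[OF u(1) v(1) x] mp_idn[OF x] by simp
 qed
 have up: "mp u (pA S T s t) = tp S T s t" if st: "s el bob S" "t el bob T" for s t
  using fact_A(2)[OF S T Q D(1,2,3) q0 q qb u st] by (simp add: tp_def)
 have vu: "mp v (mp u x) = x" if x: "x el ?D" for x
 proof (rule tensor_by.ext[OF D(2) hm_vs[OF D(1)] _ lin_id _ x])
  show "lin ?D ?D (%x. mp v (mp u x))" by (rule lin_comp[OF hlinD(1)[OF arD(1)[OF u(1)]] hlinD(1)[OF arD(1)[OF v(1)]]])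
  fix s t assume st: "s el bob S" "t el bob T"
  have "mp v (mp u (pA S T s t)) = mp (cmp CC v ?q) (hpure K H (bob S) (bob T) s t)"
   using st hpD(4)[OF htens_hp[OF hS hT] st] by (simp add: up tp_def pmap_def mp_cmp[OF v(1) q])
  also have "... = pA S T s t" using q0(2)[OF st] by (simp add: v(2) pmap_def)
  finally show "mp v (mp u (pA S T s t)) = pA S T s t" .
 qed
 have bij: "bij_betw (mp u) (carrier ?D) (carrier ?Q)" by (rule bij_betwI[of _ _ _ "mp v"]) (use ar_closed[OF u(1)] ar_closed[OF v(1)] uv vu in auto)
 note I = tensor_by.iso_ten[OF D(2)]
 show "tensor_by K (balA S T) (bob S) (bob T) ?Q (tp S T)"
 proof (rule tensor_data.tensor_byI[OF bal_td[OF S T] hm_vs[OF Q]])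
  show "lin (tensor K (balA S T) (bob S) (bob T)) ?Q (%x. mp u (tensor_by.iso_ten K (balA S T) (bob S) (bob T) ?D (pA S T) x))"
   by (rule lin_comp[OF I(1) hlinD(1)[OF arD(1)[OF u(1)]]])
  show "bij_betw (%x. mp u (tensor_by.iso_ten K (balA S T) (bob S) (bob T) ?D (pA S T) x))
    (carrier (tensor K (balA S T) (bob S) (bob T))) (carrier ?Q)" using bij_betw_trans[OF I(2) bij] by (simp add: comp_def)
 qed (simp add: I(3) up)
 show "hpairing (bob S) (bob T) ?Q (tp S T)" unfolding tp_def by (rule pmap_hp[OF hS hT Q q])
qed

abbreviation "bt S T \<equiv> bten CC A S T"

lemma left_ext_A:
 assumes S: "bim S" and T: "bim T"
 obtains l where "hpairing X (bo S T) (bo S T) l"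
  "!!a s t. a el X ==> s el bob S ==> t el bob T ==> l a (tp S T s t) = tp S T (lm S a s) t"
proof (rule left_ext[OF tp_tensor[OF S T] bimD(4)[OF S] bimD(4)[OF T] bo_hm[OF S T] hmX tp_hp[OF S T] bim_laws(2)[OF S]])
 fix \<rho> l' a s t assume b: "(\<rho>, l') \<in> balA S T" and a: "a el X" and s: "s el bob S" and t: "t el bob T"
 obtain c where c: "c el X" "\<rho> = (%s. rm S s c) \<and> l' = (%t. lm T c t)" by (rule balAD[OF b, THEN bexE])
 have "tp S T (lm S a (rm S s c)) t = tp S T (rm S (lm S a s) c) t" using bim_laws(8)[OF S a c(1) s] by simp
 also have "... = tp S T (lm S a s) (lm T c t)" by (rule tp_bal[OF S T lm_closed[OF S a s] c(1) t])
 finally show "tp S T (lm S a (\<rho> s)) t = tp S T (lm S a s) (l' t)" using c(2) by simp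
qed (rule that, assumption+)

lemma right_ext_A:
 assumes S: "bim S" and T: "bim T"
 obtains r where "hpairing (bo S T) X (bo S T) r"
  "!!a s t. a el X ==> s el bob S ==> t el bob T ==> r (tp S T s t) a = tp S T s (rm T t a)"
proof (rule right_ext[OF tp_tensor[OF S T] bimD(4)[OF S] bimD(4)[OF T] bo_hm[OF S T] hmX tp_hp[OF S T] bim_laws(3)[OF T]])
 fix \<rho> l' a s t assume b: "(\<rho>, l') \<in> balA S T" and a: "a el X" and s: "s el bob S" and t: "t el bob T"
 obtain c where c: "c el X" "\<rho> = (%s. rm S s c) \<and> l' = (%t. lm T c t)" by (rule balAD[OF b, THEN bexE])
 have "tp S T (rm S s c) (rm T t a) = tp S T s (lm T c (rm T t a))" by (rule tp_bal[OF S T s c(1) rm_closed[OF T a t]])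
 also have "... = tp S T s (rm T (lm T c t) a)" using bim_laws(8)[OF T c(1) a t] by simp
 finally show "tp S T (\<rho> s) (rm T t a) = tp S T s (rm T (l' t) a)" using c(2) by simp
qed (rule that, assumption+)

lemma tp_closed [simp]: "bim S ==> bim T ==> s el bob S ==> t el bob T ==> tp S T s t el bo S T"
 using hpD(4)[OF tp_hp] .

lemma tp_ext:
 assumes S: "bim S" and T: "bim T" and W: "vs W" "lin (bo S T) W f" "lin (bo S T) W g"
  and e: "!!s t. s el bob S ==> t el bob T ==> f (tp S T s t) = g (tp S T s t)"
  and x: "x el bo S T"
 shows "f x = g x" by (rule tensor_by.ext[OF tp_tensor[OF S T] W e x])

lemma bten:
 assumes S: "bim S" and T: "bim T"
 shows bten_bim [simp]: "bim (bt S T)" and bten_bob: "bob (bt S T) = bo S T"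
  and bten_lm: "a el X ==> s el bob S ==> t el bob T ==> lm (bt S T) a (tp S T s t) = tp S T (lm S a s) t"
  and bten_rm: "a el X ==> s el bob S ==> t el bob T ==> rm (bt S T) (tp S T s t) a = tp S T s (rm T t a)"
proof -
 let ?Q = "bo S T" and ?q = "bten_pr CC A S T"
 note hS = bimD(4)[OF S] and hT = bimD(4)[OF T] and hQ = bo_hm[OF S T] and q = pr_in[OF S T]
 note vQ = hm_vs[OF hQ]
 show b: "bob (bt S T) = ?Q" by (simp add: bten_def Let_def)
 obtain l where l: "hpairing X ?Q ?Q l"
  "!!a s t. a el X ==> s el bob S ==> t el bob T ==> l a (tp S T s t) = tp S T (lm S a s) t" by (rule left_ext_A[OF S T], rule that, assumption+)
 obtain r where r: "hpairing ?Q X ?Q r"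
  "!!a s t. a el X ==> s el bob S ==> t el bob T ==> r (tp S T s t) a = tp S T s (rm T t a)" by (rule right_ext_A[OF S T], rule that, assumption+)
 note pl = par[OF hmX hQ hQ l(1)] and pr = par[OF hQ hmX hQ r(1)]
 have lac: "lac (bt S T) = par X ?Q ?Q l" unfolding bten_def Let_def bimod.simps CC_simps(3)
 proof (rule the_equality)
  show "par X ?Q ?Q l \<in> ar CC (htens K H X ?Q) ?Q \<and>
    cmp CC (par X ?Q ?Q l) (cmp CC (tar CC (idn CC X) ?q) (asc CC X (bob S) (bob T))) =
    cmp CC ?q (tar CC (lac S) (idn CC (bob T)))" using pl assoc_iff[OF hmX hS hT hS hQ hQ bimD(1)[OF S] q q pl(1)] l(2) tp_closed[OF S T]
   by (auto simp: tp_def)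
 next
  fix l' assume a: "l' \<in> ar CC (htens K H X ?Q) ?Q \<and>
    cmp CC l' (cmp CC (tar CC (idn CC X) ?q) (asc CC X (bob S) (bob T))) =
    cmp CC ?q (tar CC (lac S) (idn CC (bob T)))"
  then have l': "l' \<in> ar CC (htens K H X ?Q) ?Q" by simp
  note hl = pmap_hp[OF hmX hQ hQ l']
  have v: "pmap X ?Q l' a (tp S T s t) = tp S T (lm S a s) t"
   if "a el X" "s el bob S" "t el bob T" for a s t using a assoc_iff[OF hmX hS hT hS hQ hQ bimD(1)[OF S] q q l'] that by (simp add: tp_def)
  show "l' = par X ?Q ?Q l"
  proof (rule tens_ar_eqI[OF hmX hQ hQ l' pl(1)])
   fix a x assume a: "a el X" and x: "x el ?Q"
   have "pmap X ?Q l' a x = l a x" by (rule tp_ext[OF S T vQ bilinD(2)[OF hpD(1)[OF hl] a] bilinD(2)[OF hpD(1)[OF l(1)] a] _ x])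
     (simp add: v l(2) a)
   then show "mp l' (hpure K H X ?Q a x) = mp (par X ?Q ?Q l) (hpure K H X ?Q a x)" using pl(2)[OF a x] by (simp add: pmap_def)
  qed
 qed
 have rac: "rac (bt S T) = par ?Q X ?Q r" unfolding bten_def Let_def bimod.simps CC_simps(3)
 proof (rule the_equality)
  show "par ?Q X ?Q r \<in> ar CC (htens K H ?Q X) ?Q \<and>
    cmp CC (par ?Q X ?Q r) (tar CC ?q (idn CC X)) =
    cmp CC ?q (cmp CC (tar CC (idn CC (bob S)) (rac T)) (asc CC (bob S) (bob T) X))"
   using pr assoc_iff[OF hS hT hmX hQ hT hQ q pr(1) bimD(2)[OF T] q] r(2) tp_closed[OF S T] by (auto simp: tp_def)
 next
  fix r' assume a: "r' \<in> ar CC (htens K H ?Q X) ?Q \<and>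
    cmp CC r' (tar CC ?q (idn CC X)) =
    cmp CC ?q (cmp CC (tar CC (idn CC (bob S)) (rac T)) (asc CC (bob S) (bob T) X))"
  then have r': "r' \<in> ar CC (htens K H ?Q X) ?Q" by simp
  note hr = pmap_hp[OF hQ hmX hQ r']
  have v: "pmap ?Q X r' (tp S T s t) a = tp S T s (rm T t a)"
   if "a el X" "s el bob S" "t el bob T" for a s t using a assoc_iff[OF hS hT hmX hQ hT hQ q r' bimD(2)[OF T] q] that by (simp add: tp_def)
  show "r' = par ?Q X ?Q r"
  proof (rule tens_ar_eqI[OF hQ hmX hQ r' pr(1)])
   fix x a assume x: "x el ?Q" and a: "a el X"
   have "pmap ?Q X r' x a = r x a" by (rule tp_ext[OF S T vQ bilinD(3)[OF hpD(1)[OF hr] a] bilinD(3)[OF hpD(1)[OF r(1)] a] _ x])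
     (simp add: v r(2) a)
   then show "mp r' (hpure K H ?Q X x a) = mp (par ?Q X ?Q r) (hpure K H ?Q X x a)" using pr(2)[OF x a] by (simp add: pmap_def)
  qed
 qed
 have e: "bt S T = mkb ?Q l r" using lac rac b by (cases "bt S T") (simp add: mkb_def)
 note lb = lin_b1[OF hpD(1)[OF l(1)]] lin_b2[OF hpD(1)[OF l(1)]]
 note rb = lin_b1[OF hpD(1)[OF r(1)]] lin_b2[OF hpD(1)[OF r(1)]]
 have lc: "l a x el ?Q" "r x a el ?Q" if "a el X" "x el ?Q" for a x using hpD(4)[OF l(1) that] hpD(4)[OF r(1) that(2,1)] by simp_all
 have c: "cbim ?Q l r" unfolding cbim_def
 proof (intro conjI ballI)
  fix x assume x: "x el ?Q"
  show "l one x = x" by (rule tp_ext[OF S T vQ _ lin_id _ x]) (intro lb lins, simp, simp add: l(2) bim_laws(5)[OF S])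
  show "r x one = x" by (rule tp_ext[OF S T vQ _ lin_id _ x]) (intro rb lins, simp, simp add: r(2) bim_laws(7)[OF T])
  fix a b assume a: "a el X" and b: "b el X"
  show "l (mul a b) x = l a (l b x)"
   by (rule tp_ext[OF S T vQ _ _ _ x]) (intro lb lins, use a b S in simp, intro lb lins, (use a b S in "simp add: l(2) bim_laws(4)[OF S]")+)
  show "r (r x a) b = r x (mul a b)"
   by (rule tp_ext[OF S T vQ _ _ _ x, where f = "%x. r (r x a) b"]) ((intro rb lins; use a b in simp)+, use a b T in "simp add: r(2) bim_laws(6)[OF T]")
  show "r (l a x) b = l a (r x b)"
   by (rule tp_ext[OF S T vQ _ _ _ x, where f = "%x. r (l a x) b"]) ((intro rb lb lins; use a b in simp)+, use a b S T in "simp add: l(2) r(2)")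
 qed (rule hQ l(1) r(1))+
 note M = mkb[OF c, folded e]
 show "bim (bt S T)" by (rule M(1))
 show "lm (bt S T) a (tp S T s t) = tp S T (lm S a s) t" if "a el X" "s el bob S" "t el bob T" using M(3)[of a "tp S T s t"] that l(2) S T by simp
 show "rm (bt S T) (tp S T s t) a = tp S T s (rm T t a)" if "a el X" "s el bob S" "t el bob T" using M(4)[of a "tp S T s t"] that r(2) S T by simp
qed

text \<open>Tensor products of arrows and the unit isomorphisms are given by definite descriptions; here the described arrow is shown to exist, to be
 a map of bimodules, and to have the expected values.\<close>

lemma bt_the:
 assumes S: "bim S" and T: "bim T" and W: "bim W" and e: "e \<in> ar CC (htens K H (bob S) (bob T)) (bob W)"
  and b: "!!s t. s el bob S ==> t el bob T ==> pmap (bob S) (bob T) e s t = b s t"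
  and bal: "!!s a t. s el bob S ==> a el X ==> t el bob T ==> b (rm S s a) t = b s (lm T a t)"
  and l: "!!s a t. s el bob S ==> a el X ==> t el bob T ==> b (lm S a s) t = lm W a (b s t)"
  and r: "!!s a t. s el bob S ==> a el X ==> t el bob T ==> b s (rm T t a) = rm W (b s t) a"
 defines "h \<equiv> THE h. h \<in> ar CC (bo S T) (bob W) \<and> cmp CC h (bten_pr CC A S T) = e"
 shows "h \<in> ar BB (bt S T) W" and "s el bob S ==> t el bob T ==> mp h (tp S T s t) = b s t"
proof -
 note hS = bimD(4)[OF S] and hT = bimD(4)[OF T] and hW = bimD(4)[OF W]
 have q: "pmap (bob S) (bob T) (bten_pr CC A S T) s t = tp S T s t" for s t by (simp add: tp_def)
 have bal': "pmap (bob S) (bob T) e (rm S s a) t = pmap (bob S) (bob T) e s (lm T a t)"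
  if "s el bob S" "a el X" "t el bob T" for s a t using that S T bal by (simp add: b)
 have F1: "\<exists>!u. u \<in> ar CC (bo S T) (bob W) \<and> cmp CC u (bten_pr CC A S T) = e"
  by (rule fact_A(1)[OF S T hW bo_hm[OF S T] tp_tensor[OF S T] tp_hp[OF S T] pr_in[OF S T] q e bal'])
 have h: "h \<in> ar CC (bo S T) (bob W) \<and> cmp CC h (bten_pr CC A S T) = e" unfolding h_def by (rule theI'[OF F1])
 show v: "mp h (tp S T s t) = b s t" if "s el bob S" "t el bob T" for s t
  using fact_A(2)[OF S T hW bo_hm[OF S T] tp_tensor[OF S T] tp_hp[OF S T] pr_in[OF S T] q e bal' conjunct1[OF h] conjunct2[OF h] that] b[OF that] by simp
 note hl = hlinD(1)[OF arD(1)[OF conjunct1[OF h]]]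
 note vW = bimD(5)[OF W]
 have Q: "bim (bt S T)" "bob (bt S T) = bo S T" using bten[OF S T] by simp_all
 note LW = bim_laws[OF W] and LQ = bim_laws[OF Q(1)]
 note hl' = hl[unfolded Q(2)[symmetric]]
 have "bhom (bo S T) (lm (bt S T)) (rm (bt S T)) (bob W) (lm W) (rm W) (mp h)" unfolding bhom_def
 proof (intro conjI ballI)
  show "hlin (bo S T) (bob W) (mp h)" by (rule arD(1)[OF conjunct1[OF h]])
  fix a x assume a: "a el X" and x: "x el bo S T"
  have L1: "lin (bo S T) (bob W) (%x. mp h (lm (bt S T) a x))" "lin (bo S T) (bob W) (%x. lm W a (mp h x))" unfolding Q(2)[symmetric]
   by (rule lin_comp[OF bilinD(2)[OF hpD(1)[OF LQ(2)] a] hl'], rule lin_comp[OF hl' bilinD(2)[OF hpD(1)[OF LW(2)] a]])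
  have L2: "lin (bo S T) (bob W) (%x. mp h (rm (bt S T) x a))" "lin (bo S T) (bob W) (%x. rm W (mp h x) a)" unfolding Q(2)[symmetric]
   by (rule lin_comp[OF bilinD(3)[OF hpD(1)[OF LQ(3)] a] hl'], rule lin_comp[OF hl' bilinD(3)[OF hpD(1)[OF LW(3)] a]])
  show "mp h (lm (bt S T) a x) = lm W a (mp h x)" by (rule tp_ext[OF S T vW L1 _ x]) (use a S in "simp add: bten_lm[OF S T] v l")
  show "mp h (rm (bt S T) x a) = rm W (mp h x) a" by (rule tp_ext[OF S T vW L2 _ x]) (use a T in "simp add: bten_rm[OF S T] v r")
 qed
 then have "bh (bt S T) W (mp h)" by (simp only: Q(2))
 then show "h \<in> ar BB (bt S T) W" unfolding B_ar_iff[OF Q(1) W] Q(2) using h by blast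
qed

lemma bten_ar:
 assumes S: "bim S" "bim S'" and T: "bim T" "bim T'" and f: "f \<in> ar BB S S'" and g: "g \<in> ar BB T T'"
 shows bten_ar_in: "bten_ar CC A S S' T T' f g \<in> ar BB (bt S T) (bt S' T')"
  and mp_bten_ar: "s el bob S ==> t el bob T ==>
   mp (bten_ar CC A S S' T T' f g) (tp S T s t) = tp S' T' (mp f s) (mp g t)"
proof -
 note fb = B_arD(2)[OF S f] and gb = B_arD(2)[OF T g]
 note t = tar[OF bimD(4)[OF S(1)] bimD(4)[OF T(1)] bimD(4)[OF S(2)] bimD(4)[OF T(2)] B_arD(1)[OF f] B_arD(1)[OF g]]
 note q = pr_in[OF S(2) T(2)]
 note W = bten[OF S(2) T(2)]
 let ?e = "cmp CC (bten_pr CC A S' T') (tar CC f g)"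
 have e: "?e \<in> ar CC (htens K H (bob S) (bob T)) (bob (bt S' T'))"
  unfolding W(2) by (rule cmp_in[OF htens_hm[OF bimD(4)[OF S(1)] bimD(4)[OF T(1)]] q t(1)])
 have b: "pmap (bob S) (bob T) ?e s t = tp S' T' (mp f s) (mp g t)" if "s el bob S" "t el bob T" for s t
  using that hpD(4)[OF htens_hp[OF bimD(4)[OF S(1)] bimD(4)[OF T(1)]] that] by (simp add: pmap_def mp_cmp[OF q t(1)] t(2) tp_def)
 have eq: "bten_ar CC A S S' T T' f g = (THE h. h \<in> ar CC (bo S T) (bob (bt S' T')) \<and> cmp CC h (bten_pr CC A S T) = ?e)"
  by (simp add: bten_ar_def W(2))
 note c = bhD(5)[OF fb] bhD(5)[OF gb]
 have R: "tp S' T' (mp f (rm S s a)) (mp g t) = tp S' T' (mp f s) (mp g (lm T a t))"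
  "tp S' T' (mp f (lm S a s)) (mp g t) = lm (bt S' T') a (tp S' T' (mp f s) (mp g t))"
  "tp S' T' (mp f s) (mp g (rm T t a)) = rm (bt S' T') (tp S' T' (mp f s) (mp g t)) a"
  if "s el bob S" "a el X" "t el bob T" for s a t using that by (simp_all add: bhD(3,4)[OF fb] bhD(3,4)[OF gb] c tp_bal[OF S(2) T(2)] W(3,4))
 note B = bt_the[OF S(1) T(1) W(1) e b R, folded eq]
 show "bten_ar CC A S S' T T' f g \<in> ar BB (bt S T) (bt S' T')" by (rule B(1))
 show "s el bob S ==> t el bob T ==>
   mp (bten_ar CC A S S' T T' f g) (tp S T s t) = tp S' T' (mp f s) (mp g t)" by (rule B(2))
qed

lemma bten_lun:
 assumes T: "bim T"
 shows bten_lun_in: "bten_lun CC A T \<in> ar BB (bt AA T) T"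
  and mp_bten_lun: "a el X ==> t el bob T ==> mp (bten_lun CC A T) (tp AA T a t) = lm T a t"
proof -
 note L = bim_laws[OF T]
 have R: "lm T (rm AA s a) t = lm T s (lm T a t)" "lm T (lm AA a s) t = lm T a (lm T s t)"
  "lm T s (rm T t a) = rm T (lm T s t) a"
  if "s el bob AA" "a el X" "t el bob T" for s a t using that(1)[unfolded A_bim(2)] that(2,3) by (simp_all add: A_bim(3,4) L(4,8))
 have e: "lac T \<in> ar CC (htens K H (bob AA) (bob T)) (bob T)" using bimD(1)[OF T] by (simp add: A_bim(2))
 have b: "pmap (bob AA) (bob T) (lac T) s t = lm T s t" for s t by (simp add: A_bim(2))
 note B = bt_the[OF A_bim(1) T T e b R, folded bten_lun_def]
 show "bten_lun CC A T \<in> ar BB (bt AA T) T" by (rule B(1))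
 show "a el X ==> t el bob T ==> mp (bten_lun CC A T) (tp AA T a t) = lm T a t" using B(2) by (simp add: A_bim(2))
qed

lemma bten_run:
 assumes S: "bim S"
 shows bten_run_in: "bten_run CC A S \<in> ar BB (bt S AA) S"
  and mp_bten_run: "s el bob S ==> a el X ==> mp (bten_run CC A S) (tp S AA s a) = rm S s a"
proof -
 note L = bim_laws[OF S]
 have R: "rm S (rm S s a) t = rm S s (lm AA a t)" "rm S (lm S a s) t = lm S a (rm S s t)"
  "rm S s (rm AA t a) = rm S (rm S s t) a"
  if "s el bob S" "a el X" "t el bob AA" for s a t using that(3)[unfolded A_bim(2)] that(1,2) by (simp_all add: A_bim(3,4) L(6,8))
 have e: "rac S \<in> ar CC (htens K H (bob S) (bob AA)) (bob S)" using bimD(2)[OF S] by (simp add: A_bim(2))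
 have b: "pmap (bob S) (bob AA) (rac S) s t = rm S s t" for s t by (simp add: A_bim(2))
 note B = bt_the[OF S A_bim(1) S e b R, folded bten_run_def]
 show "bten_run CC A S \<in> ar BB (bt S AA) S" by (rule B(1))
 show "s el bob S ==> a el X ==> mp (bten_run CC A S) (tp S AA s a) = rm S s a" using B(2) by (simp add: A_bim(2))
qed

end

section \<open>Induced bimodules\<close>

lemma (in vec) tensor_lift_list:
 assumes td: "tensor_data K {} M N" and W: "vs W" and b: "bilin M N W b"
  and xs: "set xs \<subseteq> carrier M \<times> carrier N" "e = lsum (tensor K {} M N) (%(m, n). pure_tensor K {} M N m n) xs"
 shows "tensor_lift K W b e = lsum W (%p. b (fst p) (snd p)) xs"
proof -
 note tl = tensor_data.tensor_lift[OF td W b, unfolded balanced_def, simplified]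
 note pc = bilinD(4)[OF tensor_data.pt_bilin[OF td]]
 have c: "fst p el M \<and> snd p el N" if "p \<in> set xs" for p using that xs(1) by (cases p) auto
 have "tensor_lift K W b e = lsum W (%p. tensor_lift K W b (case p of (m, n) => pure_tensor K {} M N m n)) xs" unfolding xs(2)
  by (rule lsum_lin[OF tensor_data.ten_vs[OF td] W tl(1)]) (use c pc in "auto simp: case_prod_beta")
 also have "... = lsum W (%p. b (fst p) (snd p)) xs" by (rule lsum_cong) (use c tl(2) in "auto simp: case_prod_beta")
 finally show ?thesis .
qed

context halg
begin

lemma A_simps [simp]: "bim AA" "bob AA = X" "lac AA = amul A" "rac AA = amul A" "pmap X X (amul A) = mul"
 using A_bim(1) by (simp_all add: alg_bimod_def mul_def)

text \<open>Lifting on elements; epimorphisms of bimodules are the surjections.\<close>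

lemma projD:
 assumes P: "projective BB P" and S: "bim Y" "bim Z" and g: "bh Y Z g" "g ` carrier (bob Y) = carrier (bob Z)"
  and f: "bh P Z f"
 obtains h where "bh P Y h" "!!p. p el bob P ==> g (h p) = f p"
proof -
 have bP: "bim P" using P by (simp add: projective_def BB_simps)
 let ?g = "mk_ar (bob Y) g (bob Z)" and ?f = "mk_ar (bob P) f (bob Z)"
 have ga: "?g \<in> ar BB Y Z" by (rule B_arI[OF S g(1)])
 have fa: "?f \<in> ar BB P Z" by (rule B_arI[OF bP S(2) f])
 have "mp ?g ` carrier (bob Y) = g ` carrier (bob Y)" by (rule image_cong[OF refl mp_mk])
 then have e: "epi BB Y Z ?g" using B_epiI[OF S ga] g(2) by simp
 have "\<exists>h\<in>ar BB P Y. cmp BB ?g h = ?f"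
  by (rule P[unfolded projective_def, THEN conjunct2, rule_format, OF _ _ e fa]) (use S in "simp_all add: BB_simps(1)")
 then obtain h where h: "h \<in> ar BB P Y" "cmp CC ?g h = ?f" by (auto simp: BB_simps)
 show thesis
 proof (rule that)
  show "bh P Y (mp h)" by (rule B_arD(2)[OF bP S(1) h(1)])
  fix p assume p: "p el bob P"
  have "g (mp h p) = mp (cmp CC ?g h) p" using p mp_cmp[OF B_arD(1)[OF ga] B_arD(1)[OF h(1)] p] ar_closed[OF B_arD(1)[OF h(1)] p] by simp
  then show "g (mp h p) = f p" using p by (simp add: h(2))
 qed
qed

lemma projI:
 assumes bP: "bim P"
  and l: "!!Y Z g f. bim Y ==> bim Z ==> bh Y Z g ==> g ` carrier (bob Y) = carrier (bob Z) ==> bh P Z f ==>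
   \<exists>h. bh P Y h \<and> (\<forall>p\<in>carrier (bob P). g (h p) = f p)"
 shows "projective BB P" unfolding projective_def
proof (intro conjI ballI allI impI)
 show "P \<in> obj BB" using bP by (simp add: BB_simps)
 fix Y Z g f assume "Y \<in> obj BB" "Z \<in> obj BB" and e: "epi BB Y Z g" and f: "f \<in> ar BB P Z"
 then have S: "bim Y" "bim Z" by (simp_all add: BB_simps)
 note g = B_epiD[OF S e]
 obtain h where h: "bh P Y h" "\<forall>p\<in>carrier (bob P). mp g (h p) = mp f p"
  using l[OF S B_arD(2)[OF S g(1)] g(2) B_arD(2)[OF bP S(2) f]] by blast
 let ?h = "mk_ar (bob P) h (bob Y)"
 have ha: "?h \<in> ar BB P Y" by (rule B_arI[OF bP S(1) h(1)])
 have "cmp CC g ?h = f" by (rule ar_eqI[OF cmp_in[OF bimD(4)[OF bP] B_arD(1)[OF g(1)] B_arD(1)[OF ha]] B_arD(1)[OF f]])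
   (use h(2) in "simp add: mp_cmp[OF B_arD(1)[OF g(1)] B_arD(1)[OF ha]]")
 then show "\<exists>h\<in>ar BB P Y. cmp BB g h = f" using ha by (auto simp: BB_simps)
qed

lemma proj_bim: "projective BB P ==> bim P" by (simp add: projective_def BB_simps)

lemma proj_retract:
 assumes P: "projective BB P" and S: "bim S" and i: "bh S P i" and \<pi>: "bh P S \<pi>"
  and e: "!!s. s el bob S ==> \<pi> (i s) = s"
 shows "projective BB S"
proof (rule projI[OF S])
 fix Y Z :: "('k, 'h, 'u) bm" and g f
 assume a: "bim Y" "bim Z" "bh Y Z g" "g ` carrier (bob Y) = carrier (bob Z)" "bh S Z f"
 obtain h where h: "bh P Y h" "!!p. p el bob P ==> g (h p) = f (\<pi> p)"
  by (rule projD[OF P a(1-4) bhom_comp[OF \<pi> a(5)]], rule that, assumption+)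
 show "\<exists>h. bh S Y h \<and> (\<forall>p\<in>carrier (bob S). g (h p) = f p)"
  by (intro exI[of _ "%s. h (i s)"] conjI bhom_comp[OF i h(1)] ballI) (simp add: h(2) bhD(5)[OF i] e)
qed

text \<open>\<open>Q\<close> is the free \<open>H\<close>-module \<open>H \<otimes> V\<close> over \<open>K\<close>, with \<open>fp h v\<close>
 standing for \<open>h \<otimes> v\<close>.\<close>

definition hfree :: "('k, 'h, 'u) hmod => ('k, 'h, 'u) hmod => ('h => 'u => 'u) => bool"
 where "hfree V Q fp \<longleftrightarrow> vs V \<and> hm Q \<and> tensor_by K {} H V Q fp \<and>
  (\<forall>h\<in>carrier H. \<forall>k\<in>carrier H. \<forall>v\<in>carrier V. act Q h (fp k v) = fp (h ** k) v)"

lemma hfree_ex: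
 assumes V: "vs V"
 shows "\<exists>Q fp. hfree V Q fp"
proof -
 let ?T = "tensor K {} H V" and ?p = "pure_tensor K {} H V"
 have td: "tensor_data K {} H V" by (rule tensor_dataI) (use V in auto)
 have inj: "\<exists>f :: ('h \<times> 'u => 'k) set => 'u. inj_on f (carrier ?T)"
  by (rule tensor_data.ten_inj[OF td inf_u size_H]) (rule exI[of _ "%x. x"], simp)
 note vT = tensor_data.ten_vs[OF td] and pb = tensor_data.pt_bilin[OF td]
 note PB = lin_b1[OF pb] lin_b2[OF pb]
 let ?\<alpha> = "%h. tensor_lift K ?T (%k v. ?p (h ** k) v)"
 define Q where "Q = (code_mod ?T ?\<alpha> :: ('k, 'h, 'u) hmod)"
 note code = code_mod[OF vT inj, where \<alpha> = ?\<alpha>, folded Q_def]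
 let ?e = "code_in (carrier ?T) :: _ => 'u"
 define fp where "fp = (%k v. ?e (?p k v))"
 have bl: "bilin H V ?T (%k v. ?p (h ** k) v)" if "h el H" for h using that by (intro bilinI PB lins; simp)
 note lift = tensor_data.tensor_lift[OF td vT bl bal_empty]
 have TB: "tensor_by K {} H V Q fp" by (rule tensor_data.tensor_byI[OF td code(1-3)]) (simp add: fp_def)
 note fb = tensor_by.p_bilin[OF TB]
 note FB = lin_b1[OF fb] lin_b2[OF fb]
 note fc = bilinD(4)[OF fb]
 have ac: "act Q h (fp k v) = fp (h ** k) v" if "h el H" "k el H" "v el V" for h k v
  using that code(4)[OF bilinD(4)[OF pb that(2,3)], of h] lift(2)[OF that] by (simp add: fp_def)
 have al: "lin Q Q (act Q h)" if h: "h el H" for h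
 proof -
  note iv = lin_inv[OF code(2,3) vT]
  let ?i = "inv_into (carrier ?T) ?e"
  have "lin Q Q (%x. ?e (?\<alpha> h (?i x)))" by (rule lin_comp[OF lin_comp[OF iv(1) lift(1)[OF h]] code(2)])
  moreover have "act Q h x = ?e (?\<alpha> h (?i x))" if x: "x el Q" for x
  proof -
   have "?e (?i x) = x" by (rule f_inv_into_f) (use code(3) x in "simp add: bij_betw_def")
   then show ?thesis using code(4)[OF linD(1)[OF iv(1) x], of h] by simp
  qed
  ultimately show ?thesis using lin_cong[OF _ code(1), of "act Q h" "%x. ?e (?\<alpha> h (?i x))" Q] by simp
 qed
 have hl: "lin H Q (%h. act Q h x)" if x: "x el Q" for x
 proof (rule tensor_by.induct[OF TB x])
  show "lin H Q (%h. act Q h 0[Q])"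
   using lin_cong[OF _ vsH, of "%h. act Q h 0[Q]" "%h. 0[Q]" Q] lin_zero[OF code(1) code(1) al] lin_zero_map[OF code(1), of H] by simp
  fix y z assume yz: "y el Q" "z el Q" "lin H Q (%h. act Q h y)" "lin H Q (%h. act Q h z)"
  show "lin H Q (%h. act Q h (y +[Q] z))" using lin_cong[OF _ vsH, of "%h. act Q h (y +[Q] z)" "%h. act Q h y +[Q] act Q h z" Q]
    linD(2)[OF al yz(1,2)] lin_add_map[OF code(1) yz(3,4)] by simp
 next
  fix k v assume kv: "k el H" "v el V"
  have L: "lin H Q (%h. fp (h ** k) v)" using kv by (intro FB lins; simp)
  show "lin H Q (%h. act Q h (fp k v))" using lin_cong[OF _ vsH, of "%h. act Q h (fp k v)" "%h. fp (h ** k) v" Q] ac kv L by simp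
 qed
 have "hm Q" unfolding is_hmod_def
 proof (intro conjI ballI code(1) al hl)
  fix x assume x: "x el Q"
  show "act Q 1[H] x = x" by (rule tensor_by.ext[OF TB code(1) al lin_id _ x]) (simp_all add: ac)
  fix g h assume gh: "g el H" "h el H"
  show "act Q (g ** h) x = act Q g (act Q h x)"
   by (rule tensor_by.ext[OF TB code(1) al lin_comp[OF al al] _ x]) (use gh in "simp_all add: ac H_assoc")
 qed
 then show ?thesis using V TB ac unfolding hfree_def by blast
qed

lemma hfreeD:
 assumes "hfree V Q fp"
 shows "vs V" "hm Q" "tensor_by K {} H V Q fp"
  "h el H ==> k el H ==> v el V ==> act Q h (fp k v) = fp (h ** k) v" using assms by (simp_all add: hfree_def)

lemma hfree_map:
 assumes F: "hfree V Q fp" and M: "hm M" and s: "lin V M s"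
 obtains f where "hlin Q M f" "!!h v. h el H ==> v el V ==> f (fp h v) = act M h (s v)"
proof -
 note D = hfreeD[OF F]
 have b: "bilin H V M (%h v. act M h (s v))" using M linD(1)[OF s] by (intro bilinI lins s; simp)
 obtain f where f: "lin Q M f" "!!h v. h el H ==> v el V ==> f (fp h v) = act M h (s v)"
  by (rule tensor_by.lift[OF D(3) hm_vs[OF M] b bal_empty], rule that, assumption+)
 have "f (act Q g x) = act M g (f x)" if g: "g el H" and x: "x el Q" for g x
  by (rule tensor_by.ext[OF D(3) hm_vs[OF M] lin_comp[OF hmD(2)[OF D(2) g] f(1)] lin_comp[OF f(1) hmD(2)[OF M g]] _ x])
   (use g linD(1)[OF s] in "simp add: D(4) f(2) hmD(5)[OF M]")
 then show thesis using that hlinI[OF f(1)] f(2) by blast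
qed

abbreviation "NN Q T \<equiv> htens K H Q (bob T)"
abbreviation "np Q T \<equiv> hpure K H Q (bob T)"
abbreviation "WW Q T \<equiv> htens K H X (NN Q T)"
abbreviation "wn Q T \<equiv> hpure K H X (NN Q T)"
abbreviation "wp Q T a q t \<equiv> hpure K H X (NN Q T) a (np Q T q t)"

text \<open>\<open>W\<close> is \<open>A \<otimes> (Q \<otimes> T)\<close> with \<open>A\<close> acting on the left factor \<open>A\<close> and,
 through \<open>r\<close>, on the right of \<open>T\<close>. The map \<open>r\<close> on \<open>Q \<otimes> T\<close> is kept as a parameter because
 maps out of \<open>W\<close> correspond to maps out of \<open>Q \<otimes> T\<close> that respect it.\<close>

definition ind :: "('k, 'h, 'u) hmod => ('k, 'h, 'u) bm => ('u => 'u => 'u) => ('k, 'h, 'u) bm => bool"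
 where "ind Q T r W \<longleftrightarrow> hm Q \<and> bim T \<and> bim W \<and> bob W = WW Q T \<and> hpairing (NN Q T) X (NN Q T) r \<and>
  (\<forall>q\<in>carrier Q. \<forall>t\<in>carrier (bob T). \<forall>c\<in>carrier X. r (np Q T q t) c = np Q T q (rm T t c)) \<and>
  (\<forall>a\<in>carrier X. \<forall>b\<in>carrier X. \<forall>n\<in>carrier (NN Q T).
   lm W a (wn Q T b n) = wn Q T (mul a b) n \<and> rm W (wn Q T b n) a = wn Q T b (r n a))"

lemma indD:
 assumes "ind Q T r W"
 shows "hm Q" "bim T" "bim W" "bob W = WW Q T" "hpairing (NN Q T) X (NN Q T) r"
  "q el Q ==> t el bob T ==> c el X ==> r (np Q T q t) c = np Q T q (rm T t c)"
  "a el X ==> b el X ==> n el NN Q T ==> lm W a (wn Q T b n) = wn Q T (mul a b) n"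
  "a el X ==> b el X ==> n el NN Q T ==> rm W (wn Q T b n) a = wn Q T b (r n a)" using assms unfolding ind_def by blast+

lemma ind_ex:
 assumes Q: "hm Q" and T: "bim T"
 shows "\<exists>r W. ind Q T r W"
proof -
 let ?N = "NN Q T" and ?W = "WW Q T"
 note hT = bimD(4)[OF T] and L = bim_laws[OF T]
 note hN = htens_hm[OF Q hT]
 note hW = htens_hm[OF hmX hN]
 note pN = htens_hp[OF Q hT] and tN = htens_tensor[OF Q hT]
 note pW = htens_hp[OF hmX hN] and tW = htens_tensor[OF hmX hN]
 have cr: "p (\<rho> m) (r n a) = p m (r (l' n) a)"
  if M: "hm M" "hm N" "hm V" "hpairing M N V p" and r: "hpairing N X N r"
   and bl: "(\<rho>, l') \<in> base_bal K H M N" and m: "m el M" and n: "n el N" and a: "a el X"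
  for M N V :: "('k, 'h, 'u) hmod" and p r \<rho> l' a m n
 proof -
  obtain k where k: "k el H" "\<rho> = act M (br k) \<and> l' = act N (\<epsilon>t k)" by (rule base_balD[OF bl, THEN bexE])
  have "p (\<rho> m) (r n a) = p m (act N (\<epsilon>t k) (r n a))" using hpD(2)[OF M(4) k(1) m hpD(4)[OF r n a]] k(2) by simp
  also have "... = p m (r (l' n) a)" using hp_target[OF M(2) hmX M(2) r k(1) n a] k(2) by simp
  finally show ?thesis .
 qed
 obtain r where r: "hpairing ?N X ?N r"
  "!!c q t. c el X ==> q el Q ==> t el bob T ==> r (np Q T q t) c = np Q T q (rm T t c)"
  by (rule right_ext[OF tN Q hT hN hmX pN L(3)], rule cr[OF Q hT hN pN L(3)], assumption+, rule that, assumption+)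
 obtain R where R: "hpairing ?W X ?W R"
  "!!c a n. c el X ==> a el X ==> n el ?N ==> R (wn Q T a n) c = wn Q T a (r n c)"
  by (rule right_ext[OF tW hmX hN hW hmX pW r(1)], rule cr[OF hmX hN hW pW r(1)], assumption+, rule that, assumption+)
 have cl: "wn Q T (mul a (\<rho> m)) n = wn Q T (mul a m) (l' n)"
  if bl: "(\<rho>, l') \<in> base_bal K H X ?N" and a: "a el X" and m: "m el X" and n: "n el ?N" for \<rho> l' a m n
 proof -
  obtain k where k: "k el H" "\<rho> = act X (br k) \<and> l' = act ?N (\<epsilon>t k)" by (rule base_balD[OF bl, THEN bexE])
  show ?thesis using hp_source[OF hmX hmX hmX mul_hp k(1) a m] hpD(2)[OF pW k(1) mul_closed[OF a m] n] k(2) by simp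
 qed
 obtain l where l: "hpairing X ?W ?W l"
  "!!c a n. c el X ==> a el X ==> n el ?N ==> l c (wn Q T a n) = wn Q T (mul c a) n"
  by (rule left_ext[OF tW hmX hN hW hmX pW mul_hp], rule cl, assumption+, rule that, assumption+)
 note rb = lin_b1[OF hpD(1)[OF r(1)]] lin_b2[OF hpD(1)[OF r(1)]]
 note Rb = lin_b1[OF hpD(1)[OF R(1)]] lin_b2[OF hpD(1)[OF R(1)]]
 note lb = lin_b1[OF hpD(1)[OF l(1)]] lin_b2[OF hpD(1)[OF l(1)]]
 note c = hpD(4)[OF pN] hpD(4)[OF pW] hpD(4)[OF r(1)]
 note vN = hm_vs[OF hN] and vW = hm_vs[OF hW]
 have r1: "r n one = n" if n: "n el ?N" for n by (rule tensor_by.ext[OF tN vN _ lin_id _ n]) (intro rb lins, simp, simp add: r(2) L(7))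
 have rr: "r (r n a) b = r n (mul a b)" if n: "n el ?N" and a: "a el X" and b: "b el X" for n a b
  by (rule tensor_by.ext[OF tN vN _ _ _ n, where f = "%n. r (r n a) b"])
   ((intro rb lins; use a b in simp)+, use a b T in "simp add: r(2) L(6)")
 have cb: "cbim ?W l R" unfolding cbim_def
 proof (intro conjI ballI hW l(1) R(1))
  fix x assume x: "x el ?W"
  show "l one x = x" by (rule tensor_by.ext[OF tW vW _ lin_id _ x]) (intro lb lins, simp, simp add: l(2) mul_laws(2))
  show "R x one = x" by (rule tensor_by.ext[OF tW vW _ lin_id _ x]) (intro Rb lins, simp, simp add: R(2) r1)
  fix a b assume a: "a el X" and b: "b el X"
  show "l (mul a b) x = l a (l b x)"
   by (rule tensor_by.ext[OF tW vW _ _ _ x]) (intro lb lins, use a b in simp, intro lb lins, (use a b in "simp add: l(2) mul_laws(1)")+)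
  show "R (R x a) b = R x (mul a b)" by (rule tensor_by.ext[OF tW vW _ _ _ x, where f = "%x. R (R x a) b"])
    ((intro Rb lins; use a b in simp)+, use a b c in "simp add: R(2) rr")
  show "R (l a x) b = l a (R x b)" by (rule tensor_by.ext[OF tW vW _ _ _ x, where f = "%x. R (l a x) b"])
    ((intro Rb lb lins; use a b in simp)+, use a b c in "simp add: R(2) l(2)")
 qed
 have "ind Q T r (mkb ?W l R)" unfolding ind_def mkb_bob[OF cb]
  using Q T r mkb_bim[OF cb] mkb_lm[OF cb, unfolded mkb_bob[OF cb]] mkb_rm[OF cb, unfolded mkb_bob[OF cb]] l(2) R(2) c by simp
 then show ?thesis by blast
qed

lemma ind_facts:
 assumes "ind Q T r W"
 shows "hm (NN Q T)" "vs (NN Q T)" "vs (WW Q T)"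
  "q el Q ==> t el bob T ==> np Q T q t el NN Q T"
  "a el X ==> n el NN Q T ==> wn Q T a n el WW Q T"
  "bilin Q (bob T) (NN Q T) (np Q T)" "bilin X (NN Q T) (WW Q T) (wn Q T)"
  "hpairing Q (bob T) (NN Q T) (np Q T)" "hpairing X (NN Q T) (WW Q T) (wn Q T)"
  "tensor_by K (base_bal K H Q (bob T)) Q (bob T) (NN Q T) (np Q T)"
  "tensor_by K (base_bal K H X (NN Q T)) X (NN Q T) (WW Q T) (wn Q T)"
  "q el Q ==> t el bob T ==> a el X ==> c el X ==> lm W c (wp Q T a q t) = wp Q T (mul c a) q t"
  "q el Q ==> t el bob T ==> a el X ==> c el X ==> rm W (wp Q T a q t) c = wp Q T a q (rm T t c)"
proof -
 note D = indD[OF assms]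
 note hT = bimD(4)[OF D(2)]
 note hN = htens_hm[OF D(1) hT]
 note pN = htens_hp[OF D(1) hT] and pW = htens_hp[OF hmX hN]
 show "hm (NN Q T)" "vs (NN Q T)" "vs (WW Q T)" using hN hm_vs[OF hN] hm_vs[OF htens_hm[OF hmX hN]] by simp_all
 show c: "q el Q ==> t el bob T ==> np Q T q t el NN Q T"
  "a el X ==> n el NN Q T ==> wn Q T a n el WW Q T" for q t a n by (rule hpD(4)[OF pN], assumption+) (rule hpD(4)[OF pW], assumption+)
 show "bilin Q (bob T) (NN Q T) (np Q T)" "bilin X (NN Q T) (WW Q T) (wn Q T)"
  "hpairing Q (bob T) (NN Q T) (np Q T)" "hpairing X (NN Q T) (WW Q T) (wn Q T)" by (rule hpD(1)[OF pN], rule hpD(1)[OF pW], rule pN, rule pW)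
 show "tensor_by K (base_bal K H Q (bob T)) Q (bob T) (NN Q T) (np Q T)"
  "tensor_by K (base_bal K H X (NN Q T)) X (NN Q T) (WW Q T) (wn Q T)" by (rule htens_tensor[OF D(1) hT], rule htens_tensor[OF hmX hN])
 show "lm W c (wp Q T a q t) = wp Q T (mul c a) q t" "rm W (wp Q T a q t) c = wp Q T a q (rm T t c)"
  if "q el Q" "t el bob T" "a el X" "c el X" using that c(1)[OF that(1,2)] by (simp_all add: D(6-8))
qed

lemma ind_ext:
 assumes I: "ind Q T r W" and Z: "vs Z" "lin (WW Q T) Z f" "lin (WW Q T) Z g"
  and e: "!!a q t. a el X ==> q el Q ==> t el bob T ==> f (wp Q T a q t) = g (wp Q T a q t)"
  and x: "x el WW Q T"
 shows "f x = g x"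
proof (rule tensor_by.ext[OF ind_facts(11)[OF I] Z _ x])
 fix a n assume a: "a el X" and n: "n el NN Q T"
 note l = bilinD(1)[OF ind_facts(7)[OF I] a]
 show "f (wn Q T a n) = g (wn Q T a n)"
  by (rule tensor_by.ext[OF ind_facts(10)[OF I] Z(1) lin_comp[OF l Z(2)] lin_comp[OF l Z(3)] _ n]) (rule e[OF a])
qed

text \<open>\<open>A \<otimes> (Q \<otimes> T)\<close> is the free left \<open>A\<close>-module on \<open>Q \<otimes> T\<close>.\<close>

lemma ind_map:
 assumes I: "ind Q T r W" and Y: "bim Y" and b: "hlin (NN Q T) (bob Y) \<beta>"
  and br: "!!n c. n el NN Q T ==> c el X ==> \<beta> (r n c) = rm Y (\<beta> n) c"
 obtains F where "bh W Y F" "!!a n. a el X ==> n el NN Q T ==> F (wn Q T a n) = lm Y a (\<beta> n)"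
proof -
 note D = indD[OF I] and E = ind_facts[OF I]
 note hY = bimD(4)[OF Y] and L = bim_laws[OF Y]
 have hp: "hpairing X (NN Q T) (bob Y) (%a n. lm Y a (\<beta> n))" by (rule hpairing_comp[OF hmX hY hmX E(1) hY hY L(2) hlin_id b hlin_id])
 define F where "F = hlift K H X (NN Q T) (bob Y) (%a n. lm Y a (\<beta> n))"
 have F: "hlin (WW Q T) (bob Y) F" "!!a n. a el X ==> n el NN Q T ==> F (wn Q T a n) = lm Y a (\<beta> n)"
  unfolding F_def by (rule hlift_hlin[OF hmX E(1) hY hp])
   (rule hlift(2)[OF hmX E(1) hm_vs[OF hY] hpD(1)[OF hp] hp_balanced[OF hp]])
 note DL = bim_laws(2,3)[OF D(3), unfolded D(4)]
 have bc: "\<beta> n el bob Y" if "n el NN Q T" for n by (rule hlinD(3)[OF b that])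
 have rc: "r n c el NN Q T" if "n el NN Q T" "c el X" for n c by (rule hpD(4)[OF D(5) that])
 have "bh W Y F" unfolding bhom_def
 proof (intro conjI ballI)
  show "hlin (bob W) (bob Y) F" unfolding D(4) by (rule F(1))
  fix a x assume a: "a el X" and "x el bob W"
  then have x: "x el WW Q T" using D(4) by simp
  have l1: "lin (WW Q T) (WW Q T) (%x. lm W a x)" "lin (WW Q T) (WW Q T) (%x. rm W x a)"
   using bilinD(2)[OF hpD(1)[OF bim_laws(2)[OF D(3)]] a] bilinD(3)[OF hpD(1)[OF bim_laws(3)[OF D(3)]] a] by (simp_all only: D(4)) 
  note l2 = bilinD(2)[OF hpD(1)[OF L(2)] a] bilinD(3)[OF hpD(1)[OF L(3)] a]
  note FL = hlinD(1)[OF F(1)]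
  show "F (lm W a x) = lm Y a (F x)" by (rule tensor_by.ext[OF E(11) bimD(5)[OF Y] lin_comp[OF l1(1) FL] lin_comp[OF FL l2(1)] _ x])
    (use a in "simp add: D(7) F(2) L(4) bc")
  show "F (rm W x a) = rm Y (F x) a" by (rule tensor_by.ext[OF E(11) bimD(5)[OF Y] lin_comp[OF l1(2) FL] lin_comp[OF FL l2(2)] _ x])
    (use a in "simp add: D(8) F(2) L(8) bc rc br")
 qed
 then show thesis using that F(2) by blast
qed

lemma ind_map2:
 assumes I: "ind Q T r W" and Y: "bim Y" and b: "hpairing Q (bob T) (bob Y) b"
  and br: "!!q t c. q el Q ==> t el bob T ==> c el X ==> b q (rm T t c) = rm Y (b q t) c"
 obtains F where "bh W Y F"
  "!!a q t. a el X ==> q el Q ==> t el bob T ==> F (wp Q T a q t) = lm Y a (b q t)"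
proof -
 note D = indD[OF I] and E = ind_facts[OF I]
 note hT = bimD(4)[OF D(2)] and hY = bimD(4)[OF Y]
 define \<beta> where "\<beta> = hlift K H Q (bob T) (bob Y) b"
 have B: "hlin (NN Q T) (bob Y) \<beta>" "!!q t. q el Q ==> t el bob T ==> \<beta> (np Q T q t) = b q t"
  unfolding \<beta>_def by (rule hlift_hlin[OF D(1) hT hY b])
   (rule hlift(2)[OF D(1) hT hm_vs[OF hY] hpD(1)[OF b] hp_balanced[OF b]])
 have R: "\<beta> (r n c) = rm Y (\<beta> n) c" if n: "n el NN Q T" and c: "c el X" for n c
  by (rule tensor_by.ext[OF E(10) hm_vs[OF hY] lin_comp[OF bilinD(3)[OF hpD(1)[OF D(5)] c] hlinD(1)[OF B(1)]]
   lin_comp[OF hlinD(1)[OF B(1)] bilinD(3)[OF hpD(1)[OF bim_laws(3)[OF Y]] c]] _ n])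
   (use c D(2) in "simp add: D(6) B(2) br")
 obtain F where F: "bh W Y F" "!!a n. a el X ==> n el NN Q T ==> F (wn Q T a n) = lm Y a (\<beta> n)"
  by (rule ind_map[OF I Y B(1)], rule R, assumption+, rule that, assumption+)
 show thesis by (rule that[OF F(1)]) (simp add: F(2) E(4) B(2))
qed

text \<open>Maps that are merely linear, for which all three factors are on an equal footing.\<close>

lemma ind_lin_map:
 assumes I: "ind Q T r W" and Z: "vs Z"
  and t1: "!!a. a el X ==> bilin Q (bob T) Z (t a)"
  and t2: "!!q s. q el Q ==> s el bob T ==> lin X Z (%a. t a q s)"
  and b1: "!!k a q s. k el H ==> a el X ==> q el Q ==> s el bob T ==>
   t (act X (br k) a) q s = t a (act Q (\<epsilon>t k) q) s"
  and b2: "!!k a q s. k el H ==> a el X ==> q el Q ==> s el bob T ==>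
   t a (act Q (br k) q) s = t a q (act (bob T) (\<epsilon>t k) s)"
 obtains F where "lin (WW Q T) Z F"
  "!!a q s. a el X ==> q el Q ==> s el bob T ==> F (wp Q T a q s) = t a q s"
proof -
 note D = indD[OF I] and E = ind_facts[OF I]
 note hT = bimD(4)[OF D(2)]
 have bal: "balanced (base_bal K H Q (bob T)) Q (bob T) (t a)" if a: "a el X" for a unfolding balanced_def
 proof (intro allI impI ballI)
  fix \<rho> l m n assume bl: "(\<rho>, l) \<in> base_bal K H Q (bob T)" and mn: "m el Q" "n el bob T"
  obtain k where k: "k el H" "\<rho> = act Q (br k) \<and> l = act (bob T) (\<epsilon>t k)" by (rule base_balD[OF bl, THEN bexE])
  show "t a (\<rho> m) n = t a m (l n)" using b2[OF k(1) a mn] k(2) by simp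
 qed
 obtain g where g: "bilin X (NN Q T) Z g"
  "!!a q s. a el X ==> q el Q ==> s el bob T ==> g a (np Q T q s) = t a q s"
  by (rule tensor_by.param_lift[OF E(10) Z t1 bal vsX t2], assumption+, rule that, assumption+)
 have "balanced (base_bal K H X (NN Q T)) X (NN Q T) g" unfolding balanced_def
 proof (intro allI impI ballI)
  fix \<rho> l a n assume bl: "(\<rho>, l) \<in> base_bal K H X (NN Q T)" and a: "a el X" and n: "n el NN Q T"
  obtain k where k: "k el H" "\<rho> = act X (br k) \<and> l = act (NN Q T) (\<epsilon>t k)" by (rule base_balD[OF bl, THEN bexE])
  have "g (act X (br k) a) n = g a (act (NN Q T) (\<epsilon>t k) n)"
   by (rule tensor_by.ext[OF E(10) Z bilinD(2)[OF g(1)] lin_comp[OF hmD(2)[OF E(1)] bilinD(2)[OF g(1)]] _ n])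
    (use k(1) a D(1) in "simp_all add: g(2) hp_target[OF D(1) hT E(1) E(8)] b1")
  then show "g (\<rho> a) n = g a (l n)" using k(2) by simp
 qed
 then obtain F where F: "lin (WW Q T) Z F" "!!a n. a el X ==> n el NN Q T ==> F (wn Q T a n) = g a n" using tensor_by.lift[OF E(11) Z g(1)] by metis
 show thesis by (rule that[OF F(1)]) (simp add: F(2) E(4) g(2))
qed

end

section \<open>Separability and projectivity on the right\<close>

locale shalg = halg K H U A for K :: "'k ring" and H :: "('k, 'h) weak_hopf" and U :: "'u itself"
  and A :: "(('k, 'h, 'u) hmod, ('k, 'h, 'u) harrow) alg" +
 assumes sep: "separable_algebra K (base_alg K H)"
begin

lemma R0_ops: "(\<otimes>\<^bsub>R0\<^esub>) = (\<otimes>\<^bsub>H\<^esub>)" "1[R0] = 1[H]" "lsum R0 f xs = lsum H f xs"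
proof -
 show "(\<otimes>\<^bsub>R0\<^esub>) = (\<otimes>\<^bsub>H\<^esub>)" "1[R0] = 1[H]" by (simp_all add: base_alg_def)
 show "lsum R0 f xs = lsum H f xs" by (induction xs) (simp_all add: base_alg_def)
qed

lemma R0_mult: "z el R0 ==> w el R0 ==> z ** w el R0"
 using eps_t_mult[of z w] by (simp add: R0_iff)

lemma R0_H: "z el R0 ==> z el H" by (simp add: R0_iff)

lemma R0_lin: "lin R0 H (%z. z)"
 by (rule linI) (auto simp: R0_iff base_alg_def)

lemma lin_R0: "lin R0 H f ==> (!!z. z el R0 ==> f z el R0) ==> lin R0 R0 f"
 by (simp add: lin_hom_def base_alg_def)

text \<open>The separability idempotent \<open>\<Sum> x \<otimes> y\<close> as a list: \<open>\<Sum> x y = 1\<close> and \<open>\<Sum> r x \<otimes> y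
 = \<Sum> x \<otimes> y r\<close>.\<close>

lemma sep_list:
 obtains xs where "set xs \<subseteq> carrier R0 \<times> carrier R0" "lsum H (%p. fst p ** snd p) xs = 1[H]"
  "!!(W :: ('k, 'h, 'u) hmod) b r. vs W ==> bilin R0 R0 W b ==> r el R0 ==>
   lsum W (%p. b (r ** fst p) (snd p)) xs = lsum W (%p. b (fst p) (snd p ** r)) xs"
proof -
 let ?T = "tensor K {} R0 R0" and ?p = "pure_tensor K {} R0 R0"
 have td: "tensor_data K {} R0 R0" by (rule tensor_dataI) auto
 obtain e where e: "e el ?T" "tensor_lift K R0 (%x y. x ** y) e = 1[H]"
  "!!r. r el R0 ==> tensor_lift K ?T (%x y. ?p (r ** x) y) e = tensor_lift K ?T (%x y. ?p x (y ** r)) e"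
  using sep unfolding separable_algebra_def R0_ops by blast
 obtain xs where xs: "set xs \<subseteq> carrier R0 \<times> carrier R0" "e = lsum ?T (%(m, n). ?p m n) xs"
  using tensor_data.ten_list[OF td e(1)] by blast
 note vT = tensor_data.ten_vs[OF td] and pb = tensor_data.pt_bilin[OF td]
 note tl = tensor_lift_list[OF td _ _ xs]
 have c: "fst p el R0 \<and> snd p el R0" if "p \<in> set xs" for p using that xs(1) by (cases p) auto
 have ml: "lin R0 R0 (%x. r ** x)" "lin R0 R0 (%x. x ** r)" if "r el R0" for r using that R0_H R0_mult by (intro lin_R0 lin_mult R0_lin; simp)+
 show thesis
 proof (rule that[OF xs(1)])
  have "bilin R0 R0 R0 (%x y. x ** y)" using ml by (intro bilinI)
  then show "lsum H (%p. fst p ** snd p) xs = 1[H]" using tl[OF vsR0] e(2) by (simp add: R0_ops)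
 next
  fix W :: "('k, 'h, 'u) hmod" and b r
  assume W: "vs W" and b: "bilin R0 R0 W b" and r: "r el R0"
  have P: "bilin R0 R0 ?T (%x y. ?p (r ** x) y)" "bilin R0 R0 ?T (%x y. ?p x (y ** r))"
   by (rule bilin_comp[OF pb ml(1)[OF r] lin_id], rule bilin_comp[OF pb lin_id ml(2)[OF r]])
  note \<phi> = tensor_data.tensor_lift[OF td W b bal_empty]
  have "lsum W (%p. b (r ** fst p) (snd p)) xs = tensor_lift K W b (lsum ?T (%p. ?p (r ** fst p) (snd p)) xs)"
   using c r bilinD(4)[OF pb] by (simp add: lsum_lin[OF vT W \<phi>(1)] \<phi>(2) R0_mult cong: lsum_cong)
  also have "... = tensor_lift K W b (lsum ?T (%p. ?p (fst p) (snd p ** r)) xs)" using e(3)[OF r] tl[OF vT P(1)] tl[OF vT P(2)] by simp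
  also have "... = lsum W (%p. b (fst p) (snd p ** r)) xs"
   using c r bilinD(4)[OF pb] by (simp add: lsum_lin[OF vT W \<phi>(1)] \<phi>(2) R0_mult cong: lsum_cong)
  finally show "lsum W (%p. b (r ** fst p) (snd p)) xs = lsum W (%p. b (fst p) (snd p ** r)) xs" .
 qed
qed

abbreviation "\<eta> z \<equiv> act X z one"

text \<open>The base maps to the algebra by \<open>z \<mapsto> z 1\<close>, multiplicatively.\<close>

lemma eta: "z el R0 ==> \<eta> z el X" "lin R0 X \<eta>"
 "z el R0 ==> a el X ==> mul (\<eta> z) a = act X z a"
 "z el R0 ==> w el R0 ==> mul (\<eta> z) (\<eta> w) = \<eta> (z ** w)"
proof -
 show c: "\<eta> z el X" if "z el R0" for z using that by (simp add: R0_H)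
 show "lin R0 X \<eta>" by (intro lins R0_lin) simp_all
 show m: "mul (\<eta> z) a = act X z a" if z: "z el R0" and a: "a el X" for z a
  using hp_target[OF hmX hmX hmX mul_hp R0_H[OF z] one_in a] z a mul_laws(2)[OF a] by (simp add: R0_iff)
 show "mul (\<eta> z) (\<eta> w) = \<eta> (z ** w)" if "z el R0" "w el R0"
  using m[OF that(1) c[OF that(2)]] hmD(5)[OF hmX, of z w one] that by (simp add: R0_H)
qed

text \<open>A linear section \<open>s\<^sub>0\<close> is averaged to \<open>z \<mapsto> \<Sum> s\<^sub>0(z x) y\<close> over the separability
 idempotent. The result is still a section as \<open>\<Sum> x y = 1\<close>, and it commutes with the right action of the base.\<close>

lemma right_section:
 assumes S: "bim Y" "bim Z" and g: "bh Y Z g" "g ` carrier (bob Y) = carrier (bob Z)"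
 obtains s where "lin (bob Z) (bob Y) s" "!!z. z el bob Z ==> g (s z) = z"
  "!!z w. z el bob Z ==> w el R0 ==> s (rm Z z (\<eta> w)) = rm Y (s z) (\<eta> w)"
proof -
 let ?Y = "bob Y" and ?Z = "bob Z"
 note vY = bimD(5)[OF S(1)] and vZ = bimD(5)[OF S(2)]
 note LY = bim_laws[OF S(1)] and LZ = bim_laws[OF S(2)]
 note YB = lin_b1[OF hpD(1)[OF LY(3)]] lin_b2[OF hpD(1)[OF LY(3)]]
 note ZB = lin_b1[OF hpD(1)[OF LZ(3)]] lin_b2[OF hpD(1)[OF LZ(3)]]
 obtain s0 where s0: "lin ?Z ?Y s0" "!!z. z el ?Z ==> g (s0 z) = z" using lin_section[OF vY vZ bhD(2)[OF g(1)] g(2)] by blast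
 obtain xs where xs: "set xs \<subseteq> carrier R0 \<times> carrier R0" "lsum H (%p. fst p ** snd p) xs = 1[H]"
  "!!(W :: ('k, 'h, 'u) hmod) b r. vs W ==> bilin R0 R0 W b ==> r el R0 ==>
   lsum W (%p. b (r ** fst p) (snd p)) xs = lsum W (%p. b (fst p) (snd p ** r)) xs" by (rule sep_list, rule that, assumption+)
 have c: "fst p el R0" "snd p el R0" if "p \<in> set xs" for p using that xs(1) by (cases p, auto)+
 \<comment> \<open>The summand of the average, as a function of the two legs of the idempotent.\<close>
 define t where "t z x y = rm Y (s0 (rm Z z (\<eta> x))) (\<eta> y)" for z x y
 define s where "s z = lsum ?Y (%p. t z (fst p) (snd p)) xs" for z
 have tc: "t z x y el ?Y" if "z el ?Z" "x el R0" "y el R0" for z x y unfolding t_def using that S eta(1) linD(1)[OF s0(1)] by simp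
 show thesis
 proof (rule that)
  show "lin ?Z ?Y s" unfolding s_def[abs_def]
  proof (rule lin_lsum[OF vY])
   fix p assume p: "p \<in> set xs"
   show "lin ?Z ?Y (%z. t z (fst p) (snd p))" unfolding t_def by (intro YB lin_comp[OF _ s0(1)] ZB lins) (use c[OF p] eta(1) in simp_all)
  qed
 next
  fix z assume z: "z el ?Z"
  have "g (s z) = lsum ?Z (%p. g (t z (fst p) (snd p))) xs" unfolding s_def by (rule lsum_lin[OF vY vZ bhD(2)[OF g(1)]]) (use tc z c in simp)
  also have "... = lsum ?Z (%p. rm Z z (\<eta> (fst p ** snd p))) xs"
  proof (rule lsum_cong)
   fix p assume p: "p \<in> set xs"
   note cp = c[OF p] eta(1)[OF c(1)[OF p]] eta(1)[OF c(2)[OF p]]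
   show "g (t z (fst p) (snd p)) = rm Z z (\<eta> (fst p ** snd p))" unfolding t_def using z cp S s0(2) linD(1)[OF s0(1)]
    by (simp add: bhD(4)[OF g(1)] LZ(6) eta(4))
  qed
  also have "... = rm Z z (\<eta> (lsum H (%p. fst p ** snd p) xs))"
   by (rule lsum_lin[symmetric, OF vsH vZ]) (intro ZB lins, use z c R0_H in simp_all)
  also have "... = z" using z LZ(7) hmD(4)[OF hmX one_in] by (simp add: xs(2))
  finally show "g (s z) = z" .
  fix w assume w: "w el R0"
  have bl: "bilin R0 R0 ?Y (t z)" unfolding t_def by (intro bilinI YB lin_comp[OF _ s0(1)] ZB lin_comp[OF _ eta(2)] lins)
    (use z S eta(1) linD(1)[OF s0(1)] in simp_all)
  have "s (rm Z z (\<eta> w)) = lsum ?Y (%p. t z (w ** fst p) (snd p)) xs" unfolding s_def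
  proof (rule lsum_cong)
   fix p assume p: "p \<in> set xs"
   note cp = c[OF p] eta(1)[OF c(1)[OF p]]
   show "t (rm Z z (\<eta> w)) (fst p) (snd p) = t z (w ** fst p) (snd p)" unfolding t_def using z w cp eta(1)[OF w] by (simp add: LZ(6) eta(4))
  qed
  also have "... = lsum ?Y (%p. t z (fst p) (snd p ** w)) xs" by (rule xs(3)[OF vY bl w])
  also have "... = lsum ?Y (%p. rm Y (t z (fst p) (snd p)) (\<eta> w)) xs"
  proof (rule lsum_cong)
   fix p assume p: "p \<in> set xs"
   note cp = c[OF p] eta(1)[OF c(1)[OF p]] eta(1)[OF c(2)[OF p]]
   show "t z (fst p) (snd p ** w) = rm Y (t z (fst p) (snd p)) (\<eta> w)"
    unfolding t_def using z w cp eta(1)[OF w] S linD(1)[OF s0(1)] by (simp add: LY(6) eta(4)[symmetric])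
  qed
  also have "... = rm Y (s z) (\<eta> w)" unfolding s_def by (rule lsum_lin[symmetric, OF vY vY]) (intro YB lins, use eta(1)[OF w] tc z c in simp_all)
  finally show "s (rm Z z (\<eta> w)) = rm Y (s z) (\<eta> w)" .
 qed
qed

text \<open>Right \<open>A\<close>-linear maps out of \<open>T\<close> lift through surjections of bimodules, the maps being only
 \<open>K\<close>-linear otherwise, and a family of maps depending linearly on a vector space \<open>V\<close> lifts to such a family. Bimodule maps
 out of \<open>A \<otimes> (H \<otimes> V) \<otimes> T\<close> are such families.\<close>

definition rproj :: "('k, 'h, 'u) bm => bool"
 where "rproj T \<longleftrightarrow> (\<forall>(Y :: ('k, 'h, 'u) bm) (Z :: ('k, 'h, 'u) bm) g (V :: ('k, 'h, 'u) hmod) \<psi>.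
  bim Y --> bim Z --> bh Y Z g --> g ` carrier (bob Y) = carrier (bob Z) --> vs V -->
  bilin V (bob T) (bob Z) \<psi> -->
  (\<forall>v\<in>carrier V. \<forall>t\<in>carrier (bob T). \<forall>a\<in>carrier X. \<psi> v (rm T t a) = rm Z (\<psi> v t) a) -->
  (\<exists>\<psi>'. bilin V (bob T) (bob Y) \<psi>' \<and>
   (\<forall>v\<in>carrier V. \<forall>t\<in>carrier (bob T). \<forall>a\<in>carrier X. \<psi>' v (rm T t a) = rm Y (\<psi>' v t) a) \<and>
   (\<forall>v\<in>carrier V. \<forall>t\<in>carrier (bob T). g (\<psi>' v t) = \<psi> v t)))"

lemma rprojI:
 assumes "!!(Y :: ('k, 'h, 'u) bm) (Z :: ('k, 'h, 'u) bm) g (V :: ('k, 'h, 'u) hmod) \<psi>.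
  bim Y ==> bim Z ==> bh Y Z g ==> g ` carrier (bob Y) = carrier (bob Z) ==> vs V ==>
  bilin V (bob T) (bob Z) \<psi> ==>
  (!!v t a. v el V ==> t el bob T ==> a el X ==> \<psi> v (rm T t a) = rm Z (\<psi> v t) a) ==>
  \<exists>\<psi>'. bilin V (bob T) (bob Y) \<psi>' \<and>
   (\<forall>v\<in>carrier V. \<forall>t\<in>carrier (bob T). \<forall>a\<in>carrier X. \<psi>' v (rm T t a) = rm Y (\<psi>' v t) a) \<and>
   (\<forall>v\<in>carrier V. \<forall>t\<in>carrier (bob T). g (\<psi>' v t) = \<psi> v t)"
 shows "rproj T" unfolding rproj_def by (intro allI impI) (rule assms, assumption+, simp)

lemma rprojD:
 fixes Y Z :: "('k, 'h, 'u) bm" and V :: "('k, 'h, 'u) hmod"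
 assumes "rproj T" "bim Y" "bim Z" "bh Y Z g" "g ` carrier (bob Y) = carrier (bob Z)" "vs V"
  "bilin V (bob T) (bob Z) \<psi>"
  "!!v t a. v el V ==> t el bob T ==> a el X ==> \<psi> v (rm T t a) = rm Z (\<psi> v t) a"
 shows "\<exists>\<psi>'. bilin V (bob T) (bob Y) \<psi>' \<and>
   (\<forall>v\<in>carrier V. \<forall>t\<in>carrier (bob T). \<forall>a\<in>carrier X. \<psi>' v (rm T t a) = rm Y (\<psi>' v t) a) \<and>
   (\<forall>v\<in>carrier V. \<forall>t\<in>carrier (bob T). g (\<psi>' v t) = \<psi> v t)"
 by (rule assms(1)[unfolded rproj_def, rule_format, OF assms(2-7)]) (rule assms(8), assumption+)

lemma rproj_retract:
 assumes T: "rproj T" and i: "bh S T i" and \<pi>: "bh T S \<pi>"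
  and e: "!!s. s el bob S ==> \<pi> (i s) = s"
 shows "rproj S"
proof (rule rprojI)
 fix Y Z :: "('k, 'h, 'u) bm" and g and V :: "('k, 'h, 'u) hmod" and \<psi>
 assume a: "bim Y" "bim Z" "bh Y Z g" "g ` carrier (bob Y) = carrier (bob Z)" "vs V"
  and b: "bilin V (bob S) (bob Z) \<psi>"
  and r: "!!v t a. v el V ==> t el bob S ==> a el X ==> \<psi> v (rm S t a) = rm Z (\<psi> v t) a"
 note B = bilin_comp[OF b lin_id bhD(2)[OF \<pi>]]
 have R: "\<psi> v (\<pi> (rm T t a)) = rm Z (\<psi> v (\<pi> t)) a" if "v el V" "t el bob T" "a el X" for v t a
  using that by (simp add: bhD(4,5)[OF \<pi>] r)
 obtain \<psi>' where p: "bilin V (bob T) (bob Y) \<psi>'"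
   "\<forall>v\<in>carrier V. \<forall>t\<in>carrier (bob T). \<forall>a\<in>carrier X. \<psi>' v (rm T t a) = rm Y (\<psi>' v t) a"
   "\<forall>v\<in>carrier V. \<forall>t\<in>carrier (bob T). g (\<psi>' v t) = \<psi> v (\<pi> t)" using rprojD[OF T a B R] by blast
 show "\<exists>\<psi>'. bilin V (bob S) (bob Y) \<psi>' \<and>
   (\<forall>v\<in>carrier V. \<forall>t\<in>carrier (bob S). \<forall>a\<in>carrier X. \<psi>' v (rm S t a) = rm Y (\<psi>' v t) a) \<and>
   (\<forall>v\<in>carrier V. \<forall>t\<in>carrier (bob S). g (\<psi>' v t) = \<psi> v t)"
  by (intro exI[of _ "%v s. \<psi>' v (i s)"] conjI bilin_comp[OF p(1) lin_id bhD(2)[OF i]])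
   (simp_all add: p(2,3) bhD(4,5)[OF i] e)
qed

text \<open>A right linear map out of \<open>A\<close> is determined by its value at \<open>1\<close>, which is lifted by a linear section.\<close>

lemma rproj_AA: "rproj AA"
proof (rule rprojI)
 fix Y Z :: "('k, 'h, 'u) bm" and g and V :: "('k, 'h, 'u) hmod" and \<psi>
 assume S: "bim Y" "bim Z" and g: "bh Y Z g" "g ` carrier (bob Y) = carrier (bob Z)" and V: "vs V"
  and b: "bilin V (bob AA) (bob Z) \<psi>"
  and r: "!!v t a. v el V ==> t el bob AA ==> a el X ==> \<psi> v (rm AA t a) = rm Z (\<psi> v t) a"
 obtain s where s: "lin (bob Z) (bob Y) s" "!!z. z el bob Z ==> g (s z) = z"
  using lin_section[OF bimD(5)[OF S(1)] bimD(5)[OF S(2)] bhD(2)[OF g(1)] g(2)] by blast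
 note LY = bim_laws[OF S(1)]
 note YB = lin_b1[OF hpD(1)[OF LY(3)]] lin_b2[OF hpD(1)[OF LY(3)]]
 have b': "bilin V X (bob Z) \<psi>" using b by simp
 have r': "\<psi> v (mul t a) = rm Z (\<psi> v t) a" if "v el V" "t el X" "a el X" for v t a using r[of v t a] that by simp
 note bc = bilinD(4)[OF b'] and sc = linD(1)[OF s(1)]
 have "bilin V X (bob Y) (%v a. rm Y (s (\<psi> v one)) a)" by (intro bilinI YB lin_comp[OF bilinD(3)[OF b' one_in] s(1)] lins) (simp_all add: bc sc)
 then show "\<exists>\<psi>'. bilin V (bob AA) (bob Y) \<psi>' \<and>
   (\<forall>v\<in>carrier V. \<forall>t\<in>carrier (bob AA). \<forall>a\<in>carrier X. \<psi>' v (rm AA t a) = rm Y (\<psi>' v t) a) \<and>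
   (\<forall>v\<in>carrier V. \<forall>t\<in>carrier (bob AA). g (\<psi>' v t) = \<psi> v t)"
  by (intro exI[of _ "%v a. rm Y (s (\<psi> v one)) a"] conjI)
   (simp_all add: bc sc LY(6) bhD(4)[OF g(1)] s(2) r'[symmetric] mul_laws(2))
qed

text \<open>The lift is \<open>a \<otimes> q \<otimes> b \<mapsto> s(\<psi>(a \<otimes> q \<otimes> 1)) b\<close>. Since \<open>q \<otimes> b\<close>
 is balanced over the base, the section \<open>s\<close> has to commute with the right action of the base.\<close>

lemma rproj_ind:
 assumes I: "ind Q AA r W"
 shows "rproj W"
proof (rule rprojI)
 fix Y Z :: "('k, 'h, 'u) bm" and g and V :: "('k, 'h, 'u) hmod" and \<psi>
 assume S: "bim Y" "bim Z" and g: "bh Y Z g" "g ` carrier (bob Y) = carrier (bob Z)" and V: "vs V"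
  and b0: "bilin V (bob W) (bob Z) \<psi>"
  and r0: "!!v t a. v el V ==> t el bob W ==> a el X ==> \<psi> v (rm W t a) = rm Z (\<psi> v t) a"
 let ?Y = "bob Y" and ?Z = "bob Z" and ?N = "htens K H Q X" and ?W = "htens K H X (htens K H Q X)"
 note D = indD[OF I, unfolded A_simps(2-5)] and E = ind_facts[OF I, unfolded A_simps(2-5)]
 note iext = ind_ext[OF I, unfolded A_simps(2-5)]
 note vY = bimD(5)[OF S(1)] and vZ = bimD(5)[OF S(2)]
 note LY = bim_laws[OF S(1)] and LZ = bim_laws[OF S(2)]
 note YB = lin_b1[OF hpD(1)[OF LY(3)]] lin_b2[OF hpD(1)[OF LY(3)]]
 have b: "bilin V ?W ?Z \<psi>" using b0 by (simp only: D(4))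
 have r': "\<psi> v (rm W t a) = rm Z (\<psi> v t) a" if "v el V" "t el ?W" "a el X" for v t a by (rule r0) (use that D(4) in simp_all)
 obtain s where s: "lin ?Z ?Y s" "!!z. z el ?Z ==> g (s z) = z"
  "!!z w. z el ?Z ==> w el R0 ==> s (rm Z z (\<eta> w)) = rm Y (s z) (\<eta> w)" by (rule right_section[OF S g], rule that, assumption+)
 let ?n = "hpure K H Q X"
 let ?w = "%a q c. hpure K H X ?N a (?n q c)"
 have wc: "?w a q c el ?W" if "a el X" "q el Q" "c el X" for a q c using that E(4,5) by simp
 note bc = bilinD(4)[OF b] and sc = linD(1)[OF s(1)]
 note NB = lin_b1[OF E(6)] lin_b2[OF E(6)] lin_b1[OF E(7)] lin_b2[OF E(7)]
 have npc: "?n q c el ?N" if "q el Q" "c el X" for q c using E(4)[of q c] that by simp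
 \<comment> \<open>Trilinear in \<open>a\<close>, \<open>q\<close>, \<open>c\<close> for fixed \<open>v\<close>; linearity in \<open>v\<close> is recovered afterwards from uniqueness.\<close>
 define t where "t v a q c = rm Y (s (\<psi> v (?w a q one))) c" for v a q c
 have tc: "s (\<psi> v (?w a q one)) el ?Y" if "v el V" "a el X" "q el Q" for v a q using that by (simp add: bc sc wc)
 have lp: "lin M ?Y (%x. s (\<psi> v (f x)))" if "lin M ?W f" "v el V" for f v and M :: "('k, 'h, 'u) hmod"
  by (rule lin_comp[OF lin_b2[OF b that] s(1)])
 have "\<exists>F. lin ?W ?Y F \<and> (\<forall>a q c. a el X --> q el Q --> c el X --> F (?w a q c) = t v a q c)"
  if v: "v el V" for v
 proof -
  have b1: "t v (act X (br k) a) q c = t v a (act Q (\<epsilon>t k) q) c"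
   if "k el H" "a el X" "q el Q" "c el X" for k a q c using hpD(2)[OF E(9) that(1,2) npc[OF that(3) one_in]]
    hp_target[OF D(1) hmX E(1) E(8) that(1,3) one_in] by (simp add: t_def)
  have b2: "t v a (act Q (br k) q) c = t v a q (act X (\<epsilon>t k) c)"
   if "k el H" "a el X" "q el Q" "c el X" for k a q c
  proof -
   have cX: "c el X" using that(4) by simp
   have z: "\<epsilon>t k el R0" using that(1) by (simp add: R0_iff eps_t_idem)
   have "?n (act Q (br k) q) one = ?n q (\<eta> (\<epsilon>t k))" using hpD(2)[OF E(8) that(1,3), of one] by simp
   then have "?w a (act Q (br k) q) one = rm W (?w a q one) (\<eta> (\<epsilon>t k))"
    using E(13)[of q one a "\<eta> (\<epsilon>t k)"] that eta(1)[OF z] mul_laws(2) by simp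
   then have "s (\<psi> v (?w a (act Q (br k) q) one)) = rm Y (s (\<psi> v (?w a q one))) (\<eta> (\<epsilon>t k))"
    using v that wc eta(1)[OF z] by (simp add: r' s(3)[OF _ z] bc)
   then show ?thesis using tc[OF v that(2,3)] eta(1)[OF z] cX by (simp add: t_def LY(6) eta(3)[OF z])
  qed
  have t1: "bilin Q X ?Y (t v a)" if "a el X" for a unfolding t_def using v that by (intro bilinI YB lp NB lins) (simp_all add: tc npc)
  have t2: "lin X ?Y (%a. t v a q c)" if "q el Q" "c el X" for q c unfolding t_def using v that by (intro YB lp NB lins) (simp_all add: tc npc)
  show ?thesis by (rule ind_lin_map[OF I vY, unfolded A_simps(2-5), OF t1 t2 b1 b2], assumption+) auto
 qed
 then obtain F where F: "!!v. v el V ==> lin ?W ?Y (F v)"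
  "!!v a q c. v el V ==> a el X ==> q el Q ==> c el X ==> F v (?w a q c) = t v a q c" by metis
 have lv: "lin V ?Y (%v. t v a q c)" if "a el X" "q el Q" "c el X" for a q c unfolding t_def
  by (intro YB lin_comp[OF bilinD(3)[OF b wc] s(1)] lins) (use that in simp_all)
 have Fv: "lin V ?Y (%v. F v x)" if x: "x el ?W" for x
 proof (rule linI)
  show "F v x el ?Y" if "v el V" for v by (rule linD(1)[OF F(1)[OF that] x])
  show "F (v +[V] v') x = F v x +[?Y] F v' x" if "v el V" "v' el V" for v v' by (rule iext[OF vY F(1) lin_add_map[OF vY F(1) F(1)] _ x])
    (use that V linD(2)[OF lv] in "simp_all add: F(2)")
  show "F (k *[V] v) x = k *[?Y] F v x" if "k el K" "v el V" for k v by (rule iext[OF vY F(1) lin_smult_map[OF vY _ F(1)] _ x])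
    (use that V linD(3)[OF lv] in "simp_all add: F(2)")
 qed
 note RW = bilinD(3)[OF hpD(1)[OF bim_laws(3)[OF D(3)]], unfolded D(4)]
 have lW: "lin ?W ?W (%x. rm W x a)" if a: "a el X" for a using bilinD(3)[OF hpD(1)[OF bim_laws(3)[OF D(3)]] a] by (simp only: D(4))
 have Fr: "F v (rm W x a) = rm Y (F v x) a" if v: "v el V" and x: "x el ?W" and a: "a el X" for v x a
  by (rule iext[OF vY lin_comp[OF lW[OF a] F(1)[OF v]] lin_comp[OF F(1)[OF v] bilinD(3)[OF hpD(1)[OF LY(3)] a]] _ x])
   (use v a in "simp add: E(13) F(2), simp add: t_def LY(6) tc")
 have Fg: "g (F v x) = \<psi> v x" if v: "v el V" and x: "x el ?W" for v x
 proof (rule iext[OF vZ lin_comp[OF F(1)[OF v] bhD(2)[OF g(1)]] bilinD(1)[OF b v] _ x])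
  fix a q c assume h: "a el X" "q el Q" "c el X"
  then have c: "c el X" by simp
  have "g (F v (?w a q c)) = rm Z (\<psi> v (?w a q one)) c" using v h c by (simp add: F(2) t_def bhD(4)[OF g(1)] tc s(2) bc wc)
  also have "... = \<psi> v (rm W (?w a q one) c)" using v h c by (simp add: r' wc)
  also have "rm W (?w a q one) c = ?w a q c" using E(13)[of q one a c] h c by (simp add: mul_laws(2))
  finally show "g (F v (?w a q c)) = \<psi> v (?w a q c)" .
 qed
 have e: "carrier (bob W) = carrier ?W" "bilin V (bob W) ?Y F" using D(4) bilinI[OF F(1) Fv] by simp_all
 show "\<exists>\<psi>'. bilin V (bob W) (bob Y) \<psi>' \<and>
   (\<forall>v\<in>carrier V. \<forall>t\<in>carrier (bob W). \<forall>a\<in>carrier X. \<psi>' v (rm W t a) = rm Y (\<psi>' v t) a) \<and>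
   (\<forall>v\<in>carrier V. \<forall>t\<in>carrier (bob W). g (\<psi>' v t) = \<psi> v t)"
  by (intro exI[of _ F] conjI e(2) ballI) (use Fr Fg in "simp_all only: e(1)")
qed

end

section \<open>Projectivity of induced bimodules and of tensor products\<close>

context shalg
begin

text \<open>\<open>\<Sum> \<epsilon>t(h\<^sub>1) h\<^sub>2 = h\<close>, by the same computation as for \<open>br\<close> on the other side.\<close>

lemma SW_eps_t_left:
 assumes W: "vs W" and f: "lin H W f" and h: "h el H"
 shows "SW W (%u v. f (\<epsilon>t u ** v)) h = f h"
proof -
 note fl = lin_comp[OF _ f]
 have "SW W (%u v. f (\<epsilon>t u ** v)) h = SW W (%u v. SW W (%x y. \<epsilon> (x ** u) *[W] f (y ** v)) 1[H]) h"
  by (rule SW_cong[OF h], rule lin_counital_SW(1)[OF W]) (intro fl lins, simp_all)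
 also have "... = SW W (%x y. SW W (%u v. \<epsilon> (x ** u) *[W] f (y ** v)) h) 1[H]" by (rule SW_swap[OF W h]) (use W linD(1)[OF f] in simp_all)
 also have "... = SW W (%x y. \<epsilon> x *[W] f y) h" by (rule SW_mult_one(2)[OF W _ h]) (use W linD(1)[OF f] in "intro bilinI fl lins; simp")
 also have "... = f h" by (rule counit_SW(1)[OF W f h])
 finally show ?thesis .
qed

lemma act_one: "h el H ==> act X h one = act X (br h) one"
proof -
 assume h: "h el H"
 have "act X h one = act X (\<epsilon>t h) one" using hlinD(2)[OF arD(1)[OF aone_in] h ec_closed[OF one_R0]] h hunit_code(4)[OF one_R0, of h]
   aone_ec[of "\<epsilon>t h"] by (simp add: one_def R0_iff eps_t_idem)
 then show ?thesis using src_act[OF A_simps(1) h, of one] h mul_laws(2)[of "act X (\<epsilon>t h) one"] by simp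
qed

text \<open>The unit of the algebra is invariant, \<open>h 1 = \<epsilon>t(h) 1\<close>, so \<open>1 \<otimes> n\<close> transforms like
 \<open>n\<close>.\<close>

lemma hp_one:
 assumes hm: "hm N" "hm W" and p: "hpairing X N W p" and h: "h el H" and n: "n el N"
 shows "act W h (p one n) = p one (act N h n)"
proof -
 note vW = hm_vs[OF hm(2)]
 have "act W h (p one n) = SW W (%u v. p one (act N (\<epsilon>t u ** v) n)) h" unfolding hpD(3)[OF p h one_in n]
 proof (rule SW_cong[OF h])
  fix u v assume uv: "u el H" "v el H"
  show "p (act X u one) (act N v n) = p one (act N (\<epsilon>t u ** v) n)"
   unfolding act_one[OF uv(1)] using hpD(2)[OF p uv(1) one_in, of "act N v n"] uv n hm by (simp add: hmD(5)[OF hm(1)])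
 qed
 also have "... = p one (act N h n)" by (rule SW_eps_t_left[OF vW _ h]) (rule lin_comp[OF hmD(3)[OF hm(1) n] bilinD(1)[OF hpD(1)[OF p] one_in]])
 finally show ?thesis .
qed

text \<open>A map \<open>f\<close> out of \<open>A \<otimes> Q \<otimes> T\<close> is determined by \<open>\<psi>(v, t) = f(1 \<otimes> (1 \<otimes>
 v) \<otimes> t)\<close>, and the lift \<open>\<psi>'\<close> of \<open>\<psi>\<close> is to be turned back into an equivariant map. The formula
 \<open>\<beta>((h \<otimes> v) \<otimes> t) = \<Sum> h\<^sub>1 \<psi>'(v, anti(h\<^sub>2) t)\<close> does it. Equivariance would be awkward to test on
 these elements; instead all of them are sums of elements \<open>h ((1 \<otimes> v) \<otimes> t)\<close> by the untwisting identity, on which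
 \<open>\<beta>\<close> takes the value \<open>h \<psi>'(v, t)\<close>.\<close>

lemma proj_ind:
 assumes F: "hfree V Q fp" and T: "rproj T" and I: "ind Q T r W"
 shows "projective BB W"
proof (rule projI[OF indD(3)[OF I]])
 fix Y Z :: "('k, 'h, 'u) bm" and g f
 assume S: "bim Y" "bim Z" and g: "bh Y Z g" "g ` carrier (bob Y) = carrier (bob Z)" and f: "bh W Z f"
 let ?Y = "bob Y" and ?Z = "bob Z" and ?N = "NN Q T"
 note D = indD[OF I] and E = ind_facts[OF I] and G = hfreeD[OF F]
 note hT = bimD(4)[OF D(2)] and hY = bimD(4)[OF S(1)] and hZ = bimD(4)[OF S(2)]
 note vY = hm_vs[OF hY] and vZ = hm_vs[OF hZ]
 note fb = tensor_by.p_bilin[OF G(3)]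
 note B1 = lin_b1[OF fb] lin_b2[OF fb] lin_b1[OF E(6)] lin_b2[OF E(6)] lin_b1[OF E(7)] lin_b2[OF E(7)]
 have f': "lin (WW Q T) ?Z f" using bhD(2)[OF f] by (simp only: D(4))
 define q0 where "q0 v = fp 1[H] v" for v
 have q0: "q0 v el Q" if "v el V" for v unfolding q0_def using bilinD(4)[OF fb] that by simp
 \<comment> \<open>Restriction to the generators, no longer equivariant.\<close>
 define \<psi> where "\<psi> v t = f (wp Q T one (q0 v) t)" for v t
 have pb: "bilin V (bob T) ?Z \<psi>" unfolding \<psi>_def q0_def by (intro bilinI lin_comp[OF _ f'] B1 lins) (use E(4) bilinD(4)[OF fb] in simp_all)
 have wW: "wn Q T a n el bob W" if "a el X" "n el ?N" for a n using E(5)[OF that] D(4) by simp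
 have pr: "\<psi> v (rm T t a) = rm Z (\<psi> v t) a" if "v el V" "t el bob T" "a el X" for v t a
  unfolding \<psi>_def using E(13)[OF q0[OF that(1)] that(2) one_in that(3)]
   bhD(4)[OF f that(3) wW[OF one_in E(4)[OF q0[OF that(1)] that(2)]]] by simp
 obtain \<psi>' where p': "bilin V (bob T) ?Y \<psi>'"
   "\<forall>v\<in>carrier V. \<forall>t\<in>carrier (bob T). \<forall>a\<in>carrier X. \<psi>' v (rm T t a) = rm Y (\<psi>' v t) a"
   "\<forall>v\<in>carrier V. \<forall>t\<in>carrier (bob T). g (\<psi>' v t) = \<psi> v t" using rprojD[OF T S g G(1) pb pr] by blast
 note PB = lin_b1[OF p'(1)] lin_b2[OF p'(1)]
 note pc = bilinD(4)[OF p'(1)]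
 define s where "s t h v = SW ?Y (%u w. act ?Y u (\<psi>' v (act (bob T) (anti w) t))) h" for t h v
 have bs: "bilin H H ?Y (%u w. act ?Y u (\<psi>' v (act (bob T) (anti w) t)))" if "v el V" "t el bob T" for v t
  by (intro bilinI PB lins) (use that hY hT pc in simp_all)
 have s1: "bilin H V ?Y (s t)" if t: "t el bob T" for t unfolding s_def[abs_def]
 proof (rule bilinI)
  show "lin V ?Y (%n. SW ?Y (%u w. act ?Y u (\<psi>' n (act (bob T) (anti w) t))) m)" if "m el H" for m
   by (intro PB lins) (use that t hY hT vY in simp_all)
  show "lin H ?Y (%m. SW ?Y (%u w. act ?Y u (\<psi>' n (act (bob T) (anti w) t))) m)" if "n el V" for n by (rule SW_hlin[OF vY bs[OF that t]])
 qed
 have s2: "lin (bob T) ?Y (%t. s t h v)" if "h el H" "v el V" for h v unfolding s_def by (intro PB lins) (use that hY hT vY in simp_all)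
 obtain gg where gg: "bilin (bob T) Q ?Y gg"
  "!!t h v. t el bob T ==> h el H ==> v el V ==> gg t (fp h v) = s t h v"
  by (rule tensor_by.param_lift[OF G(3) vY s1 bal_empty bimD(5)[OF D(2)] s2], assumption+, rule that, assumption+)
 have bal: "gg t (act Q (br k) q) = gg (act (bob T) (\<epsilon>t k) t) q"
  if k: "k el H" and q: "q el Q" and t: "t el bob T" for k q t
 proof (rule tensor_by.ext[OF G(3) vY lin_comp[OF hmD(2)[OF G(2)] bilinD(1)[OF gg(1) t]] bilinD(1)[OF gg(1)] _ q])
  show "br k el H" "act (bob T) (\<epsilon>t k) t el bob T" using k t hT by simp_all
  fix h v assume hv: "h el H" "v el V"
  have "s t (br k ** h) v = SW ?Y (%u w. act ?Y u (\<psi>' v (act (bob T) (anti (br k ** w)) t))) h"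
   unfolding s_def by (rule SW_mult_br(2)[OF vY bs[OF hv(2) t] hv(1) k])
  also have "... = s (act (bob T) (\<epsilon>t k) t) h v"
   unfolding s_def by (rule SW_cong[OF hv(1)]) (use k t hT in "simp add: antipode_br hmD(5)[OF hT]")
  finally show "gg t (act Q (br k) (fp h v)) = gg (act (bob T) (\<epsilon>t k) t) (fp h v)" using k t hT hv by (simp add: G(4) gg(2))
 qed
 have bal': "balanced (base_bal K H Q (bob T)) Q (bob T) (%q t. gg t q)" unfolding balanced_def
 proof (intro allI impI ballI)
  fix \<rho> l m n assume bl: "(\<rho>, l) \<in> base_bal K H Q (bob T)" and mn: "m el Q" "n el bob T"
  obtain k where k: "k el H" "\<rho> = act Q (br k) \<and> l = act (bob T) (\<epsilon>t k)" by (rule base_balD[OF bl, THEN bexE])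
  show "gg n (\<rho> m) = gg (l n) m" using bal[OF k(1) mn] k(2) by simp
 qed
 define \<beta> where "\<beta> = hlift K H Q (bob T) ?Y (%q t. gg t q)"
 note hl = hlift[OF G(2) hT vY bilin_flip[OF gg(1)] bal', folded \<beta>_def]
 note bl = hl(1)
 \<comment> \<open>The untwisting identity writes a pure tensor through \<open>H\<close>-translates of generators.\<close>
 have gf: "np Q T (fp h v) t = SW ?N (%u w. act ?N u (np Q T (q0 v) (act (bob T) (anti w) t))) h"
  if h: "h el H" and v: "v el V" and t: "t el bob T" for h v t
 proof -
  have "act Q h (q0 v) = fp h v" using h v by (simp add: q0_def G(4))
  then show ?thesis using hp_antipode[OF G(2) hT E(1) E(8) h q0[OF v] t] by simp
 qed
 \<comment> \<open>Hence linear maps are determined by their values on translates of generators.\<close>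
 have gext: "f1 n = f2 n" if M: "vs M" "lin ?N M f1" "lin ?N M f2" and n: "n el ?N"
  and e: "!!h v t. h el H ==> v el V ==> t el bob T ==>
   f1 (act ?N h (np Q T (q0 v) t)) = f2 (act ?N h (np Q T (q0 v) t))" for M :: "('k, 'h, 'u) hmod" and f1 f2 n
 proof (rule tensor_by.ext[OF E(10) M _ n])
  fix q t assume q: "q el Q" and t: "t el bob T"
  show "f1 (np Q T q t) = f2 (np Q T q t)"
  proof (rule tensor_by.ext[OF G(3) M(1) lin_comp[OF bilinD(3)[OF E(6) t] M(2)] lin_comp[OF bilinD(3)[OF E(6) t] M(3)] _ q])
   fix h v assume hv: "h el H" "v el V"
   have c: "act ?N u (np Q T (q0 v) (act (bob T) (anti w) t)) el ?N" if "u el H" "w el H" for u w using that t hT E(1,4) q0[OF hv(2)] by simp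
   show "f1 (np Q T (fp h v) t) = f2 (np Q T (fp h v) t)" unfolding gf[OF hv t]
   proof -
    let ?b = "%u w. act ?N u (np Q T (q0 v) (act (bob T) (anti w) t))"
    have "f1 (SW ?N ?b h) = SW M (%u w. f1 (?b u w)) h" by (rule SW_lin[OF E(2) M(1,2) hv(1)], rule c, assumption+)
    also have "... = SW M (%u w. f2 (?b u w)) h" by (rule SW_cong[OF hv(1)]) (use e hv t hT in simp)
    also have "... = f2 (SW ?N ?b h)" by (rule SW_lin[symmetric, OF E(2) M(1,3) hv(1)], rule c, assumption+)
    finally show "f1 (SW ?N ?b h) = f2 (SW ?N ?b h)" .
   qed
  qed
 qed
 have bg: "\<beta> (act ?N h (np Q T (q0 v) t)) = act ?Y h (\<psi>' v t)"
  if h: "h el H" and v: "v el V" and t: "t el bob T" for h v t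
 proof -
  have tr: "trilin ?Y (%u w x. act ?Y u (\<psi>' v (act (bob T) (anti w ** x) t)))" by (intro trilinI PB lins) (use v t hY hT pc in simp_all)
  have "\<beta> (act ?N h (np Q T (q0 v) t)) = SW ?Y (%u w. \<beta> (np Q T (act Q u (q0 v)) (act (bob T) w t))) h"
   unfolding hpD(3)[OF E(8) h q0[OF v] t] by (rule SW_lin[OF E(2) vY bl h]) (use E(4) G(2) hT t q0[OF v] in simp)
  also have "... = SW ?Y (%u w. SW ?Y (%u1 u2. act ?Y u1 (\<psi>' v (act (bob T) (anti u2 ** w) t))) u) h"
  proof (rule SW_cong[OF h])
   fix u w assume uw: "u el H" "w el H"
   have "\<beta> (np Q T (act Q u (q0 v)) (act (bob T) w t)) = s (act (bob T) w t) u v"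
    using uw v t hT bilinD(4)[OF fb] by (simp add: q0_def G(4) hl(2) gg(2))
   also have "... = SW ?Y (%u1 u2. act ?Y u1 (\<psi>' v (act (bob T) (anti u2 ** w) t))) u"
    unfolding s_def by (rule SW_cong[OF uw(1)]) (use uw t in "simp add: hmD(5)[OF hT]")
   finally show "\<beta> (np Q T (act Q u (q0 v)) (act (bob T) w t)) = SW ?Y (%u1 u2. act ?Y u1 (\<psi>' v (act (bob T) (anti u2 ** w) t))) u" .
  qed
  also have "... = SW ?Y (%u w. SW ?Y (%w1 w2. act ?Y u (\<psi>' v (act (bob T) (anti w1 ** w2) t))) w) h" by (rule coassoc3[OF vY tr h])
  also have "... = SW ?Y (%u w. act ?Y (u ** \<epsilon>s w) (\<psi>' v t)) h"
  proof (rule SW_cong[OF h])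
   fix u w assume uw: "u el H" "w el H"
   have L: "lin H ?Y (%x. act ?Y u (\<psi>' v (act (bob T) x t)))" by (intro PB lins) (use uw v t hY hT in simp_all)
   have "SW ?Y (%w1 w2. act ?Y u (\<psi>' v (act (bob T) (anti w1 ** w2) t))) w = act ?Y u (\<psi>' v (act (bob T) (SW H (%w1 w2. anti w1 ** w2) w) t))"
    by (rule SW_lin[symmetric, OF vsH vY L uw(2)]) simp
   also have "... = act ?Y u (\<psi>' v (act (bob T) (br (\<epsilon>t (\<epsilon>s w))) t))" using uw by (simp add: antipode_SW(2) eps_s_br)
   also have "... = act ?Y u (act ?Y (br (\<epsilon>t (\<epsilon>s w))) (\<psi>' v t))"
    using uw v t p'(2) pc src_act[OF D(2), of "\<epsilon>t (\<epsilon>s w)" t] src_act[OF S(1), of "\<epsilon>t (\<epsilon>s w)" "\<psi>' v t"] by simp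
   also have "... = act ?Y (u ** \<epsilon>s w) (\<psi>' v t)" using uw v t pc by (simp add: eps_s_br hmD(5)[OF hY])
   finally show "SW ?Y (%w1 w2. act ?Y u (\<psi>' v (act (bob T) (anti w1 ** w2) t))) w = act ?Y (u ** \<epsilon>s w) (\<psi>' v t)" .
  qed
  also have "... = act ?Y h (\<psi>' v t)" by (rule SW_eps_s[OF vY _ h, where f = "%x. act ?Y x (\<psi>' v t)"]) (rule hmD(3)[OF hY pc[OF v t]])
  finally show ?thesis .
 qed
 have bh: "hlin ?N ?Y \<beta>"
 proof (rule hlinI[OF bl])
  fix x n assume x: "x el H" and n: "n el ?N"
  show "\<beta> (act ?N x n) = act ?Y x (\<beta> n)" by (rule gext[OF vY lin_comp[OF hmD(2)[OF E(1) x] bl] lin_comp[OF bl hmD(2)[OF hY x]] n])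
    (use x q0 E(4) pc in "simp add: hmD(5)[OF E(1), symmetric] bg, simp add: hmD(5)[OF hY]")
 qed
 have br': "\<beta> (r n c) = rm Y (\<beta> n) c" if n: "n el ?N" and c: "c el X" for n c
 proof (rule gext[OF vY lin_comp[OF bilinD(3)[OF hpD(1)[OF D(5)] c] bl] lin_comp[OF bl bilinD(3)[OF hpD(1)[OF bim_laws(3)[OF S(1)]] c]] n])
  fix h v t assume h: "h el H" and v: "v el V" and t: "t el bob T"
  let ?x = "np Q T (q0 v) t"
  have x: "?x el ?N" by (rule E(4)[OF q0[OF v] t])
  have "\<beta> (r (act ?N h ?x) c) = \<beta> (SW ?N (%u w. act ?N u (r ?x (act X (anti w) c))) h)"
   using hp_antipode[OF E(1) hmX E(1) D(5) h x c] by simp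
  also have "... = SW ?Y (%u w. \<beta> (act ?N u (r ?x (act X (anti w) c)))) h"
   by (rule SW_lin[OF E(2) vY bl h]) (use c x E(1) hpD(4)[OF D(5)] in simp)
  also have "... = SW ?Y (%u w. act ?Y u (rm Y (\<psi>' v t) (act X (anti w) c))) h"
   by (rule SW_cong[OF h]) (use v t c p'(2) D(2) in "simp add: D(6) q0 bg")
  also have "... = rm Y (act ?Y h (\<psi>' v t)) c" by (rule hp_antipode[OF hY hmX hY bim_laws(3)[OF S(1)] h pc[OF v t] c])
  finally show "\<beta> (r (act ?N h ?x) c) = rm Y (\<beta> (act ?N h ?x)) c" by (simp add: bg h v t)
 qed
 obtain G' where G': "bh W Y G'" "!!a n. a el X ==> n el ?N ==> G' (wn Q T a n) = lm Y a (\<beta> n)"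
  by (rule ind_map[OF I S(1) bh], rule br', assumption+, rule that, assumption+)
 have "g (G' w) = f w" if w: "w el WW Q T" for w
 proof (rule tensor_by.ext[OF E(11) vZ _ f' _ w, where f = "%w. g (G' w)"])
  show "lin (WW Q T) ?Z (%w. g (G' w))" using lin_comp[OF bhD(2)[OF G'(1)] bhD(2)[OF g(1)]] by (simp only: D(4))
  fix a n assume a: "a el X" and n: "n el ?N"
  have "g (lm Y a (\<beta> n)) = f (wn Q T a n)"
  proof (rule gext[OF vZ lin_comp[OF bl lin_comp[OF bilinD(1)[OF hpD(1)[OF bim_laws(2)[OF S(1)]] a] bhD(2)[OF g(1)]]]
    lin_comp[OF bilinD(1)[OF E(7) a] f'] n])
   fix h v t assume h: "h el H" and v: "v el V" and t: "t el bob T"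
   let ?x = "np Q T (q0 v) t"
   have x: "?x el ?N" by (rule E(4)[OF q0[OF v] t])
   note hx = act_closed[OF E(1) h x]
   have "f (wn Q T a (act ?N h ?x)) = f (lm W a (wn Q T one (act ?N h ?x)))" using D(7)[OF a one_in hx] mul_laws(3)[OF a] by simp
   also have "... = lm Z a (f (wn Q T one (act ?N h ?x)))" by (rule bhD(3)[OF f a wW[OF one_in hx]])
   also have "f (wn Q T one (act ?N h ?x)) = f (act (bob W) h (wn Q T one ?x))" using hp_one[OF E(1) htens_hm[OF hmX E(1)] E(9) h x] D(4) by simp
   also have "... = act ?Z h (\<psi> v t)" unfolding \<psi>_def by (rule hlinD(2)[OF bhD(1)[OF f] h wW[OF one_in x]])
   finally show "g (lm Y a (\<beta> (act ?N h ?x))) = f (wn Q T a (act ?N h ?x))"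
    using a h v t hY pc p'(3) by (simp add: bg bhD(3)[OF g(1)] hlinD(2)[OF bhD(1)[OF g(1)]])
  qed
  then show "g (G' (wn Q T a n)) = f (wn Q T a n)" using G'(2)[OF a n] by simp
 qed
 then show "\<exists>h. bh W Y h \<and> (\<forall>p\<in>carrier (bob W). g (h p) = f p)" using G'(1) D(4) by (intro exI[of _ G']) simp
qed

text \<open>Every bimodule \<open>P\<close> is a quotient of \<open>A \<otimes> (H \<otimes> P) \<otimes> A\<close>.\<close>

lemma cover:
 assumes P: "bim P"
 obtains Q fp r W f \<pi> where "hfree (bob P) Q fp" "ind Q AA r W" "hlin Q (bob P) f" "bh W P \<pi>"
  "!!a q b. a el X ==> q el Q ==> b el X ==> \<pi> (wp Q AA a q b) = lm P a (rm P (f q) b)"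
  "\<pi> ` carrier (bob W) = carrier (bob P)"
proof -
 note hP = bimD(4)[OF P] and L = bim_laws[OF P]
 obtain Q fp where F: "hfree (bob P) Q fp" using hfree_ex[OF bimD(5)[OF P]] by blast
 note G = hfreeD[OF F]
 obtain f where f: "hlin Q (bob P) f" "!!h v. h el H ==> v el bob P ==> f (fp h v) = act (bob P) h v"
  by (rule hfree_map[OF F hP lin_id], rule that, assumption+)
 obtain r W where I: "ind Q AA r W" using ind_ex[OF G(2) A_simps(1)] by blast
 note D = indD[OF I, unfolded A_simps(2-5)] and E = ind_facts[OF I, unfolded A_simps(2-5)]
 have hp: "hpairing Q (bob AA) (bob P) (%q t. rm P (f q) t)"
  unfolding A_simps(2) by (rule hpairing_comp[OF hP hmX G(2) hmX hP hP L(3) f(1) hlin_id hlin_id])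
 have R: "rm P (f q) (rm AA t c) = rm P (rm P (f q) t) c" if "q el Q" "t el bob AA" "c el X" for q t c
  using that hlinD(3)[OF f(1)] by (simp add: L(6))
 obtain \<pi> where \<pi>: "bh W P \<pi>"
  "!!a q t. a el X ==> q el Q ==> t el bob AA ==> \<pi> (wp Q AA a q t) = lm P a (rm P (f q) t)"
  by (rule ind_map2[OF I P hp], rule R, assumption+, rule that, assumption+)
 have s: "\<pi> ` carrier (bob W) = carrier (bob P)"
 proof
  show "\<pi> ` carrier (bob W) \<subseteq> carrier (bob P)" using bhD(5)[OF \<pi>(1)] by (intro image_subsetI)
  show "carrier (bob P) \<subseteq> \<pi> ` carrier (bob W)"
  proof
   fix p assume p: "p el bob P"
   have q: "fp 1[H] p el Q" using bilinD(4)[OF tensor_by.p_bilin[OF G(3)]] p by simp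
   let ?w = "hpure K H X (htens K H Q X) one (hpure K H Q X (fp 1[H] p) one)"
   have "\<pi> ?w = p" using \<pi>(2)[OF one_in q, of one] p by (simp add: f(2) hmD(4)[OF hP] L(5,7))
   moreover have "?w el bob W" using E(4)[OF q one_in] E(5)[OF one_in] D(4) by simp
   ultimately show "p \<in> \<pi> ` carrier (bob W)" by (intro image_eqI[of p \<pi> ?w]) simp_all
  qed
 qed
 show thesis by (rule that[OF F I f(1) \<pi>(1) _ s]) (use \<pi>(2) in simp)
qed

lemma proj_section:
 assumes P: "projective BB P" and W: "bim W" and \<pi>: "bh W P \<pi>" "\<pi> ` carrier (bob W) = carrier (bob P)"
 obtains \<sigma> where "bh P W \<sigma>" "!!p. p el bob P ==> \<pi> (\<sigma> p) = p"
proof -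
 have "bh P P (%p. p)" by (simp add: bhom_def hlin_id)
 then show thesis using projD[OF P W proj_bim[OF P] \<pi>] that by metis
qed

lemma rproj_proj: "projective BB P ==> rproj P"
proof -
 assume P: "projective BB P"
 obtain Q fp r W f \<pi> where c: "ind Q AA r W" "bh W P \<pi>" "\<pi> ` carrier (bob W) = carrier (bob P)"
  by (rule cover[OF proj_bim[OF P]], rule that, assumption+)
 obtain \<sigma> where "bh P W \<sigma>" "!!p. p el bob P ==> \<pi> (\<sigma> p) = p"
  by (rule proj_section[OF P indD(3)[OF c(1)] c(2,3)], rule that, assumption+)
 then show "rproj P" by (rule rproj_retract[OF rproj_ind[OF c(1)] _ c(2)])
qed

lemma proj_ex:
 obtains P d where "projective BB P" "bh P AA d" "d ` carrier (bob P) = carrier X"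
proof -
 obtain Q fp r W f \<pi> where c: "hfree (bob AA) Q fp" "ind Q AA r W" "bh W AA \<pi>" "\<pi> ` carrier (bob W) = carrier (bob AA)"
  by (rule cover[OF A_simps(1)], rule that, assumption+)
 show thesis by (rule that[OF proj_ind[OF c(1) rproj_AA c(2)] c(3)]) (use c(4) in simp)
qed

lemma bt_map:
 assumes S: "bim S" and T: "bim T" and W: "bim W" and b: "hpairing (bob S) (bob T) (bob W) b"
  and bal: "!!s a t. s el bob S ==> a el X ==> t el bob T ==> b (rm S s a) t = b s (lm T a t)"
  and l: "!!s a t. s el bob S ==> a el X ==> t el bob T ==> b (lm S a s) t = lm W a (b s t)"
  and r: "!!s a t. s el bob S ==> a el X ==> t el bob T ==> b s (rm T t a) = rm W (b s t) a"
 obtains h where "bh (bt S T) W h" "!!s t. s el bob S ==> t el bob T ==> h (tp S T s t) = b s t"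
proof -
 note p = par[OF bimD(4)[OF S] bimD(4)[OF T] bimD(4)[OF W] b]
 note B = bt_the[OF S T W p bal l r]
 show thesis by (rule that[OF B_arD(2)[OF bten_bim[OF S T] W B(1)] B(2)])
qed

text \<open>The section \<open>\<sigma>\<close> of the cover of \<open>P\<close> by \<open>A \<otimes> Q \<otimes> A\<close> embeds \<open>P
 \<otimes>\<^sub>A T\<close> into \<open>A \<otimes> Q \<otimes> A \<otimes>\<^sub>A T = A \<otimes> Q \<otimes> T\<close>, and the cover itself
 induces a retraction.\<close>

lemma proj_bt:
 assumes P: "projective BB P" and T: "projective BB T"
 shows "projective BB (bt P T)"
proof -
 note bP = proj_bim[OF P] and bT = proj_bim[OF T]
 note hP = bimD(4)[OF bP] and hT = bimD(4)[OF bT]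
 note LP = bim_laws[OF bP] and LT = bim_laws[OF bT]
 obtain Q fp r1 W1 f \<pi> where c: "hfree (bob P) Q fp" "ind Q AA r1 W1" "hlin Q (bob P) f" "bh W1 P \<pi>"
  "!!a q b. a el X ==> q el Q ==> b el X ==> \<pi> (wp Q AA a q b) = lm P a (rm P (f q) b)"
  "\<pi> ` carrier (bob W1) = carrier (bob P)" by (rule cover[OF bP], rule that, assumption+)
 note I1 = c(2)
 note D1 = indD[OF I1, unfolded A_simps(2-5)] and E1 = ind_facts[OF I1, unfolded A_simps(2-5)]
 note ext1 = ind_ext[OF I1, unfolded A_simps(2-5)]
 note \<pi>v = c(5)[unfolded A_simps(2-5)]
 have hQ: "hm Q" by (rule hfreeD(2)[OF c(1)])
 obtain \<sigma> where \<sigma>: "bh P W1 \<sigma>" "!!p. p el bob P ==> \<pi> (\<sigma> p) = p"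
  by (rule proj_section[OF P D1(3) c(4,6)], rule that, assumption+)
 obtain r2 W2 where I2: "ind Q T r2 W2" using ind_ex[OF hQ bT] by blast
 note D2 = indD[OF I2] and E2 = ind_facts[OF I2]
 note pW2 = proj_ind[OF c(1) rproj_proj[OF T] I2]
 note BT = bten[OF bP bT]
 let ?B = "bt P T"
 have hB: "hm (bob ?B)" by (rule bimD(4)[OF BT(1)])
 have tph: "hpairing (bob P) (bob T) (bob ?B) (tp P T)" unfolding BT(2) by (rule tp_hp[OF bP bT])
 have m1: "hpairing Q (bob T) (bob ?B) (%q t. tp P T (f q) t)" by (rule hpairing_comp[OF hP hT hQ hT hB hB tph c(3) hlin_id hlin_id])
 have m2: "tp P T (f q) (rm T t a) = rm ?B (tp P T (f q) t) a" if "q el Q" "t el bob T" "a el X" for q t a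
  by (rule BT(4)[symmetric, OF that(3) hlinD(3)[OF c(3) that(1)] that(2)])
 obtain \<mu> where \<mu>: "bh W2 ?B \<mu>"
  "!!a q t. a el X ==> q el Q ==> t el bob T ==> \<mu> (wp Q T a q t) = lm ?B a (tp P T (f q) t)"
  by (rule ind_map2[OF I2 BT(1) m1], rule m2, assumption+, rule that, assumption+)
 let ?NX = "htens K H Q X" and ?NT = "NN Q T"
 let ?W1 = "htens K H X ?NX" and ?W2 = "WW Q T"
 note hNX = E1(1) and hNT = E2(1)
 note hW1 = htens_hm[OF hmX hNX] and hW2 = htens_hm[OF hmX hNT]
 note la = bimD(1)[OF bT]
 note hXT = htens_hm[OF hmX hT]
 note t1 = tar[OF hQ hXT hQ hT idn_in[OF hQ] la] and a1 = asc[OF hQ hmX hT]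
 let ?L = "cmp CC (tar CC (idn CC Q) (lac T)) (asc CC Q X (bob T))"
 note hNXT = htens_hm[OF hNX hT]
 note L1 = cmp_in[OF hNXT t1(1) a1(1)]
 note t2 = tar[OF hmX hNXT hmX hNT idn_in[OF hmX] L1] and a2 = asc[OF hmX hNX hT]
 let ?\<kappa> = "cmp CC (tar CC (idn CC X) ?L) (asc CC X ?NX (bob T))"
 note K1 = cmp_in[OF htens_hm[OF hW1 hT] t2(1) a2(1)]
 \<comment> \<open>\<open>\<kappa>\<close> is \<open>(a \<otimes> (q \<otimes> b), t) \<mapsto> a \<otimes> (q \<otimes> b t)\<close>; composing it from associativity arrows yields equivariance for free.\<close>
 define \<kappa> where "\<kappa> = pmap ?W1 (bob T) ?\<kappa>"
 have \<kappa>h: "hpairing ?W1 (bob T) ?W2 \<kappa>" unfolding \<kappa>_def by (rule pmap_hp[OF hW1 hT hW2 K1])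
 have \<kappa>v: "\<kappa> (hpure K H X ?NX a (hpure K H Q X q b)) t = wp Q T a q (lm T b t)"
  if "a el X" "q el Q" "b el X" "t el bob T" for a q b t
 proof -
  note n = E1(4)[OF that(2,3)]
  note w = E1(5)[OF that(1) n]
  note c1 = hpD(4)[OF htens_hp[OF hW1 hT] w that(4)] and c2 = hpD(4)[OF htens_hp[OF hNX hT] n that(4)]
  note c3 = hpD(4)[OF htens_hp[OF hmX hT] that(3,4)]
  show ?thesis unfolding \<kappa>_def pmap_def
   using that by (simp add: mp_cmp[OF t2(1) a2(1) c1] a2(2)[OF that(1) n that(4)] t2(2)[OF that(1) c2] mp_idn
    mp_cmp[OF t1(1) a1(1) c2] a1(2)[OF that(2-4)] t1(2)[OF that(2) c3])
 qed
 note \<kappa>b = bilinD[OF hpD(1)[OF \<kappa>h]]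
 have wc: "hpure K H X ?NX a (hpure K H Q X q b) el ?W1" if "a el X" "q el Q" "b el X" for a q b using E1(4)[OF that(2,3)] E1(5)[OF that(1)] by simp
 have wc2: "wp Q T a q t el ?W2" if "a el X" "q el Q" "t el bob T" for a q t using E2(4)[OF that(2,3)] E2(5)[OF that(1)] by simp
 have l1: "lin ?W1 ?W1 (%w. lm W1 a w)" "lin ?W1 ?W1 (%w. rm W1 w a)" if a: "a el X" for a
  using bilinD(2)[OF hpD(1)[OF bim_laws(2)[OF D1(3)]] a] bilinD(3)[OF hpD(1)[OF bim_laws(3)[OF D1(3)]] a] by (simp_all only: D1(4))
 have l2: "lin ?W2 ?W2 (%w. lm W2 a w)" "lin ?W2 ?W2 (%w. rm W2 w a)" if a: "a el X" for a
  using bilinD(2)[OF hpD(1)[OF bim_laws(2)[OF D2(3)]] a] bilinD(3)[OF hpD(1)[OF bim_laws(3)[OF D2(3)]] a] by (simp_all only: D2(4))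
 note vW2 = E2(3)
 have k1: "\<kappa> (rm W1 w a) t = \<kappa> w (lm T a t)"
  if w: "w el ?W1" and a: "a el X" and t: "t el bob T" for w a t
  by (rule ext1[OF vW2 lin_comp[OF l1(2)[OF a] \<kappa>b(3)[OF t]] \<kappa>b(3)[OF lm_closed[OF bT a t]] _ w])
   (use a t bT in "simp add: E1(13) \<kappa>v LT(4)")
 have k2: "\<kappa> (lm W1 a w) t = lm W2 a (\<kappa> w t)"
  if w: "w el ?W1" and a: "a el X" and t: "t el bob T" for w a t
  by (rule ext1[OF vW2 lin_comp[OF l1(1)[OF a] \<kappa>b(3)[OF t]] lin_comp[OF \<kappa>b(3)[OF t] l2(1)[OF a]] _ w])
   (use a t bT in "simp add: E1(12) E2(12) \<kappa>v")
 have k3: "\<kappa> w (rm T t a) = rm W2 (\<kappa> w t) a"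
  if w: "w el ?W1" and a: "a el X" and t: "t el bob T" for w a t
  by (rule ext1[OF vW2 \<kappa>b(3)[OF rm_closed[OF bT a t]] lin_comp[OF \<kappa>b(3)[OF t] l2(2)[OF a]] _ w])
   (use a t bT in "simp add: E2(13) \<kappa>v LT(8)")
 have \<sigma>c: "\<sigma> p el ?W1" if "p el bob P" for p using bhD(5)[OF \<sigma>(1) that] D1(4) by simp
 have \<sigma>h: "hlin (bob P) ?W1 \<sigma>" using bhD(1)[OF \<sigma>(1)] by (simp only: D1(4))
 have n1: "hpairing (bob P) (bob T) (bob W2) (%p t. \<kappa> (\<sigma> p) t)"
  unfolding D2(4) by (rule hpairing_comp[OF hW1 hT hP hT hW2 hW2 \<kappa>h \<sigma>h hlin_id hlin_id])
 have n2: "\<kappa> (\<sigma> (rm P p a)) t = \<kappa> (\<sigma> p) (lm T a t)" "\<kappa> (\<sigma> (lm P a p)) t = lm W2 a (\<kappa> (\<sigma> p) t)"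
  "\<kappa> (\<sigma> p) (rm T t a) = rm W2 (\<kappa> (\<sigma> p) t) a"
  if "p el bob P" "a el X" "t el bob T" for p a t using that by (simp_all add: bhD(3,4)[OF \<sigma>(1)] k1 k2 k3 \<sigma>c)
 obtain \<nu> where \<nu>: "bh ?B W2 \<nu>" "!!p t. p el bob P ==> t el bob T ==> \<nu> (tp P T p t) = \<kappa> (\<sigma> p) t"
  by (rule bt_map[OF bP bT D2(3) n1], rule n2(1), assumption+, rule n2(2), assumption+, rule n2(3), assumption+, rule that, assumption+)
 note tb = bilinD[OF hpD(1)[OF tp_hp[OF bP bT]]]
 have \<pi>l: "lin ?W1 (bob P) \<pi>" using bhD(2)[OF c(4)] by (simp only: D1(4))
 have \<mu>l: "lin ?W2 (bo P T) \<mu>" using bhD(2)[OF \<mu>(1)] by (simp only: D2(4) BT(2))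
 have vB: "vs (bo P T)" by (rule hm_vs[OF bo_hm[OF bP bT]])
 have fc: "f q el bob P" if "q el Q" for q by (rule hlinD(3)[OF c(3) that])
 \<comment> \<open>On all of the cover, where it can be tested on generators; only then restricted along \<open>\<sigma>\<close>.\<close>
 have mk: "\<mu> (\<kappa> w t) = tp P T (\<pi> w) t" if w: "w el ?W1" and t: "t el bob T" for w t
 proof (rule ext1[OF vB lin_comp[OF \<kappa>b(3)[OF t] \<mu>l] lin_comp[OF \<pi>l tb(3)[OF t]] _ w])
  fix a q b assume h: "a el X" "q el Q" "b el X"
  show "\<mu> (\<kappa> (hpure K H X ?NX a (hpure K H Q X q b)) t) = tp P T (\<pi> (hpure K H X ?NX a (hpure K H Q X q b))) t"
   using h t bT bP fc[OF h(2)] by (simp add: \<kappa>v \<mu>(2) BT(3) \<pi>v LP(8)[symmetric] tp_bal[OF bP bT])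
 qed
 show ?thesis
 proof (rule proj_retract[OF pW2 BT(1) \<nu>(1) \<mu>(1)])
  fix x assume x: "x el bob ?B"
  have L: "lin (bo P T) (bo P T) (%x. \<mu> (\<nu> x))" using lin_comp[OF bhD(2)[OF \<nu>(1)] bhD(2)[OF \<mu>(1)]] by (simp only: BT(2))
  show "\<mu> (\<nu> x) = x" by (rule tp_ext[OF bP bT vB L lin_id _ x[unfolded BT(2)]]) (simp add: \<nu>(2) mk \<sigma>c \<sigma>(2))
 qed
qed

end

section \<open>The bar resolution\<close>

text \<open>\<open>\<Sum>\<^sub>i\<^sub><\<^sub>k (-1)\<^sup>i f(i)\<close>\<close>

primrec (in vec) asum :: "('k, 'm, 'y) module_scheme => (nat => 'm) => nat => 'm"
 where "asum M f 0 = 0[M]" | "asum M f (Suc k) = asum M f k +[M] (if even k then f k else -[M] f k)"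

context vec
begin

lemma asum_closed: "vs M ==> (!!i. i < k ==> f i el M) ==> asum M f k el M"
 by (induction k) auto

lemma asum_cong: "(!!i. i < k ==> f i = g i) ==> asum M f k = asum M g k"
 by (induction k) auto

lemma asum_lin:
 assumes "vs M" "vs N" "lin M N \<phi>"
 shows "(!!i. i < k ==> f i el M) ==> \<phi> (asum M f k) = asum N (%i. \<phi> (f i)) k"
proof (induction k)
 case 0 then show ?case using lin_zero[OF assms] by simp
next
 case (Suc k)
 then show ?case using asum_closed[OF assms(1), of k f] lin_neg[OF assms, of "f k"] assms(1) by (simp add: linD(2)[OF assms(3)])
qed

lemma asum_Suc:
 assumes "vs M"
 shows "(!!i. i \<le> k ==> f i el M) ==> asum M f (Suc k) = f 0 -[M] asum M (%i. f (Suc i)) k"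
proof (induction k)
 case 0 then show ?case using assms by simp
next
 case (Suc k)
 let ?s = "asum M (%i. f (Suc i)) k"
 have c: "f 0 el M" "f (Suc k) el M" "?s el M" using Suc.prems by (auto intro!: asum_closed[OF assms])
 have "asum M f (Suc (Suc k)) = asum M f (Suc k) +[M] (if even (Suc k) then f (Suc k) else -[M] f (Suc k))" by (rule asum.simps(2))
 also have "asum M f (Suc k) = f 0 -[M] ?s" using Suc by simp
 finally show ?case using c assms by (simp add: a_minus_def vs_neg_add vs_assoc)
qed

lemma finsum_asum:
 assumes "vs M"
 shows "(!!i. i < k ==> f i el M) ==> finsum M (%i. if even i then f i else -[M] f i) {..<k} = asum M f k"
proof (induction k)
 case 0 interpret abelian_group M by (rule vs_group[OF assms])
 show ?case by simp
next
 case (Suc k)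
 interpret abelian_group M by (rule vs_group[OF assms])
 have "finsum M (%i. if even i then f i else -[M] f i) (insert k {..<k}) =
   (if even k then f k else -[M] f k) +[M] finsum M (%i. if even i then f i else -[M] f i) {..<k}" by (rule finsum_insert) (use Suc.prems in auto)
 then show ?case using Suc asum_closed[OF assms, of k f] assms by (simp add: lessThan_Suc vs_comm)
qed

end

context halg
begin

lemma homs_ops: "f +[homs CC M N] g = mk_ar M (%m. mp f m +[N] mp g m) N"
 "k *[homs CC M N] f = mk_ar M (%m. k *[N] mp f m) N"
 by (cases f; cases g; simp add: CC_simps hhom_def mp_def) (cases f; simp add: CC_simps hhom_def mp_def)

lemma B_ops:
 assumes S: "bim S" and T: "bim T"
 shows "f \<in> ar BB S T ==> g \<in> ar BB S T ==> f +[homs BB S T] g \<in> ar BB S T"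
  and "k el K ==> f \<in> ar BB S T ==> k *[homs BB S T] f \<in> ar BB S T"
  and "0[homs BB S T] \<in> ar BB S T"
proof -
 note vT = bimD(5)[OF T] and LT = bim_laws[OF T]
 note AD = B_arD(2)[OF S T]
 note ll = bilinD(1)[OF hpD(1)[OF LT(2)]] and lr = bilinD(3)[OF hpD(1)[OF LT(3)]] and la = hmD(2)[OF bimD(4)[OF T]]
 note lD = linD(2)[OF ll] linD(2)[OF lr] linD(3)[OF ll] linD(3)[OF lr] lin_zero[OF vT vT ll] lin_zero[OF vT vT lr]
 note aD = linD(2)[OF la] linD(3)[OF la] lin_zero[OF vT vT la]
 show "f +[homs BB S T] g \<in> ar BB S T" if "f \<in> ar BB S T" "g \<in> ar BB S T" unfolding BB_simps(4) homs_ops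
 proof (rule B_arI[OF S T])
  note fD = AD[OF that(1)] and gD = AD[OF that(2)]
  show "bh S T (%m. mp f m +[bob T] mp g m)" unfolding bhom_def by (intro conjI ballI hlinI lin_add_map[OF vT bhD(2)[OF fD] bhD(2)[OF gD]])
    (simp_all add: bhD(3-5)[OF fD] bhD(3-5)[OF gD] hlinD(2)[OF bhD(1)[OF fD]] hlinD(2)[OF bhD(1)[OF gD]] lD aD)
 qed
 show "k *[homs BB S T] f \<in> ar BB S T" if "k el K" "f \<in> ar BB S T" unfolding BB_simps(6) homs_ops
 proof (rule B_arI[OF S T])
  note fD = AD[OF that(2)]
  show "bh S T (%m. k *[bob T] mp f m)" unfolding bhom_def by (intro conjI ballI hlinI lin_smult_map[OF vT that(1) bhD(2)[OF fD]])
    (simp_all add: bhD(3-5)[OF fD] hlinD(2)[OF bhD(1)[OF fD]] lD aD that(1))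
 qed
 show "0[homs BB S T] \<in> ar BB S T" unfolding BB_simps(5) zero_ar
 proof (rule B_arI[OF S T])
  show "bh S T (%m. 0[bob T])" unfolding bhom_def by (intro conjI ballI hlinI lin_zero_map[OF vT]) (simp_all add: lD aD vT)
 qed
qed

lemma mp_ops:
 "m el bob S ==> mp (f +[homs BB S T] g) m = mp f m +[bob T] mp g m"
 "m el bob S ==> mp (k *[homs BB S T] f) m = k *[bob T] mp f m"
 "m el bob S ==> mp 0[homs BB S T] m = 0[bob T]" by (simp_all add: BB_simps homs_ops zero_ar)

lemma B_homs:
 assumes S: "bim S" and T: "bim T"
 shows "vs (homs BB S T)" and "m el bob S ==> lin (homs BB S T) (bob T) (%f. mp f m)"
proof -
 let ?H = "homs BB S T"
 note vT = bimD(5)[OF T] and O = B_ops[OF S T]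
 have c: "mp f m el bob T" if "f el ?H" "m el bob S" for f m by (rule ar_closed[OF B_arD(1)[OF that(1)] that(2)])
 have eq: "f = g" if "f el ?H" "g el ?H" "!!m. m el bob S ==> mp f m = mp g m" for f g
  by (rule ar_eqI[OF B_arD(1)[OF that(1)] B_arD(1)[OF that(2)] that(3)])
 show "vs ?H"
 proof (rule moduleI[OF cring_K abelian_groupI])
  fix f assume f: "f el ?H"
  let ?g = "(\<ominus>\<^bsub>K\<^esub> 1[K]) *[?H] f"
  have g: "?g el ?H" by (rule O(2)) (simp_all add: f)
  have "?g +[?H] f = 0[?H]" by (rule eq[OF O(1)[OF g f] O(3)]) (use c[OF f] vT in "simp add: mp_ops vs_neg_smult[symmetric]")
  then show "\<exists>g\<in>carrier ?H. g +[?H] f = 0[?H]" using g by (intro bexI[of _ ?g])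
 qed ((rule O(1), assumption, assumption) | (rule O(2), assumption, assumption) | rule O(3) |
   (rule eq, (assumption | rule O(1) O(2) O(3) K_simps)+, use c vT in "simp add: mp_ops vs_smult vs_ac"))+
 show "lin ?H (bob T) (%f. mp f m)" if "m el bob S" by (rule linI) (use c that in "simp_all add: mp_ops")
qed

abbreviation "bp P n \<equiv> bpow CC A P n"

lemma bpow_bim: "bim P ==> bim (bp P n)"
 by (induction n) simp_all

lemma face_first:
 assumes P: "bim P" and d: "d \<in> ar BB P AA"
 shows "face_first CC A P d n \<in> ar BB (bt P (bp P n)) (bp P n)"
  and "p el bob P ==> t el bob (bp P n) ==>
   mp (face_first CC A P d n) (tp P (bp P n) p t) = lm (bp P n) (mp d p) t"
proof -
 let ?T = "bp P n"
 note T = bpow_bim[OF P, of n]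
 note i = B_idn_in[OF T]
 note b = bten_ar[OF P A_simps(1) T T d i]
 note l = bten_lun[OF T]
 have bb: "bim (bt P ?T)" "bim (bt AA ?T)" by (rule bten_bim[OF P T], rule bten_bim[OF A_simps(1) T])
 show "face_first CC A P d n \<in> ar BB (bt P ?T) ?T" unfolding face_first_def Let_def by (rule B_cmp_in[OF bb(1,2) T l(1) b(1)])
 assume p: "p el bob P" and t: "t el bob ?T"
 have "mp d p el X" using ar_closed[OF B_arD(1)[OF d] p] by simp
 moreover have "tp P ?T p t el bob (bt P ?T)" using p t P T by (simp add: bten_bob)
 ultimately show "mp (face_first CC A P d n) (tp P ?T p t) = lm ?T (mp d p) t" unfolding face_first_def Let_def using p t
  by (simp add: mp_cmp[OF B_arD(1)[OF l(1)] B_arD(1)[OF b(1)]] b(2) mp_idn l(2))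
qed

lemma face_last:
 assumes P: "bim P" and d: "d \<in> ar BB P AA"
 shows "face CC A P d 0 (Suc i) \<in> ar BB (bt P P) P"
  and "p el bob P ==> q el bob P ==> mp (face CC A P d 0 (Suc i)) (tp P P p q) = rm P p (mp d q)"
proof -
 note j = B_idn_in[OF P]
 note b = bten_ar[OF P P P A_simps(1) j d]
 note r = bten_run[OF P]
 have bb: "bim (bt P P)" "bim (bt P AA)" by (rule bten_bim[OF P P], rule bten_bim[OF P A_simps(1)])
 show "face CC A P d 0 (Suc i) \<in> ar BB (bt P P) P" by (simp add: B_cmp_in[OF bb P r(1) b(1)])
 assume p: "p el bob P" and q: "q el bob P"
 have "mp d q el X" using ar_closed[OF B_arD(1)[OF d] q] by simp
 moreover have "tp P P p q el bob (bt P P)" using p q P by (simp add: bten_bob)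
 ultimately show "mp (face CC A P d 0 (Suc i)) (tp P P p q) = rm P p (mp d q)"
  using p q by (simp add: mp_cmp[OF B_arD(1)[OF r(1)] B_arD(1)[OF b(1)]] b(2) mp_idn r(2))
qed

lemma face_in:
 assumes P: "bim P" and d: "d \<in> ar BB P AA"
 shows "face CC A P d n i \<in> ar BB (bp P (Suc n)) (bp P n)"
proof (induction n arbitrary: i)
 case 0 then show ?case using face_first(1)[OF P d, of 0] face_last(1)[OF P d] by (cases i) (simp_all del: face.simps add: face.simps(1)[of CC A P d, THEN fun_cong, of 0])
next
 case (Suc n)
 note b = bten_ar(1)[OF P P bpow_bim[OF P, of "Suc n"] bpow_bim[OF P, of n] B_idn_in[OF P] Suc]
 show ?case using face_first(1)[OF P d, of "Suc n"] b by (cases i) simp_all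
qed

text \<open>The bar differential as an arrow, so that any functor can be applied to it.\<close>

definition bar :: "('k, 'h, 'u) bm => ('k, 'h, 'u) harrow => nat => ('k, 'h, 'u) harrow"
 where "bar P d n = asum (homs BB (bp P (Suc n)) (bp P n)) (face CC A P d n) (Suc (Suc n))"

lemma bar:
 assumes P: "bim P" and d: "d \<in> ar BB P AA"
 shows "bar P d n \<in> ar BB (bp P (Suc n)) (bp P n)"
  and "x el bob (bp P (Suc n)) ==> mp (bar P d n) x = asum (bob (bp P n)) (%i. mp (face CC A P d n i) x) (Suc (Suc n))"
  and "p el bob P ==> q el bob P ==>
   mp (bar P d 0) (tp P P p q) = lm P (mp d p) q -[bob P] rm P p (mp d q)"
  and "p el bob P ==> t el bob (bp P (Suc n)) ==>
   mp (bar P d (Suc n)) (tp P (bp P (Suc n)) p t) =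
    lm (bp P (Suc n)) (mp d p) t -[bob (bp P (Suc n))] tp P (bp P n) p (mp (bar P d n) t)"
proof -
 note B = bpow_bim[OF P]
 have Hn: "vs (homs BB (bp P (Suc n)) (bp P n))"
  "x el bob (bp P (Suc n)) ==> lin (homs BB (bp P (Suc n)) (bp P n)) (bob (bp P n)) (%f. mp f x)" for n x
  by (rule B_homs(1)[OF B B], rule B_homs(2)[OF B B])
 note fi = face_in[OF P d]
 show "bar P d n \<in> ar BB (bp P (Suc n)) (bp P n)" unfolding bar_def by (rule asum_closed[OF Hn(1) fi])
 have val: "mp (bar P d n) x = asum (bob (bp P n)) (%i. mp (face CC A P d n i) x) (Suc (Suc n))"
  if "x el bob (bp P (Suc n))" for n x unfolding bar_def by (rule asum_lin[OF Hn(1) bimD(5)[OF B] Hn(2)[OF that] fi])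
 show "x el bob (bp P (Suc n)) ==> mp (bar P d n) x = asum (bob (bp P n)) (%i. mp (face CC A P d n i) x) (Suc (Suc n))" by (rule val)
 have fc: "mp (face CC A P d n i) x el bob (bp P n)" if "x el bob (bp P (Suc n))" for n i x by (rule ar_closed[OF B_arD(1)[OF fi] that])
 have tc: "tp P (bp P n) p t el bob (bp P (Suc n))" if "p el bob P" "t el bob (bp P n)" for n p t using that P B by (simp add: bten_bob)
 have dc: "mp d p el X" if "p el bob P" for p using ar_closed[OF B_arD(1)[OF d] that] by simp
 show "mp (bar P d 0) (tp P P p q) = lm P (mp d p) q -[bob P] rm P p (mp d q)"
  if "p el bob P" "q el bob P"
 proof -
  have x: "tp P P p q el bob (bp P (Suc 0))" using tc[of p q 0] that by simp
  have f0: "face CC A P d 0 0 = face_first CC A P d 0" by simp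
  have "mp (bar P d 0) (tp P P p q) = mp (face CC A P d 0 0) (tp P P p q) -[bob P] mp (face CC A P d 0 (Suc 0)) (tp P P p q)"
   unfolding val[OF x] using fc[OF x] bimD(5)[OF P] by (simp del: face.simps add: a_minus_def)
  then show ?thesis unfolding f0 face_last(2)[OF P d that] using face_first(2)[OF P d, of p q 0] that by simp
 qed
 show "mp (bar P d (Suc n)) (tp P (bp P (Suc n)) p t) =
    lm (bp P (Suc n)) (mp d p) t -[bob (bp P (Suc n))] tp P (bp P n) p (mp (bar P d n) t)"
  if p: "p el bob P" and t: "t el bob (bp P (Suc n))"
 proof -
  let ?T = "bp P (Suc n)" and ?x = "tp P (bp P (Suc n)) p t"
  have x: "?x el bob (bp P (Suc (Suc n)))" by (rule tc[OF p t])
  have "mp (bar P d (Suc n)) ?x = mp (face CC A P d (Suc n) 0) ?x -[bob ?T]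
    asum (bob ?T) (%i. mp (face CC A P d (Suc n) (Suc i)) ?x) (Suc (Suc n))" unfolding val[OF x] by (rule asum_Suc[OF bimD(5)[OF B] fc[OF x]])
  also have "mp (face CC A P d (Suc n) 0) ?x = lm ?T (mp d p) t" using face_first(2)[OF P d p t] by simp
  also have "asum (bob ?T) (%i. mp (face CC A P d (Suc n) (Suc i)) ?x) (Suc (Suc n)) =
    asum (bob ?T) (%i. tp P (bp P n) p (mp (face CC A P d n i) t)) (Suc (Suc n))"
  proof (rule asum_cong)
   fix i
   show "mp (face CC A P d (Suc n) (Suc i)) ?x = tp P (bp P n) p (mp (face CC A P d n i) t)"
    using bten_ar(2)[OF P P B B B_idn_in[OF P] fi[of n i] p t] mp_idn[OF p] by simp
  qed
  also have "... = tp P (bp P n) p (mp (bar P d n) t)" unfolding val[OF t]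
  proof (rule asum_lin[symmetric, OF bimD(5)[OF B] bimD(5)[OF B] _ fc[OF t]])
   show "lin (bob (bp P n)) (bob ?T) (tp P (bp P n) p)" using bilinD(2)[OF hpD(1)[OF tp_hp[OF P B[of n]]] p] P B by (simp add: bten_bob)
  qed
  finally show ?thesis .
 qed
qed

text \<open>One step of the bar complex. \<open>S' \<leftarrow> S \<leftarrow> P \<otimes>\<^sub>A S\<close> are consecutive terms with differentials
 \<open>e\<close> and \<open>b\<close>, and \<open>j p\<close> is multiplication by \<open>p\<close>, from \<open>S'\<close> to \<open>S\<close>. The
 condition on \<open>e (j p (e t))\<close> follows from \<open>e\<close> annihilating boundaries; the second conclusion is the same condition for the
 next step, so the lemma can be iterated.\<close>

lemma bar_step:
 assumes P: "bim P" and S: "bim S" "bim S'" and e: "bh S S' e" and d: "d \<in> ar BB P AA"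
  and p0: "p0 el bob P" "mp d p0 = one"
  and j': "\<forall>p\<in>carrier (bob P). lin (bob S') (bob S) (j p)"
  and b: "bh (bt P S) S b"
  and bt': "\<forall>p\<in>carrier (bob P). \<forall>t\<in>carrier (bob S). b (tp P S p t) = lm S (mp d p) t -[bob S] j p (e t)"
  and ej': "\<forall>p\<in>carrier (bob P). \<forall>t\<in>carrier (bob S). e (j p (e t)) = lm S' (mp d p) (e t)"
 shows "b ` carrier (bob (bt P S)) = ker (bob S) (bob S') e"
  and "\<forall>p\<in>carrier (bob P). \<forall>x\<in>carrier (bob (bt P S)). b (tp P S p (b x)) = lm S (mp d p) (b x)"
proof -
 note j = bspec[OF j'] and bt = bspec[OF bspec[OF bt']] and ej = bspec[OF bspec[OF ej']]
 note vS = bimD(5)[OF S(1)] and vS' = bimD(5)[OF S(2)] and L = bim_laws[OF S(1)]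
 note el = bhD(2)[OF e]
 note BT = bten_bob[OF P S(1)]
 have dc: "mp d p el X" if "p el bob P" for p using ar_closed[OF B_arD(1)[OF d] that] by simp
 have eb: "e (b x) = 0[bob S']" if x: "x el bo P S" for x
 proof (rule tp_ext[OF P S(1) vS' _ lin_zero_map[OF vS'] _ x])
  show "lin (bo P S) (bob S') (%x. e (b x))" using lin_comp[OF bhD(2)[OF b] el] by (simp only: BT)
  fix p t assume p: "p el bob P" and t: "t el bob S"
  have jc: "j p (e t) el bob S" by (rule linD(1)[OF j[OF p] bhD(5)[OF e t]])
  show "e (b (tp P S p t)) = 0[bob S']" using lin_minus[OF vS vS' el lm_closed[OF S(1) dc[OF p] t] jc] bhD(3)[OF e dc[OF p] t] ej[OF p t]
    lm_closed[OF S(2) dc[OF p] bhD(5)[OF e t]] vS' by (simp add: bt[OF p t])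
 qed
 show "b ` carrier (bob (bt P S)) = ker (bob S) (bob S') e"
 proof
  show "b ` carrier (bob (bt P S)) \<subseteq> ker (bob S) (bob S') e" by (rule image_subsetI) (use eb bhD(5)[OF b] BT in simp)
  show "ker (bob S) (bob S') e \<subseteq> b ` carrier (bob (bt P S))"
  proof
   fix x assume "x \<in> ker (bob S) (bob S') e"
   then have x: "x el bob S" "e x = 0[bob S']" by simp_all
   have "b (tp P S p0 x) = x" using bt[OF p0(1) x(1)] lin_zero[OF vS' vS j[OF p0(1)]] x vS L(5) by (simp add: p0(2))
   moreover have "tp P S p0 x el bob (bt P S)" using p0(1) x(1) P S by (simp add: BT)
   ultimately show "x \<in> b ` carrier (bob (bt P S))" by (intro image_eqI[of x b "tp P S p0 x"]) simp_all
  qed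
 qed
 show "\<forall>p\<in>carrier (bob P). \<forall>x\<in>carrier (bob (bt P S)). b (tp P S p (b x)) = lm S (mp d p) (b x)"
 proof (intro ballI)
  fix p x assume p: "p el bob P" and x: "x el bob (bt P S)"
  show "b (tp P S p (b x)) = lm S (mp d p) (b x)" using bt[OF p bhD(5)[OF b x]] eb[of x] x BT lin_zero[OF vS' vS j[OF p]] vS
   lm_closed[OF S(1) dc[OF p] bhD(5)[OF b x]] by simp
 qed
qed

lemma bar_exact:
 assumes P: "bim P" and d: "d \<in> ar BB P AA" and s: "mp d ` carrier (bob P) = carrier X"
 shows "mp (bar P d 0) ` carrier (bob (bp P (Suc 0))) = ker (bob P) X (mp d)"
  and "mp (bar P d (Suc n)) ` carrier (bob (bp P (Suc (Suc n)))) = ker (bob (bp P (Suc n))) (bob (bp P n)) (mp (bar P d n))"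
proof -
 note B = bpow_bim[OF P]
 have "one \<in> mp d ` carrier (bob P)" using s by simp
 then obtain p0 where p0: "p0 el bob P" "mp d p0 = one" by (rule imageE) simp
 note L = bim_laws[OF P]
 note dh = B_arD(2)[OF P A_simps(1) d]
 have bb: "bh (bp P (Suc n)) (bp P n) (mp (bar P d n))" for n by (rule B_arD(2)[OF B B bar(1)[OF P d]])
 note bb' = bb[unfolded bpow.simps(2)]
 have dc: "mp d p el X" if "p el bob P" for p using bhD(5)[OF dh that] by simp
 have j0: "\<forall>p\<in>carrier (bob P). lin (bob AA) (bob P) (rm P p)" using bilinD(2)[OF hpD(1)[OF L(3)]] by simp
 have e0: "\<forall>p\<in>carrier (bob P). \<forall>t\<in>carrier (bob P). mp d (rm P p (mp d t)) = lm AA (mp d p) (mp d t)"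
  using bhD(4)[OF dh dc] by simp
 have b3: "\<forall>p\<in>carrier (bob P). \<forall>t\<in>carrier (bob P). mp (bar P d 0) (tp P P p t) = lm P (mp d p) t -[bob P] rm P p (mp d t)"
  using bar(3)[OF P d] by simp
 have b4: "\<forall>p\<in>carrier (bob P). \<forall>t\<in>carrier (bob (bp P (Suc n))). mp (bar P d (Suc n)) (tp P (bp P (Suc n)) p t) =
    lm (bp P (Suc n)) (mp d p) t -[bob (bp P (Suc n))] tp P (bp P n) p (mp (bar P d n) t)" for n by (intro ballI bar(4)[OF P d])
 have b0: "bh (bt P P) P (mp (bar P d 0))" using bb'[of 0] by simp
 note s0 = bar_step[where j = "rm P", OF P P A_simps(1) dh d p0 j0 b0 b3 e0]
 show "mp (bar P d 0) ` carrier (bob (bp P (Suc 0))) = ker (bob P) X (mp d)" using s0(1) by simp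
 have jn: "\<forall>p\<in>carrier (bob P). lin (bob (bp P n)) (bob (bp P (Suc n))) (tp P (bp P n) p)" for n
  using bilinD(2)[OF hpD(1)[OF tp_hp[OF P B[of n]]]] P B by (simp add: bten_bob)
 have "mp (bar P d (Suc n)) ` carrier (bob (bp P (Suc (Suc n)))) = ker (bob (bp P (Suc n))) (bob (bp P n)) (mp (bar P d n)) \<and>
  (\<forall>p\<in>carrier (bob P). \<forall>x\<in>carrier (bob (bp P (Suc n))). mp (bar P d n) (tp P (bp P n) p (mp (bar P d n) x)) = lm (bp P n) (mp d p) (mp (bar P d n) x))"
 proof (induction n)
  case 0
  have ej: "\<forall>p\<in>carrier (bob P). \<forall>t\<in>carrier (bob (bp P (Suc 0))). mp (bar P d 0) (tp P (bp P 0) p (mp (bar P d 0) t)) = lm (bp P 0) (mp d p) (mp (bar P d 0) t)"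
   using s0(2) by simp
  have b1: "bh (bt P (bp P (Suc 0))) (bp P (Suc 0)) (mp (bar P d (Suc 0)))" using bb[of "Suc 0"] by (simp only: bpow.simps(2))
  note s1 = bar_step[where j = "tp P (bp P 0)", OF P B B bb[of 0] d p0 jn b1 b4 ej]
  show ?case by (rule conjI, subst bpow.simps(2)[of CC A P "Suc 0"], rule s1(1), rule ej)
 next
  case (Suc n)
  have b: "bh (bt P (bp P (Suc n))) (bp P (Suc n)) (mp (bar P d (Suc n)))" using bb[of "Suc n"] by (simp only: bpow.simps(2))
  have ej: "\<forall>p\<in>carrier (bob P). \<forall>t\<in>carrier (bob (bp P (Suc (Suc n)))). mp (bar P d (Suc n)) (tp P (bp P (Suc n)) p (mp (bar P d (Suc n)) t)) = lm (bp P (Suc n)) (mp d p) (mp (bar P d (Suc n)) t)"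
   by (subst bpow.simps(2)[of CC A P "Suc n"], rule bar_step(2)[where j = "tp P (bp P n)", OF P B B bb[of n] d p0 jn b b4 conjunct2[OF Suc]])
  have b2: "bh (bt P (bp P (Suc (Suc n)))) (bp P (Suc (Suc n))) (mp (bar P d (Suc (Suc n))))" using bb[of "Suc (Suc n)"] by (simp only: bpow.simps(2))
  note s2 = bar_step(1)[where j = "tp P (bp P (Suc n))", OF P B B bb[of "Suc n"] d p0 jn b2 b4 ej]
  show ?case by (rule conjI, subst bpow.simps(2)[of CC A P "Suc (Suc n)"], rule s2, rule ej)
 qed
 then show "mp (bar P d (Suc n)) ` carrier (bob (bp P (Suc (Suc n)))) = ker (bob (bp P (Suc n))) (bob (bp P n)) (mp (bar P d n))" by (rule conjunct1)
qed

lemma bar0: "bim P ==> d \<in> ar BB P AA ==>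
  face CC A P d 0 0 -[homs BB (bt P P) P] face CC A P d 0 1 = bar P d 0"
proof -
 assume P: "bim P" and d: "d \<in> ar BB P AA"
 have f: "face CC A P d 0 i \<in> ar BB (bt P P) P" for i using face_in[OF P d, of 0 i] by (simp del: face.simps)
 have v: "vs (homs BB (bt P P) P)" by (rule B_homs(1)[OF bten_bim[OF P P] P])
 show ?thesis unfolding bar_def using f[of 0] f[of 1] v by (simp del: face.simps add: a_minus_def)
qed

end

context shalg
begin

lemma bar_resolution:
 assumes P: "projective BB P" and d: "d \<in> ar BB P AA" and s: "mp d ` carrier (bob P) = carrier X"
 shows "proj_resolution BB AA (bp P) (bar P d) d" unfolding proj_resolution_def
proof (intro conjI allI)
 note bP = proj_bim[OF P]
 note B = bpow_bim[OF bP]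
 note E = bar_exact[OF bP d s]
 show "projective BB (bp P n)" for n by (induction n) (simp_all add: P proj_bt)
 show "exact_at BB (bp P (Suc (Suc n))) (bp P (Suc n)) (bp P n) (bar P d (Suc n)) (bar P d n)" for n
  by (rule B_exactI[OF B B B bar(1)[OF bP d] bar(1)[OF bP d] E(2)])
 have "exact_at BB (bp P (Suc 0)) (bp P 0) AA (bar P d 0) d" by (rule B_exactI[OF B B A_simps(1) bar(1)[OF bP d]]) (use d E(1) in simp_all)
 moreover have "epi BB (bp P 0) AA d" using B_epiI[OF bP A_simps(1) d] s by simp
 ultimately show "right_exact BB (bp P 1) (bp P 0) AA (bar P d 0) d" by (simp add: right_exact_def)
qed

text \<open>Exactness at \<open>P\<close> is automatic for a surjective \<open>d\<close>, being the first step of the bar complex.\<close>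

lemma admissible_iff:
 "admissible_pair CC A P d \<longleftrightarrow> projective BB P \<and> d \<in> ar BB P AA \<and> mp d ` carrier (bob P) = carrier X"
proof
 assume a: "admissible_pair CC A P d"
 then have P: "projective BB P" "d \<in> ar BB P AA" "epi BB P AA d" by (simp_all add: admissible_pair_def right_exact_def)
 then show "projective BB P \<and> d \<in> ar BB P AA \<and> mp d ` carrier (bob P) = carrier X"
  using B_epiD(2)[OF proj_bim[OF P(1)] A_simps(1) P(3)] by simp
next
 assume a: "projective BB P \<and> d \<in> ar BB P AA \<and> mp d ` carrier (bob P) = carrier X"
 then have "proj_resolution BB AA (bp P) (bar P d) d" by (intro bar_resolution) simp_all
 then show "admissible_pair CC A P d" using a bar0[OF proj_bim, of P d] by (simp add: admissible_pair_def proj_resolution_def)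
qed

lemma admissible_ex: "\<exists>P d. admissible_pair CC A P d"
proof -
 obtain P d where p: "projective BB P" "bh P AA d" "d ` carrier (bob P) = carrier X" by (rule proj_ex, rule that, assumption+)
 have "mp (mk_ar (bob P) d (bob AA)) ` carrier (bob P) = d ` carrier (bob P)" by (rule image_cong[OF refl mp_mk])
 then have "admissible_pair CC A P (mk_ar (bob P) d (bob AA))" unfolding admissible_iff using p B_arI[OF proj_bim[OF p(1)] A_simps(1) p(2)] by simp
 then show ?thesis by blast
qed

end

section \<open>Comparison of projective resolutions\<close>

context vec
begin

lemma quot_map:
 assumes M: "vs M" "submodule N K M" and W: "vs W" and f: "lin M W f" and z: "!!x. x \<in> N ==> f x = 0[W]"
 obtains g where "lin (quot_mod M N) W g" "!!x. x el M ==> g (N +>[M] x) = f x"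
proof -
 define g where "g q = f (SOME x. x \<in> q)" for q
 have g: "g (N +>[M] x) = f x" if x: "x el M" for x
 proof -
  let ?y = "SOME y. y \<in> N +>[M] x"
  have "x \<in> N +>[M] x" using coset_mem[OF M x] x by simp
  then have "?y \<in> N +>[M] x" by (rule someI[of "%y. y \<in> N +>[M] x"])
  then have y: "?y el M" "?y -[M] x \<in> N" using coset_mem[OF M x] coset_eq[OF M _ x] by auto
  have "f ?y -[W] f x = 0[W]" using z[OF y(2)] lin_minus[OF M(1) W f y(1) x] by simp
  then show ?thesis unfolding g_def using vs_minus_eq[OF W linD(1)[OF f y(1)] linD(1)[OF f x]] by simp
 qed
 have "lin (quot_mod M N) W g"
 proof (rule linI)
  fix q assume "q el quot_mod M N"
  then obtain x where x: "x el M" "q = N +>[M] x" by (auto simp: quot_carrier)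
  show "g q el W" using linD(1)[OF f x(1)] g x by simp
  show "g (c *[quot_mod M N] q) = c *[W] g q" if "c el K" for c
   using quot_smult[OF M that x(1)] g[OF x(1)] g[OF vs_simps(5)[OF M(1) that x(1)]] linD(3)[OF f that x(1)] x(2) by simp
  show "g (q +[quot_mod M N] r) = g q +[W] g r" if r: "r el quot_mod M N" for r
  proof -
   obtain y where y: "y el M" "r = N +>[M] y" using r by (auto simp: quot_carrier)
   show ?thesis using quot_add[OF M x(1) y(1)] g[OF x(1)] g[OF y(1)] g[OF vs_simps(1)[OF M(1) x(1) y(1)]]
     linD(2)[OF f x(1) y(1)] x(2) y(2) by simp
  qed
 qed
 then show thesis using that g by blast
qed

text \<open>Cochain complexes and their cocycles and coboundaries, in the encoding used for cohomology, where differentials are only relevant on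
 carriers.\<close>

definition cpx :: "(nat => ('k, 'v) module) => (nat => 'v => 'v) => bool"
 where "cpx D \<delta> \<longleftrightarrow> (\<forall>n. vs (D n) \<and> lin (D n) (D (Suc n)) (\<delta> n) \<and> (\<forall>x\<in>carrier (D n). \<delta> (Suc n) (\<delta> n x) = 0[D (Suc (Suc n))]))"

definition cyc :: "(nat => ('k, 'v) module) => (nat => 'v => 'v) => nat => ('k, 'v) module"
 where "cyc D \<delta> n = (D n)\<lparr>carrier := {x \<in> carrier (D n). \<delta> n x = 0[D (Suc n)]}\<rparr>"

definition bd :: "(nat => ('k, 'v) module) => (nat => 'v => 'v) => nat => 'v set"
 where "bd D \<delta> n = (case n of 0 => {0[D 0]} | Suc m => \<delta> m ` carrier (D m))"

lemma cohomology_eq: "cohomology D \<delta> n = quot_mod (cyc D \<delta> n) (bd D \<delta> n)"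
 by (simp add: cohomology_def cyc_def bd_def)

lemma cohomology_cong:
 fixes D :: "nat => ('k, 'v) module"
 assumes "!!n x. x el D n ==> \<delta> n x = \<delta>' n x"
 shows "cohomology D \<delta> n = cohomology D \<delta>' n"
proof -
 have "cyc D \<delta> n = cyc D \<delta>' n" by (simp add: cyc_def assms cong: conj_cong)
 moreover have "bd D \<delta> n = bd D \<delta>' n" by (cases n) (simp_all add: bd_def assms cong: image_cong)
 ultimately show ?thesis by (simp add: cohomology_eq)
qed

lemma cpxD:
 assumes "cpx D \<delta>"
 shows "vs (D n)" "lin (D n) (D (Suc n)) (\<delta> n)" "x el D n ==> \<delta> (Suc n) (\<delta> n x) = 0[D (Suc (Suc n))]"
 using assms by (simp_all add: cpx_def)

lemma cyc:
 assumes C: "cpx D \<delta>"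
 shows "vs (cyc D \<delta> n)" "lin (cyc D \<delta> n) (D n) (%x. x)"
  "x el cyc D \<delta> n \<longleftrightarrow> x el D n \<and> \<delta> n x = 0[D (Suc n)]"
  "submodule (bd D \<delta> n) K (cyc D \<delta> n)"
  "x el cyc D \<delta> n ==> y el cyc D \<delta> n ==> x -[cyc D \<delta> n] y = x -[D n] y"
proof -
 note d = cpxD[OF C]
 show v: "vs (cyc D \<delta> n)" unfolding cyc_def by (rule submod_vs[OF d(1) submod_ker[OF d(1,1,2)]])
 show i: "lin (cyc D \<delta> n) (D n) (%x. x)" by (rule linI) (simp_all add: cyc_def)
 show c: "x el cyc D \<delta> n \<longleftrightarrow> x el D n \<and> \<delta> n x = 0[D (Suc n)]" for x by (simp add: cyc_def)
 show "x el cyc D \<delta> n ==> y el cyc D \<delta> n ==> x -[cyc D \<delta> n] y = x -[D n] y" by (rule lin_minus[OF v d(1) i])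
 have o: "zero (cyc D \<delta> n) = zero (D n)" "add (cyc D \<delta> n) = add (D n)" "smult (cyc D \<delta> n) = smult (D n)"
  by (simp_all add: cyc_def)
 show "submodule (bd D \<delta> n) K (cyc D \<delta> n)"
 proof (cases n)
  case 0
  show ?thesis by (rule submodI[OF v]) (use d(1)[of 0] lin_zero[OF d(1,1,2)] in "auto simp: bd_def 0 c[unfolded 0] o[unfolded 0]")
 next
  case (Suc m)
  have B: "bd D \<delta> n = \<delta> m ` carrier (D m)" by (simp add: bd_def Suc)
  note s = submodD[OF d(1) submod_im[OF d(1,1) d(2)[of m]], folded Suc]
  show ?thesis unfolding B
  proof (rule submodI[OF v])
   show "\<delta> m ` carrier (D m) \<subseteq> carrier (cyc D \<delta> n)"
    by (rule image_subsetI) (use linD(1)[OF d(2)[of m]] d(3)[of _ m] in "simp add: c[unfolded Suc] Suc")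
  qed (unfold o, rule s, (rule s(3), assumption+) | (rule s(4), assumption+))+
 qed
qed

lemma cohom_map:
 assumes C: "cpx D \<delta>" "cpx D' \<delta>'" and a: "!!n. lin (D n) (D' n) (a n)"
  and ac: "!!n x. x el D n ==> a (Suc n) (\<delta> n x) = \<delta>' n (a n x)"
 obtains f where "lin (cohomology D \<delta> n) (cohomology D' \<delta>' n) f"
  "!!x. x el cyc D \<delta> n ==> f (bd D \<delta> n +>[cyc D \<delta> n] x) = bd D' \<delta>' n +>[cyc D' \<delta>' n] a n x"
  "!!x. x el cyc D \<delta> n ==> a n x el cyc D' \<delta>' n"
proof -
 note d = cpxD[OF C(1)] and d' = cpxD[OF C(2)] and z = cyc[OF C(1), where n = n] and z' = cyc[OF C(2), where n = n]
 have az: "a n x el cyc D' \<delta>' n" if "x el cyc D \<delta> n" for x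
  using that ac[of x n, symmetric] linD(1)[OF a] lin_zero[OF d(1) d'(1) a] by (simp add: z(3) z'(3))
 have la: "lin (cyc D \<delta> n) (cyc D' \<delta>' n) (a n)" by (rule linI) (use az linD(2,3)[OF a[of n]] in "simp_all add: cyc_def")
 have "a n x \<in> bd D' \<delta>' n" if xB: "x \<in> bd D \<delta> n" for x
 proof (cases n)
  case 0 then show ?thesis using xB lin_zero[OF d(1) d'(1) a] by (simp add: bd_def)
 next
  case (Suc m)
  then obtain y where "y el D m" "x = \<delta> m y" using xB by (auto simp: bd_def)
  then show ?thesis using ac[of y m] linD(1)[OF a] Suc by (simp add: bd_def)
 qed
 moreover have "x \<in> bd D \<delta> n ==> x el cyc D \<delta> n" for x using submodD(1)[OF z(1,4)] by blast
 ultimately have k: "bd D' \<delta>' n +>[cyc D' \<delta>' n] a n x = 0[cohomology D' \<delta>' n]" if "x \<in> bd D \<delta> n" for x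
  using coset_zero(2)[OF z'(1,4) az] that by (simp add: cohomology_eq quot_zero)
 obtain f where "lin (quot_mod (cyc D \<delta> n) (bd D \<delta> n)) (cohomology D' \<delta>' n) f"
  "!!x. x el cyc D \<delta> n ==> f (bd D \<delta> n +>[cyc D \<delta> n] x) = bd D' \<delta>' n +>[cyc D' \<delta>' n] a n x"
  by (rule quot_map[OF z(1,4) quot_vs[OF z'(1,4), folded cohomology_eq] lin_comp[OF la quot_lin[OF z'(1,4), folded cohomology_eq]] k],
   assumption, rule that, assumption+)
 then show thesis using that az unfolding cohomology_eq by blast
qed

text \<open>Two cochain maps whose composites differ from the identity by coboundaries, on cocycles.\<close>

lemma cohom_iso:
 assumes C: "cpx D \<delta>" "cpx D' \<delta>'" and a: "!!n. lin (D n) (D' n) (a n)" and b: "!!n. lin (D' n) (D n) (b n)"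
  and ac: "!!n x. x el D n ==> a (Suc n) (\<delta> n x) = \<delta>' n (a n x)"
  and bc: "!!n x. x el D' n ==> b (Suc n) (\<delta>' n x) = \<delta> n (b n x)"
  and ba: "!!n x. x el D n ==> \<delta> n x = 0[D (Suc n)] ==> b n (a n x) -[D n] x \<in> bd D \<delta> n"
  and ab: "!!n x. x el D' n ==> \<delta>' n x = 0[D' (Suc n)] ==> a n (b n x) -[D' n] x \<in> bd D' \<delta>' n"
 shows "vs_iso K (cohomology D \<delta> n) (cohomology D' \<delta>' n)"
proof -
 note z = cyc[OF C(1), where n = n] and z' = cyc[OF C(2), where n = n]
 let ?H = "cohomology D \<delta> n" and ?H' = "cohomology D' \<delta>' n"
 let ?c = "%x. bd D \<delta> n +>[cyc D \<delta> n] x" and ?c' = "%x. bd D' \<delta>' n +>[cyc D' \<delta>' n] x"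
 obtain f where f: "lin ?H ?H' f" "!!x. x el cyc D \<delta> n ==> f (?c x) = ?c' (a n x)"
  "!!x. x el cyc D \<delta> n ==> a n x el cyc D' \<delta>' n" by (rule cohom_map[OF C a ac], assumption, rule that, assumption+)
 obtain g where g: "lin ?H' ?H g" "!!x. x el cyc D' \<delta>' n ==> g (?c' x) = ?c (b n x)"
  "!!x. x el cyc D' \<delta>' n ==> b n x el cyc D \<delta> n" by (rule cohom_map[OF C(2,1) b bc], assumption, rule that, assumption+)
 have gf: "g (f q) = q" if q: "q el ?H" for q
 proof -
  obtain x where x: "x el cyc D \<delta> n" "q = ?c x" using q by (auto simp: cohomology_eq quot_carrier)
  have "?c (b n (a n x)) = ?c x" using coset_eq[OF z(1,4) g(3)[OF f(3)[OF x(1)]] x(1)] z(5)[OF g(3)[OF f(3)[OF x(1)]] x(1)] ba x(1) z(3) by simp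
  then show ?thesis using f(2,3) g(2) x by simp
 qed
 have fg: "f (g q) = q" if q: "q el ?H'" for q
 proof -
  obtain x where x: "x el cyc D' \<delta>' n" "q = ?c' x" using q by (auto simp: cohomology_eq quot_carrier)
  have "?c' (a n (b n x)) = ?c' x" using coset_eq[OF z'(1,4) f(3)[OF g(3)[OF x(1)]] x(1)] z'(5)[OF f(3)[OF g(3)[OF x(1)]] x(1)] ab x(1) z'(3) by simp
  then show ?thesis using g(2,3) f(2) x by simp
 qed
 have "bij_betw f (carrier ?H) (carrier ?H')" by (rule bij_betw_byWitness[where f' = g]) (use gf fg linD(1)[OF f(1)] linD(1)[OF g(1)] in auto)
 then show ?thesis unfolding vs_iso_def using f(1) by blast
qed

end

context halg
begin

text \<open>The map is lifted through the surjection of \<open>S\<close> onto the kernel of \<open>e'\<close>.\<close>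

lemma proj_lift:
 assumes P: "projective BB P" and S: "bim S" "bim T" "bim V" and e: "e \<in> ar BB S T" and e': "e' \<in> ar BB T V"
  and ex: "mp e ` carrier (bob S) = ker (bob T) (bob V) (mp e')"
  and f: "f \<in> ar BB P T" and z: "!!x. x el bob P ==> mp e' (mp f x) = 0[bob V]"
 shows "\<exists>h\<in>ar BB P S. \<forall>x\<in>carrier (bob P). mp e (mp h x) = mp f x"
proof -
 note bP = proj_bim[OF P]
 obtain W where W: "bim W" "bob W = sub (bob T) (ker (bob T) (bob V) (mp e'))"
  "\<forall>(U :: ('k, 'h, 'u) bm) f. bh U T f --> (\<forall>m\<in>carrier (bob U). f m \<in> ker (bob T) (bob V) (mp e')) --> bh U W f"
  by (rule B_kernel[OF S(2,3) e'], rule that, assumption+)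
 note eh = B_arD(2)[OF S(1,2) e] and fh = B_arD(2)[OF bP S(2) f]
 have "bh S W (mp e)" using W(3) eh ex by blast
 moreover have "bh P W (mp f)" by (rule W(3)[rule_format, OF fh]) (use z bhD(5)[OF fh] in simp)
 moreover have "mp e ` carrier (bob S) = carrier (bob W)" using ex by (simp only: W(2) sub_simps)
 ultimately obtain h where h: "bh P S h" "!!p. p el bob P ==> mp e (h p) = mp f p" using projD[OF P S(1) W(1)] by metis
 show ?thesis by (rule bexI[OF _ B_arI[OF bP S(1) h(1)]]) (simp add: h(2))
qed

text \<open>An augmented projective resolution with the resolved object put in degree \<open>0\<close>, which spares the separate treatment of the
 augmentation in the inductions below.\<close>

definition resol :: "(nat => ('k, 'h, 'u) bm) => (nat => ('k, 'h, 'u) harrow) => bool"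
 where "resol C D \<longleftrightarrow> (\<forall>n. bim (C n) \<and> D n \<in> ar BB (C (Suc n)) (C n) \<and> projective BB (C (Suc n)) \<and>
  mp (D (Suc n)) ` carrier (bob (C (Suc (Suc n)))) = ker (bob (C (Suc n))) (bob (C n)) (mp (D n))) \<and>
  mp (D 0) ` carrier (bob (C 1)) = carrier (bob (C 0))"

lemma resolD:
 assumes "resol C D"
 shows "bim (C n)" "D n \<in> ar BB (C (Suc n)) (C n)" "projective BB (C (Suc n))"
  "mp (D (Suc n)) ` carrier (bob (C (Suc (Suc n)))) = ker (bob (C (Suc n))) (bob (C n)) (mp (D n))"
  "mp (D 0) ` carrier (bob (C (Suc 0))) = carrier (bob (C 0))"
  "x el bob (C (Suc n)) ==> mp (D n) x el bob (C n)"
  "x el bob (C (Suc (Suc n))) ==> mp (D n) (mp (D (Suc n)) x) = 0[bob (C n)]"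
proof -
 show R: "bim (C n)" "D n \<in> ar BB (C (Suc n)) (C n)" "projective BB (C (Suc n))"
  "mp (D (Suc n)) ` carrier (bob (C (Suc (Suc n)))) = ker (bob (C (Suc n))) (bob (C n)) (mp (D n))"
  "mp (D 0) ` carrier (bob (C (Suc 0))) = carrier (bob (C 0))" for n using assms unfolding resol_def by simp_all
 show "x el bob (C (Suc n)) ==> mp (D n) x el bob (C n)" by (rule ar_closed[OF B_arD(1)[OF R(2)]])
 assume "x el bob (C (Suc (Suc n)))"
 then have "mp (D (Suc n)) x \<in> ker (bob (C (Suc n))) (bob (C n)) (mp (D n))" unfolding R(4)[symmetric] by (rule imageI)
 then show "mp (D n) (mp (D (Suc n)) x) = 0[bob (C n)]" by simp
qed

lemma resol_lift:
 assumes R: "resol C D" and P: "projective BB P" and f: "f \<in> ar BB P (C n)"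
  and z: "!!m x. n = Suc m ==> x el bob P ==> mp (D m) (mp f x) = 0[bob (C m)]"
 shows "\<exists>h\<in>ar BB P (C (Suc n)). \<forall>x\<in>carrier (bob P). mp (D n) (mp h x) = mp f x"
proof (cases n)
 case 0
 note r = resolD[OF R]
 note bP = proj_bim[OF P]
 obtain h where h: "bh P (C (Suc 0)) h" "!!p. p el bob P ==> mp (D 0) (h p) = mp f p"
  by (rule projD[OF P r(1) r(1) B_arD(2)[OF r(1) r(1) r(2)] r(5) B_arD(2)[OF bP r(1) f[unfolded 0]]], rule that, assumption+)
 show ?thesis unfolding 0 by (rule bexI[OF _ B_arI[OF bP r(1) h(1)]]) (simp add: h(2))
next
 case (Suc m)
 note r = resolD[OF R]
 show ?thesis unfolding Suc by (rule proj_lift[OF P r(1) r(1) r(1) r(2) r(2) r(4) f[unfolded Suc]]) (rule z[OF Suc])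
qed

text \<open>The next component is a lift of \<open>\<phi> \<circ> d\<close>, which \<open>d\<close> annihilates. That fact only concerns
 \<open>\<phi>\<close> and is carried along as the invariant \<open>Pr\<close>.\<close>

lemma chain_map:
 assumes R: "resol C D" "resol C' D'" and e: "C' 0 = C 0"
 obtains f where "f 0 = idn CC (bob (C 0))" "!!n. f n \<in> ar BB (C n) (C' n)"
  "!!n x. x el bob (C (Suc n)) ==> mp (D' n) (mp (f (Suc n)) x) = mp (f n) (mp (D n) x)"
proof -
 note r = resolD[OF R(1)] and r' = resolD[OF R(2)]
 define Pr where "Pr n \<phi> \<longleftrightarrow> \<phi> \<in> ar BB (C n) (C' n) \<and> (n = 0 --> \<phi> = idn CC (bob (C 0))) \<and>
  (\<forall>m x. n = Suc m --> x el bob (C (Suc n)) --> mp (D' m) (mp \<phi> (mp (D n) x)) = 0[bob (C' m)])" for n \<phi>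
 define Qr where "Qr n \<phi> \<phi>' \<longleftrightarrow> (\<forall>x\<in>carrier (bob (C (Suc n))). mp (D' n) (mp \<phi>' x) = mp \<phi> (mp (D n) x))" for n \<phi> \<phi>'
 have "\<exists>f. \<forall>n. Pr n (f n) \<and> Qr n (f n) (f (Suc n))"
 proof (rule dependent_nat_choice)
  show "\<exists>\<phi>. Pr 0 \<phi>" using B_idn_in[OF r(1)[of 0]] e by (intro exI[of _ "idn CC (bob (C 0))"]) (simp add: Pr_def)
  fix \<phi> n assume p: "Pr n \<phi>"
  then have \<phi>: "\<phi> \<in> ar BB (C n) (C' n)" by (simp add: Pr_def)
  note \<phi>l = bhD(2)[OF B_arD(2)[OF r(1) r'(1) \<phi>]]
  let ?g = "cmp CC \<phi> (D n)"
  have g: "?g \<in> ar BB (C (Suc n)) (C' n)" by (rule B_cmp_in[OF r(1) r(1) r'(1) \<phi> r(2)])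
  have gv: "mp ?g x = mp \<phi> (mp (D n) x)" if "x el bob (C (Suc n))" for x by (rule mp_cmp[OF B_arD(1)[OF \<phi>] B_arD(1)[OF r(2)] that])
  have z: "mp (D' m) (mp ?g x) = 0[bob (C' m)]" if "n = Suc m" "x el bob (C (Suc n))" for m x using p that gv by (simp add: Pr_def)
  obtain h where h: "h \<in> ar BB (C (Suc n)) (C' (Suc n))" "\<forall>x\<in>carrier (bob (C (Suc n))). mp (D' n) (mp h x) = mp ?g x"
   using resol_lift[OF R(2) r(3) g z] by blast
  have "Pr (Suc n) h" using h gv r(6,7) lin_zero[OF bimD(5)[OF r(1)] bimD(5)[OF r'(1)] \<phi>l] by (simp add: Pr_def)
  then show "\<exists>\<phi>'. Pr (Suc n) \<phi>' \<and> Qr n \<phi> \<phi>'" using h(2) gv by (intro exI[of _ h]) (simp add: Qr_def)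
 qed
 then obtain f where f: "\<forall>n. Pr n (f n) \<and> Qr n (f n) (f (Suc n))" by blast
 show thesis by (rule that[of f]) (use f in "simp_all add: Pr_def Qr_def")
qed

text \<open>A chain endomorphism \<open>\<psi>\<close> that is the identity in degree \<open>0\<close> is homotopic to the identity:
 \<open>s\<^sub>n\<^sub>+\<^sub>1\<close> lifts \<open>\<psi>\<^sub>n\<^sub>+\<^sub>1 - 1 - s\<^sub>n d\<^sub>n\<close>. Starting with \<open>s\<^sub>0
 = 0\<close> ensures that the homotopy never involves the degree of the resolved object.\<close>

lemma homotopy:
 assumes R: "resol C D" and p0: "\<psi> 0 = idn CC (bob (C 0))" and p1: "!!n. \<psi> n \<in> ar BB (C n) (C n)"
  and p2: "!!n x. x el bob (C (Suc n)) ==> mp (D n) (mp (\<psi> (Suc n)) x) = mp (\<psi> n) (mp (D n) x)"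
 obtains s where "s 0 = 0[homs BB (C 0) (C (Suc 0))]" "!!n. s n \<in> ar BB (C n) (C (Suc n))"
  "!!n. \<psi> (Suc n) = idn CC (bob (C (Suc n))) +[homs BB (C (Suc n)) (C (Suc n))]
   (cmp CC (D (Suc n)) (s (Suc n)) +[homs BB (C (Suc n)) (C (Suc n))] cmp CC (s n) (D n))"
proof -
 note r = resolD[OF R]
 note v = bimD(5)[OF r(1)]
 note dl = bhD(2)[OF B_arD(2)[OF r(1) r(1) r(2)]]
 have pc: "mp (\<psi> n) x el bob (C n)" if "x el bob (C n)" for n x by (rule ar_closed[OF B_arD(1)[OF p1] that])
 let ?H = "%n. homs BB (C n) (C n)"
 have H: "vs (?H n)" "x el bob (C n) ==> lin (?H n) (bob (C n)) (%f. mp f x)" for n x by (rule B_homs[OF r(1) r(1)], rule B_homs[OF r(1) r(1)])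
 define Pr where "Pr n s \<longleftrightarrow> s \<in> ar BB (C n) (C (Suc n)) \<and> (n = 0 --> s = 0[homs BB (C 0) (C (Suc 0))]) \<and>
  (\<forall>x\<in>carrier (bob (C (Suc n))). mp (\<psi> n) (mp (D n) x) -[bob (C n)] mp (D n) x = mp (D n) (mp s (mp (D n) x)))" for n s
 define Qr where "Qr n s s' \<longleftrightarrow> (\<forall>x\<in>carrier (bob (C (Suc n))). mp (D (Suc n)) (mp s' x) =
  (mp (\<psi> (Suc n)) x -[bob (C (Suc n))] x) -[bob (C (Suc n))] mp s (mp (D n) x))" for n s s'
 have "\<exists>s. \<forall>n. Pr n (s n) \<and> Qr n (s n) (s (Suc n))"
 proof (rule dependent_nat_choice)
  have "Pr 0 0[homs BB (C 0) (C (Suc 0))]" using B_ops(3)[OF r(1) r(1)] r(6) lin_zero[OF v v dl] v by (simp add: Pr_def p0 mp_idn mp_ops)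
  then show "\<exists>s. Pr 0 s" by blast
  fix s n assume p: "Pr n s"
  then have s: "s \<in> ar BB (C n) (C (Suc n))" by (simp add: Pr_def)
  note sl = bhD(2)[OF B_arD(2)[OF r(1) r(1) s]]
  let ?n = "Suc n"
  let ?i = "idn CC (bob (C ?n))" and ?sd = "cmp CC s (D n)"
  let ?g = "(\<psi> ?n -[?H ?n] ?i) -[?H ?n] ?sd"
  have a: "\<psi> ?n el ?H ?n" "?i el ?H ?n" "?sd el ?H ?n" by (rule p1, rule B_idn_in[OF r(1)], rule B_cmp_in[OF r(1) r(1) r(1) s r(2)])
  have g: "?g \<in> ar BB (C ?n) (C ?n)" using a H(1)[of ?n] by simp
  have sdv: "mp ?sd x = mp s (mp (D n) x)" if "x el bob (C ?n)" for x by (rule mp_cmp[OF B_arD(1)[OF s] B_arD(1)[OF r(2)] that])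
  have gv: "mp ?g x = (mp (\<psi> ?n) x -[bob (C ?n)] x) -[bob (C ?n)] mp s (mp (D n) x)" if x: "x el bob (C ?n)" for x
   using lin_minus[OF H(1) v H(2)[OF x] vs_simps(4)[OF H(1) a(1,2)] a(3)] lin_minus[OF H(1) v H(2)[OF x] a(1,2)] sdv[OF x] mp_idn[OF x] by simp
  have sc: "mp s (mp (D n) x) el bob (C ?n)" if "x el bob (C ?n)" for x by (rule linD(1)[OF sl r(6)[OF that]])
  have z0: "mp (D n) (mp ?g x) = 0[bob (C n)]" if x: "x el bob (C ?n)" for x
  proof -
   have "mp (D n) (mp ?g x) = (mp (D n) (mp (\<psi> ?n) x) -[bob (C n)] mp (D n) x) -[bob (C n)] mp (D n) (mp s (mp (D n) x))"
    unfolding gv[OF x] using lin_minus[OF v v dl vs_simps(4)[OF v pc[OF x] x] sc[OF x]] lin_minus[OF v v dl pc[OF x] x] by simp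
   also have "... = 0[bob (C n)]" using p x p2[OF x] linD(1)[OF dl sc[OF x]] v by (simp add: Pr_def)
   finally show ?thesis .
  qed
  have z: "mp (D m) (mp ?g x) = 0[bob (C m)]" if "?n = Suc m" "x el bob (C ?n)" for m x using z0[OF that(2)] that(1) by simp
  obtain h where h: "h \<in> ar BB (C ?n) (C (Suc ?n))" "\<forall>x\<in>carrier (bob (C ?n)). mp (D ?n) (mp h x) = mp ?g x"
   using resol_lift[OF R r(3) g z] by blast
  have "Pr ?n h" unfolding Pr_def
  proof (intro conjI ballI)
   fix x assume x: "x el bob (C (Suc ?n))"
   note y = r(6)[OF x]
   have "mp (D ?n) (mp h (mp (D ?n) x)) = (mp (\<psi> ?n) (mp (D ?n) x) -[bob (C ?n)] mp (D ?n) x) -[bob (C ?n)] mp s (mp (D n) (mp (D ?n) x))"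
    using h(2) gv y by simp
   also have "mp s (mp (D n) (mp (D ?n) x)) = 0[bob (C ?n)]" using r(7)[OF x] lin_zero[OF v v sl] by simp
   finally show "mp (\<psi> ?n) (mp (D ?n) x) -[bob (C ?n)] mp (D ?n) x = mp (D ?n) (mp h (mp (D ?n) x))" using v y pc[OF y] by simp
  qed (use h(1) in simp_all)
  then show "\<exists>s'. Pr ?n s' \<and> Qr n s s'" using h(2) gv by (intro exI[of _ h]) (simp add: Qr_def)
 qed
 then obtain s where s: "\<forall>n. Pr n (s n) \<and> Qr n (s n) (s (Suc n))" by blast
 then have sa: "s n \<in> ar BB (C n) (C (Suc n))" for n by (simp add: Pr_def)
 show thesis
 proof (rule that[of s])
  show "s 0 = 0[homs BB (C 0) (C (Suc 0))]" using s by (simp add: Pr_def)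
  fix n
  show "s n \<in> ar BB (C n) (C (Suc n))" by (rule sa)
  let ?n = "Suc n"
  have c: "cmp CC (D ?n) (s ?n) \<in> ar BB (C ?n) (C ?n)" "cmp CC (s n) (D n) \<in> ar BB (C ?n) (C ?n)"
   by (rule B_cmp_in[OF r(1) r(1) r(1) r(2) sa], rule B_cmp_in[OF r(1) r(1) r(1) sa r(2)])
  note o = B_ops(1)[OF r(1) r(1)]
  show "\<psi> ?n = idn CC (bob (C ?n)) +[?H ?n] (cmp CC (D ?n) (s ?n) +[?H ?n] cmp CC (s n) (D n))"
  proof (rule ar_eqI[OF B_arD(1)[OF p1] B_arD(1)[OF o[OF B_idn_in[OF r(1)] o[OF c]]]])
   fix x assume x: "x el bob (C ?n)"
   let ?u = "mp (\<psi> ?n) x" and ?w = "mp (s n) (mp (D n) x)" and ?V = "bob (C ?n)"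
   have w: "?w el ?V" by (rule ar_closed[OF B_arD(1)[OF sa] r(6)[OF x]])
   have "mp (D ?n) (mp (s ?n) x) = (?u -[?V] x) -[?V] ?w" using s x by (simp add: Qr_def)
   then have "x +[?V] (mp (D ?n) (mp (s ?n) x) +[?V] ?w) = ?u" using vs_minus_add[OF v] v x w pc[OF x] by simp
   then show "?u = mp (idn CC (bob (C ?n)) +[?H ?n] (cmp CC (D ?n) (s ?n) +[?H ?n] cmp CC (s n) (D n))) x"
    using x by (simp add: mp_ops mp_idn mp_cmp[OF B_arD(1)[OF r(2)] B_arD(1)[OF sa]] mp_cmp[OF B_arD(1)[OF sa] B_arD(1)[OF r(2)]])
  qed
 qed
qed

lemma contraD:
 assumes "contra_functor K BB G"
 shows "bim S ==> vs (fob G S)" "bim S ==> bim T ==> f \<in> ar BB S T ==> lin (fob G T) (fob G S) (far G f)"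
  "bim S ==> x el fob G S ==> far G (idn CC (bob S)) x = x"
  "bim S ==> bim T ==> bim V ==> f \<in> ar BB S T ==> g \<in> ar BB T V ==> x el fob G V ==>
   far G (cmp CC g f) x = far G f (far G g x)"
  "bim S ==> bim T ==> x el fob G T ==> lin (homs BB S T) (fob G S) (%f. far G f x)"
proof -
 note c = assms[unfolded contra_functor_def BB_simps(1-3) Ball_def mem_Collect_eq]
 note c4 = c[THEN conjunct2, THEN conjunct2, THEN conjunct2]
 show "bim S ==> vs (fob G S)" by (rule c[THEN conjunct1, rule_format])
 show l: "bim S ==> bim T ==> f \<in> ar BB S T ==> lin (fob G T) (fob G S) (far G f)" for S T f
  by (rule c[THEN conjunct2, THEN conjunct1, rule_format])
 show "bim S ==> x el fob G S ==> far G (idn CC (bob S)) x = x" by (rule c[THEN conjunct2, THEN conjunct2, THEN conjunct1, rule_format])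
 show "bim S ==> bim T ==> bim V ==> f \<in> ar BB S T ==> g \<in> ar BB T V ==> x el fob G V ==>
   far G (cmp CC g f) x = far G f (far G g x)" by (rule c4[THEN conjunct1, rule_format])
 show "lin (homs BB S T) (fob G S) (%f. far G f x)" if "bim S" "bim T" "x el fob G T"
  by (rule linI) (rule linD(1)[OF l[OF that(1,2)] that(3)], assumption,
   rule c4[THEN conjunct2, THEN conjunct1, rule_format, OF that(1,2) _ _ that(3)], assumption+,
   rule c4[THEN conjunct2, THEN conjunct2, rule_format, OF that(1,2) _ _ that(3)], assumption+)
qed

text \<open>The composites of the two comparison maps are homotopic to the identity, and additive functors preserve homotopies.\<close>

lemma comparison:
 assumes G: "contra_functor K BB G" and R: "resol C D" "resol C' D'" and e: "C' 0 = C 0"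
 shows "vs_iso K (cohomology (%n. fob G (C (Suc n))) (%n. far G (D (Suc n))) n)
  (cohomology (%n. fob G (C' (Suc n))) (%n. far G (D' (Suc n))) n)"
proof -
 note g = contraD[OF G]
 have cp: "cpx (%n. fob G (E (Suc n))) (%n. far G (d (Suc n)))" if "resol E d" for E d
 proof -
  note r = resolD[OF that]
  have "far G (d (Suc (Suc n))) (far G (d (Suc n)) x) = 0[fob G (E (Suc (Suc (Suc n))))]"
   if x: "x el fob G (E (Suc n))" for n x
  proof -
   let ?H = "homs BB (E (Suc (Suc (Suc n)))) (E (Suc n))"
   have "cmp CC (d (Suc n)) (d (Suc (Suc n))) = 0[?H]" using cmp_zero_iff[OF B_arD(1)[OF r(2)] B_arD(1)[OF r(2)]] r(7) by (simp add: BB_simps(5))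
   then show ?thesis using g(4)[OF r(1) r(1) r(1) r(2) r(2) x] lin_zero[OF B_homs(1)[OF r(1) r(1)] g(1)[OF r(1)] g(5)[OF r(1) r(1) x]] by simp
  qed
  then show ?thesis using g(1,2) r(1,2) by (simp add: cpx_def)
 qed
 have nat: "far G (a (Suc (Suc n))) (far G (d' (Suc n)) x) = far G (d (Suc n)) (far G (a (Suc n)) x)"
  if r: "resol E d" "resol E' d'" and a: "!!n. a n \<in> ar BB (E n) (E' n)"
   "!!n x. x el bob (E (Suc n)) ==> mp (d' n) (mp (a (Suc n)) x) = mp (a n) (mp (d n) x)"
   and x: "x el fob G (E' (Suc n))" for E d E' d' a n x
 proof -
  note r1 = resolD[OF r(1)] and r2 = resolD[OF r(2)]
  have "cmp CC (d' (Suc n)) (a (Suc (Suc n))) = cmp CC (a (Suc n)) (d (Suc n))"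
   by (rule ar_eqI[OF B_arD(1)[OF B_cmp_in[OF r1(1) r2(1) r2(1) r2(2) a(1)]] B_arD(1)[OF B_cmp_in[OF r1(1) r1(1) r2(1) a(1) r1(2)]]])
    (simp add: mp_cmp[OF B_arD(1)[OF r2(2)] B_arD(1)[OF a(1)]] mp_cmp[OF B_arD(1)[OF a(1)] B_arD(1)[OF r1(2)]] a(2))
  then show ?thesis using g(4)[OF r1(1) r2(1) r2(1) a(1) r2(2) x] g(4)[OF r1(1) r1(1) r2(1) r1(2) a(1) x] by simp
 qed
 have hom: "far G (a (Suc n)) (far G (b (Suc n)) x) -[fob G (E (Suc n))] x \<in> bd (%n. fob G (E (Suc n))) (%n. far G (d (Suc n))) n"
  if r: "resol E d" "resol E' d'" and ee: "E' 0 = E 0" and a0: "a 0 = idn CC (bob (E 0))" "b 0 = idn CC (bob (E' 0))"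
   and a: "!!n. a n \<in> ar BB (E n) (E' n)"
   "!!n x. x el bob (E (Suc n)) ==> mp (d' n) (mp (a (Suc n)) x) = mp (a n) (mp (d n) x)"
   and b: "!!n. b n \<in> ar BB (E' n) (E n)"
   "!!n x. x el bob (E' (Suc n)) ==> mp (d n) (mp (b (Suc n)) x) = mp (b n) (mp (d' n) x)"
   and x: "x el fob G (E (Suc n))" and z: "far G (d (Suc n)) x = 0[fob G (E (Suc (Suc n)))]" for E d E' d' a b n x
 proof -
  note r1 = resolD[OF r(1)] and r2 = resolD[OF r(2)]
  let ?\<psi> = "%n. cmp CC (b n) (a n)"
  note pv = mp_cmp[OF B_arD(1)[OF b(1)] B_arD(1)[OF a(1)]]
  have p0: "?\<psi> 0 = idn CC (bob (E 0))"
   by (rule ar_eqI[OF cmp_in[OF bimD(4)[OF r1(1)] B_arD(1)[OF b(1)] B_arD(1)[OF a(1)]] B_arD(1)[OF B_idn_in[OF r1(1)]]])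
    (subst pv, assumption, simp add: a0 mp_idn ee)
  have p1: "?\<psi> n \<in> ar BB (E n) (E n)" for n by (rule B_cmp_in[OF r1(1) r2(1) r1(1) b(1) a(1)])
  have p2: "mp (d n) (mp (?\<psi> (Suc n)) x) = mp (?\<psi> n) (mp (d n) x)" if "x el bob (E (Suc n))" for n x
   using that r1(6)[OF that] ar_closed[OF B_arD(1)[OF a(1)] that] by (simp add: pv a(2) b(2))
  obtain s where s: "s 0 = 0[homs BB (E 0) (E (Suc 0))]" "!!n. s n \<in> ar BB (E n) (E (Suc n))"
   "!!n. ?\<psi> (Suc n) = idn CC (bob (E (Suc n))) +[homs BB (E (Suc n)) (E (Suc n))]
    (cmp CC (d (Suc n)) (s (Suc n)) +[homs BB (E (Suc n)) (E (Suc n))] cmp CC (s n) (d n))"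
   by (rule homotopy[OF r(1) p0 p1 p2], assumption, rule that, assumption+)
  let ?V = "fob G (E (Suc n))"
  note v = g(1)[OF r1(1)]
  note L = g(5)[OF r1(1) r1(1) x]
  have c: "cmp CC (d (Suc n)) (s (Suc n)) \<in> ar BB (E (Suc n)) (E (Suc n))" "cmp CC (s n) (d n) \<in> ar BB (E (Suc n)) (E (Suc n))"
   by (rule B_cmp_in[OF r1(1) r1(1) r1(1) r1(2) s(2)], rule B_cmp_in[OF r1(1) r1(1) r1(1) s(2) r1(2)])
  let ?w = "far G (d n) (far G (s n) x)"
  have sx: "far G (s n) x el fob G (E n)" by (rule linD(1)[OF g(2)[OF r1(1) r1(1) s(2)] x])
  have w: "?w el ?V" by (rule linD(1)[OF g(2)[OF r1(1) r1(1) r1(2)] sx])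
  have "far G (a (Suc n)) (far G (b (Suc n)) x) = far G (?\<psi> (Suc n)) x" by (rule g(4)[symmetric, OF r1(1) r2(1) r1(1) a(1) b(1) x])
  also have "... = far G (idn CC (bob (E (Suc n)))) x +[?V] (far G (cmp CC (d (Suc n)) (s (Suc n))) x +[?V] far G (cmp CC (s n) (d n)) x)"
   unfolding s(3) using linD(2)[OF L B_idn_in[OF r1(1)] B_ops(1)[OF r1(1) r1(1) c]] linD(2)[OF L c] by simp
  also have "far G (cmp CC (d (Suc n)) (s (Suc n))) x = 0[?V]"
   using g(4)[OF r1(1) r1(1) r1(1) s(2) r1(2) x] lin_zero[OF v v g(2)[OF r1(1) r1(1) s(2)]] z by simp
  also have "far G (cmp CC (s n) (d n)) x = ?w" by (rule g(4)[OF r1(1) r1(1) r1(1) r1(2) s(2) x])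
  also have "far G (idn CC (bob (E (Suc n)))) x = x" by (rule g(3)[OF r1(1) x])
  finally have "far G (a (Suc n)) (far G (b (Suc n)) x) = x +[?V] ?w" using v w by simp
  then have eq: "far G (a (Suc n)) (far G (b (Suc n)) x) -[?V] x = ?w" using vs_comm[OF v x w] v w x by (simp add: a_minus_def vs_assoc)
  show ?thesis
  proof (cases n)
   case 0
   have "far G (s 0) x = 0[fob G (E 0)]" using lin_zero[OF B_homs(1)[OF r1(1) r1(1)] v g(5)[OF r1(1) r1(1) x[unfolded 0]]] s(1) by simp
   then show ?thesis using eq lin_zero[OF v v g(2)[OF r1(1) r1(1) r1(2)]] 0 by (simp add: bd_def)
  next
   case (Suc m) then show ?thesis using eq sx by (simp add: bd_def)
  qed
 qed
 obtain a where a: "a 0 = idn CC (bob (C 0))" "!!n. a n \<in> ar BB (C n) (C' n)"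
  "!!n x. x el bob (C (Suc n)) ==> mp (D' n) (mp (a (Suc n)) x) = mp (a n) (mp (D n) x)" by (rule chain_map[OF R e], rule that, assumption+)
 obtain b where b: "b 0 = idn CC (bob (C' 0))" "!!n. b n \<in> ar BB (C' n) (C n)"
  "!!n x. x el bob (C' (Suc n)) ==> mp (D n) (mp (b (Suc n)) x) = mp (b n) (mp (D' n) x)"
  by (rule chain_map[OF R(2,1) e[symmetric]], rule that, assumption+)
 note r = resolD[OF R(1)] and r' = resolD[OF R(2)]
 show ?thesis
 proof (rule cohom_iso[where a = "%n. far G (b (Suc n))" and b = "%n. far G (a (Suc n))", OF cp[OF R(1)] cp[OF R(2)]])
  show "lin (fob G (C (Suc n))) (fob G (C' (Suc n))) (far G (b (Suc n)))" for n by (rule g(2)[OF r'(1) r(1) b(2)])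
  show "lin (fob G (C' (Suc n))) (fob G (C (Suc n))) (far G (a (Suc n)))" for n by (rule g(2)[OF r(1) r'(1) a(2)])
  show "far G (b (Suc (Suc n))) (far G (D (Suc n)) x) = far G (D' (Suc n)) (far G (b (Suc n)) x)"
   if "x el fob G (C (Suc n))" for n x by (rule nat[OF R(2,1) b(2,3) that])
  show "far G (a (Suc (Suc n))) (far G (D' (Suc n)) x) = far G (D (Suc n)) (far G (a (Suc n)) x)"
   if "x el fob G (C' (Suc n))" for n x by (rule nat[OF R a(2,3) that])
  show "far G (a (Suc n)) (far G (b (Suc n)) x) -[fob G (C (Suc n))] x \<in> bd (%n. fob G (C (Suc n))) (%n. far G (D (Suc n))) n"
   if "x el fob G (C (Suc n))" "far G (D (Suc n)) x = 0[fob G (C (Suc (Suc n)))]" for n x by (rule hom[OF R e a(1) b(1) a(2,3) b(2,3) that])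
  show "far G (b (Suc n)) (far G (a (Suc n)) x) -[fob G (C' (Suc n))] x \<in> bd (%n. fob G (C' (Suc n))) (%n. far G (D' (Suc n))) n"
   if "x el fob G (C' (Suc n))" "far G (D' (Suc n)) x = 0[fob G (C' (Suc (Suc n)))]" for n x
   by (rule hom[OF R(2,1) e[symmetric] b(1) a(1) b(2,3) a(2,3) that])
 qed
qed

lemma resol_of:
 assumes "proj_resolution BB AA Q dQ aug"
 shows "resol (case_nat AA Q) (case_nat aug dQ)"
proof -
 have p: "projective BB (Q n)" and e: "exact_at BB (Q (Suc (Suc n))) (Q (Suc n)) (Q n) (dQ (Suc n)) (dQ n)"
  and e0: "exact_at BB (Q 1) (Q 0) AA (dQ 0) aug" "epi BB (Q 0) AA aug" for n using assms by (simp_all add: proj_resolution_def right_exact_def)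
 note b = proj_bim[OF p]
 note E = B_exactD[OF b b b e] and E0 = B_exactD[OF b b A_simps(1) e0(1)]
 have C: "bim (case_nat AA Q n)" for n by (cases n) (simp_all add: b)
 have D: "case_nat aug dQ n \<in> ar BB (case_nat AA Q (Suc n)) (case_nat AA Q n)" for n using E(2) E0(2) by (cases n) simp_all
 have X: "mp (case_nat aug dQ (Suc n)) ` carrier (bob (case_nat AA Q (Suc (Suc n)))) =
   ker (bob (case_nat AA Q (Suc n))) (bob (case_nat AA Q n)) (mp (case_nat aug dQ n))" for n using E(3) E0(3) by (cases n) simp_all
 show ?thesis unfolding resol_def using C D X p B_epiD(2)[OF b A_simps(1) e0(2)] by simp
qed

end

section \<open>The functor on bimodules and its derived functors\<close>

locale contra = shalg K H U A for K :: "'k ring" and H :: "('k, 'h) weak_hopf" and U :: "'u itself"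
  and A :: "(('k, 'h, 'u) hmod, ('k, 'h, 'u) harrow) alg" +
 fixes F :: "('k, ('k, 'h, 'u) hmod, ('k, 'h, 'u) harrow, 'v) vfun"
  and \<tau> :: "('k, 'h, 'u) hmod => ('k, 'h, 'u) hmod => 'v => 'v"
 assumes ct: "contratrace K (HMod K H) F \<tau>" and le: "left_exact (HMod K H) F"
begin

lemma F_functor:
 shows "hm M ==> vs (fob F M)" "hm M ==> hm N ==> f \<in> ar CC M N ==> lin (fob F N) (fob F M) (far F f)"
  "hm M ==> x el fob F M ==> far F (idn CC M) x = x"
  "hm M ==> hm N ==> hm P ==> f \<in> ar CC M N ==> g \<in> ar CC N P ==> x el fob F P ==>
   far F (cmp CC g f) x = far F f (far F g x)"
  "hm M ==> hm N ==> f \<in> ar CC M N ==> g \<in> ar CC M N ==> x el fob F N ==>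
   far F (f +[homs CC M N] g) x = far F f x +[fob F M] far F g x"
  "hm M ==> hm N ==> k el K ==> f \<in> ar CC M N ==> x el fob F N ==>
   far F (k *[homs CC M N] f) x = k *[fob F M] far F f x"
proof -
 have c0: "contra_functor K CC F" using ct by (simp add: contratrace_def)
 note c = c0[unfolded contra_functor_def CC_simps(1) Ball_def mem_Collect_eq]
 note c2 = c[THEN conjunct2]
 note c3 = c2[THEN conjunct2]
 note c4 = c3[THEN conjunct2]
 note c5 = c4[THEN conjunct2]
 show "hm M ==> vs (fob F M)" by (rule c[THEN conjunct1, rule_format])
 show "hm M ==> hm N ==> f \<in> ar CC M N ==> lin (fob F N) (fob F M) (far F f)" by (rule c2[THEN conjunct1, rule_format])
 show "hm M ==> x el fob F M ==> far F (idn CC M) x = x" by (rule c3[THEN conjunct1, rule_format])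
 show "hm M ==> hm N ==> hm P ==> f \<in> ar CC M N ==> g \<in> ar CC N P ==> x el fob F P ==>
   far F (cmp CC g f) x = far F f (far F g x)" by (rule c4[THEN conjunct1, rule_format])
 show "hm M ==> hm N ==> f \<in> ar CC M N ==> g \<in> ar CC M N ==> x el fob F N ==>
   far F (f +[homs CC M N] g) x = far F f x +[fob F M] far F g x" by (rule c5[THEN conjunct1, rule_format])
 show "hm M ==> hm N ==> k el K ==> f \<in> ar CC M N ==> x el fob F N ==>
   far F (k *[homs CC M N] f) x = k *[fob F M] far F f x" by (rule c5[THEN conjunct2, rule_format])
qed

lemma F_tau:
 shows "hm M ==> hm N ==> lin (fob F (htens K H M N)) (fob F (htens K H N M)) (\<tau> M N)"
  "hm M ==> hm M' ==> hm N ==> hm N' ==> f \<in> ar CC M M' ==> g \<in> ar CC N N' ==> x el fob F (htens K H M' N') ==>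
   \<tau> M N (far F (tar CC f g) x) = far F (tar CC g f) (\<tau> M' N' x)"
proof -
 note c = ct[unfolded contratrace_def CC_simps(1,3) Ball_def mem_Collect_eq, THEN conjunct2]
 show "hm M ==> hm N ==> lin (fob F (htens K H M N)) (fob F (htens K H N M)) (\<tau> M N)" by (rule c[THEN conjunct1, rule_format, THEN conjunct1])
 show "hm M ==> hm M' ==> hm N ==> hm N' ==> f \<in> ar CC M M' ==> g \<in> ar CC N N' ==> x el fob F (htens K H M' N') ==>
   \<tau> M N (far F (tar CC f g) x) = far F (tar CC g f) (\<tau> M' N' x)" by (rule c[THEN conjunct2, THEN conjunct1, rule_format])
qed

lemma F_exact:
 assumes "hm M" "hm N" "hm P" "right_exact CC M N P f g"
 shows "inj_on (far F g) (carrier (fob F P))"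
  "far F g ` carrier (fob F P) = {y \<in> carrier (fob F N). far F f y = 0[fob F M]}"
 using le[unfolded left_exact_def CC_simps(1) Ball_def mem_Collect_eq, rule_format, OF assms] by blast+

abbreviation "FA \<equiv> contratrace_bimod A F \<tau>"

lemma FA:
 "x el fob FA S \<longleftrightarrow> x el fob F (bob S) \<and> \<tau> X (bob S) (far F (lac S) x) = far F (rac S) x"
 "far FA = far F" "add (fob FA S) = add (fob F (bob S))" "smult (fob FA S) = smult (fob F (bob S))"
 "zero (fob FA S) = zero (fob F (bob S))" by (simp_all add: contratrace_bimod_def)

lemma B_ar_equiv:
 "f \<in> ar BB S T ==> cmp CC f (lac S) = cmp CC (lac T) (tar CC (idn CC X) f)"
 "f \<in> ar BB S T ==> cmp CC f (rac S) = cmp CC (rac T) (tar CC f (idn CC X))" by (simp_all add: Bimd_def)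

text \<open>Both maps defining the equalizer are natural in the bimodule.\<close>

lemma FA_square:
 assumes S: "bim S" "bim T" and f: "f \<in> ar BB S T" and x: "x el fob F (bob T)"
 shows "\<tau> X (bob S) (far F (lac S) (far F f x)) = far F (tar CC f (idn CC X)) (\<tau> X (bob T) (far F (lac T) x))"
  and "far F (rac S) (far F f x) = far F (tar CC f (idn CC X)) (far F (rac T) x)"
proof -
 note hS = bimD(4)[OF S(1)] and hT = bimD(4)[OF S(2)]
 note fa = B_arD(1)[OF f] and i = idn_in[OF hmX]
 note l = bimD(1)[OF S(1)] bimD(1)[OF S(2)] and r = bimD(2)[OF S(1)] bimD(2)[OF S(2)]
 have "far F (lac S) (far F f x) = far F (cmp CC f (lac S)) x" by (rule F_functor(4)[symmetric, OF htens_hm[OF hmX hS] hS hT l(1) fa x])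
 also have "... = far F (tar CC (idn CC X) f) (far F (lac T) x)" unfolding B_ar_equiv(1)[OF f]
  by (rule F_functor(4)[OF htens_hm[OF hmX hS] htens_hm[OF hmX hT] hT tar_in[OF hmX hS hmX hT i fa] l(2) x])
 finally show "\<tau> X (bob S) (far F (lac S) (far F f x)) = far F (tar CC f (idn CC X)) (\<tau> X (bob T) (far F (lac T) x))"
  using F_tau(2)[OF hmX hmX hS hT i fa linD(1)[OF F_functor(2)[OF htens_hm[OF hmX hT] hT l(2)] x]] by simp
 have "far F (rac S) (far F f x) = far F (cmp CC f (rac S)) x" by (rule F_functor(4)[symmetric, OF htens_hm[OF hS hmX] hS hT r(1) fa x])
 also have "... = far F (tar CC f (idn CC X)) (far F (rac T) x)" unfolding B_ar_equiv(2)[OF f]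
  by (rule F_functor(4)[OF htens_hm[OF hS hmX] htens_hm[OF hT hmX] hT tar_in[OF hS hmX hT hmX fa i] r(2) x])
 finally show "far F (rac S) (far F f x) = far F (tar CC f (idn CC X)) (far F (rac T) x)" .
qed

lemma FA_vs:
 assumes S: "bim S"
 shows "vs (fob FA S)"
proof -
 let ?M = "fob F (bob S)" and ?N = "fob F (htens K H (bob S) X)"
 let ?f = "%x. \<tau> X (bob S) (far F (lac S) x)" and ?g = "far F (rac S)"
 note hS = bimD(4)[OF S]
 note h1 = htens_hm[OF hmX hS] and h2 = htens_hm[OF hS hmX]
 note v = F_functor(1)[OF hS] and w = F_functor(1)[OF h2]
 have l: "lin ?M ?N ?f" "lin ?M ?N ?g"
  by (rule lin_comp[OF F_functor(2)[OF h1 hS bimD(1)[OF S]] F_tau(1)[OF hmX hS]], rule F_functor(2)[OF h2 hS bimD(2)[OF S]])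
 have "submodule {x \<in> carrier ?M. ?f x -[?N] ?g x = 0[?N]} K ?M" by (rule submod_ker[OF v w lin_minus_map[OF w l]])
 moreover have "{x \<in> carrier ?M. ?f x -[?N] ?g x = 0[?N]} = {x \<in> carrier ?M. ?f x = ?g x}"
  using vs_minus_eq[OF w linD(1)[OF l(1)] linD(1)[OF l(2)]] by auto
 ultimately show ?thesis using submod_vs[OF v] by (simp add: contratrace_bimod_def)
qed

lemma FA_functor: "contra_functor K BB FA"
 unfolding contra_functor_def BB_simps(1-3)
proof (intro conjI ballI)
 fix S assume "S \<in> Collect bim" then have S: "bim S" by simp
 note hS = bimD(4)[OF S]
 show "vs (fob FA S)" by (rule FA_vs[OF S])
 show "far FA (idn CC (bob S)) x = x" if "x el fob FA S" for x using F_functor(3)[OF hS] that by (simp add: FA)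
 fix T assume "T \<in> Collect bim" then have T: "bim T" by simp
 note hT = bimD(4)[OF T]
 show "lin (fob FA T) (fob FA S) (far FA f)" if f: "f \<in> ar BB S T" for f
 proof (rule linI)
  note L = linD[OF F_functor(2)[OF hS hT B_arD(1)[OF f]]]
  show "far FA f x el fob FA S" if "x el fob FA T" for x using that FA_square[OF S T f, of x] L(1) by (simp add: FA)
  show "far FA f (x +[fob FA T] y) = far FA f x +[fob FA S] far FA f y"
   if "x el fob FA T" "y el fob FA T" for x y using that L(2) by (simp add: FA)
  show "far FA f (a *[fob FA T] x) = a *[fob FA S] far FA f x"
   if "a el K" "x el fob FA T" for a x using that L(3) by (simp add: FA)
 qed
 show "far FA (f +[homs BB S T] g) x = far FA f x +[fob FA S] far FA g x"
  if "f \<in> ar BB S T" "g \<in> ar BB S T" "x el fob FA T" for f g x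
  using F_functor(5)[OF hS hT B_arD(1)[OF that(1)] B_arD(1)[OF that(2)]] that(3) by (simp add: FA BB_simps(4))
 show "far FA (a *[homs BB S T] f) x = a *[fob FA S] far FA f x"
  if "a el K" "f \<in> ar BB S T" "x el fob FA T" for a f x
  using F_functor(6)[OF hS hT that(1) B_arD(1)[OF that(2)]] that(3) by (simp add: FA BB_simps(6))
 fix V f g x assume "V \<in> Collect bim" and fg: "f \<in> ar BB S T" "g \<in> ar BB T V" and x: "x el fob FA V"
 then have V: "bim V" by simp
 show "far FA (cmp CC g f) x = far FA f (far FA g x)"
  using F_functor(4)[OF hS hT bimD(4)[OF V] B_arD(1)[OF fg(1)] B_arD(1)[OF fg(2)]] x by (simp add: FA)
qed

text \<open>The image contains all pure tensors.\<close>

lemma tar_id_surj: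
 assumes hm: "hm M" "hm N" and g: "g \<in> ar CC M N" and s: "mp g ` carrier M = carrier N"
 shows "mp (tar CC g (idn CC X)) ` carrier (htens K H M X) = carrier (htens K H N X)"
proof -
 let ?t = "tar CC g (idn CC X)" and ?M = "htens K H M X" and ?N = "htens K H N X"
 note t = tar[OF hm(1) hmX hm(2) hmX g idn_in[OF hmX]]
 note hM = htens_hm[OF hm(1) hmX] and hN = htens_hm[OF hm(2) hmX]
 note tl = hlinD(1)[OF arD(1)[OF t(1)]]
 note sm = submodD[OF hm_vs[OF hN] submod_im[OF hm_vs[OF hM] hm_vs[OF hN] tl]]
 have "x \<in> mp ?t ` carrier ?M" if x: "x el ?N" for x
 proof (rule tensor_by.induct[OF htens_tensor[OF hm(2) hmX] x])
  fix n a assume n: "n el N" and a: "a el X"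
  have "n \<in> mp g ` carrier M" unfolding s by (rule n)
  then obtain m where m: "n = mp g m" "m el M" by (rule imageE)
  have "mp ?t (hpure K H M X m a) = hpure K H N X n a" using t(2)[OF m(2) a] m(1) a by (simp add: mp_idn)
  then show "hpure K H N X n a \<in> mp ?t ` carrier ?M"
   by (intro image_eqI[of _ _ "hpure K H M X m a"]) (simp_all add: hpD(4)[OF htens_hp[OF hm(1) hmX] m(2) a])
 qed (rule sm(2), rule sm(3), assumption+)
 then show ?thesis using sm(1) by blast
qed

text \<open>The point is that membership in \<open>F\<^sub>A\<close> is reflected by \<open>F(g)\<close>, since \<open>F(g \<otimes> A)\<close> is
 injective.\<close>

lemma FA_left_exact: "left_exact BB FA"
 unfolding left_exact_def BB_simps(1)
proof (intro ballI allI impI)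
 fix S T V f g assume "S \<in> Collect bim" "T \<in> Collect bim" "V \<in> Collect bim" and ex: "right_exact BB S T V f g"
 then have B: "bim S" "bim T" "bim V" by simp_all
 note hS = bimD(4)[OF B(1)] and hT = bimD(4)[OF B(2)] and hV = bimD(4)[OF B(3)]
 note E = B_exactD[OF B ex[unfolded right_exact_def, THEN conjunct1]]
  and e = B_epiD[OF B(2,3) ex[unfolded right_exact_def, THEN conjunct2]]
 have "right_exact CC (bob S) (bob T) (bob V) f g" by (rule C_right_exact[OF hS hT hV B_arD(1)[OF E(1)] B_arD(1)[OF E(2)] E(3) e(2)])
 then have L: "inj_on (far F g) (carrier (fob F (bob V)))"
  "far F g ` carrier (fob F (bob V)) = {y \<in> carrier (fob F (bob T)). far F f y = 0[fob F (bob S)]}" using F_exact[OF hS hT hV] by blast+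
 let ?t = "tar CC g (idn CC X)"
 note t = tar_in[OF hT hmX hV hmX B_arD(1)[OF e(1)] idn_in[OF hmX]]
 note h2 = htens_hm[OF hT hmX] htens_hm[OF hV hmX]
 obtain W k where "hm W" "right_exact CC W (htens K H (bob T) X) (htens K H (bob V) X) k ?t"
  using C_surj_right_exact[OF h2 t tar_id_surj[OF hT hV B_arD(1)[OF e(1)] e(2)]] by blast
 then have inj: "inj_on (far F ?t) (carrier (fob F (htens K H (bob V) X)))" using F_exact(1)[OF _ h2] by blast
 have c: "\<tau> X (bob V) (far F (lac V) z) el fob F (htens K H (bob V) X)"
  "far F (rac V) z el fob F (htens K H (bob V) X)" if "z el fob F (bob V)" for z
  using linD(1)[OF F_tau(1)[OF hmX hV]] linD(1)[OF F_functor(2)[OF htens_hm[OF hmX hV] hV bimD(1)[OF B(3)]] that]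
   linD(1)[OF F_functor(2)[OF h2(2) hV bimD(2)[OF B(3)]] that] by simp_all
 have FA_back: "z el fob FA V" if z: "z el fob F (bob V)" and y: "far F g z el fob FA T" for z
  using inj_onD[OF inj _ c[OF z]] y z FA_square[OF B(2,3) e(1) z] by (simp add: FA)
 have sub: "z el fob F (bob V)" if "z el fob FA V" for z using that by (simp add: FA)
 show "inj_on (far FA g) (carrier (fob FA V)) \<and>
   far FA g ` carrier (fob FA V) = {y \<in> carrier (fob FA T). far FA f y = 0[fob FA S]}"
 proof (intro conjI equalityI subsetI)
  show "inj_on (far FA g) (carrier (fob FA V))" unfolding FA(2) by (rule inj_on_subset[OF L(1)]) (use sub in blast)
 next
  fix y assume "y \<in> far FA g ` carrier (fob FA V)"
  then obtain z where z: "y = far F g z" "z el fob FA V" unfolding FA(2) by (rule imageE)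
  have "y \<in> far F g ` carrier (fob F (bob V))" unfolding z(1) by (rule imageI[OF sub[OF z(2)]])
  moreover have "y el fob FA T" using linD(1)[OF contraD(2)[OF FA_functor B(2,3) e(1)] z(2)] z(1) by (simp add: FA(2))
  ultimately show "y \<in> {y \<in> carrier (fob FA T). far FA f y = 0[fob FA S]}" unfolding L(2) FA(2,5) by simp
 next
  fix y assume y: "y \<in> {y \<in> carrier (fob FA T). far FA f y = 0[fob FA S]}"
  then have "y \<in> far F g ` carrier (fob F (bob V))" unfolding L(2) FA(2,5) by (simp add: FA(1))
  then obtain z where z: "y = far F g z" "z el fob F (bob V)" by (rule imageE)
  then show "y \<in> far FA g ` carrier (fob FA V)" unfolding FA(2) using FA_back[OF z(2)] y by simp
 qed
qed

text \<open>Additivity of the functor moves the alternating sum of the faces inside.\<close>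

lemma HH_bar:
 assumes P: "bim P" and d: "d \<in> ar BB P AA"
 shows "HH CC A F \<tau> P d n = cohomology (%n. fob FA (bp P n)) (%n. far FA (bar P d n)) n" unfolding HH_def Let_def
proof (rule cohomology_cong)
 fix n x assume x: "x el fob FA (bp P n)"
 let ?D = "fob FA (bp P (Suc n))"
 note B = bpow_bim[OF P]
 note v = contraD(1)[OF FA_functor B[of "Suc n"]]
 note L = contraD(5)[OF FA_functor B[of "Suc n"] B[of n] x]
 note f = face_in[OF P d]
 have "finsum ?D (%i. if even i then far FA (face CC A P d n i) x else -[?D] far FA (face CC A P d n i) x) {..Suc n} =
   asum ?D (%i. far FA (face CC A P d n i) x) (Suc (Suc n))"
  unfolding lessThan_Suc_atMost[symmetric] by (rule finsum_asum[OF v]) (rule linD(1)[OF L f])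
 also have "... = far FA (bar P d n) x" unfolding bar_def by (rule asum_lin[symmetric, OF B_homs(1)[OF B B] v L f])
 finally show "finsum ?D (%i. if even i then far FA (face CC A P d n i) x else -[?D] far FA (face CC A P d n i) x) {..Suc n} =
  far FA (bar P d n) x" .
qed

lemma HH_derived:
 assumes a: "admissible_pair CC A P d"
 shows "vs_iso K (HH CC A F \<tau> P d n) (right_derived BB FA n AA)"
proof -
 have P: "projective BB P" "d \<in> ar BB P AA" "mp d ` carrier (bob P) = carrier X" using a unfolding admissible_iff by simp_all
 note r1 = bar_resolution[OF P]
 let ?R = "SOME (Q, dQ, aug). proj_resolution BB AA Q dQ aug"
 obtain Q dQ aug where Q: "?R = (Q, dQ, aug)" by (cases ?R) simp
 have "case ?R of (Q, dQ, aug) => proj_resolution BB AA Q dQ aug" by (rule someI[of _ "(bp P, bar P d, d)"]) (simp add: r1)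
 then have r2: "proj_resolution BB AA Q dQ aug" by (simp add: Q)
 have "vs_iso K (cohomology (%n. fob FA (bp P n)) (%n. far FA (bar P d n)) n)
   (cohomology (%n. fob FA (Q n)) (%n. far FA (dQ n)) n)" using comparison[OF FA_functor resol_of[OF r1] resol_of[OF r2]] by simp
 then show ?thesis unfolding HH_bar[OF proj_bim[OF P(1)] P(2)] right_derived_def Q by simp
qed

end

text \<open>The multiples of \<open>1\<close> are distinct. This is what makes the universe infinite.\<close>

lemma char_0_infinite:
 assumes K: "field K" and c: "!!n::nat. n > 0 ==> [n] \<cdot>\<^bsub>K\<^esub> 1[K] \<noteq> 0[K]"
 shows "infinite (carrier K)"
proof -
 interpret field K by (rule K)
 have "n = m" if e: "[n] \<cdot>\<^bsub>K\<^esub> 1[K] = [m] \<cdot>\<^bsub>K\<^esub> 1[K]" and le: "n \<le> m" for n m :: nat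
 proof (rule ccontr)
  assume "n \<noteq> m"
  then obtain k where k: "m = n + k" "k > 0" using le by (metis le_Suc_ex add_0_right gr0I)
  have "[n] \<cdot>\<^bsub>K\<^esub> 1[K] +[K] [k] \<cdot>\<^bsub>K\<^esub> 1[K] = [n] \<cdot>\<^bsub>K\<^esub> 1[K]"
   using e add.nat_pow_mult[of "1[K]" n k] by (simp add: k(1))
  then have "[k] \<cdot>\<^bsub>K\<^esub> 1[K] = 0[K]" using add.l_cancel_one[of "[n] \<cdot>\<^bsub>K\<^esub> 1[K]" "[k] \<cdot>\<^bsub>K\<^esub> 1[K]"] by simp
  then show False using c[OF k(2)] by simp
 qed
 then have "inj (%n::nat. [n] \<cdot>\<^bsub>K\<^esub> 1[K])" by (intro injI) (metis nat_le_linear)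
 then have "infinite (range (%n::nat. [n] \<cdot>\<^bsub>K\<^esub> 1[K]))" by (metis finite_imageD infinite_UNIV_nat)
 moreover have "range (%n::nat. [n] \<cdot>\<^bsub>K\<^esub> 1[K]) \<subseteq> carrier K" by (intro image_subsetI) simp
 ultimately show ?thesis using infinite_super by blast
qed

theorem lemma4p18:
  fixes K :: "'k ring"
    and H :: "('k, 'h) weak_hopf"
    and C :: "('k, ('k, 'h, 'u) hmod, ('k, 'h, 'u) harrow) mcat"
    and A :: "(('k, 'h, 'u) hmod, ('k, 'h, 'u) harrow) alg"
    and F :: "('k, ('k, 'h, 'u) hmod, ('k, 'h, 'u) harrow, 'v) vfun"
    and \<tau> :: "('k, 'h, 'u) hmod \<Rightarrow> ('k, 'h, 'u) hmod \<Rightarrow> 'v \<Rightarrow> 'v"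
  assumes field: "field K"
    and char_0: "\<And>n::nat. n > 0 \<Longrightarrow> [n] \<cdot>\<^bsub>K\<^esub> \<one>\<^bsub>K\<^esub> \<noteq> \<zero>\<^bsub>K\<^esub>"
    and weak_hopf: "weak_hopf_algebra K H"
    and separable_base: "separable_algebra K (base_alg K H)"
    and size_K: "\<exists>j :: 'k \<Rightarrow> 'u. inj_on j (carrier K)"
    and size_H: "\<exists>j :: 'h \<Rightarrow> 'u. inj_on j (carrier H)"
    and C_def: "C = HMod K H"
    and alg: "is_alg C A"
    and contratrace: "symmetric_contratrace K C F \<tau>"
    and left_exact: "left_exact C F"
  defines "FA \<equiv> contratrace_bimod A F \<tau>"
  shows "contra_functor K (Bimd C A) FA \<and> left_exact (Bimd C A) FA \<and>
    (\<exists>P d. admissible_pair C A P d) \<and>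
    (\<forall>P d. admissible_pair C A P d \<longrightarrow>
      (\<forall>n. vs_iso K (HH C A F \<tau> P d n) (right_derived (Bimd C A) FA n (alg_bimod A))))"
proof -
 interpret weak_hopf_algebra K H by (rule weak_hopf)
 obtain j :: "'k => 'u" where j: "inj_on j (carrier K)" using size_K by blast
 have "infinite (UNIV :: 'u set)"
  using finite_imageD[OF finite_subset[OF subset_UNIV] j] char_0_infinite[OF field char_0] by blast
 then interpret contra K H "TYPE('u)" A F \<tau>
  by unfold_locales (use size_H separable_base alg contratrace left_exact in
   \<open>simp_all add: C_def symmetric_contratrace_def\<close>)
 show ?thesis
  unfolding FA_def C_def using FA_functor FA_left_exact admissible_ex HH_derived by blast
qed

end
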